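(* Let $0<\mu\le 1$ and $m>2\mu+\frac12$. There exists $r_0>0$ such that, for all initial data $\mathbf w_0\in\mathbb L^2(m)$ with $\|\mathbf w_0\|_m\le r_0$, the integral equation $$w_i(\tau)=e^{\tau\Lambda}w_i(0)+\sum_{j=1}^3\int_0^\tau \partial_j e^{(\tau-s)(\Lambda-\frac12)}\bigl(w_j(s)v_i(s)-v_j(s)w_i(s)\bigr)\,ds,\qquad i=1,2,3,\ \tau\ge 0,$$ where $\mathbf v(s)$ is the velocity field obtained from $\mathbf w(s)$ via the Biot-Savart law, has a unique global solution $\mathbf w\in C^0([0,\infty),\mathbb L^2(m))$ satisfying $\mathbf w(0)=\mathbf w_0$. In addition, there exists $K_0\ge 1$ (independent of $\mathbf w_0$) such that $$\|\mathbf w(\tau)\|_m\le K_0\,e^{-\mu\tau}\|\mathbf w_0\|_m,\qquad \tau\ge 0.$$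
   Context: Notation: $\rho(\xi)=1+|\xi|$ on $\mathbb R^3$; $|\cdot|_p$ is the norm of $L^p(\mathbb R^3)$ (for a vector field, the $L^p$ norm of its Euclidean length). For $m\ge 0$, $\|f\|_m=|\rho^m f|_2$, $L^2(m)=\{f\in L^2(\mathbb R^3): \|f\|_m<\infty\}$, and $\mathbb L^2(m)=\{\mathbf f\in L^2(m)^3:\operatorname{div}\mathbf f=0\}$ (divergence in the distributional sense), with norm $\|\mathbf f\|_m=|\rho^m|\mathbf f||_2$. Biot-Savart law: the velocity field $\mathbf v$ obtained from $\mathbf w$ is $$\mathbf v(\xi)=-\frac1{4\pi}\int_{\mathbb R^3}\frac{(\xi-\eta)\wedge\mathbf w(\eta)}{|\xi-\eta|^3}\,d\eta,$$ where $\wedge$ is the cross product. $\Lambda=\Delta_\xi+\frac12\xi\cdot\nabla_\xi+1$ generates a $C_0$ semigroup $e^{\tau\Lambda}$ on $L^2(m)$ (acting componentwise on vector fields), given by $$(e^{\tau\Lambda}f)(\xi)=\frac{e^{\tau}}{(4\pi(1-e^{-\tau}))^{3/2}}\int_{\mathbb R^3}e^{-\frac{|\xi-\eta|^2}{4(1-e^{-\tau})}}f(\eta e^{\tau/2})\,d\eta,\quad\tau>0,$$ and $e^{\tau(\Lambda-\frac12)}=e^{-\tau/2}e^{\tau\Lambda}$. The integral equation is the mild form of the rescaled vorticity equation $\partial_\tau\mathbf w=\Lambda\mathbf w-(\mathbf v\cdot\nabla)\mathbf w+(\mathbf w\cdot\nabla)\mathbf v$, $\operatorname{div}\mathbf w=0$.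 *)

theory Defs
  imports "HOL-Analysis.Analysis"
begin

text \<open>
  Elements of the weighted spaces are represented by Borel functions on \<^typ>\<open>real^3\<close>;
  equality in these spaces is equality almost everywhere.
\<close>

definition rho :: "real^3 \<Rightarrow> real" where
  "rho \<xi> = 1 + norm \<xi>"

definition wnorm :: "real \<Rightarrow> (real^3 \<Rightarrow> 'b::real_normed_vector) \<Rightarrow> real" where
  "wnorm m f = sqrt (LBINT \<xi>. (rho \<xi> powr m * norm (f \<xi>))\<^sup>2)"

text \<open>The integrability condition is the finiteness of the norm; without it,
  \<^const>\<open>wnorm\<close> would be \<open>0\<close> by the convention for non-integrable functions.\<close>

definition L2w :: "real \<Rightarrow> (real^3 \<Rightarrow> 'b::real_normed_vector) set" where
  "L2w m = {f. f \<in> borel_measurable borel \<and>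
               integrable lborel (\<lambda>\<xi>. (rho \<xi> powr m * norm (f \<xi>))\<^sup>2)}"

definition partial :: "3 \<Rightarrow> (real^3 \<Rightarrow> real) \<Rightarrow> real^3 \<Rightarrow> real" where
  "partial j f \<xi> = deriv (\<lambda>t. f (\<xi> + t *\<^sub>R axis j 1)) 0"

primrec Ck :: "nat \<Rightarrow> (real^3 \<Rightarrow> real) \<Rightarrow> bool" where
  "Ck 0 f \<longleftrightarrow> continuous_on UNIV f"
| "Ck (Suc k) f \<longleftrightarrow> f differentiable_on UNIV \<and> (\<forall>j. Ck k (partial j f))"

definition test_function :: "(real^3 \<Rightarrow> real) \<Rightarrow> bool" where
  "test_function \<phi> \<longleftrightarrow> (\<forall>k. Ck k \<phi>) \<and> compact (closure {\<xi>. \<phi> \<xi> \<noteq> 0})"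

text \<open>Distributional \<open>div f = 0\<close>, for locally integrable \<open>f\<close>.\<close>

definition div_free :: "(real^3 \<Rightarrow> real^3) \<Rightarrow> bool" where
  "div_free f \<longleftrightarrow>
     (\<forall>\<phi>. test_function \<phi> \<longrightarrow> (LBINT \<xi>. (\<Sum>j\<in>UNIV. f \<xi> $ j * partial j \<phi> \<xi>)) = 0)"

definition LL2w :: "real \<Rightarrow> (real^3 \<Rightarrow> real^3) set" where
  "LL2w m = {f \<in> L2w m. div_free f}"

definition biot_savart :: "(real^3 \<Rightarrow> real^3) \<Rightarrow> real^3 \<Rightarrow> real^3" where
  "biot_savart w \<xi> =
     - (1 / (4 * pi)) *\<^sub>R (LBINT \<eta>. (1 / norm (\<xi> - \<eta>) ^ 3) *\<^sub>R cross3 (\<xi> - \<eta>) (w \<eta>))"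

text \<open>The semigroup \<open>e\<^bsup>\<tau>\<Lambda>\<^esup>\<close> generated by \<open>\<Lambda> = \<Delta> + \<xi>\<cdot>\<nabla>/2 + 1\<close> on scalar functions.\<close>

definition expL :: "real \<Rightarrow> (real^3 \<Rightarrow> real) \<Rightarrow> real^3 \<Rightarrow> real" where
  "expL \<tau> f \<xi> = (if \<tau> = 0 then f \<xi> else
     exp \<tau> / (4 * pi * (1 - exp (- \<tau>))) powr (3 / 2) *
     (LBINT \<eta>. exp (- ((norm (\<xi> - \<eta>))\<^sup>2 / (4 * (1 - exp (- \<tau>))))) * f (exp (\<tau> / 2) *\<^sub>R \<eta>)))"

definition expL_half :: "real \<Rightarrow> (real^3 \<Rightarrow> real) \<Rightarrow> real^3 \<Rightarrow> real" where
  "expL_half \<tau> f \<xi> = exp (- \<tau> / 2) * expL \<tau> f \<xi>"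

text \<open>The integrand of the Duhamel term. At the single point \<open>s = \<tau>\<close> it is the partial
  derivative of a possibly non-smooth function, which does not affect the integral over \<open>s\<close>.\<close>

definition duhamel ::
    "(real \<Rightarrow> real^3 \<Rightarrow> real^3) \<Rightarrow> 3 \<Rightarrow> 3 \<Rightarrow> real \<Rightarrow> real^3 \<Rightarrow> real \<Rightarrow> real" where
  "duhamel w i j \<tau> \<xi> s =
     partial j (expL_half (\<tau> - s)
       (\<lambda>\<eta>. w s \<eta> $ j * biot_savart (w s) \<eta> $ i - biot_savart (w s) \<eta> $ j * w s \<eta> $ i)) \<xi>"

definition C0_LL2w :: "real \<Rightarrow> (real \<Rightarrow> real^3 \<Rightarrow> real^3) set" where
  "C0_LL2w m = {w. (\<forall>\<tau>\<ge>0. w \<tau> \<in> LL2w m) \<and>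
     (\<forall>t\<ge>0. ((\<lambda>\<tau>. wnorm m (\<lambda>\<xi>. w \<tau> \<xi> - w t \<xi>)) \<longlongrightarrow> 0) (at t within {0..}))}"

text \<open>The integral equation is an identity in \<open>L\<^sup>2(m)\<close> for every \<open>\<tau>\<close>, hence for almost
  every \<open>\<xi>\<close>; the time integrals are absolutely convergent for almost every \<open>\<xi>\<close>.\<close>

definition integral_equation :: "(real \<Rightarrow> real^3 \<Rightarrow> real^3) \<Rightarrow> bool" where
  "integral_equation w \<longleftrightarrow> (\<forall>\<tau>\<ge>0. \<forall>i. AE \<xi> in lborel.
     (\<forall>j. set_integrable lborel {0..\<tau>} (duhamel w i j \<tau> \<xi>)) \<and>
     w \<tau> \<xi> $ i = expL \<tau> (\<lambda>\<eta>. w 0 \<eta> $ i) \<xi>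
       + (\<Sum>j\<in>UNIV. LBINT s:{0..\<tau>}. duhamel w i j \<tau> \<xi> s))"

definition global_solution ::
    "real \<Rightarrow> (real^3 \<Rightarrow> real^3) \<Rightarrow> (real \<Rightarrow> real^3 \<Rightarrow> real^3) \<Rightarrow> bool" where
  "global_solution m w0 w \<longleftrightarrow>
     w \<in> C0_LL2w m \<and> integral_equation w \<and> (AE \<xi> in lborel. w 0 \<xi> = w0 \<xi>)"

end

theory Submission imports Defs "HOL-Probability.Probability" begin

text \<open>
  The semigroup of the rescaled linear problem is explicit. With \<open>e = exp (- t / 2)\<close> and
  \<open>a = 1 - exp (- t)\<close>, a change of variables turns it into the integral of
  \<open>e * G\<^sub>a (x - e y) * f y\<close> over \<open>y\<close>, where \<open>G\<^sub>a\<close> is the heat kernel at time \<open>a\<close>. The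
  solution is the fixed point, found by Picard iteration, of the integral equation in the ball of
  curves with \<open>wnorm m (w s) \<le> R * exp (- \<mu> * s)\<close>. Three facts make this work.

  Linear decay (\<open>expLv_decay\<close>). On all of \<open>L\<^sup>2(m)\<close> the semigroup grows like \<open>exp (t / 4)\<close>
  (\<open>expL_bound\<close>). A divergence-free field, however, has vanishing integrals of its components in
  a weak sense: pair it with the gradient of a cut-off coordinate function. Subtracting
  \<open>G\<^sub>a x\<close> from the kernel therefore changes nothing, and the difference is small, of size
  \<open>min 1 (e |y|)\<close> times a Gaussian. Together with the ratio \<open>(rho (e y) / rho y) powr m\<close> that the
  weight gains under the contraction \<open>y \<mapsto> e y\<close>, this leaves a factor \<open>e powr (2 \<mu>) = exp (- \<mu> t)\<close>,
  provided a certain power of \<open>rho\<close> is integrable on \<open>\<real>\<^sup>3\<close>; that is exactly the condition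
  \<open>m > 2 \<mu> + 1/2\<close>.

  Bilinear estimate (\<open>bilinear_kernel_estimate\<close>, \<open>dflux_norm_diff\<close>). The Biot-Savart velocity is
  dominated by the Riesz potential of \<open>|w|\<close>. Both here and in the linear part one weighted
  Cauchy-Schwarz argument (\<open>kernel_estimate\<close>) reduces the bound on \<open>L\<^sup>2(m)\<close> to a bound, uniform in
  \<open>x\<close>, of one integral against a Gaussian. The factor \<open>exp (- t / 2)\<close> in the semigroup
  takes the place of the cancellation, and the derivative costs a power of \<open>a\<close>. The integrand of the
  Duhamel term is at most a multiple of \<open>exp (- \<mu> t) * a powr (- 7/8)\<close> times the product of two norms. The power \<open>7/8\<close> is
  below \<open>1\<close>, hence the singularity at \<open>t = 0\<close> is integrable.

  Time integration (\<open>duhamel_op_estimate\<close>, \<open>time_kernel_convolution\<close>). Minkowski's inequality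
  carries the bound through the time integral. Since the nonlinearity is quadratic, two curves
  that decay like \<open>exp (- \<mu> s)\<close> produce \<open>exp (- 2 \<mu> s)\<close>; one half of this restores the decay of the
  result, and the other half keeps the time integral bounded uniformly in \<open>\<tau>\<close>. Hence the Duhamel
  term is a contraction on a small ball (\<open>duhamel_op_contraction\<close>) and the iteration converges
  (\<open>mild_solution_exists\<close>). Uniqueness holds among all continuous curves, of any size, because
  with a weight \<open>exp (- N s)\<close> on a bounded time interval and a large \<open>N\<close> the Duhamel term is again
  a contraction (\<open>mild_solution_unique\<close>). The divergence constraint is preserved since the flux is
  antisymmetric and the second derivatives of the heat kernel are symmetric
  (\<open>div_free_duhamel_op\<close>).
\<close>

section \<open>Lebesgue integrals and the weight\<close>

lemma borel_measurable_vec_nth' [measurable (raw)]: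
  fixes f :: "'a \<Rightarrow> real^'n"
  assumes "f \<in> borel_measurable M"
  shows "(\<lambda>x. f x $ i) \<in> borel_measurable M"
  using measurable_compose[OF assms, of "\<lambda>x. x $ i" borel]
  by (simp add: borel_measurable_continuous_onI continuous_on_component)

lemma nn_integral_affine:
  fixes f :: "'a::euclidean_space \<Rightarrow> ennreal"
  assumes [measurable]: "f \<in> borel_measurable borel" and c: "c \<noteq> 0"
  shows "(\<integral>\<^sup>+x. f (t + c *\<^sub>R x) \<partial>lborel) = ennreal (1 / \<bar>c\<bar> ^ DIM('a)) * (\<integral>\<^sup>+x. f x \<partial>lborel)"
proof -
  have "(\<integral>\<^sup>+x. f x \<partial>lborel) = ennreal (\<bar>c\<bar> ^ DIM('a)) * (\<integral>\<^sup>+x. f (t + c *\<^sub>R x) \<partial>lborel)"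
    by (subst lborel_affine[OF c, of t])
       (simp add: nn_integral_density nn_integral_distr nn_integral_cmult)
  then show ?thesis using c by (simp add: mult.assoc[symmetric] ennreal_mult'[symmetric])
qed

lemma integral_affine:
  fixes f :: "'a::euclidean_space \<Rightarrow> real"
  assumes [measurable]: "f \<in> borel_measurable borel" and c: "c \<noteq> 0"
  shows "(LBINT x. f x) = \<bar>c\<bar> ^ DIM('a) * (LBINT x. f (t + c *\<^sub>R x))"
  by (subst lborel_affine[OF c, of t]) (simp add: integral_density integral_distr)

lemma nn_integral_translate_reflect:
  fixes f :: "'a::euclidean_space \<Rightarrow> ennreal"
  assumes [measurable]: "f \<in> borel_measurable borel"
  shows "(\<integral>\<^sup>+x. f (t - x) \<partial>lborel) = (\<integral>\<^sup>+x. f x \<partial>lborel)"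
        "(\<integral>\<^sup>+x. f (x - t) \<partial>lborel) = (\<integral>\<^sup>+x. f x \<partial>lborel)"
  using nn_integral_affine[of f "-1" t] nn_integral_affine[of f "1" "-t"] by simp_all

lemma nn_integral_lborel_power:
  assumes [measurable]: "g \<in> borel_measurable borel"
  shows "(\<integral>\<^sup>+x. (\<Prod>b\<in>Basis. g (x \<bullet> b)) \<partial>(lborel::(real^3) measure)) = (\<integral>\<^sup>+t. g t \<partial>lborel) ^ 3"
  by (subst nn_integral_lborel_prod) auto

lemma nn_integral_even_le:
  fixes g :: "real \<Rightarrow> ennreal"
  assumes [measurable]: "g \<in> borel_measurable borel"
  shows "(\<integral>\<^sup>+t. g \<bar>t\<bar> \<partial>lborel) \<le> 2 * (\<integral>\<^sup>+t. g t * indicator {0..} t \<partial>lborel)"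
proof -
  have "(\<integral>\<^sup>+t. g \<bar>t\<bar> \<partial>lborel) \<le> (\<integral>\<^sup>+t. g t * indicator {0..} t + g (0 + (-1) * t) * indicator {0..} (0 + (-1) * t) \<partial>lborel)"
    by (intro nn_integral_mono) (auto split: split_indicator)
  also have "\<dots> = (\<integral>\<^sup>+t. g t * indicator {0..} t \<partial>lborel) + (\<integral>\<^sup>+t. g (0 + (-1) * t) * indicator {0..} (0 + (-1) * t) \<partial>lborel)"
    by (rule nn_integral_add) auto
  also have "(\<integral>\<^sup>+t. g (0 + (-1) * t) * indicator {0..} (0 + (-1) * t) \<partial>lborel) = (\<integral>\<^sup>+t. g t * indicator {0..} t \<partial>lborel)"
    by (subst nn_integral_real_affine[where c="-1" and t=0 and f="\<lambda>t. g t * indicator {0..} t"]) auto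
  finally show ?thesis by (simp add: mult_2)
qed

lemma nn_integral_powr_inf:
  assumes "s > (1::real)"
  shows "(\<integral>\<^sup>+t. ennreal ((1 + \<bar>t\<bar>) powr (-s)) \<partial>lborel) < \<infinity>"
proof -
  have "(\<integral>\<^sup>+t. ennreal ((1 + t) powr (-s)) * indicator {0..} t \<partial>lborel) = ennreal (0 - (1 + 0) powr (1 - s) / (1 - s))"
  proof (rule nn_integral_FTC_atLeast)
    show "((\<lambda>t. (1 + t) powr (1 - s) / (1 - s)) \<longlongrightarrow> 0) at_top"
      using assms by real_asymp
    show "((\<lambda>t. (1 + t) powr (1 - s) / (1 - s)) has_real_derivative (1 + x) powr - s) (at x)" if "0 \<le> x" for x
      using that assms by (auto intro!: derivative_eq_intros)
  qed auto
  then have "(\<integral>\<^sup>+t. ennreal ((1 + \<bar>t\<bar>) powr (-s)) \<partial>lborel) \<le> 2 * ennreal (0 - (1 + 0) powr (1 - s) / (1 - s))"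
    using nn_integral_even_le[of "\<lambda>t. ennreal ((1 + t) powr (-s))"] by simp
  also have "\<dots> < \<infinity>" by (simp add: ennreal_mult_less_top)
  finally show ?thesis .
qed

lemma nn_integral_powr_0:
  assumes "0 \<le> s" "s < (1::real)" "0 \<le> c"
  shows "(\<integral>\<^sup>+t. ennreal (\<bar>t\<bar> powr (-s)) * indicator {0..c} \<bar>t\<bar> \<partial>lborel) < \<infinity>"
proof -
  have "((\<lambda>x. x powr (-s)) has_integral (c powr (-s+1) / (-s+1))) {0..c}"
    using assms by (intro has_integral_powr_from_0) auto
  then have "(\<integral>\<^sup>+t. ennreal (indicator {0..c} t * t powr (-s)) \<partial>lborel) = ennreal (c powr (-s+1) / (-s+1))"
    by (intro nn_integral_has_integral_lebesgue) auto
  also have "(\<integral>\<^sup>+t. ennreal (indicator {0..c} t * t powr (-s)) \<partial>lborel) = (\<integral>\<^sup>+t. ennreal (t powr (-s)) * indicator {0..c} t * indicator {0..} t \<partial>lborel)"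
    by (intro nn_integral_cong) (auto split: split_indicator)
  finally have "(\<integral>\<^sup>+t. ennreal (\<bar>t\<bar> powr (-s)) * indicator {0..c} \<bar>t\<bar> \<partial>lborel) \<le> 2 * ennreal (c powr (-s+1) / (-s+1))"
    using nn_integral_even_le[of "\<lambda>t. ennreal (t powr (-s)) * indicator {0..c} t"] by simp
  also have "\<dots> < \<infinity>" by (simp add: ennreal_mult_less_top)
  finally show ?thesis .
qed

lemma rho_pos [simp]: "0 < rho x" and rho_ge1 [simp]: "1 \<le> rho x" and rho_nz [simp]: "rho x \<noteq> 0"
  unfolding rho_def using norm_ge_zero[of x] by linarith+

lemma rho_measurable [measurable]: "rho \<in> borel_measurable borel"
  unfolding rho_def by measurable

lemma rho_add_le: "rho (x + y) \<le> rho x * rho y"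
proof -
  have "norm (x + y) \<le> norm x + norm y + norm x * norm y" using norm_triangle_ineq[of x y] by (smt (verit) mult_nonneg_nonneg norm_ge_zero)
  then show ?thesis by (simp add: rho_def algebra_simps)
qed

lemma rho_le_diff: "rho x \<le> rho (x - y) * rho y"
  using rho_add_le[of "x - y" y] by simp

lemma rho_powr_le_diff: "0 \<le> m \<Longrightarrow> rho x powr m \<le> rho (x - y) powr m * rho y powr m"
  using powr_mono2[OF _ _ rho_le_diff[of x y]] by (simp add: powr_mult less_imp_le[OF rho_pos])

lemma rho_powr_ge1: "0 \<le> m \<Longrightarrow> 1 \<le> rho x powr m"
  by (simp add: ge_one_powr_ge_zero)

text \<open>
  Every coordinate satisfies \<open>1 + |x\<^sub>i| \<le> rho x\<close>, so the integrand is at most a product of three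
  functions of one variable, each with exponent \<open>q / 3 > 1\<close>.
\<close>

lemma finite_rho_integral:
  assumes "q > 3"
  shows "(\<integral>\<^sup>+x. ennreal (rho x powr (-q)) \<partial>lborel) < \<infinity>"
proof -
  have "ennreal (rho x powr (-q)) \<le> (\<Prod>b\<in>Basis. ennreal ((1 + \<bar>x \<bullet> b\<bar>) powr (-(q/3))))" for x :: "real^3"
  proof -
    have "rho x powr (-q) = (\<Prod>b\<in>(Basis::(real^3) set). rho x powr (-(q/3)))"
      by (simp add: powr_power)
    also have "\<dots> \<le> (\<Prod>b\<in>Basis. (1 + \<bar>x \<bullet> b\<bar>) powr (-(q/3)))"
    proof (rule prod_mono)
      fix b :: "real^3" assume "b \<in> Basis"
      then have "1 + \<bar>x \<bullet> b\<bar> \<le> rho x" unfolding rho_def by (simp add: Basis_le_norm)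
      then show "0 \<le> rho x powr - (q / 3) \<and> rho x powr - (q / 3) \<le> (1 + \<bar>x \<bullet> b\<bar>) powr - (q / 3)"
        using assms by (auto intro!: powr_mono2')
    qed
    finally show ?thesis by (simp add: prod_ennreal ennreal_leI)
  qed
  then have "(\<integral>\<^sup>+x. ennreal (rho x powr (-q)) \<partial>lborel) \<le> (\<integral>\<^sup>+x. (\<Prod>b\<in>Basis. ennreal ((1 + \<bar>x \<bullet> b\<bar>) powr (-(q/3)))) \<partial>(lborel::(real^3) measure))"
    by (intro nn_integral_mono)
  also have "\<dots> = (\<integral>\<^sup>+t. ennreal ((1 + \<bar>t\<bar>) powr (-(q/3))) \<partial>lborel) ^ 3"
    by (rule nn_integral_lborel_power) auto
  also have "\<dots> < \<infinity>"
    using nn_integral_powr_inf[of "q/3"] assms by (simp add: power_less_top_ennreal)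
  finally show ?thesis .
qed

lemma AE_inner_Basis_nonzero:
  assumes "b \<in> Basis"
  shows "AE x in lborel. (x::'a::euclidean_space) \<bullet> b \<noteq> 0"
proof -
  have "(\<integral>\<^sup>+x. (\<Prod>c\<in>Basis. (if c = b then indicator {0::real} else (\<lambda>_. 1)) (x \<bullet> c)) \<partial>(lborel::'a measure)) = (\<Prod>c\<in>(Basis::'a set). \<integral>\<^sup>+t. (if c = b then indicator {0::real} else (\<lambda>_. 1)) t \<partial>lborel)"
  proof (rule nn_integral_lborel_prod[where f="\<lambda>c. if c = b then indicator {0::real} else (\<lambda>_. 1)"])
    show "(if c = b then indicator {0::real} else (\<lambda>_. 1::ennreal)) \<in> borel_measurable borel" for c
      by (cases "c = b") simp_all
  qed simp
  also have "\<dots> = 0"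
    using assms by (intro prod_zero) (auto intro!: bexI[of _ b])
  finally have "AE x in lborel. (\<Prod>c\<in>Basis. (if c = b then indicator {0::real} else (\<lambda>_. 1)) ((x::'a) \<bullet> c)) = (0::ennreal)"
  proof (subst (asm) nn_integral_0_iff_AE)
    have [measurable]: "(\<lambda>x. (if c = b then indicator {0::real} else (\<lambda>_. 1::ennreal)) (x \<bullet> c)) \<in> borel_measurable (borel::'a measure)" for c
      by (cases "c = b") simp_all
    show "(\<lambda>x. \<Prod>c\<in>Basis. (if c = b then indicator {0::real} else (\<lambda>_. 1::ennreal)) (x \<bullet> c)) \<in> borel_measurable (lborel::'a measure)"
      by measurable
  qed simp
  then show ?thesis
  proof (eventually_elim)
    case (elim x)
    then obtain c where "c \<in> Basis" "(if c = b then indicator {0::real} else (\<lambda>_. 1)) (x \<bullet> c) = (0::ennreal)"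
      by auto
    then show ?case by (auto split: if_splits)
  qed
qed

text \<open>
  Again by comparison with a product: \<open>|x\<^sub>i| \<le> norm x\<close>, and each one-dimensional factor has
  exponent \<open>p / 3 < 1\<close>. The points with a vanishing coordinate form a null set.
\<close>

lemma finite_singular_integral:
  assumes p: "0 \<le> p" "p < 3"
  shows "(\<integral>\<^sup>+x. ennreal (norm x powr (-p)) * indicator (cball 0 1) x \<partial>(lborel::(real^3) measure)) < \<infinity>"
proof -
  have *: "ennreal (norm x powr (-p)) * indicator (cball 0 1) x \<le> (\<Prod>b\<in>Basis. ennreal (\<bar>x \<bullet> b\<bar> powr (-(p/3))) * indicator {0..1} \<bar>x \<bullet> b\<bar>)"
    if nz: "\<forall>b\<in>Basis. x \<bullet> b \<noteq> 0" for x :: "real^3"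
  proof (cases "norm x \<le> 1")
    case True
    have "norm x powr (-p) = (\<Prod>b\<in>(Basis::(real^3) set). norm x powr (-(p/3)))"
      by (cases "x = 0") (auto simp: powr_power)
    also have "\<dots> \<le> (\<Prod>b\<in>Basis. \<bar>x \<bullet> b\<bar> powr (-(p/3)))"
    proof (rule prod_mono)
      fix b :: "real^3" assume "b \<in> Basis"
      then have "0 < \<bar>x \<bullet> b\<bar>" "\<bar>x \<bullet> b\<bar> \<le> norm x" using nz by (auto simp: Basis_le_norm)
      then show "0 \<le> norm x powr - (p / 3) \<and> norm x powr - (p / 3) \<le> \<bar>x \<bullet> b\<bar> powr - (p / 3)"
        using assms by (auto intro!: powr_mono2')
    qed
    finally have "ennreal (norm x powr (-p)) \<le> (\<Prod>b\<in>Basis. ennreal (\<bar>x \<bullet> b\<bar> powr (-(p/3))))"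
      by (simp add: prod_ennreal ennreal_leI)
    also have "\<dots> = (\<Prod>b\<in>Basis. ennreal (\<bar>x \<bullet> b\<bar> powr (-(p/3))) * indicator {0..1} \<bar>x \<bullet> b\<bar>)"
    proof (rule prod.cong)
      fix b :: "real^3" assume "b \<in> Basis"
      then have "\<bar>x \<bullet> b\<bar> \<le> 1" using Basis_le_norm[of b x] True by linarith
      then show "ennreal (\<bar>x \<bullet> b\<bar> powr (-(p/3))) = ennreal (\<bar>x \<bullet> b\<bar> powr (-(p/3))) * indicator {0..1} \<bar>x \<bullet> b\<bar>" by simp
    qed simp
    finally show ?thesis using True by simp
  qed simp
  have "AE x in lborel. \<forall>b\<in>Basis. (x::real^3) \<bullet> b \<noteq> 0"
    by (rule AE_finite_allI) (auto intro: AE_inner_Basis_nonzero)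
  then have "(\<integral>\<^sup>+x. ennreal (norm x powr (-p)) * indicator (cball 0 1) x \<partial>(lborel::(real^3) measure)) \<le> (\<integral>\<^sup>+x. (\<Prod>b\<in>Basis. ennreal (\<bar>x \<bullet> b\<bar> powr (-(p/3))) * indicator {0..1} \<bar>x \<bullet> b\<bar>) \<partial>(lborel::(real^3) measure))"
    by (intro nn_integral_mono_AE) (auto elim!: eventually_mono intro: *)
  also have "\<dots> = (\<integral>\<^sup>+t. ennreal (\<bar>t\<bar> powr (-(p/3))) * indicator {0..1} \<bar>t\<bar> \<partial>lborel) ^ 3"
    by (rule nn_integral_lborel_power) auto
  also have "\<dots> < \<infinity>"
    using nn_integral_powr_0[of "p/3" 1] assms by (simp add: power_less_top_ennreal)
  finally show ?thesis .
qed

section \<open>Gaussian kernels\<close>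

lemma nn_integral_gauss1: "(\<integral>\<^sup>+t. ennreal (exp (- t\<^sup>2)) \<partial>lborel) = ennreal (sqrt pi)"
proof -
  have "(\<integral>\<^sup>+t. ennreal (normal_density 0 (1/sqrt 2) t) \<partial>lborel) = 1"
    by (subst nn_integral_eq_integral) auto
  moreover have "ennreal (normal_density 0 (1/sqrt 2) t) = ennreal (1 / sqrt pi) * ennreal (exp (- t\<^sup>2))" for t
    by (simp add: normal_density_def power_divide ennreal_mult'[symmetric])
  ultimately have "ennreal (1 / sqrt pi) * (\<integral>\<^sup>+t. ennreal (exp (- t\<^sup>2)) \<partial>lborel) = 1"
    by (simp add: nn_integral_cmult)
  then have "ennreal (sqrt pi) * (ennreal (1 / sqrt pi) * (\<integral>\<^sup>+t. ennreal (exp (- t\<^sup>2)) \<partial>lborel)) = ennreal (sqrt pi)"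
    by simp
  then show ?thesis by (simp add: mult.assoc[symmetric] ennreal_mult'[symmetric])
qed

lemma nn_integral_gauss3: "(\<integral>\<^sup>+x. ennreal (exp (- (norm x)\<^sup>2)) \<partial>(lborel::(real^3) measure)) = ennreal (sqrt pi ^ 3)"
proof -
  have "ennreal (exp (- (norm x)\<^sup>2)) = (\<Prod>b\<in>Basis. ennreal (exp (- (x \<bullet> b)\<^sup>2)))" for x :: "real^3"
  proof -
    have "(norm x)\<^sup>2 = (\<Sum>b\<in>Basis. (x \<bullet> b)\<^sup>2)"
      using euclidean_inner[of x x] by (simp only: power2_norm_eq_inner) (simp add: power2_eq_square)
    then show ?thesis by (simp add: exp_sum sum_negf[symmetric] prod_ennreal)
  qed
  then have "(\<integral>\<^sup>+x. ennreal (exp (- (norm x)\<^sup>2)) \<partial>(lborel::(real^3) measure)) = (\<integral>\<^sup>+t. ennreal (exp (- t\<^sup>2)) \<partial>lborel) ^ 3"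
    using nn_integral_lborel_power[of "\<lambda>t. ennreal (exp (- t\<^sup>2))"] by simp
  then show ?thesis by (simp add: nn_integral_gauss1 ennreal_power)
qed

lemma nn_integral_gauss_scaled:
  fixes \<xi> :: "real^3"
  assumes "0 < s" "c \<noteq> 0"
  shows "(\<integral>\<^sup>+y. ennreal (exp (- (norm (\<xi> - c *\<^sub>R y))\<^sup>2 / s)) \<partial>lborel) = ennreal ((sqrt (pi * s) / \<bar>c\<bar>) ^ 3)"
proof -
  let ?f = "\<lambda>x::real^3. ennreal (exp (- (norm x)\<^sup>2))"
  have "(norm (\<xi> - c *\<^sub>R y))\<^sup>2 / s = (norm ((1/sqrt s) *\<^sub>R \<xi> + (- c / sqrt s) *\<^sub>R y))\<^sup>2" for y
  proof -
    have "(1/sqrt s) *\<^sub>R \<xi> + (- c / sqrt s) *\<^sub>R y = (1/sqrt s) *\<^sub>R (\<xi> - c *\<^sub>R y)"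
      by (simp add: scaleR_diff_right)
    then show ?thesis using assms by (simp add: power_divide)
  qed
  then have "(\<integral>\<^sup>+y. ennreal (exp (- (norm (\<xi> - c *\<^sub>R y))\<^sup>2 / s)) \<partial>lborel) = (\<integral>\<^sup>+y. ?f ((1/sqrt s) *\<^sub>R \<xi> + (- c / sqrt s) *\<^sub>R y) \<partial>lborel)"
    by simp
  also have "\<dots> = ennreal (1 / \<bar>- c / sqrt s\<bar> ^ 3) * ennreal (sqrt pi ^ 3)"
    using assms by (subst nn_integral_affine) (auto simp: nn_integral_gauss3)
  also have "\<dots> = ennreal ((sqrt (pi * s) / \<bar>c\<bar>) ^ 3)"
    using assms by (simp add: ennreal_mult'[symmetric] real_sqrt_mult power_divide power_mult_distrib mult.commute)
  finally show ?thesis .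
qed

text \<open>
  A Gaussian with four times the variance of the heat kernel at time \<open>a\<close>: it absorbs a polynomial
  weight from the heat kernel and its derivatives at the cost of a constant.
\<close>

definition wide :: "real \<Rightarrow> real^3 \<Rightarrow> real" where
  "wide a x = exp (- (norm x)\<^sup>2 / (16 * a))"

lemma wide_pos [simp]: "0 < wide a x" and wide_nonneg [simp]: "0 \<le> wide a x" and wide_le1: "0 < a \<Longrightarrow> wide a x \<le> 1"
  by (auto simp: wide_def)

lemma wide_measurable [measurable]: "wide a \<in> borel_measurable borel"
  unfolding wide_def by measurable

lemma nn_integral_wide:
  assumes "0 < a" "c \<noteq> 0"
  shows "(\<integral>\<^sup>+y. ennreal (wide a (x - c *\<^sub>R y)) \<partial>lborel) = ennreal ((sqrt (16 * pi * a) / \<bar>c\<bar>) ^ 3)"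
  unfolding wide_def using nn_integral_gauss_scaled[of "16 * a" c x] assms by (simp add: mult_ac)

lemma nn_integral_wide':
  assumes "0 < a"
  shows "(\<integral>\<^sup>+\<xi>. ennreal (wide a (\<xi> - z)) \<partial>lborel) = ennreal (sqrt (16 * pi * a) ^ 3)"
  using nn_integral_wide[OF assms, of 1 0] nn_integral_translate_reflect(2)[of "\<lambda>x. ennreal (wide a x)" z]
    nn_integral_translate_reflect(1)[of "\<lambda>x. ennreal (wide a x)" 0]
  by simp

text \<open>
  The heat kernel at time \<open>a\<close>; below are its first and, further on, its second derivatives.
\<close>

definition heat :: "real \<Rightarrow> real^3 \<Rightarrow> real" where
  "heat a x = exp (- (norm x)\<^sup>2 / (4 * a)) / (4 * pi * a) powr (3 / 2)"

definition heatD :: "real \<Rightarrow> 3 \<Rightarrow> real^3 \<Rightarrow> real" where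
  "heatD a j x = - (x $ j) / (2 * a) * heat a x"

lemma heat_nonneg [simp]: "0 \<le> heat a x"
  by (auto simp: heat_def)

lemma heatD_measurable [measurable]: "(\<lambda>p. heatD (fst p) j (snd p)) \<in> borel_measurable (borel \<Otimes>\<^sub>M borel)"
  unfolding heatD_def heat_def by measurable

lemma heat_measurable1 [measurable]: "heat a \<in> borel_measurable borel"
  unfolding heat_def by measurable

lemma heatD_measurable1 [measurable]: "heatD a j \<in> borel_measurable borel"
  unfolding heatD_def by measurable

lemma nn_integral_heat:
  assumes "0 < a"
  shows "(\<integral>\<^sup>+x. ennreal (heat a x) \<partial>lborel) = 1"
proof -
  have *: "(4 * pi * a) powr (3 / 2) = sqrt (pi * (4 * a)) ^ 3"
    using assms by (simp add: powr_half_sqrt[symmetric] powr_power mult_ac)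
  have "ennreal (heat a x) = ennreal (1 / (4 * pi * a) powr (3 / 2)) * ennreal (exp (- (norm (0 - (1::real) *\<^sub>R x))\<^sup>2 / (4 * a)))" for x
    by (simp add: heat_def ennreal_mult'[symmetric])
  then have "(\<integral>\<^sup>+x. ennreal (heat a x) \<partial>lborel) = ennreal (1 / (4 * pi * a) powr (3 / 2)) * ennreal ((sqrt (pi * (4 * a)) / \<bar>1\<bar>) ^ 3)"
    using nn_integral_gauss_scaled[of "4*a" 1 0] assms by (simp add: nn_integral_cmult)
  also have "\<dots> = 1"
    using assms unfolding * by (simp add: ennreal_mult'[symmetric] )
  finally show ?thesis .
qed

text \<open>
  Since \<open>rho x \<le> exp (norm x)\<close>, this is Young's inequality
  \<open>m r \<le> m\<^sup>2 / (4 d) + d r\<^sup>2\<close> in the exponent.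
\<close>

lemma rho_powr_le_exp:
  assumes "0 \<le> m" "0 < d"
  shows "rho x powr m \<le> exp (m\<^sup>2 / (4 * d)) * exp (d * (norm x)\<^sup>2)"
proof -
  have "rho x powr m \<le> exp (norm x) powr m"
    unfolding rho_def using assms exp_ge_add_one_self[of "norm x"] by (intro powr_mono2) auto
  also have "\<dots> = exp (m * norm x)" by (simp add: powr_def)
  also have "m * norm x \<le> m\<^sup>2 / (4 * d) + d * (norm x)\<^sup>2"
  proof -
    have "0 \<le> d * (norm x - m / (2 * d))\<^sup>2" using assms by simp
    also have "\<dots> = m\<^sup>2 / (4 * d) + d * (norm x)\<^sup>2 - m * norm x"
      using assms by (simp add: power2_eq_square field_simps)
    finally show ?thesis by simp
  qed
  finally show ?thesis by (simp add: exp_add)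
qed

lemma rho_heat_le:
  assumes "0 \<le> m" "0 < a" "a \<le> 1"
  shows "rho x powr m * heat a x \<le> exp (4 * m\<^sup>2) * a powr (-(3/2)) * wide a x"
proof -
  have "rho x powr m \<le> exp (4 * m\<^sup>2) * exp (1/16 * (norm x)\<^sup>2)"
    using rho_powr_le_exp[OF assms(1), of "1/16" x] by (simp add: field_simps)
  also have "\<dots> \<le> exp (4 * m\<^sup>2) * exp ((norm x)\<^sup>2 / (16 * a))"
    using assms by (intro mult_left_mono) (auto simp: field_simps intro!: mult_left_le_one_le)
  finally have 1: "rho x powr m \<le> exp (4 * m\<^sup>2) * exp ((norm x)\<^sup>2 / (16 * a))" .
  have 2: "heat a x \<le> a powr (-(3/2)) * exp (- (norm x)\<^sup>2 / (4 * a))"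
  proof -
    have "a powr (3/2) \<le> (4 * pi * a) powr (3 / 2)"
      using assms pi_gt3 by (intro powr_mono2) auto
    then show ?thesis using assms unfolding heat_def by (simp add: powr_minus divide_simps)
  qed
  have "rho x powr m * heat a x \<le> (exp (4 * m\<^sup>2) * exp ((norm x)\<^sup>2 / (16 * a))) * (a powr (-(3/2)) * exp (- (norm x)\<^sup>2 / (4 * a)))"
    by (intro mult_mono 1 2) auto
  also have "\<dots> = exp (4 * m\<^sup>2) * a powr (-(3/2)) * (exp ((norm x)\<^sup>2 / (16 * a)) * exp (- (norm x)\<^sup>2 / (4 * a)))"
    by (simp only: mult_ac)
  also have "\<dots> \<le> exp (4 * m\<^sup>2) * a powr (-(3/2)) * wide a x"
    unfolding wide_def exp_add[symmetric] using assms by (intro mult_left_mono) (auto simp: field_simps)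
  finally show ?thesis .
qed

lemma rho_heatD_le:
  assumes "0 \<le> m" "0 < a" "a \<le> 1"
  shows "rho x powr m * \<bar>heatD a j x\<bar> \<le> exp (4 * m\<^sup>2 + 4) * a powr (-2) * wide a x"
proof -
  have 1: "rho x powr m \<le> exp (4 * m\<^sup>2) * exp ((norm x)\<^sup>2 / (16 * a))"
  proof -
    have "rho x powr m \<le> exp (4 * m\<^sup>2) * exp (1/16 * (norm x)\<^sup>2)"
      using rho_powr_le_exp[OF assms(1), of "1/16" x] by (simp add: field_simps)
    also have "\<dots> \<le> exp (4 * m\<^sup>2) * exp ((norm x)\<^sup>2 / (16 * a))"
      using assms by (intro mult_left_mono) (auto simp: field_simps intro!: mult_left_le_one_le)
    finally show ?thesis .
  qed
  have 3: "\<bar>x $ j\<bar> / (2 * a) \<le> exp 4 * a powr (-(1/2)) * exp ((norm x)\<^sup>2 / (16 * a))"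
  proof -
    let ?s = "norm x / sqrt a"
    have "?s \<le> exp ?s" using exp_ge_add_one_self[of ?s] by linarith
    also have "\<dots> \<le> exp (4 + ?s\<^sup>2 / 16)"
    proof -
      have "r \<le> 4 + r\<^sup>2 / 16" for r :: real
      proof -
        have "0 \<le> (r - 8)\<^sup>2" by simp
        then show ?thesis by (simp add: power2_eq_square algebra_simps)
      qed
      then show ?thesis by simp
    qed
    also have "\<dots> = exp 4 * exp ((norm x)\<^sup>2 / (16 * a))"
      using assms by (simp add: exp_add power_divide mult.commute)
    finally have "?s * a powr (-(1/2)) \<le> exp 4 * exp ((norm x)\<^sup>2 / (16 * a)) * a powr (-(1/2))"
      by (intro mult_right_mono) auto
    moreover have "?s * a powr (-(1/2)) = norm x / a"
      using assms by (simp add: powr_minus powr_half_sqrt field_simps)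
    moreover have "\<bar>x $ j\<bar> / (2 * a) \<le> norm x / a"
      using component_le_norm_cart[of x j] assms by (auto simp: field_simps intro: order_trans)
    ultimately show ?thesis by (simp add: mult_ac)
  qed
  have 2: "heat a x \<le> a powr (-(3/2)) * exp (- (norm x)\<^sup>2 / (4 * a))"
  proof -
    have "a powr (3/2) \<le> (4 * pi * a) powr (3 / 2)"
      using assms pi_gt3 by (intro powr_mono2) auto
    then show ?thesis using assms unfolding heat_def by (simp add: powr_minus divide_simps)
  qed
  have "rho x powr m * \<bar>heatD a j x\<bar> = rho x powr m * (\<bar>x $ j\<bar> / (2 * a) * heat a x)"
    using assms by (simp add: heatD_def abs_mult)
  also have "\<dots> \<le> (exp (4 * m\<^sup>2) * exp ((norm x)\<^sup>2 / (16 * a))) * ((exp 4 * a powr (-(1/2)) * exp ((norm x)\<^sup>2 / (16 * a))) * (a powr (-(3/2)) * exp (- (norm x)\<^sup>2 / (4 * a))))"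
    using assms by (intro mult_mono 1 2 3) auto
  also have "\<dots> = (exp (4 * m\<^sup>2) * exp 4) * (a powr (-(1/2)) * a powr (-(3/2))) * (exp ((norm x)\<^sup>2 / (16 * a)) * exp ((norm x)\<^sup>2 / (16 * a)) * exp (- (norm x)\<^sup>2 / (4 * a)))"
    by (simp add: mult_ac)
  also have "\<dots> \<le> (exp (4 * m\<^sup>2) * exp 4) * (a powr (-(1/2)) * a powr (-(3/2))) * wide a x"
    unfolding wide_def exp_add[symmetric] using assms by (intro mult_left_mono) (auto simp: field_simps)
  finally show ?thesis by (simp add: exp_add powr_add[symmetric])
qed

section \<open>Weighted square integrals\<close>

lemma ennreal_sum_sq: "((x::ennreal) + y)\<^sup>2 \<le> 2 * x\<^sup>2 + 2 * y\<^sup>2"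
proof (cases x; cases y)
  fix r s :: real assume rs: "0 \<le> r" "x = ennreal r" "0 \<le> s" "y = ennreal s"
  have "(r + s)\<^sup>2 \<le> 2 * r\<^sup>2 + 2 * s\<^sup>2"
    using zero_le_power2[of "r - s"] by (simp add: power2_eq_square algebra_simps)
  then have "ennreal ((r + s)\<^sup>2) \<le> ennreal (2 * r\<^sup>2 + 2 * s\<^sup>2)" by (rule ennreal_leI)
  also have "\<dots> = 2 * x\<^sup>2 + 2 * y\<^sup>2"
    using rs by (simp add: ennreal_power ennreal_mult ennreal_plus)
  finally show ?thesis using rs by (simp add: ennreal_power flip: ennreal_plus)
qed (auto simp: ennreal_mult_top top_power_ennreal ennreal_top_mult)

text \<open>
  The square of the weighted norm, as an extended nonnegative number: it needs no integrability and
  allows functions with infinite values, such as integrals of kernels.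
\<close>

definition wsq :: "real \<Rightarrow> (real^3 \<Rightarrow> ennreal) \<Rightarrow> ennreal" where
  "wsq m u = (\<integral>\<^sup>+x. (ennreal (rho x powr m) * u x)\<^sup>2 \<partial>lborel)"

lemma wsq_mono_AE: "AE x in lborel. u x \<le> v x \<Longrightarrow> wsq m u \<le> wsq m v"
  unfolding wsq_def
  by (rule nn_integral_mono_AE) (auto elim!: eventually_mono intro!: power_mono_ennreal mult_left_mono)

lemma wsq_mono: "(\<And>x. u x \<le> v x) \<Longrightarrow> wsq m u \<le> wsq m v"
  by (rule wsq_mono_AE) simp

lemma wsq_add:
  assumes [measurable]: "u \<in> borel_measurable borel" "v \<in> borel_measurable borel"
  shows "wsq m (\<lambda>x. u x + v x) \<le> 2 * wsq m u + 2 * wsq m v"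
proof -
  have "wsq m (\<lambda>x. u x + v x) \<le> (\<integral>\<^sup>+\<xi>. 2 * (ennreal (rho \<xi> powr m) * u \<xi>)\<^sup>2 + 2 * (ennreal (rho \<xi> powr m) * v \<xi>)\<^sup>2 \<partial>lborel)"
    unfolding wsq_def by (intro nn_integral_mono) (simp add: distrib_left ennreal_sum_sq)
  also have "\<dots> = 2 * wsq m u + 2 * wsq m v"
    unfolding wsq_def by (subst nn_integral_add) (auto simp: nn_integral_cmult)
  finally show ?thesis .
qed

lemma wsq_cmult:
  assumes [measurable]: "u \<in> borel_measurable borel"
  shows "wsq m (\<lambda>x. c * u x) = c\<^sup>2 * wsq m u"
proof -
  have "(ennreal (rho \<xi> powr m) * (c * u \<xi>))\<^sup>2 = c\<^sup>2 * (ennreal (rho \<xi> powr m) * u \<xi>)\<^sup>2" for \<xi>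
    by (simp add: power_mult_distrib mult_ac)
  then show ?thesis unfolding wsq_def by (simp add: nn_integral_cmult)
qed

lemma L2_le_wsq:
  assumes "0 \<le> m"
  shows "(\<integral>\<^sup>+x. (u x)\<^sup>2 \<partial>lborel) \<le> wsq m u"
  unfolding wsq_def
proof (intro nn_integral_mono power_mono_ennreal)
  fix x :: "real^3"
  have "1 * u x \<le> ennreal (rho x powr m) * u x"
    using rho_powr_ge1[OF assms, of x] by (intro mult_right_mono) auto
  then show "u x \<le> ennreal (rho x powr m) * u x" by simp
qed

lemma cball_borel [measurable]: "cball (x::'a::metric_space) r \<in> sets borel"
  by (simp add: borel_closed)

section \<open>Riesz potential\<close>

text \<open>
  Up to a constant, the Riesz potential of order one of \<open>q\<close>.
\<close>

definition riesz :: "(real^3 \<Rightarrow> ennreal) \<Rightarrow> real^3 \<Rightarrow> ennreal" where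
  "riesz q y = (\<integral>\<^sup>+z. ennreal (1 / (norm (y - z))\<^sup>2) * q z \<partial>lborel)"

lemma riesz_measurable [measurable]:
  assumes [measurable]: "q \<in> borel_measurable borel"
  shows "riesz q \<in> borel_measurable borel"
  unfolding riesz_def by measurable

text \<open>
  The exponent \<open>5/4\<close> is chosen so that \<open>nearker\<close> and its square, as well as the complementary
  singularity \<open>norm x powr (- 11/4)\<close> in \<open>norm x powr (- 4)\<close>, are integrable near the origin.
\<close>

definition nearker :: "real^3 \<Rightarrow> ennreal" where
  "nearker x = ennreal (norm x powr (-(5/4))) * indicator (cball 0 1) x"

lemma nearker_measurable [measurable]: "nearker \<in> borel_measurable borel"
  unfolding nearker_def by measurable

lemma nearker_finite: "(\<integral>\<^sup>+x. nearker x \<partial>lborel) < \<infinity>" "(\<integral>\<^sup>+x. (nearker x)\<^sup>2 \<partial>lborel) < \<infinity>"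
proof -
  show "(\<integral>\<^sup>+x. nearker x \<partial>lborel) < \<infinity>"
    unfolding nearker_def by (rule finite_singular_integral) auto
  have "(nearker x)\<^sup>2 = ennreal (norm x powr (-(5/2))) * indicator (cball 0 1) x" for x
    unfolding nearker_def by (cases "x = 0") (auto simp: power_mult_distrib ennreal_power powr_power split: split_indicator)
  then show "(\<integral>\<^sup>+x. (nearker x)\<^sup>2 \<partial>lborel) < \<infinity>"
    using finite_singular_integral[of "5/2"] by simp
qed

text \<open>
  The Cauchy-Schwarz inequality, applied separately to the singular part of the kernel
  near the origin and to the square integrable rest. The bound is pointwise: the remaining
  singularity \<open>nearker\<close> is weak enough to be integrated against a Gaussian later.
\<close>

lemma riesz_bound:
  "\<exists>C<\<infinity>. \<forall>q\<in>borel_measurable borel. \<forall>y.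
       (riesz q y)\<^sup>2 \<le> C * ((\<integral>\<^sup>+z. (q z)\<^sup>2 \<partial>lborel) + (\<integral>\<^sup>+z. nearker (y - z) * (q z)\<^sup>2 \<partial>lborel))"
proof -
  \<comment> \<open>near the origin \<open>norm x powr (-2)\<close> splits as \<open>- 11/8 - 5/8\<close>, and the squares of both factors are integrable\<close>
  define \<alpha> :: "real^3 \<Rightarrow> ennreal" where "\<alpha> x = ennreal (norm x powr (-(11/8))) * indicator (cball 0 1) x" for x
  define \<beta> :: "real^3 \<Rightarrow> ennreal" where "\<beta> x = ennreal (norm x powr (-(5/8))) * indicator (cball 0 1) x" for x
  define \<gamma> :: "real^3 \<Rightarrow> ennreal" where "\<gamma> x = ennreal (4 * rho x powr (-2))" for x
  have [measurable]: "\<alpha> \<in> borel_measurable borel" "\<beta> \<in> borel_measurable borel" "\<gamma> \<in> borel_measurable borel"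
    unfolding \<alpha>_def \<beta>_def \<gamma>_def by measurable
  have \<beta>2: "(\<beta> x)\<^sup>2 = nearker x" for x
    unfolding nearker_def \<beta>_def by (cases "x = 0") (auto simp: power_mult_distrib ennreal_power powr_power split: split_indicator)
  have \<alpha>2: "(\<alpha> x)\<^sup>2 = ennreal (norm x powr (-(11/4))) * indicator (cball 0 1) x" for x
    unfolding \<alpha>_def by (cases "x = 0") (auto simp: power_mult_distrib ennreal_power powr_power split: split_indicator)
  have \<gamma>2: "(\<gamma> x)\<^sup>2 = 16 * ennreal (rho x powr (-4))" for x
    unfolding \<gamma>_def by (simp add: ennreal_power power_mult_distrib powr_power ennreal_mult)
  define A where "A = (\<integral>\<^sup>+x. (\<alpha> x)\<^sup>2 \<partial>lborel)"
  define B where "B = (\<integral>\<^sup>+x. (\<gamma> x)\<^sup>2 \<partial>lborel)"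
  have A: "A < \<infinity>" unfolding A_def \<alpha>2 by (rule finite_singular_integral) auto
  have B: "B < \<infinity>" unfolding B_def \<gamma>2
    using finite_rho_integral[of 4] by (simp add: nn_integral_cmult ennreal_mult_less_top)
  have ker: "ennreal (1 / (norm x)\<^sup>2) \<le> \<alpha> x * \<beta> x + \<gamma> x" for x
  proof (cases "norm x \<le> 1")
    case True
    have "ennreal (1 / (norm x)\<^sup>2) = \<alpha> x * \<beta> x"
      using True unfolding \<alpha>_def \<beta>_def
      by (cases "x = 0") (auto simp: ennreal_mult'[symmetric] powr_add[symmetric] powr_minus powr_numeral inverse_eq_divide)
    then show ?thesis by simp
  next
    case False
    then have "rho x \<le> 2 * norm x" by (simp add: rho_def)
    then have "(rho x)\<^sup>2 \<le> (2 * norm x)\<^sup>2" by (intro power_mono) (auto simp: less_imp_le)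
    then have "1 / (norm x)\<^sup>2 \<le> 4 * rho x powr (-2)"
      using False by (auto simp: powr_minus powr_numeral less_imp_le[OF rho_pos] inverse_eq_divide divide_simps)
    then have "ennreal (1 / (norm x)\<^sup>2) \<le> \<gamma> x" unfolding \<gamma>_def by (rule ennreal_leI)
    then show ?thesis by (simp add: add_increasing)
  qed
  show ?thesis
  proof (intro exI conjI ballI allI)
    show "2 * A + 2 * B < \<infinity>" using A B by (simp add: ennreal_mult_less_top)
    fix q :: "real^3 \<Rightarrow> ennreal" and y assume [measurable]: "q \<in> borel_measurable borel"
    let ?I = "\<integral>\<^sup>+z. (q z)\<^sup>2 \<partial>lborel" and ?J = "\<integral>\<^sup>+z. nearker (y - z) * (q z)\<^sup>2 \<partial>lborel"
    have "riesz q y \<le> (\<integral>\<^sup>+z. \<alpha> (y - z) * (\<beta> (y - z) * q z) + \<gamma> (y - z) * q z \<partial>lborel)"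
      unfolding riesz_def
    proof (rule nn_integral_mono)
      fix z show "ennreal (1 / (norm (y - z))\<^sup>2) * q z \<le> \<alpha> (y - z) * (\<beta> (y - z) * q z) + \<gamma> (y - z) * q z"
        using mult_right_mono[OF ker[of "y - z"], of "q z"] by (simp add: distrib_right mult.assoc)
    qed
    also have "\<dots> = (\<integral>\<^sup>+z. \<alpha> (y - z) * (\<beta> (y - z) * q z) \<partial>lborel) + (\<integral>\<^sup>+z. \<gamma> (y - z) * q z \<partial>lborel)"
      by (rule nn_integral_add) auto
    finally have "(riesz q y)\<^sup>2 \<le> ((\<integral>\<^sup>+z. \<alpha> (y - z) * (\<beta> (y - z) * q z) \<partial>lborel) + (\<integral>\<^sup>+z. \<gamma> (y - z) * q z \<partial>lborel))\<^sup>2"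
      by (rule power_mono_ennreal)
    also have "\<dots> \<le> 2 * (\<integral>\<^sup>+z. \<alpha> (y - z) * (\<beta> (y - z) * q z) \<partial>lborel)\<^sup>2 + 2 * (\<integral>\<^sup>+z. \<gamma> (y - z) * q z \<partial>lborel)\<^sup>2"
      by (rule ennreal_sum_sq)
    also have "\<dots> \<le> 2 * ((\<integral>\<^sup>+z. (\<alpha> (y - z))\<^sup>2 \<partial>lborel) * (\<integral>\<^sup>+z. (\<beta> (y - z) * q z)\<^sup>2 \<partial>lborel))
        + 2 * ((\<integral>\<^sup>+z. (\<gamma> (y - z))\<^sup>2 \<partial>lborel) * ?I)"
      by (intro add_mono mult_left_mono Cauchy_Schwarz_nn_integral) auto
    also have "\<dots> = 2 * (A * ?J) + 2 * (B * ?I)"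
      using nn_integral_translate_reflect(1)[of "\<lambda>x. (\<alpha> x)\<^sup>2" y] nn_integral_translate_reflect(1)[of "\<lambda>x. (\<gamma> x)\<^sup>2" y]
      by (simp add: A_def B_def power_mult_distrib \<beta>2)
    also have "\<dots> \<le> 2 * (A * (?I + ?J)) + 2 * (B * (?I + ?J))"
      by (intro add_mono mult_left_mono) auto
    also have "\<dots> = (2 * A + 2 * B) * (?I + ?J)" by (simp add: distrib_right mult.assoc)
    finally show "(riesz q y)\<^sup>2 \<le> (2 * A + 2 * B) * (?I + ?J)" .
  qed
qed

text \<open>
  Tonelli's theorem: the inner integral is moved onto the weight \<open>g\<close>.
\<close>

lemma nearker_convolution:
  assumes [measurable]: "q \<in> borel_measurable borel" "g \<in> borel_measurable borel"
    and g: "\<And>z. (\<integral>\<^sup>+y. g y * nearker (y - z) \<partial>lborel) \<le> D"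
  shows "(\<integral>\<^sup>+y. g y * (\<integral>\<^sup>+z. nearker (y - z) * (q z)\<^sup>2 \<partial>lborel) \<partial>lborel) \<le> D * (\<integral>\<^sup>+z. (q z)\<^sup>2 \<partial>lborel)"
proof -
  have "(\<integral>\<^sup>+y. g y * (\<integral>\<^sup>+z. nearker (y - z) * (q z)\<^sup>2 \<partial>lborel) \<partial>lborel) = (\<integral>\<^sup>+y. \<integral>\<^sup>+z. g y * (nearker (y - z) * (q z)\<^sup>2) \<partial>lborel \<partial>lborel)"
    by (simp add: nn_integral_cmult)
  also have "\<dots> = (\<integral>\<^sup>+z. \<integral>\<^sup>+y. g y * (nearker (y - z) * (q z)\<^sup>2) \<partial>lborel \<partial>lborel)"
    by (rule lborel_pair.Fubini') measurable
  also have "\<dots> = (\<integral>\<^sup>+z. (\<integral>\<^sup>+y. g y * nearker (y - z) \<partial>lborel) * (q z)\<^sup>2 \<partial>lborel)"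
    by (simp add: mult.assoc[symmetric] nn_integral_multc)
  also have "\<dots> \<le> (\<integral>\<^sup>+z. D * (q z)\<^sup>2 \<partial>lborel)"
    by (intro nn_integral_mono mult_right_mono g) auto
  also have "\<dots> = D * (\<integral>\<^sup>+z. (q z)\<^sup>2 \<partial>lborel)" by (simp add: nn_integral_cmult)
  finally show ?thesis .
qed

text \<open>
  The potential of a square integrable function need not be square integrable; the weight
  \<open>rho powr (- 4)\<close> makes up for its slow decay. Finiteness almost everywhere and
  local integrability of the nonlinearity follow.
\<close>

lemma riesz_weighted:
  "\<exists>C<\<infinity>. \<forall>q\<in>borel_measurable borel.
       (\<integral>\<^sup>+y. ennreal (rho y powr (-4)) * (riesz q y)\<^sup>2 \<partial>lborel) \<le> C * (\<integral>\<^sup>+z. (q z)\<^sup>2 \<partial>lborel)"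
proof -
  obtain C where C: "C < \<infinity>" "\<And>q y. q \<in> borel_measurable borel \<Longrightarrow>
       (riesz q y)\<^sup>2 \<le> C * ((\<integral>\<^sup>+z. (q z)\<^sup>2 \<partial>lborel) + (\<integral>\<^sup>+z. nearker (y - z) * (q z)\<^sup>2 \<partial>lborel))"
    using riesz_bound by blast
  define R where "R = (\<integral>\<^sup>+y. ennreal (rho y powr (-4)) \<partial>lborel)"
  define K where "K = (\<integral>\<^sup>+x. nearker x \<partial>lborel)"
  show ?thesis
  proof (intro exI conjI ballI allI)
    show "C * (R + K) < \<infinity>"
      using C(1) nearker_finite(1) finite_rho_integral[of 4] unfolding R_def K_def by (simp add: ennreal_mult_less_top)
    fix q :: "real^3 \<Rightarrow> ennreal" assume [measurable]: "q \<in> borel_measurable borel"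
    let ?I = "\<integral>\<^sup>+z. (q z)\<^sup>2 \<partial>lborel" and ?J = "\<lambda>y. \<integral>\<^sup>+z. nearker (y - z) * (q z)\<^sup>2 \<partial>lborel"
    have "(\<integral>\<^sup>+y. ennreal (rho y powr (-4)) * (riesz q y)\<^sup>2 \<partial>lborel) \<le> (\<integral>\<^sup>+y. C * (ennreal (rho y powr (-4)) * ?I + ennreal (rho y powr (-4)) * ?J y) \<partial>lborel)"
    proof (rule nn_integral_mono)
      fix y
      show "ennreal (rho y powr (-4)) * (riesz q y)\<^sup>2 \<le> C * (ennreal (rho y powr (-4)) * ?I + ennreal (rho y powr (-4)) * ?J y)"
        using mult_left_mono[OF C(2)[of q y], of "ennreal (rho y powr (-4))"]
        by (simp add: distrib_left mult_ac)
    qed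
    also have "\<dots> = C * (R * ?I + (\<integral>\<^sup>+y. ennreal (rho y powr (-4)) * ?J y \<partial>lborel))"
      by (subst nn_integral_cmult, measurable) (subst nn_integral_add; simp add: nn_integral_multc R_def)
    also have "\<dots> \<le> C * (R * ?I + K * ?I)"
    proof (intro mult_left_mono add_left_mono nearker_convolution)
      fix z
      have "(\<integral>\<^sup>+y. ennreal (rho y powr (-4)) * nearker (y - z) \<partial>lborel) \<le> (\<integral>\<^sup>+y. 1 * nearker (y - z) \<partial>lborel)"
        by (intro nn_integral_mono mult_right_mono) (auto simp: powr_minus inverse_le_1_iff rho_powr_ge1)
      also have "\<dots> = K" using nn_integral_translate_reflect(2)[of nearker z] by (simp add: K_def)
      finally show "(\<integral>\<^sup>+y. ennreal (rho y powr (-4)) * nearker (y - z) \<partial>lborel) \<le> K" .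
    qed auto
    also have "\<dots> = C * (R + K) * ?I" by (simp add: distrib_right mult.assoc)
    finally show "(\<integral>\<^sup>+y. ennreal (rho y powr (-4)) * (riesz q y)\<^sup>2 \<partial>lborel) \<le> C * (R + K) * ?I" .
  qed
qed

lemma riesz_mult_weighted:
  "\<exists>C<\<infinity>. \<forall>p\<in>borel_measurable borel. \<forall>q\<in>borel_measurable borel.
       (\<integral>\<^sup>+y. ennreal (rho y powr (-2)) * (p y * riesz q y) \<partial>lborel)\<^sup>2 \<le> C * (\<integral>\<^sup>+z. (p z)\<^sup>2 \<partial>lborel) * (\<integral>\<^sup>+z. (q z)\<^sup>2 \<partial>lborel)"
proof -
  obtain C where C: "C < \<infinity>" "\<And>q. q \<in> borel_measurable borel \<Longrightarrow>
       (\<integral>\<^sup>+y. ennreal (rho y powr (-4)) * (riesz q y)\<^sup>2 \<partial>lborel) \<le> C * (\<integral>\<^sup>+z. (q z)\<^sup>2 \<partial>lborel)"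
    using riesz_weighted by blast
  show ?thesis
  proof (intro exI conjI ballI allI)
    show "C < \<infinity>" by fact
    fix p q :: "real^3 \<Rightarrow> ennreal" assume [measurable]: "p \<in> borel_measurable borel" "q \<in> borel_measurable borel"
    have "(\<integral>\<^sup>+y. ennreal (rho y powr (-2)) * (p y * riesz q y) \<partial>lborel)\<^sup>2 = (\<integral>\<^sup>+y. p y * (ennreal (rho y powr (-2)) * riesz q y) \<partial>lborel)\<^sup>2"
      by (simp add: mult_ac)
    also have "\<dots> \<le> (\<integral>\<^sup>+z. (p z)\<^sup>2 \<partial>lborel) * (\<integral>\<^sup>+y. (ennreal (rho y powr (-2)) * riesz q y)\<^sup>2 \<partial>lborel)"
      by (rule Cauchy_Schwarz_nn_integral) auto
    also have "\<dots> = (\<integral>\<^sup>+z. (p z)\<^sup>2 \<partial>lborel) * (\<integral>\<^sup>+y. ennreal (rho y powr (-4)) * (riesz q y)\<^sup>2 \<partial>lborel)"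
      by (simp add: power_mult_distrib ennreal_power powr_power)
    also have "\<dots> \<le> (\<integral>\<^sup>+z. (p z)\<^sup>2 \<partial>lborel) * (C * (\<integral>\<^sup>+z. (q z)\<^sup>2 \<partial>lborel))"
      by (intro mult_left_mono C) auto
    finally show "(\<integral>\<^sup>+y. ennreal (rho y powr (-2)) * (p y * riesz q y) \<partial>lborel)\<^sup>2 \<le> C * (\<integral>\<^sup>+z. (p z)\<^sup>2 \<partial>lborel) * (\<integral>\<^sup>+z. (q z)\<^sup>2 \<partial>lborel)"
      by (simp add: mult_ac)
  qed
qed

lemma riesz_finite_AE:
  assumes [measurable]: "q \<in> borel_measurable borel" and fin: "(\<integral>\<^sup>+z. (q z)\<^sup>2 \<partial>lborel) < \<infinity>"
  shows "AE y in lborel. riesz q y < \<infinity>"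
proof -
  obtain C where C: "C < \<infinity>" "\<And>q. q \<in> borel_measurable borel \<Longrightarrow>
       (\<integral>\<^sup>+y. ennreal (rho y powr (-4)) * (riesz q y)\<^sup>2 \<partial>lborel) \<le> C * (\<integral>\<^sup>+z. (q z)\<^sup>2 \<partial>lborel)"
    using riesz_weighted by blast
  have "(\<integral>\<^sup>+y. ennreal (rho y powr (-4)) * (riesz q y)\<^sup>2 \<partial>lborel) \<le> C * (\<integral>\<^sup>+z. (q z)\<^sup>2 \<partial>lborel)"
    by (rule C) simp
  also have "\<dots> < \<infinity>" using C(1) fin by (simp add: ennreal_mult_less_top)
  finally have "AE y in lborel. ennreal (rho y powr (-4)) * (riesz q y)\<^sup>2 \<noteq> \<infinity>"
    by (intro nn_integral_PInf_AE) auto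
  then show ?thesis
  proof eventually_elim
    case (elim y)
    have "riesz q y \<noteq> \<infinity>"
    proof
      assume "riesz q y = \<infinity>"
      then have "ennreal (rho y powr (-4)) * (riesz q y)\<^sup>2 = \<infinity>" by (simp add: ennreal_mult_top)
      with elim show False by simp
    qed
    then show ?case by (simp add: top.not_eq_extremum)
  qed
qed

section \<open>Kernel estimates in the weighted space\<close>

lemma wide_double: "0 < a \<Longrightarrow> (wide (2 * a) x)\<^sup>2 = wide a x"
  unfolding wide_def by (simp add: exp_double[symmetric] power2_eq_square exp_add[symmetric])

text \<open>
  A weighted Schur test. The Gaussian in the bound of \<open>H\<close> is split into two equal factors; by
  Cauchy-Schwarz one half goes with the weighted \<open>p\<close>, whose contribution integrates to
  \<open>wsq m p\<close> by Tonelli, and the other with \<open>l\<close> and \<open>g\<close>, where only the supremum \<open>S\<close> over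
  \<open>x\<close> remains. The linear estimates use \<open>g = 1\<close>, the bilinear one a Riesz potential.
\<close>

lemma kernel_estimate:
  fixes H :: "real^3 \<Rightarrow> real^3 \<Rightarrow> real"
  assumes [measurable]: "case_prod H \<in> borel_measurable (borel \<Otimes>\<^sub>M borel)"
      "p \<in> borel_measurable borel" "g \<in> borel_measurable borel" "l \<in> borel_measurable borel"
    and a: "0 < a" and A: "0 \<le> A" and l: "\<And>y. 0 \<le> l y"
    and H: "\<And>\<xi> y. rho \<xi> powr m * \<bar>H \<xi> y\<bar> \<le> A * wide a (\<xi> - \<epsilon> *\<^sub>R y) * (l y * rho y powr m)"
    and S: "\<And>\<xi>. (\<integral>\<^sup>+y. ennreal (wide a (\<xi> - \<epsilon> *\<^sub>R y)) * (ennreal ((l y)\<^sup>2) * (g y)\<^sup>2) \<partial>lborel) \<le> S"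
  shows "wsq m (\<lambda>\<xi>. \<integral>\<^sup>+y. ennreal \<bar>H \<xi> y\<bar> * (p y * g y) \<partial>lborel) \<le> ennreal (A\<^sup>2 * sqrt (16 * pi * a) ^ 3) * S * wsq m p"
proof -
  have [measurable]: "wide b \<in> borel_measurable borel" for b by simp
  have point: "(ennreal (rho \<xi> powr m) * (\<integral>\<^sup>+y. ennreal \<bar>H \<xi> y\<bar> * (p y * g y) \<partial>lborel))\<^sup>2
      \<le> ennreal (A\<^sup>2) * S * (\<integral>\<^sup>+y. ennreal (wide a (\<xi> - \<epsilon> *\<^sub>R y)) * (ennreal (rho y powr m) * p y)\<^sup>2 \<partial>lborel)" for \<xi>
  proof -
    define X where "X y = ennreal (wide (2 * a) (\<xi> - \<epsilon> *\<^sub>R y)) * (ennreal (rho y powr m) * p y)" for y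
    define Y where "Y y = ennreal (wide (2 * a) (\<xi> - \<epsilon> *\<^sub>R y)) * (ennreal (l y) * g y)" for y
    have [measurable]: "X \<in> borel_measurable borel" "Y \<in> borel_measurable borel"
      unfolding X_def Y_def by measurable
    have EEs: "(ennreal (wide (2 * a) x))\<^sup>2 = ennreal (wide a x)" for x
      using a by (simp add: ennreal_power wide_double)
    have "ennreal (rho \<xi> powr m) * (\<integral>\<^sup>+y. ennreal \<bar>H \<xi> y\<bar> * (p y * g y) \<partial>lborel)
        = (\<integral>\<^sup>+y. ennreal (rho \<xi> powr m * \<bar>H \<xi> y\<bar>) * (p y * g y) \<partial>lborel)"
      by (subst nn_integral_cmult[symmetric]) (auto simp: ennreal_mult mult.assoc)
    also have "\<dots> \<le> (\<integral>\<^sup>+y. ennreal (A * wide a (\<xi> - \<epsilon> *\<^sub>R y) * (l y * rho y powr m)) * (p y * g y) \<partial>lborel)"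
      by (intro nn_integral_mono mult_right_mono ennreal_leI H) auto
    also have "\<dots> = (\<integral>\<^sup>+y. ennreal A * (X y * Y y) \<partial>lborel)"
    proof (rule nn_integral_cong)
      fix y
      have "ennreal (A * wide a (\<xi> - \<epsilon> *\<^sub>R y) * (l y * rho y powr m)) = ennreal A * (ennreal (wide (2 * a) (\<xi> - \<epsilon> *\<^sub>R y)))\<^sup>2 * (ennreal (l y) * ennreal (rho y powr m))"
        unfolding EEs using A l by (simp add: ennreal_mult less_imp_le)
      then show "ennreal (A * wide a (\<xi> - \<epsilon> *\<^sub>R y) * (l y * rho y powr m)) * (p y * g y) = ennreal A * (X y * Y y)"
        unfolding X_def Y_def by (simp add: power2_eq_square mult_ac)
    qed
    also have "\<dots> = ennreal A * (\<integral>\<^sup>+y. X y * Y y \<partial>lborel)" by (simp add: nn_integral_cmult)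
    finally have "(ennreal (rho \<xi> powr m) * (\<integral>\<^sup>+y. ennreal \<bar>H \<xi> y\<bar> * (p y * g y) \<partial>lborel))\<^sup>2 \<le> (ennreal A * (\<integral>\<^sup>+y. X y * Y y \<partial>lborel))\<^sup>2"
      by (rule power_mono_ennreal)
    also have "\<dots> = ennreal (A\<^sup>2) * (\<integral>\<^sup>+y. X y * Y y \<partial>lborel)\<^sup>2" using A by (simp add: power_mult_distrib ennreal_power)
    also have "\<dots> \<le> ennreal (A\<^sup>2) * ((\<integral>\<^sup>+y. (X y)\<^sup>2 \<partial>lborel) * (\<integral>\<^sup>+y. (Y y)\<^sup>2 \<partial>lborel))"
      by (intro mult_left_mono Cauchy_Schwarz_nn_integral) auto
    also have "(\<integral>\<^sup>+y. (Y y)\<^sup>2 \<partial>lborel) = (\<integral>\<^sup>+y. ennreal (wide a (\<xi> - \<epsilon> *\<^sub>R y)) * (ennreal ((l y)\<^sup>2) * (g y)\<^sup>2) \<partial>lborel)"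
      unfolding Y_def using l by (simp add: power_mult_distrib EEs ennreal_power)
    also have "(\<integral>\<^sup>+y. (X y)\<^sup>2 \<partial>lborel) = (\<integral>\<^sup>+y. ennreal (wide a (\<xi> - \<epsilon> *\<^sub>R y)) * (ennreal (rho y powr m) * p y)\<^sup>2 \<partial>lborel)" (is "_ = ?X")
      unfolding X_def by (simp add: power_mult_distrib EEs)
    also have "ennreal (A\<^sup>2) * (?X * (\<integral>\<^sup>+y. ennreal (wide a (\<xi> - \<epsilon> *\<^sub>R y)) * (ennreal ((l y)\<^sup>2) * (g y)\<^sup>2) \<partial>lborel)) \<le> ennreal (A\<^sup>2) * (?X * S)"
      by (intro mult_left_mono S) auto
    finally show ?thesis by (simp add: mult_ac)
  qed
  have "wsq m (\<lambda>\<xi>. \<integral>\<^sup>+y. ennreal \<bar>H \<xi> y\<bar> * (p y * g y) \<partial>lborel) \<le> (\<integral>\<^sup>+\<xi>. ennreal (A\<^sup>2) * S * (\<integral>\<^sup>+y. ennreal (wide a (\<xi> - \<epsilon> *\<^sub>R y)) * (ennreal (rho y powr m) * p y)\<^sup>2 \<partial>lborel) \<partial>lborel)"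
    unfolding wsq_def by (intro nn_integral_mono point)
  also have "\<dots> = ennreal (A\<^sup>2) * S * (\<integral>\<^sup>+\<xi>. \<integral>\<^sup>+y. ennreal (wide a (\<xi> - \<epsilon> *\<^sub>R y)) * (ennreal (rho y powr m) * p y)\<^sup>2 \<partial>lborel \<partial>lborel)"
    by (rule nn_integral_cmult) measurable
  also have "(\<integral>\<^sup>+\<xi>. \<integral>\<^sup>+y. ennreal (wide a (\<xi> - \<epsilon> *\<^sub>R y)) * (ennreal (rho y powr m) * p y)\<^sup>2 \<partial>lborel \<partial>lborel)
      = (\<integral>\<^sup>+y. \<integral>\<^sup>+\<xi>. ennreal (wide a (\<xi> - \<epsilon> *\<^sub>R y)) * (ennreal (rho y powr m) * p y)\<^sup>2 \<partial>lborel \<partial>lborel)"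
    by (rule lborel_pair.Fubini') measurable
  also have "\<dots> = ennreal (sqrt (16 * pi * a) ^ 3) * wsq m p"
    unfolding wsq_def using a by (simp add: nn_integral_multc nn_integral_wide' nn_integral_cmult)
  finally show ?thesis using a by (simp add: ennreal_mult'' mult_ac)
qed

text \<open>
  The factor by which the self-similar change of variables contracts space during time \<open>t\<close>. The
  function \<open>htime\<close> below is the time at which the heat kernel has to be taken.
\<close>

definition shrink :: "real \<Rightarrow> real" where "shrink t = exp (- t / 2)"
definition htime :: "real \<Rightarrow> real" where "htime t = 1 - exp (- t)"

lemma shrink_pos [simp]: "0 < shrink t" and shrink_nz [simp]: "shrink t \<noteq> 0" and shrink_nonneg [simp]: "0 \<le> shrink t"
  by (auto simp: shrink_def)
lemma shrink_le1: "0 \<le> t \<Longrightarrow> shrink t \<le> 1" by (auto simp: shrink_def)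
lemma htime_pos [simp]: "0 < t \<Longrightarrow> 0 < htime t" and htime_le1 [simp]: "htime t \<le> 1" by (auto simp: htime_def)
lemma shrink_sq: "(shrink t)\<^sup>2 = 1 - htime t"
  by (simp add: shrink_def htime_def power2_eq_square exp_add[symmetric])
lemma shrink_powr: "shrink t powr r = exp (- r * t / 2)"
  by (simp add: shrink_def powr_def)

lemma ennreal_sq_le_imp_le:
  fixes x y :: ennreal
  assumes "x\<^sup>2 \<le> y\<^sup>2" shows "x \<le> y"
proof (cases x; cases y)
  fix r s :: real assume rs: "0 \<le> r" "x = ennreal r" "0 \<le> s" "y = ennreal s"
  then have "r\<^sup>2 \<le> s\<^sup>2" using assms by (simp add: ennreal_power)
  then have "r \<le> s" using rs(3) by (rule power2_le_imp_le)
  then show ?thesis using rs by (simp add: ennreal_leI)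
next
  fix s :: real assume "x = \<top>" "0 \<le> s" "y = ennreal s"
  then show ?thesis using assms by (simp add: ennreal_power top_power_ennreal top_unique)
qed simp_all

text \<open>
  What the weight gains under the contraction \<open>y \<mapsto> e y\<close>.
\<close>

definition wratio :: "real \<Rightarrow> real \<Rightarrow> real^3 \<Rightarrow> real" where
  "wratio m e y = (rho (e *\<^sub>R y) / rho y) powr m"

lemma wratio_measurable [measurable]: "wratio m e \<in> borel_measurable borel"
  unfolding wratio_def by measurable

lemma rho_scale_le: "0 \<le> e \<Longrightarrow> e \<le> 1 \<Longrightarrow> rho (e *\<^sub>R y) \<le> rho y"
  unfolding rho_def by (simp add: mult_left_le_one_le)

lemma wratio_nonneg [simp]: "0 \<le> wratio m e y" by (simp add: wratio_def)

lemma wratio_le1: "0 \<le> m \<Longrightarrow> 0 \<le> e \<Longrightarrow> e \<le> 1 \<Longrightarrow> wratio m e y \<le> 1"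
  unfolding wratio_def using powr_mono2[of m "rho (e *\<^sub>R y) / rho y" 1] rho_scale_le[of e y]
  by (simp add: divide_simps less_imp_le)

lemma wratio_rho: "wratio m e y * rho y powr m = rho (e *\<^sub>R y) powr m"
  unfolding wratio_def by (simp add: powr_divide less_imp_le)

text \<open>
  The source of all decay rates. Outside the ball of radius \<open>1 / e\<close> the square of the weight
  ratio is at most \<open>(2 * e) powr (2 * m)\<close>, and the Gaussian integrates to a multiple of
  \<open>e powr (- 3)\<close>; their product is below \<open>e powr r\<close> since \<open>3 < 2 * m - r\<close>. Inside the ball the ratio decays like
  \<open>rho powr (- m)\<close>; there the Gaussian is estimated by \<open>1\<close>, and the same condition on \<open>r\<close>
  makes the integral converge. A factor \<open>l\<close> that is smaller than the ratio inside the ball allows a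
  larger \<open>r\<close>.
\<close>

lemma weighted_gauss_integral:
  assumes m: "0 \<le> m" and r: "3 < 2 * m - r"
  shows "\<exists>C<\<infinity>. \<forall>e a x. \<forall>l\<in>borel_measurable borel.
     0 < e \<longrightarrow> e \<le> 1 \<longrightarrow> 0 < a \<longrightarrow> a \<le> 1 \<longrightarrow> (\<forall>y. 0 \<le> l y \<and> l y \<le> wratio m e y) \<longrightarrow>
     (\<forall>y. e * norm y < 1 \<longrightarrow> (l y)\<^sup>2 \<le> 4 * (e * rho y / 2) powr r * (wratio m e y)\<^sup>2) \<longrightarrow>
     (\<integral>\<^sup>+y. ennreal (wide a (x - e *\<^sub>R y)) * ennreal ((l y)\<^sup>2) \<partial>lborel) \<le> C * ennreal (e powr r)"
proof -
  define R where "R = (\<integral>\<^sup>+y. ennreal (rho y powr (-(2 * m - r))) \<partial>lborel)"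
  have R: "R < \<infinity>" unfolding R_def using r by (rule finite_rho_integral)
  define C where "C = ennreal (2 powr (2*m) * sqrt (16 * pi) ^ 3) + ennreal (4 * 2 powr (2*m) * (1/2) powr r) * R"
  show ?thesis
  proof (intro exI[of _ C] conjI allI ballI impI)
    show "C < \<infinity>" unfolding C_def using R by (simp add: ennreal_mult_less_top)
    fix e a :: real and x :: "real^3" and l :: "real^3 \<Rightarrow> real"
    assume [measurable]: "l \<in> borel_measurable borel" and e: "0 < e" "e \<le> 1" and a: "0 < a" "a \<le> 1"
      and l: "\<forall>y. 0 \<le> l y \<and> l y \<le> wratio m e y"
      and l2: "\<forall>y. e * norm y < 1 \<longrightarrow> (l y)\<^sup>2 \<le> 4 * (e * rho y / 2) powr r * (wratio m e y)\<^sup>2"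
    let ?E = "\<lambda>y. ennreal (wide a (x - e *\<^sub>R y))"
    have pt: "?E y * ennreal ((l y)\<^sup>2) \<le> ennreal ((2 * e) powr (2*m)) * ?E y
        + ennreal (4 * 2 powr (2*m) * (1/2) powr r * e powr r) * ennreal (rho y powr (-(2 * m - r)))" for y
    proof (cases "e * norm y < 1")
      case False
      then have "rho (e *\<^sub>R y) / rho y \<le> 2 * e"
        using e by (simp add: rho_def divide_simps algebra_simps add_pos_nonneg)
      then have "wratio m e y \<le> (2 * e) powr m"
        unfolding wratio_def using m by (intro powr_mono2) (auto simp: less_imp_le)
      then have "(l y)\<^sup>2 \<le> ((2 * e) powr m)\<^sup>2"
        using l by (intro power_mono) (auto intro: order_trans)
      also have "\<dots> = (2 * e) powr (2*m)" using e by (simp add: powr_power mult.commute)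
      finally have "?E y * ennreal ((l y)\<^sup>2) \<le> ?E y * ennreal ((2 * e) powr (2*m))"
        by (intro mult_left_mono ennreal_leI) auto
      then show ?thesis by (simp add: mult.commute add_increasing2)
    next
      case True
      then have "rho (e *\<^sub>R y) \<le> 2" using e by (simp add: rho_def)
      then have "wratio m e y \<le> (2 / rho y) powr m"
        unfolding wratio_def using m by (intro powr_mono2 divide_right_mono) (auto simp: less_imp_le)
      then have "(wratio m e y)\<^sup>2 \<le> ((2 / rho y) powr m)\<^sup>2" by (intro power_mono) auto
      also have "\<dots> = 2 powr (2*m) * rho y powr (-(2*m))"
      proof -
        have "((2 / rho y) powr m)\<^sup>2 = (2 / rho y) powr (2 * m)" by (simp add: powr_power mult.commute)
        also have "\<dots> = 2 powr (2*m) / rho y powr (2*m)" by (rule powr_divide)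
        finally show ?thesis by (simp add: powr_minus divide_inverse)
      qed
      finally have "(l y)\<^sup>2 \<le> 4 * (e * rho y / 2) powr r * (2 powr (2*m) * rho y powr (-(2*m)))"
        by (intro order_trans[OF l2[rule_format, OF True]] mult_left_mono) auto
      also have "(e * rho y / 2) powr r = e powr r * rho y powr r * (1/2) powr r"
        using e by (simp add: powr_mult less_imp_le powr_divide)
      also have "4 * (e powr r * rho y powr r * (1/2) powr r) * (2 powr (2*m) * rho y powr (-(2*m)))
         = (4 * 2 powr (2*m) * (1/2) powr r * e powr r) * (rho y powr r * rho y powr (-(2*m)))" by (simp add: mult_ac)
      also have "rho y powr r * rho y powr (-(2*m)) = rho y powr (-(2 * m - r))"
        by (simp add: powr_add[symmetric])
      finally have "wide a (x - e *\<^sub>R y) * (l y)\<^sup>2 \<le> 1 * ((4 * 2 powr (2*m) * (1/2) powr r * e powr r) * rho y powr (-(2 * m - r)))"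
        using wide_le1[OF a(1)] by (intro mult_mono) auto
      then have "?E y * ennreal ((l y)\<^sup>2) \<le> ennreal (4 * 2 powr (2*m) * (1/2) powr r * e powr r) * ennreal (rho y powr (-(2 * m - r)))"
        by (simp add: ennreal_mult[symmetric] ennreal_leI)
      then show ?thesis by (simp add: add_increasing)
    qed
    have "(\<integral>\<^sup>+y. ?E y * ennreal ((l y)\<^sup>2) \<partial>lborel) \<le> (\<integral>\<^sup>+y. ennreal ((2 * e) powr (2*m)) * ?E y
        + ennreal (4 * 2 powr (2*m) * (1/2) powr r * e powr r) * ennreal (rho y powr (-(2 * m - r))) \<partial>lborel)"
      by (intro nn_integral_mono pt)
    also have "\<dots> = ennreal ((2 * e) powr (2*m)) * ennreal ((sqrt (16 * pi * a) / \<bar>e\<bar>) ^ 3)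
        + ennreal (4 * 2 powr (2*m) * (1/2) powr r * e powr r) * R"
      using a e by (subst nn_integral_add; simp add: nn_integral_cmult nn_integral_wide R_def)
    also have "\<dots> \<le> ennreal (2 powr (2*m) * sqrt (16 * pi) ^ 3) * ennreal (e powr r) + ennreal (4 * 2 powr (2*m) * (1/2) powr r) * ennreal (e powr r) * R"
    proof (rule add_mono)
      have "(2 * e) powr (2*m) * (sqrt (16 * pi * a) / \<bar>e\<bar>) ^ 3 \<le> 2 powr (2*m) * e powr (2*m) * (sqrt (16 * pi) / e) ^ 3"
        using e a by (intro mult_mono power_mono) (auto simp: powr_mult intro!: divide_right_mono)
      also have "\<dots> = 2 powr (2*m) * sqrt (16 * pi) ^ 3 * (e powr (2*m) / e ^ 3)" by (simp add: power_divide)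
      also have "e powr (2*m) / e ^ 3 = e powr (2*m - 3)"
        using e by (simp add: powr_diff powr_numeral)
      also have "2 powr (2*m) * sqrt (16 * pi) ^ 3 * e powr (2*m - 3) \<le> 2 powr (2*m) * sqrt (16 * pi) ^ 3 * e powr r"
        using e r by (intro mult_left_mono powr_mono') auto
      finally show "ennreal ((2 * e) powr (2*m)) * ennreal ((sqrt (16 * pi * a) / \<bar>e\<bar>) ^ 3) \<le> ennreal (2 powr (2*m) * sqrt (16 * pi) ^ 3) * ennreal (e powr r)"
        using e a by (simp add: ennreal_mult[symmetric] ennreal_leI)
    qed (simp add: ennreal_mult)
    also have "\<dots> = C * ennreal (e powr r)" unfolding C_def by (simp add: distrib_right distrib_left mult_ac)
    finally show "(\<integral>\<^sup>+y. ?E y * ennreal ((l y)\<^sup>2) \<partial>lborel) \<le> C * ennreal (e powr r)" .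
  qed
qed

lemma shrink_ge_half:
  assumes "htime t < 1/2"
  shows "1 / 2 \<le> shrink t"
proof -
  have "(1/2)\<^sup>2 \<le> (shrink t)\<^sup>2" using assms unfolding shrink_sq by (simp add: power2_eq_square)
  then show ?thesis by (rule power2_le_imp_le) simp
qed

lemma half_le_powr: "1/2 \<le> (a::real) \<Longrightarrow> 1 \<le> 2 * a powr (3/4)"
proof -
  assume a: "1/2 \<le> a"
  have "(1/2) powr 1 \<le> (1/2::real) powr (3/4)" by (rule powr_mono') auto
  also have "\<dots> \<le> a powr (3/4)" using a by (intro powr_mono2) auto
  finally show ?thesis by simp
qed

lemma sqrt_cube: "0 \<le> a \<Longrightarrow> sqrt a ^ 3 = a powr (3/2)"
proof -
  assume a: "0 \<le> a"
  then have "sqrt a ^ 3 = (a powr (1/2)) powr 3" by (simp add: powr_numeral powr_half_sqrt)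
  then show ?thesis by (simp add: powr_powr)
qed

text \<open>
  For \<open>htime\<close> above \<open>1/2\<close> the integral of \<open>nearker\<close> alone suffices. For small times
  Cauchy-Schwarz uses that the Gaussian is then concentrated on the scale \<open>sqrt (htime t)\<close>, whose
  cube has the square root \<open>htime t powr (3/4)\<close>.
\<close>

lemma gauss_nearker_integral:
  "\<exists>C<\<infinity>. \<forall>(t::real) \<xi> \<zeta>. 0 < t \<longrightarrow> (\<integral>\<^sup>+y. ennreal (wide (htime t) (\<xi> - shrink t *\<^sub>R y)) * nearker (y - \<zeta>) \<partial>lborel) \<le> C * ennreal (htime t powr (3/4))"
proof -
  define K where "K = (\<integral>\<^sup>+x. nearker x \<partial>lborel)"
  obtain k where k: "0 \<le> k" "(\<integral>\<^sup>+x. (nearker x)\<^sup>2 \<partial>lborel) = ennreal k"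
    using nearker_finite(2) by (cases "(\<integral>\<^sup>+x. (nearker x)\<^sup>2 \<partial>lborel)") auto
  define D where "D = sqrt ((2 * sqrt (16 * pi)) ^ 3 * k)"
  have D: "0 \<le> D" "D\<^sup>2 = (2 * sqrt (16 * pi)) ^ 3 * k" unfolding D_def using k by auto
  show ?thesis
  proof (intro exI[of _ "2 * K + ennreal D"] conjI allI impI)
    show "2 * K + ennreal D < \<infinity>" using nearker_finite(1) by (simp add: K_def ennreal_mult_less_top)
    fix t :: real and \<xi> \<zeta> :: "real^3" assume t: "0 < t"
    let ?E = "\<lambda>y. ennreal (wide (htime t) (\<xi> - shrink t *\<^sub>R y))"
    let ?I = "\<integral>\<^sup>+y. ?E y * nearker (y - \<zeta>) \<partial>lborel"
    have E1: "?E y \<le> 1" for y using wide_le1[of "htime t"] t by simp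
    consider "1/2 \<le> htime t" | "htime t < 1/2" by linarith
    then show "?I \<le> (2 * K + ennreal D) * ennreal (htime t powr (3/4))"
    proof cases
      case 1
      have "?I \<le> (\<integral>\<^sup>+y. 1 * nearker (y - \<zeta>) \<partial>lborel)" by (intro nn_integral_mono mult_right_mono E1) simp
      also have "\<dots> = K" using nn_integral_translate_reflect(2)[of nearker \<zeta>] by (simp add: K_def)
      also have "\<dots> = K * ennreal 1" by simp
      also have "\<dots> \<le> K * ennreal (2 * htime t powr (3/4))" using half_le_powr[OF 1] by (intro mult_left_mono ennreal_leI) auto
      also have "\<dots> = 2 * K * ennreal (htime t powr (3/4))" by (simp add: ennreal_mult mult_ac)
      also have "\<dots> \<le> (2 * K + ennreal D) * ennreal (htime t powr (3/4))" by (intro mult_right_mono) auto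
      finally show ?thesis .
    next
      case 2
      have "?I\<^sup>2 \<le> (\<integral>\<^sup>+y. (?E y)\<^sup>2 \<partial>lborel) * (\<integral>\<^sup>+y. (nearker (y - \<zeta>))\<^sup>2 \<partial>lborel)"
        by (rule Cauchy_Schwarz_nn_integral) auto
      also have "(\<integral>\<^sup>+y. (nearker (y - \<zeta>))\<^sup>2 \<partial>lborel) = ennreal k"
        using nn_integral_translate_reflect(2)[of "\<lambda>x. (nearker x)\<^sup>2" \<zeta>] k by simp
      also have "(\<integral>\<^sup>+y. (?E y)\<^sup>2 \<partial>lborel) \<le> (\<integral>\<^sup>+y. ?E y \<partial>lborel)"
      proof (rule nn_integral_mono)
        fix y show "(?E y)\<^sup>2 \<le> ?E y" using mult_left_mono[OF E1[of y], of "?E y"] by (simp add: power2_eq_square)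
      qed
      also have "\<dots> = ennreal ((sqrt (16 * pi * htime t) / shrink t) ^ 3)"
        using t by (simp add: nn_integral_wide)
      also have "\<dots> \<le> ennreal ((2 * sqrt (16 * pi) * sqrt (htime t)) ^ 3)"
      proof (intro ennreal_leI power_mono)
        have "sqrt (16 * pi * htime t) / shrink t \<le> sqrt (16 * pi * htime t) / (1/2)"
          using shrink_ge_half[OF 2] t by (intro divide_left_mono) (auto simp: less_imp_le[OF htime_pos])
        then show "sqrt (16 * pi * htime t) / shrink t \<le> 2 * sqrt (16 * pi) * sqrt (htime t)"
          by (simp add: real_sqrt_mult)
      qed (use t in \<open>auto simp: less_imp_le[OF htime_pos]\<close>)
      also have "ennreal ((2 * sqrt (16 * pi) * sqrt (htime t)) ^ 3) * ennreal k = (ennreal (D * htime t powr (3/4)))\<^sup>2"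
      proof -
        have "sqrt (htime t) ^ 3 = (htime t powr (3/4))\<^sup>2"
          using powr_power[of "htime t" "3/4" 2] htime_pos[OF t] sqrt_cube[of "htime t"] by simp
        then have "(2 * sqrt (16 * pi) * sqrt (htime t)) ^ 3 * k = (D * htime t powr (3/4))\<^sup>2"
          by (simp add: power_mult_distrib D(2))
        then show ?thesis using k D t by (simp add: ennreal_power ennreal_mult'' [symmetric])
      qed
      finally have "?I \<le> ennreal (D * htime t powr (3/4))"
        by (simp add: ennreal_sq_le_imp_le mult_right_mono)
      also have "\<dots> = ennreal D * ennreal (htime t powr (3/4))" using D by (simp add: ennreal_mult)
      also have "\<dots> \<le> (2 * K + ennreal D) * ennreal (htime t powr (3/4))" by (intro mult_right_mono) auto
      finally show ?thesis .
    qed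
  qed
qed

lemma shrink_rho_le: "0 \<le> e \<Longrightarrow> e \<le> 1 \<Longrightarrow> e * norm y < 1 \<Longrightarrow> e * rho y / 2 \<le> 1"
  unfolding rho_def by (simp add: algebra_simps)

text \<open>
  The exponent \<open>4 * \<mu> - 4\<close> combines with the four powers of \<open>shrink\<close> in the square of the
  kernel of the Duhamel term to give the square of \<open>exp (- \<mu> * s)\<close>.
\<close>

lemma gauss_wratio_integral:
  assumes \<mu>: "0 < \<mu>" "\<mu> \<le> 1" "2 * \<mu> + 1/2 < m"
  shows "\<exists>C<\<infinity>. \<forall>(s::real) x. 0 < s \<longrightarrow> (\<integral>\<^sup>+y. ennreal (wide (htime s) (x - shrink s *\<^sub>R y)) * ennreal ((wratio m (shrink s) y)\<^sup>2) \<partial>lborel)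
     \<le> C * ennreal (htime s powr (3/4) * shrink s powr (4 * \<mu> - 4))"
proof -
  obtain C where C: "C < \<infinity>" "\<And>e a x l. l\<in>borel_measurable borel \<Longrightarrow>
     0 < e \<Longrightarrow> e \<le> 1 \<Longrightarrow> 0 < a \<Longrightarrow> a \<le> 1 \<Longrightarrow> (\<forall>y. 0 \<le> l y \<and> l y \<le> wratio m e y) \<Longrightarrow>
     (\<forall>y. e * norm y < 1 \<longrightarrow> (l y)\<^sup>2 \<le> 4 * (e * rho y / 2) powr (4 * \<mu> - 4) * (wratio m e y)\<^sup>2) \<Longrightarrow>
     (\<integral>\<^sup>+y. ennreal (wide a (x - e *\<^sub>R y)) * ennreal ((l y)\<^sup>2) \<partial>lborel) \<le> C * ennreal (e powr (4 * \<mu> - 4))"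
    using weighted_gauss_integral[of m "4 * \<mu> - 4"] \<mu> by auto
  define D where "D = (2 * sqrt (16 * pi)) ^ 3"
  have D: "0 \<le> D" unfolding D_def by simp
  show ?thesis
  proof (intro exI[of _ "2 * C + ennreal D"] conjI allI impI)
    show "2 * C + ennreal D < \<infinity>" using C(1) by (simp add: ennreal_mult_less_top)
    fix s :: real and x :: "real^3" assume s: "0 < s"
    let ?E = "\<lambda>y. ennreal (wide (htime s) (x - shrink s *\<^sub>R y))"
    let ?I = "\<integral>\<^sup>+y. ?E y * ennreal ((wratio m (shrink s) y)\<^sup>2) \<partial>lborel"
    let ?r = "shrink s powr (4 * \<mu> - 4)"
    have r1: "1 \<le> t powr (4 * \<mu> - 4)" if "0 < t" "t \<le> 1" for t :: real
      using powr_mono'[of "4 * \<mu> - 4" 0 t] that \<mu> by simp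
    have e1: "shrink s \<le> 1" using s by (simp add: shrink_le1)
    consider "1/2 \<le> htime s" | "htime s < 1/2" by linarith
    then show "?I \<le> (2 * C + ennreal D) * ennreal (htime s powr (3/4) * ?r)"
    proof cases
      case 1
      have "?I \<le> C * ennreal ?r"
      proof (rule C(2))
        show "\<forall>y. shrink s * norm y < 1 \<longrightarrow> (wratio m (shrink s) y)\<^sup>2 \<le> 4 * (shrink s * rho y / 2) powr (4 * \<mu> - 4) * (wratio m (shrink s) y)\<^sup>2"
        proof (intro allI impI)
          fix y :: "real^3" assume "shrink s * norm y < 1"
          then have "1 \<le> (shrink s * rho y / 2) powr (4 * \<mu> - 4)"
            using e1 by (intro r1 shrink_rho_le) auto
          then have "1 * (wratio m (shrink s) y)\<^sup>2 \<le> 4 * (shrink s * rho y / 2) powr (4 * \<mu> - 4) * (wratio m (shrink s) y)\<^sup>2"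
            by (intro mult_right_mono) auto
          then show "(wratio m (shrink s) y)\<^sup>2 \<le> 4 * (shrink s * rho y / 2) powr (4 * \<mu> - 4) * (wratio m (shrink s) y)\<^sup>2" by simp
        qed
      qed (use s e1 in auto)
      also have "\<dots> = C * ennreal (1 * ?r)" by simp
      also have "\<dots> \<le> C * ennreal ((2 * htime s powr (3/4)) * ?r)"
        using half_le_powr[OF 1] by (intro mult_left_mono ennreal_leI mult_right_mono) auto
      also have "\<dots> = 2 * C * ennreal (htime s powr (3/4) * ?r)" by (simp add: ennreal_mult mult_ac)
      also have "\<dots> \<le> (2 * C + ennreal D) * ennreal (htime s powr (3/4) * ?r)" by (intro mult_right_mono) auto
      finally show ?thesis .
    next
      case 2
      have "?I \<le> (\<integral>\<^sup>+y. ?E y * 1 \<partial>lborel)"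
        using wratio_le1[of m "shrink s"] e1 \<mu> by (intro nn_integral_mono mult_left_mono) (auto simp: power_le_one)
      also have "\<dots> = ennreal ((sqrt (16 * pi * htime s) / shrink s) ^ 3)"
        using s by (simp add: nn_integral_wide)
      also have "\<dots> \<le> ennreal ((2 * sqrt (16 * pi) * sqrt (htime s)) ^ 3)"
      proof (intro ennreal_leI power_mono)
        have "sqrt (16 * pi * htime s) / shrink s \<le> sqrt (16 * pi * htime s) / (1/2)"
          using shrink_ge_half[OF 2] s by (intro divide_left_mono) (auto simp: less_imp_le[OF htime_pos])
        then show "sqrt (16 * pi * htime s) / shrink s \<le> 2 * sqrt (16 * pi) * sqrt (htime s)"
          by (simp add: real_sqrt_mult)
      qed (use s in \<open>auto simp: less_imp_le[OF htime_pos]\<close>)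
      also have "\<dots> \<le> ennreal (D * (htime s powr (3/4) * ?r))"
      proof (rule ennreal_leI)
        have "sqrt (htime s) ^ 3 = htime s powr (3/2)"
          using s by (simp add: sqrt_cube less_imp_le[OF htime_pos])
        also have "\<dots> \<le> htime s powr (3/4)" using s by (intro powr_mono') (auto simp: less_imp_le[OF htime_pos])
        also have "\<dots> \<le> htime s powr (3/4) * ?r" using r1[of "shrink s"] e1 mult_left_mono[of 1 ?r "htime s powr (3/4)"] by simp
        finally show "(2 * sqrt (16 * pi) * sqrt (htime s)) ^ 3 \<le> D * (htime s powr (3/4) * ?r)"
          unfolding power_mult_distrib[of "2 * sqrt (16 * pi)"] D_def by (rule mult_left_mono) simp
      qed
      also have "\<dots> = ennreal D * ennreal (htime s powr (3/4) * ?r)" using D by (simp add: ennreal_mult)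
      also have "\<dots> \<le> (2 * C + ennreal D) * ennreal (htime s powr (3/4) * ?r)" by (intro mult_right_mono) auto
      finally show ?thesis .
    qed
  qed
qed

text \<open>
  The kernel of the \<open>j\<close>-th derivative of \<open>expL_half\<close>, with absolute values inside the integral.
\<close>

definition heatD_op :: "3 \<Rightarrow> real \<Rightarrow> (real^3 \<Rightarrow> ennreal) \<Rightarrow> real^3 \<Rightarrow> ennreal" where
  "heatD_op j t u x = (\<integral>\<^sup>+y. ennreal \<bar>(shrink t)\<^sup>2 * heatD (htime t) j (x - shrink t *\<^sub>R y)\<bar> * u y \<partial>lborel)"

lemma heatD_op_measurable [measurable]:
  assumes [measurable]: "u \<in> borel_measurable borel"
  shows "heatD_op j t u \<in> borel_measurable borel"
  unfolding heatD_op_def by measurable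

lemma rho_powr_le_wratio: "0 \<le> m \<Longrightarrow> rho x powr m \<le> rho (x - e *\<^sub>R y) powr m * (wratio m e y * rho y powr m)"
  unfolding wratio_rho by (rule rho_powr_le_diff)

text \<open>
  By \<open>riesz_bound\<close> the square of the potential consists of a constant, for which the gain of weight
  gives the decay, and of a convolution with \<open>nearker\<close>, for which the integral of the Gaussian
  against \<open>nearker\<close> is bounded directly. The kernel contributes \<open>htime powr (- 2)\<close>, hence the
  total time singularity \<open>- 4 + 3/2 + 3/4 = 2 * (- 7/8)\<close> for the squares.
\<close>

theorem bilinear_kernel_estimate:
  assumes \<mu>: "0 < \<mu>" "\<mu> \<le> 1" "2 * \<mu> + 1/2 < m"
  shows "\<exists>C<\<infinity>. \<forall>j t. \<forall>p\<in>borel_measurable borel. \<forall>q\<in>borel_measurable borel. 0 < t \<longrightarrow>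
     wsq m (heatD_op j t (\<lambda>y. p y * riesz q y)) \<le> C * ennreal ((exp (- \<mu> * t) * htime t powr (-(7/8)))\<^sup>2) * wsq m p * (\<integral>\<^sup>+y. (q y)\<^sup>2 \<partial>lborel)"
proof -
  obtain C1 where C1: "C1 < \<infinity>" "\<And>q y. q \<in> borel_measurable borel \<Longrightarrow>
       (riesz q y)\<^sup>2 \<le> C1 * ((\<integral>\<^sup>+z. (q z)\<^sup>2 \<partial>lborel) + (\<integral>\<^sup>+z. nearker (y - z) * (q z)\<^sup>2 \<partial>lborel))"
    using riesz_bound by blast
  obtain C2 where C2: "C2 < \<infinity>" "\<And>t x \<zeta>. 0 < t \<Longrightarrow> (\<integral>\<^sup>+y. ennreal (wide (htime t) (x - shrink t *\<^sub>R y)) * nearker (y - \<zeta>) \<partial>lborel) \<le> C2 * ennreal (htime t powr (3/4))"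
    using gauss_nearker_integral by blast
  obtain C3 where C3: "C3 < \<infinity>" "\<And>t x. 0 < t \<Longrightarrow> (\<integral>\<^sup>+y. ennreal (wide (htime t) (x - shrink t *\<^sub>R y)) * ennreal ((wratio m (shrink t) y)\<^sup>2) \<partial>lborel)
     \<le> C3 * ennreal (htime t powr (3/4) * shrink t powr (4 * \<mu> - 4))"
    using gauss_wratio_integral[OF assms] by blast
  define A where "A = exp (4 * m\<^sup>2 + 4)"
  define D where "D = ennreal (A\<^sup>2 * sqrt (16 * pi) ^ 3)"
  have m: "0 \<le> m" using \<mu> by simp
  show ?thesis
  proof (intro exI[of _ "D * (C1 * (C3 + C2))"] conjI allI ballI impI)
    show "D * (C1 * (C3 + C2)) < \<infinity>" using C1(1) C2(1) C3(1) by (simp add: D_def ennreal_mult_less_top)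
    fix j and t :: real and p q :: "real^3 \<Rightarrow> ennreal"
    assume [measurable]: "p \<in> borel_measurable borel" "q \<in> borel_measurable borel" and t: "0 < t"
    let ?e = "shrink t" and ?a = "htime t"
    let ?E = "\<lambda>x y. ennreal (wide ?a (x - ?e *\<^sub>R y))"
    let ?q = "\<integral>\<^sup>+y. (q y)\<^sup>2 \<partial>lborel" and ?s = "?a powr (3/4) * ?e powr (4 * \<mu> - 4)"
    have e1: "?e \<le> 1" using t by (simp add: shrink_le1)
    have wratio2: "ennreal ((wratio m ?e y)\<^sup>2) \<le> 1" for y using wratio_le1[of m ?e y] e1 m by (simp add: power_le_one)
    have S: "(\<integral>\<^sup>+y. ?E x y * (ennreal ((wratio m ?e y)\<^sup>2) * (riesz q y)\<^sup>2) \<partial>lborel) \<le> C1 * (C3 + C2) * ennreal ?s * ?q" for x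
    proof -
      let ?J = "\<lambda>y. \<integral>\<^sup>+z. nearker (y - z) * (q z)\<^sup>2 \<partial>lborel"
      have "?E x y * (ennreal ((wratio m ?e y)\<^sup>2) * (riesz q y)\<^sup>2) \<le> C1 * (?E x y * ennreal ((wratio m ?e y)\<^sup>2) * ?q + ?E x y * ?J y)" for y
      proof -
        have "?E x y * (ennreal ((wratio m ?e y)\<^sup>2) * (riesz q y)\<^sup>2) \<le> ?E x y * (ennreal ((wratio m ?e y)\<^sup>2) * (C1 * (?q + ?J y)))"
          by (intro mult_left_mono C1) auto
        also have "\<dots> = C1 * (?E x y * ennreal ((wratio m ?e y)\<^sup>2) * ?q + ennreal ((wratio m ?e y)\<^sup>2) * (?E x y * ?J y))" by (simp add: distrib_left mult_ac)
        also have "\<dots> \<le> C1 * (?E x y * ennreal ((wratio m ?e y)\<^sup>2) * ?q + 1 * (?E x y * ?J y))"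
          by (intro mult_left_mono add_left_mono mult_right_mono wratio2) auto
        finally show ?thesis by simp
      qed
      then have "(\<integral>\<^sup>+y. ?E x y * (ennreal ((wratio m ?e y)\<^sup>2) * (riesz q y)\<^sup>2) \<partial>lborel) \<le> (\<integral>\<^sup>+y. C1 * (?E x y * ennreal ((wratio m ?e y)\<^sup>2) * ?q + ?E x y * ?J y) \<partial>lborel)"
        by (intro nn_integral_mono)
      also have "\<dots> = C1 * ((\<integral>\<^sup>+y. ?E x y * ennreal ((wratio m ?e y)\<^sup>2) \<partial>lborel) * ?q + (\<integral>\<^sup>+y. ?E x y * ?J y \<partial>lborel))"
        by (subst nn_integral_cmult, measurable) (subst nn_integral_add; simp add: nn_integral_multc)
      also have "\<dots> \<le> C1 * (C3 * ennreal ?s * ?q + C2 * ennreal (?a powr (3/4)) * ?q)"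
        using t by (intro mult_left_mono add_mono mult_right_mono C3 nearker_convolution C2) auto
      also have "\<dots> \<le> C1 * (C3 * ennreal ?s * ?q + C2 * ennreal ?s * ?q)"
      proof (intro mult_left_mono add_left_mono mult_right_mono ennreal_leI)
        have "1 \<le> ?e powr (4 * \<mu> - 4)" using powr_mono'[of "4 * \<mu> - 4" 0 ?e] e1 \<mu> by simp
        then show "?a powr (3/4) \<le> ?s" using mult_left_mono[of 1 "?e powr (4 * \<mu> - 4)" "?a powr (3/4)"] by simp
      qed auto
      also have "\<dots> = C1 * (C3 + C2) * ennreal ?s * ?q" by (simp add: distrib_right distrib_left mult_ac)
      finally show ?thesis .
    qed
    have "wsq m (heatD_op j t (\<lambda>y. p y * riesz q y)) \<le> ennreal ((A * (?e\<^sup>2 * ?a powr (-2)))\<^sup>2 * sqrt (16 * pi * ?a) ^ 3) * (C1 * (C3 + C2) * ennreal ?s * ?q) * wsq m p"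
      unfolding heatD_op_def
    proof (rule kernel_estimate[where l="wratio m ?e" and \<epsilon>="?e"])
      show "(\<integral>\<^sup>+ y. ennreal (wide (htime t) (x - ?e *\<^sub>R y)) * (ennreal ((wratio m ?e y)\<^sup>2) * (riesz q y)\<^sup>2) \<partial>lborel) \<le> C1 * (C3 + C2) * ennreal ?s * ?q" for x
        by (rule S)
      show "rho x powr m * \<bar>?e\<^sup>2 * heatD ?a j (x - ?e *\<^sub>R y)\<bar> \<le> A * (?e\<^sup>2 * ?a powr (-2)) * wide ?a (x - ?e *\<^sub>R y) * (wratio m ?e y * rho y powr m)" for x y
      proof -
        have "rho x powr m * \<bar>?e\<^sup>2 * heatD ?a j (x - ?e *\<^sub>R y)\<bar> \<le> (rho (x - ?e *\<^sub>R y) powr m * (wratio m ?e y * rho y powr m)) * \<bar>?e\<^sup>2 * heatD ?a j (x - ?e *\<^sub>R y)\<bar>"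
          by (intro mult_right_mono rho_powr_le_wratio m) auto
        also have "\<dots> = ?e\<^sup>2 * (wratio m ?e y * rho y powr m) * (rho (x - ?e *\<^sub>R y) powr m * \<bar>heatD ?a j (x - ?e *\<^sub>R y)\<bar>)"
          by (simp add: abs_mult mult_ac)
        also have "\<dots> \<le> ?e\<^sup>2 * (wratio m ?e y * rho y powr m) * (A * ?a powr (-2) * wide ?a (x - ?e *\<^sub>R y))"
          unfolding A_def using t m by (intro mult_left_mono rho_heatD_le) auto
        finally show ?thesis by (simp add: mult_ac)
      qed
    qed (use t in \<open>auto simp: A_def\<close>)
    also have "\<dots> = ennreal ((A * (?e\<^sup>2 * ?a powr (-2)))\<^sup>2 * sqrt (16 * pi * ?a) ^ 3) * ennreal ?s * (C1 * (C3 + C2)) * wsq m p * ?q"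
      by (simp only: mult_ac)
    also have "ennreal ((A * (?e\<^sup>2 * ?a powr (-2)))\<^sup>2 * sqrt (16 * pi * ?a) ^ 3) * ennreal ?s = D * ennreal ((exp (- \<mu> * t) * ?a powr (-(7/8)))\<^sup>2)"
    proof -
      have a: "0 < ?a" using t by simp
      have "?e\<^sup>2 = ?e powr 2" by (simp add: powr_numeral)
      then have "(A * (?e\<^sup>2 * ?a powr (-2)))\<^sup>2 = A\<^sup>2 * ?e powr 4 * ?a powr (-4)"
        using a by (simp add: power_mult_distrib powr_power less_imp_neq[symmetric])
      moreover have "sqrt (16 * pi * ?a) ^ 3 = sqrt (16 * pi) ^ 3 * ?a powr (3/2)"
        using a by (simp add: real_sqrt_mult power_mult_distrib sqrt_cube less_imp_le)
      ultimately have "(A * (?e\<^sup>2 * ?a powr (-2)))\<^sup>2 * sqrt (16 * pi * ?a) ^ 3 * ?s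
         = A\<^sup>2 * sqrt (16 * pi) ^ 3 * (?e powr 4 * ?e powr (4 * \<mu> - 4)) * (?a powr (-4) * ?a powr (3/2) * ?a powr (3/4))"
        by (simp add: mult_ac)
      also have "?e powr 4 * ?e powr (4 * \<mu> - 4) = (exp (- \<mu> * t))\<^sup>2"
        by (simp add: powr_add[symmetric] shrink_powr power2_eq_square exp_add[symmetric] field_simps)
      also have "?a powr (-4) * ?a powr (3/2) * ?a powr (3/4) = (?a powr (-(7/8)))\<^sup>2"
        using a by (simp add: powr_add[symmetric] powr_power)
      finally have "(A * (?e\<^sup>2 * ?a powr (-2)))\<^sup>2 * sqrt (16 * pi * ?a) ^ 3 * ?s = (A\<^sup>2 * sqrt (16 * pi) ^ 3) * (exp (- \<mu> * t) * ?a powr (-(7/8)))\<^sup>2"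
        by (simp add: power_mult_distrib mult_ac)
      then show ?thesis unfolding D_def by (simp add: ennreal_mult''[symmetric])
    qed
    finally show "wsq m (heatD_op j t (\<lambda>y. p y * riesz q y)) \<le> D * (C1 * (C3 + C2)) * ennreal ((exp (- \<mu> * t) * ?a powr (-(7/8)))\<^sup>2) * wsq m p * ?q"
      by (simp only: mult_ac)
  qed
qed

section \<open>Smooth functions and cutoffs\<close>

lemma partial_eq:
  assumes "(f has_derivative f') (at x)"
  shows "partial j f x = f' (axis j 1)"
proof -
  interpret bounded_linear f' using assms by (rule has_derivative_bounded_linear)
  have "((\<lambda>t. x + t *\<^sub>R axis j 1) has_derivative (\<lambda>t. t *\<^sub>R axis j 1)) (at 0)"
    by (auto intro!: derivative_eq_intros)
  moreover have "(f has_derivative f') (at (x + 0 *\<^sub>R axis j 1))" using assms by simp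
  ultimately have "((\<lambda>t. f (x + t *\<^sub>R axis j 1)) has_derivative (\<lambda>t. f' (t *\<^sub>R axis j 1))) (at 0)"
    by (rule has_derivative_compose)
  then have "((\<lambda>t. f (x + t *\<^sub>R axis j 1)) has_field_derivative f' (axis j 1)) (at 0)"
    unfolding has_field_derivative_def by (simp add: scaleR mult.commute[of _ "f' _"])
  then show ?thesis unfolding partial_def by (rule DERIV_imp_deriv)
qed

lemma Ck_differentiable: "Ck (Suc k) f \<Longrightarrow> f differentiable (at x)"
  by (simp add: differentiable_on_def)

lemma Ck_SucI:
  assumes "\<And>x. (f has_derivative f' x) (at x)" "\<And>j. Ck k (\<lambda>x. f' x (axis j 1))"
  shows "Ck (Suc k) f"
proof -
  have "partial j f = (\<lambda>x. f' x (axis j 1))" for j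
    using partial_eq[OF assms(1)] by (simp add: fun_eq_iff)
  moreover have "f differentiable_on UNIV"
    using assms(1) unfolding differentiable_on_def differentiable_def by auto
  ultimately show ?thesis using assms(2) by simp
qed

lemma Ck_SucD: "Ck (Suc k) f \<Longrightarrow> Ck k f"
proof (induction k arbitrary: f)
  case 0
  then show ?case by (simp add: differentiable_imp_continuous_on)
qed simp

lemma Ck_const: "Ck k (\<lambda>x. c)"
proof (induction k arbitrary: c)
  case (Suc k)
  show ?case by (rule Ck_SucI[where f'="\<lambda>x h. 0"]) (auto intro: Suc)
qed (simp add: continuous_on_const)

lemma Ck_nth: "Ck k (\<lambda>x. x $ i)"
proof (cases k)
  case (Suc n)
  show ?thesis unfolding Suc
    by (rule Ck_SucI[where f'="\<lambda>x h. h $ i"]) (auto intro: Ck_const bounded_linear_imp_has_derivative bounded_linear_vec_nth)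
qed (simp add: continuous_on_component)

lemma partial_rule:
  assumes "f differentiable (at x)" "g differentiable (at x)"
  shows "partial j (\<lambda>x. f x + g x) x = partial j f x + partial j g x"
    and "partial j (\<lambda>x. f x * g x) x = f x * partial j g x + partial j f x * g x"
proof -
  obtain f' g' where *: "(f has_derivative f') (at x)" "(g has_derivative g') (at x)"
    using assms by (auto simp: differentiable_def)
  show "partial j (\<lambda>x. f x + g x) x = partial j f x + partial j g x"
    using partial_eq[OF has_derivative_add[OF *]] partial_eq[OF *(1)] partial_eq[OF *(2)] by simp
  show "partial j (\<lambda>x. f x * g x) x = f x * partial j g x + partial j f x * g x"
    using partial_eq[OF has_derivative_mult[OF *]] partial_eq[OF *(1)] partial_eq[OF *(2)] by simp
qed

lemma Ck_add: "Ck k f \<Longrightarrow> Ck k g \<Longrightarrow> Ck k (\<lambda>x. f x + g x)"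
proof (induction k arbitrary: f g)
  case (Suc k)
  have "partial j (\<lambda>x. f x + g x) = (\<lambda>x. partial j f x + partial j g x)" for j
    using partial_rule(1)[OF Ck_differentiable[OF Suc.prems(1)] Ck_differentiable[OF Suc.prems(2)]] by (simp add: fun_eq_iff)
  then show ?case using Suc by (auto intro: differentiable_on_add)
qed (auto intro: continuous_on_add)

lemma Ck_mult: "Ck k f \<Longrightarrow> Ck k g \<Longrightarrow> Ck k (\<lambda>x. f x * g x)"
proof (induction k arbitrary: f g)
  case (Suc k)
  have "partial j (\<lambda>x. f x * g x) = (\<lambda>x. f x * partial j g x + partial j f x * g x)" for j
    using partial_rule(2)[OF Ck_differentiable[OF Suc.prems(1)] Ck_differentiable[OF Suc.prems(2)]] by (simp add: fun_eq_iff)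
  moreover have "Ck k f" "Ck k g" using Suc.prems Ck_SucD by blast+
  ultimately show ?case using Suc by (auto intro: differentiable_on_mult Ck_add)
qed (auto intro: continuous_on_mult)

text \<open>
  Stated for a whole sequence \<open>h\<close> of successive derivatives, so that the induction over the order of
  differentiability goes through; the two instances are \<open>exp\<close> and the flat function below.
\<close>

lemma Ck_compose:
  assumes h: "\<And>n x. (h n has_real_derivative h (Suc n) x) (at x)"
    and q: "\<And>k. Ck k q"
  shows "Ck k (\<lambda>x. h n (q x))"
proof (induction k arbitrary: n)
  case 0
  have "continuous_on UNIV (h n)"
    using h by (meson DERIV_isCont continuous_at_imp_continuous_on)
  moreover have "continuous_on UNIV q" using q[of 0] by simp
  ultimately show ?case by (auto intro: continuous_on_compose2)
next
  case (Suc k)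
  have d: "((\<lambda>x. h n (q x)) has_derivative (\<lambda>t. h (Suc n) (q x) * q' t)) (at x)"
    if "(q has_derivative q') (at x)" for x q'
    using has_derivative_compose[OF that, of "h n" "(*) (h (Suc n) (q x))"] h[of n "q x"]
    by (simp add: has_field_derivative_def)
  have "\<exists>q'. (q has_derivative q') (at x)" for x
    using Ck_differentiable[OF q] by (auto simp: differentiable_def)
  then obtain q' where q': "\<And>x. (q has_derivative q' x) (at x)" by metis
  have "Ck k (\<lambda>x. q' x (axis j 1))" for j
  proof -
    have "partial j q = (\<lambda>x. q' x (axis j 1))" using partial_eq[OF q'] by (simp add: fun_eq_iff)
    then show ?thesis using q[of "Suc k"] by (metis Ck.simps(2))
  qed
  then show ?case
    by (intro Ck_SucI[where f'="\<lambda>x t. h (Suc n) (q x) * q' x t"] d q' Ck_mult Suc)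
qed

lemma Ck_sum: "(\<And>i. i \<in> A \<Longrightarrow> Ck k (f i)) \<Longrightarrow> Ck k (\<lambda>x. \<Sum>i\<in>A. f i x)"
proof (induction A rule: infinite_finite_induct)
  case (insert x F)
  then show ?case using Ck_add[of k "f x" "\<lambda>y. \<Sum>i\<in>F. f i y"] by simp
qed (simp_all add: Ck_const)

lemma Ck_power2: "Ck k f \<Longrightarrow> Ck k (\<lambda>x. (f x)\<^sup>2)"
  unfolding power2_eq_square by (rule Ck_mult)

lemma norm_sq_cart: "(norm (x::real^3))\<^sup>2 = (\<Sum>i\<in>UNIV. (x $ i)\<^sup>2)"
  unfolding power2_norm_eq_inner inner_vec_def by (simp add: power2_eq_square)

lemma Ck_norm_affine_sq: "Ck k (\<lambda>y. (norm (x + c *\<^sub>R y))\<^sup>2)"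
  unfolding norm_sq_cart by (auto intro!: Ck_sum Ck_power2 Ck_add Ck_mult Ck_const Ck_nth)

lemma poly_exp_tendsto_0: "((\<lambda>t. t ^ k * poly p t * exp (- t)) \<longlongrightarrow> 0) (at_top::real filter)"
proof (induction p arbitrary: k)
  case (pCons a p)
  have "((\<lambda>t. a * (t ^ k / exp t) + t ^ Suc k * poly p t * exp (- t)) \<longlongrightarrow> a * 0 + 0) (at_top::real filter)"
    by (intro tendsto_intros pCons tendsto_power_div_exp_0)
  then show ?case by (simp add: algebra_simps exp_minus divide_inverse)
qed simp

text \<open>
  The polynomials in \<open>1 / x\<close> that occur in the derivatives of \<open>exp (- (1 / x))\<close>.
\<close>

primrec flat_poly :: "nat \<Rightarrow> real poly" where
  "flat_poly 0 = 1"
| "flat_poly (Suc n) = [:0, 0, 1:] * (flat_poly n - pderiv (flat_poly n))"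

text \<open>
  The \<open>n\<close>-th derivative of the function that is \<open>exp (- (1 / x))\<close> for positive \<open>x\<close> and \<open>0\<close>
  otherwise.
\<close>

definition flat :: "nat \<Rightarrow> real \<Rightarrow> real" where
  "flat n x = (if 0 < x then poly (flat_poly n) (1 / x) * exp (- (1 / x)) else 0)"

lemma flat_deriv: "(flat n has_real_derivative flat (Suc n) x) (at x)"
proof -
  consider "x < 0" | "x = 0" | "0 < x" by linarith
  then show ?thesis
  proof cases
    case 1
    have "((\<lambda>_. 0) has_real_derivative 0) (at x)" by simp
    moreover have "\<forall>\<^sub>F y in nhds x. flat n y = 0"
      using order_tendstoD(2)[OF tendsto_ident_at 1, of UNIV] eventually_nhds_in_open[of "{..<0}" x] 1
      by (auto elim!: eventually_mono simp: flat_def)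
    ultimately show ?thesis using 1 DERIV_cong_ev[of x x "flat n" "\<lambda>_. 0" 0 0] by (simp add: flat_def)
  next
    case 3
    have "((\<lambda>x. poly (flat_poly n) (1 / x) * exp (- (1 / x))) has_real_derivative
        (poly (flat_poly n) (1/x) * (exp (- (1/x)) * (1 / x\<^sup>2)) + poly (pderiv (flat_poly n)) (1/x) * (- 1 / x\<^sup>2) * exp (- (1/x)))) (at x)"
      using 3 by (auto intro!: derivative_eq_intros poly_DERIV[THEN DERIV_chain2] simp: power2_eq_square)
    moreover have "(poly (flat_poly n) (1/x) * (exp (- (1/x)) * (1 / x\<^sup>2)) + poly (pderiv (flat_poly n)) (1/x) * (- 1 / x\<^sup>2) * exp (- (1/x))) = flat (Suc n) x"
      using 3 by (simp add: flat_def power2_eq_square field_simps)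
    moreover have "\<forall>\<^sub>F y in nhds x. poly (flat_poly n) (1 / y) * exp (- (1 / y)) = flat n y"
      using eventually_nhds_in_open[of "{0<..}" x] 3 by (auto elim!: eventually_mono simp: flat_def)
    ultimately show ?thesis using DERIV_cong_ev by fastforce
  next
    case 2
    have "((\<lambda>h. flat n h / h) \<longlongrightarrow> 0) (at 0)"
    proof (rule filterlim_split_at)
      show "((\<lambda>h. flat n h / h) \<longlongrightarrow> 0) (at_left 0)"
        by (rule tendsto_eventually) (auto simp: eventually_at_filter flat_def)
      have "((\<lambda>h. (inverse h) ^ 1 * poly (flat_poly n) (inverse h) * exp (- (inverse h))) \<longlongrightarrow> 0) (at_right 0)"
        using filterlim_compose[OF poly_exp_tendsto_0[of 1 "flat_poly n"] filterlim_inverse_at_top_right] .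
      moreover have "\<forall>\<^sub>F h in at_right 0. (inverse h) ^ 1 * poly (flat_poly n) (inverse h) * exp (- (inverse h)) = flat n h / h"
        by (auto simp: eventually_at_filter flat_def field_simps)
      ultimately show "((\<lambda>h. flat n h / h) \<longlongrightarrow> 0) (at_right 0)"
        by (rule Lim_transform_eventually)
    qed
    then show ?thesis using 2 by (simp add: has_field_derivative_iff flat_def)
  qed
qed

text \<open>
  A smooth function with value \<open>1\<close> at the origin that vanishes outside the unit ball. It is not
  constant near the origin; the quadratic error in \<open>bump_Lipschitz\<close> takes the place of that.
\<close>

definition bump :: "real^3 \<Rightarrow> real" where
  "bump y = exp 1 * flat 0 (1 - (norm y)\<^sup>2)"

definition dbump :: "3 \<Rightarrow> real^3 \<Rightarrow> real" where
  "dbump j y = - 2 * (y $ j) * exp 1 * flat 1 (1 - (norm y)\<^sup>2)"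

lemma bump_Ck: "Ck k (\<lambda>y. bump (c *\<^sub>R y))"
proof -
  have "\<And>k. Ck k (\<lambda>y. 1 + (- 1) * (norm (0 + c *\<^sub>R y))\<^sup>2)"
    by (rule Ck_add[OF Ck_const Ck_mult[OF Ck_const Ck_norm_affine_sq]])
  from Ck_mult[OF Ck_const Ck_compose[where h=flat and n=0, OF flat_deriv this]]
  have "Ck k (\<lambda>y. exp 1 * flat 0 (1 + (- 1) * (norm (0 + c *\<^sub>R y))\<^sup>2))" .
  then show ?thesis unfolding bump_def by simp
qed

lemma bump_derivative:
  "((\<lambda>y. bump (c *\<^sub>R y)) has_derivative (\<lambda>h. \<Sum>j\<in>UNIV. c * dbump j (c *\<^sub>R y) * h $ j)) (at y)"
proof -
  have "((\<lambda>y. 1 - (norm (c *\<^sub>R y))\<^sup>2) has_derivative (\<lambda>h. - (2 * c\<^sup>2 * (y \<bullet> h)))) (at y)"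
    unfolding power2_norm_eq_inner
    by (auto intro!: derivative_eq_intros simp: inner_commute power2_eq_square)
  moreover have "(flat 0 has_derivative (*) (flat 1 s)) (at s)" for s
    using flat_deriv[of 0 s] by (simp add: has_field_derivative_def)
  ultimately have "((\<lambda>y. flat 0 (1 - (norm (c *\<^sub>R y))\<^sup>2)) has_derivative (\<lambda>h. flat 1 (1 - (norm (c *\<^sub>R y))\<^sup>2) * (- (2 * c\<^sup>2 * (y \<bullet> h))))) (at y)"
    by (rule has_derivative_compose)
  then have "((\<lambda>y. exp 1 * flat 0 (1 - (norm (c *\<^sub>R y))\<^sup>2)) has_derivative (\<lambda>h. exp 1 * (flat 1 (1 - (norm (c *\<^sub>R y))\<^sup>2) * (- (2 * c\<^sup>2 * (y \<bullet> h)))))) (at y)"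
    by (rule has_derivative_mult_right)
  moreover have "exp 1 * (flat 1 (1 - (norm (c *\<^sub>R y))\<^sup>2) * (- (2 * c\<^sup>2 * (y \<bullet> h)))) = (\<Sum>j\<in>UNIV. c * dbump j (c *\<^sub>R y) * h $ j)" for h
    unfolding inner_vec_def dbump_def by (simp add: sum_distrib_left sum_negf[symmetric] power2_eq_square mult_ac)
  ultimately show ?thesis unfolding bump_def by simp
qed

lemma bump_partial: "partial j (\<lambda>y. bump (c *\<^sub>R y)) y = c * dbump j (c *\<^sub>R y)"
  by (subst partial_eq[OF bump_derivative]) (simp add: axis_def if_distrib cong: if_cong)

lemma bump_0 [simp]: "bump 0 = 1"
  by (simp add: bump_def flat_def exp_add[symmetric])

lemma bump_eq_0: "1 \<le> norm y \<Longrightarrow> bump y = 0"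
  unfolding bump_def flat_def using one_le_power[of "norm y" 2] by (subst if_not_P) linarith+

lemma bump_bounds: "0 \<le> bump y" "bump y \<le> 1"
proof -
  show "0 \<le> bump y" by (simp add: bump_def flat_def)
  show "bump y \<le> 1"
  proof (cases "0 < 1 - (norm y)\<^sup>2")
    case True
    then have "1 \<le> 1 / (1 - (norm y)\<^sup>2)" by simp
    then show ?thesis using True by (simp add: bump_def flat_def exp_add[symmetric] del: le_divide_eq_1_pos)
  qed (simp add: bump_def flat_def)
qed

lemma flat1_bounded: obtains L where "0 < L" "\<And>s. s \<le> 1 \<Longrightarrow> \<bar>flat 1 s\<bar> \<le> L"
proof -
  have "continuous_on {0..1} (flat 1)"
    using flat_deriv by (meson DERIV_isCont continuous_at_imp_continuous_on)
  then have "bounded (flat 1 ` {0..1})" by (intro compact_imp_bounded compact_continuous_image) auto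
  then obtain L where L: "0 < L" "\<And>s. s \<in> {0..1} \<Longrightarrow> \<bar>flat 1 s\<bar> \<le> L"
    unfolding bounded_pos by auto
  then have "\<bar>flat 1 s\<bar> \<le> L" if "s \<le> 1" for s
    using that L by (cases "0 \<le> s") (auto simp: flat_def)
  then show ?thesis using that L by blast
qed

lemma bump_Lipschitz: obtains L where "0 < L" "\<And>y. \<bar>1 - bump y\<bar> \<le> L * (norm y)\<^sup>2" "\<And>j y. \<bar>dbump j y\<bar> \<le> L * norm y"
proof -
  obtain L where L: "0 < L" "\<And>s. s \<le> 1 \<Longrightarrow> \<bar>flat 1 s\<bar> \<le> L" by (rule flat1_bounded) blast
  have "\<bar>1 - bump y\<bar> \<le> 2 * exp 1 * L * (norm y)\<^sup>2" for y
  proof (cases "y = 0")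
    case False
    then have "1 - (norm y)\<^sup>2 < 1" by simp
    from MVT2[OF this, of "flat 0" "flat 1"] flat_deriv[of 0]
    obtain z where z: "1 - (norm y)\<^sup>2 < z" "z < 1" "flat 0 1 - flat 0 (1 - (norm y)\<^sup>2) = (norm y)\<^sup>2 * flat 1 z"
      by auto
    have "1 - bump y = exp 1 * (flat 0 1 - flat 0 (1 - (norm y)\<^sup>2))"
      by (simp add: bump_def algebra_simps) (simp add: flat_def exp_add[symmetric])
    also have "\<dots> = exp 1 * (norm y)\<^sup>2 * flat 1 z" using z(3) by simp
    finally have "\<bar>1 - bump y\<bar> = exp 1 * (norm y)\<^sup>2 * \<bar>flat 1 z\<bar>" by (simp add: abs_mult)
    also have "\<dots> \<le> exp 1 * (norm y)\<^sup>2 * L" using L(2)[of z] z by (intro mult_left_mono) auto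
    also have "\<dots> \<le> 2 * exp 1 * L * (norm y)\<^sup>2" using L by simp
    finally show ?thesis .
  qed simp
  moreover have "\<bar>dbump j y\<bar> \<le> 2 * exp 1 * L * norm y" for j y
  proof -
    have "\<bar>dbump j y\<bar> = 2 * exp 1 * (\<bar>flat 1 (1 - (norm y)\<^sup>2)\<bar> * \<bar>y $ j\<bar>)" by (simp add: dbump_def abs_mult)
    also have "\<dots> \<le> 2 * exp 1 * (L * norm y)"
      using L by (intro mult_left_mono mult_mono L component_le_norm_cart) auto
    finally show ?thesis by simp
  qed
  ultimately show ?thesis using L that[of "2 * exp 1 * L"] by simp
qed

lemma dbump_eq_0: "1 \<le> norm y \<Longrightarrow> dbump j y = 0"
  unfolding dbump_def flat_def using one_le_power[of "norm y" 2] by (subst if_not_P) (linarith, simp)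

lemma bump_measurable [measurable]: "bump \<in> borel_measurable borel" "dbump j \<in> borel_measurable borel"
proof -
  have "continuous_on UNIV (flat n)" for n
    using flat_deriv by (meson DERIV_isCont continuous_at_imp_continuous_on)
  then have [measurable]: "flat n \<in> borel_measurable borel" for n by (rule borel_measurable_continuous_onI)
  show "bump \<in> borel_measurable borel" "dbump j \<in> borel_measurable borel"
    unfolding bump_def dbump_def by measurable
qed

lemma test_function_cutoff:
  assumes "\<And>k. Ck k f" "0 < c"
  shows "test_function (\<lambda>y. f y * bump (c *\<^sub>R y))"
proof -
  have "{y. f y * bump (c *\<^sub>R y) \<noteq> 0} \<subseteq> cball 0 (1 / c)"
  proof
    fix y assume "y \<in> {y. f y * bump (c *\<^sub>R y) \<noteq> 0}"
    then have "norm (c *\<^sub>R y) < 1" using bump_eq_0[of "c *\<^sub>R y"] by force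
    then show "y \<in> cball 0 (1 / c)" using assms(2) by (simp add: field_simps)
  qed
  then have "bounded {y. f y * bump (c *\<^sub>R y) \<noteq> 0}" using bounded_cball bounded_subset by blast
  then show ?thesis unfolding test_function_def using assms(1) by (auto intro: Ck_mult bump_Ck)
qed

lemma partial_cutoff:
  assumes "Ck (Suc k) f"
  shows "partial j (\<lambda>y. f y * bump (c *\<^sub>R y)) y = f y * (c * dbump j (c *\<^sub>R y)) + partial j f y * bump (c *\<^sub>R y)"
  using partial_rule(2)[OF Ck_differentiable[OF assms] Ck_differentiable[OF bump_Ck]] by (simp add: bump_partial)

lemma heat_derivative:
  "((\<lambda>x. heat a x) has_derivative (\<lambda>h. \<Sum>j\<in>UNIV. heatD a j x * h $ j)) (at x)"
proof -
  have "((\<lambda>x. - (norm x)\<^sup>2 / (4 * a)) has_derivative (\<lambda>h. - (2 * (x \<bullet> h)) / (4 * a))) (at x)"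
  proof -
    have "((\<lambda>x. (-1 / (4 * a)) * (x \<bullet> x)) has_derivative (\<lambda>h. (-1 / (4 * a)) * (x \<bullet> h + h \<bullet> x))) (at x)"
      by (intro has_derivative_mult_right has_derivative_inner has_derivative_ident)
    then show ?thesis unfolding power2_norm_eq_inner by (simp add: inner_commute)
  qed
  from has_derivative_exp[OF this]
  have "((\<lambda>x. exp (- (norm x)\<^sup>2 / (4 * a)) * inverse ((4 * pi * a) powr (3/2))) has_derivative (\<lambda>h. exp (- (norm x)\<^sup>2 / (4 * a)) * (- (2 * (x \<bullet> h)) / (4 * a)) * inverse ((4 * pi * a) powr (3/2)))) (at x)"
    by (intro has_derivative_mult_left) (simp add: mult.commute)
  moreover have "exp (- (norm x)\<^sup>2 / (4 * a)) * (- (2 * (x \<bullet> h)) / (4 * a)) * inverse ((4 * pi * a) powr (3/2)) = (\<Sum>j\<in>UNIV. heatD a j x * h $ j)" for h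
  proof -
    have "(\<Sum>j\<in>UNIV. heatD a j x * h $ j) = (- 1 / (2 * a)) * heat a x * (x \<bullet> h)"
      unfolding inner_vec_def heatD_def sum_distrib_left inner_real_def by (rule sum.cong) (simp_all only: mult_ac minus_divide_left[symmetric] mult_minus_left mult_minus_right times_divide_eq_left times_divide_eq_right mult_1_left mult_1_right)
    then show ?thesis by (simp add: heat_def divide_inverse[of _ "_ powr _"])
  qed
  moreover have "heat a = (\<lambda>x. exp (- (norm x)\<^sup>2 / (4 * a)) * inverse ((4 * pi * a) powr (3/2)))"
    by (simp add: heat_def fun_eq_iff divide_inverse[of _ "_ powr _"])
  ultimately show ?thesis by simp
qed

lemma heat_Ck: "Ck k (\<lambda>y. heat a (x - c *\<^sub>R y))"
proof -
  have "\<And>k. Ck k (\<lambda>y. (- 1 / (4 * a)) * (norm (x + (- c) *\<^sub>R y))\<^sup>2)"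
    by (rule Ck_mult[OF Ck_const Ck_norm_affine_sq])
  from Ck_mult[OF Ck_const Ck_compose[where h="\<lambda>_. exp" and n=0, OF DERIV_exp this]]
  have "Ck k (\<lambda>y. inverse ((4 * pi * a) powr (3/2)) * exp ((- 1 / (4 * a)) * (norm (x + (- c) *\<^sub>R y))\<^sup>2))" .
  moreover have "heat a (x - c *\<^sub>R y) = inverse ((4 * pi * a) powr (3/2)) * exp ((- 1 / (4 * a)) * (norm (x + (- c) *\<^sub>R y))\<^sup>2)" for y
    by (simp add: heat_def divide_inverse[of _ "_ powr _"])
  ultimately show ?thesis by simp
qed

lemma heat_partial: "partial j (\<lambda>y. heat a (x - c *\<^sub>R y)) y = - c * heatD a j (x - c *\<^sub>R y)"
proof -
  have "((\<lambda>y. x - c *\<^sub>R y) has_derivative (\<lambda>h. - (c *\<^sub>R h))) (at y)"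
    by (auto intro!: derivative_eq_intros)
  from has_derivative_compose[OF this heat_derivative]
  show ?thesis by (subst partial_eq, assumption) (simp add: axis_def if_distrib sum_negf cong: if_cong)
qed

section \<open>The weighted norm\<close>

abbreviation wsqn :: "real \<Rightarrow> (real^3 \<Rightarrow> 'b::real_normed_vector) \<Rightarrow> ennreal" where
  "wsqn m f \<equiv> wsq m (\<lambda>x. ennreal (norm (f x)))"

lemma L2w_measurable: "f \<in> L2w m \<Longrightarrow> f \<in> borel_measurable borel"
  by (simp add: L2w_def)

lemma wsqn_eq: "wsqn m f = (\<integral>\<^sup>+x. ennreal ((rho x powr m * norm (f x))\<^sup>2) \<partial>lborel)"
  unfolding wsq_def by (simp add: ennreal_mult[symmetric] ennreal_power)

lemma wnorm_nonneg [simp]: "0 \<le> wnorm m f"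
  by (simp add: wnorm_def)

lemma wsqn_wnorm:
  assumes "f \<in> L2w m"
  shows "wsqn m f = ennreal ((wnorm m f)\<^sup>2)"
  using assms unfolding wsqn_eq wnorm_def L2w_def by (subst nn_integral_eq_integral) auto

lemma L2wI:
  assumes "f \<in> borel_measurable borel" "wsqn m f < \<infinity>"
  shows "f \<in> L2w m"
  using assms unfolding wsqn_eq L2w_def by (auto intro!: integrableI_nonneg)

lemma wnorm_leI:
  assumes "f \<in> borel_measurable borel" "wsqn m f \<le> ennreal (c\<^sup>2)" "0 \<le> c"
  shows "f \<in> L2w m" "wnorm m f \<le> c"
proof -
  show "f \<in> L2w m" using assms by (intro L2wI) (auto intro: le_less_trans)
  from wsqn_wnorm[OF this] have "(wnorm m f)\<^sup>2 \<le> c\<^sup>2" using assms(2) by simp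
  then show "wnorm m f \<le> c" using assms(3) by (rule power2_le_imp_le)
qed

lemma wsqn_cong_AE: "AE x in lborel. f x = g x \<Longrightarrow> wsqn m f = wsqn m g"
  by (intro antisym wsq_mono_AE) (auto elim!: eventually_mono)

lemma wnorm_cong_AE:
  assumes "AE x in lborel. f x = g x" "f \<in> L2w m" "g \<in> borel_measurable borel"
  shows "g \<in> L2w m" "wnorm m g = wnorm m f"
proof -
  have *: "wsqn m g = ennreal ((wnorm m f)\<^sup>2)" using wsqn_cong_AE[OF assms(1)] wsqn_wnorm[OF assms(2)] by simp
  show g: "g \<in> L2w m" using assms(3) * by (intro L2wI) auto
  show "wnorm m g = wnorm m f" using wsqn_wnorm[OF g] * by simp
qed

lemma wsqn_triangle:
  fixes f g :: "real^3 \<Rightarrow> 'b::euclidean_space"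
  assumes "f \<in> L2w m" "g \<in> L2w m"
  shows "wsqn m (\<lambda>x. f x + g x) \<le> ennreal ((wnorm m f + wnorm m g)\<^sup>2)"
proof -
  have [measurable]: "f \<in> borel_measurable borel" "g \<in> borel_measurable borel"
    using assms by (auto intro: L2w_measurable)
  define F where "F x = ennreal (rho x powr m) * ennreal (norm (f x))" for x
  define G where "G x = ennreal (rho x powr m) * ennreal (norm (g x))" for x
  have [measurable]: "F \<in> borel_measurable borel" "G \<in> borel_measurable borel" unfolding F_def G_def by measurable
  have F: "(\<integral>\<^sup>+x. (F x)\<^sup>2 \<partial>lborel) = ennreal ((wnorm m f)\<^sup>2)" and G: "(\<integral>\<^sup>+x. (G x)\<^sup>2 \<partial>lborel) = ennreal ((wnorm m g)\<^sup>2)"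
    using wsqn_wnorm[OF assms(1)] wsqn_wnorm[OF assms(2)] unfolding wsq_def F_def G_def by auto
  have "(\<integral>\<^sup>+x. F x * G x \<partial>lborel)\<^sup>2 \<le> ennreal ((wnorm m f)\<^sup>2) * ennreal ((wnorm m g)\<^sup>2)"
    unfolding F[symmetric] G[symmetric] by (rule Cauchy_Schwarz_nn_integral) auto
  also have "\<dots> = (ennreal (wnorm m f * wnorm m g))\<^sup>2" by (simp add: ennreal_power ennreal_mult[symmetric] power_mult_distrib)
  finally have FG: "(\<integral>\<^sup>+x. F x * G x \<partial>lborel) \<le> ennreal (wnorm m f * wnorm m g)" by (rule ennreal_sq_le_imp_le)
  have "wsqn m (\<lambda>x. f x + g x) \<le> (\<integral>\<^sup>+x. (F x)\<^sup>2 + (2 * (F x * G x) + (G x)\<^sup>2) \<partial>lborel)"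
    unfolding wsq_def
  proof (rule nn_integral_mono)
    fix x
    have "ennreal (rho x powr m) * ennreal (norm (f x + g x)) \<le> F x + G x"
      unfolding F_def G_def distrib_left[symmetric]
      by (intro mult_left_mono) (auto simp flip: ennreal_plus intro!: ennreal_leI norm_triangle_ineq)
    then have "(ennreal (rho x powr m) * ennreal (norm (f x + g x)))\<^sup>2 \<le> (F x + G x)\<^sup>2" by (rule power_mono_ennreal)
    also have "\<dots> = (F x)\<^sup>2 + (2 * (F x * G x) + (G x)\<^sup>2)"
      by (simp add: power2_sum ac_simps)
    finally show "(ennreal (rho x powr m) * ennreal (norm (f x + g x)))\<^sup>2 \<le> (F x)\<^sup>2 + (2 * (F x * G x) + (G x)\<^sup>2)" .
  qed
  also have "\<dots> = (\<integral>\<^sup>+x. (F x)\<^sup>2 \<partial>lborel) + (2 * (\<integral>\<^sup>+x. F x * G x \<partial>lborel) + (\<integral>\<^sup>+x. (G x)\<^sup>2 \<partial>lborel))"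
    by (subst nn_integral_add, measurable) (subst nn_integral_add; simp add: nn_integral_cmult)
  also have "\<dots> \<le> ennreal ((wnorm m f)\<^sup>2) + (2 * ennreal (wnorm m f * wnorm m g) + ennreal ((wnorm m g)\<^sup>2))"
    unfolding F G by (intro add_mono mult_left_mono FG) auto
  also have "\<dots> = ennreal ((wnorm m f + wnorm m g)\<^sup>2)"
    by (simp add: power2_sum ennreal_plus ennreal_mult ac_simps)
  finally show ?thesis .
qed

lemma L2w_add:
  fixes f g :: "real^3 \<Rightarrow> 'b::euclidean_space"
  assumes "f \<in> L2w m" "g \<in> L2w m"
  shows "(\<lambda>x. f x + g x) \<in> L2w m" "wnorm m (\<lambda>x. f x + g x) \<le> wnorm m f + wnorm m g"
proof -
  have [measurable]: "f \<in> borel_measurable borel" "g \<in> borel_measurable borel"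
    using assms by (auto intro: L2w_measurable)
  show "(\<lambda>x. f x + g x) \<in> L2w m" "wnorm m (\<lambda>x. f x + g x) \<le> wnorm m f + wnorm m g"
    using wsqn_triangle[OF assms] by (auto intro!: wnorm_leI)
qed

lemma wnorm_uminus [simp]: "wnorm m (\<lambda>x. - f x) = wnorm m f"
  by (simp add: wnorm_def)

lemma L2w_uminus: "f \<in> L2w m \<Longrightarrow> (\<lambda>x. - f x) \<in> L2w m" for f :: "real^3 \<Rightarrow> 'b::euclidean_space"
  by (simp add: L2w_def)

lemma L2w_diff:
  fixes f g :: "real^3 \<Rightarrow> 'b::euclidean_space"
  assumes "f \<in> L2w m" "g \<in> L2w m"
  shows "(\<lambda>x. f x - g x) \<in> L2w m" "wnorm m (\<lambda>x. f x - g x) \<le> wnorm m f + wnorm m g"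
  using L2w_add[OF assms(1) L2w_uminus[OF assms(2)]] by simp_all

lemma wnorm_triangle_diff:
  fixes f g h :: "real^3 \<Rightarrow> 'b::euclidean_space"
  assumes "f \<in> L2w m" "g \<in> L2w m" "h \<in> L2w m"
  shows "wnorm m (\<lambda>x. f x - h x) \<le> wnorm m (\<lambda>x. f x - g x) + wnorm m (\<lambda>x. g x - h x)"
  using L2w_add(2)[OF L2w_diff(1)[OF assms(1,2)] L2w_diff(1)[OF assms(2,3)]] by simp

lemma wnorm_minus_commute: "wnorm m (\<lambda>x. f x - g x) = wnorm m (\<lambda>x. g x - f x)"
  by (simp add: wnorm_def norm_minus_commute)

lemma wnorm_abs_diff_le:
  fixes f g :: "real^3 \<Rightarrow> 'b::euclidean_space"
  assumes "f \<in> L2w m" "g \<in> L2w m"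
  shows "\<bar>wnorm m f - wnorm m g\<bar> \<le> wnorm m (\<lambda>x. f x - g x)"
  using L2w_add(2)[OF L2w_diff(1)[OF assms] assms(2)] L2w_add(2)[OF L2w_diff(1)[OF assms(2,1)] assms(1)]
    wnorm_minus_commute[of m f g] by simp

lemma wnorm_zero [simp]: "wnorm m (\<lambda>x. 0) = 0"
  by (simp add: wnorm_def)

lemma L2w_zero [simp]: "(\<lambda>x. 0) \<in> L2w m"
  by (simp add: L2w_def)

lemma wnorm_eq_0_AE:
  assumes "f \<in> L2w m" "wnorm m f = 0"
  shows "AE x in lborel. f x = 0"
proof -
  have [measurable]: "f \<in> borel_measurable borel" using assms by (simp add: L2w_measurable)
  have "wsqn m f = 0" using wsqn_wnorm[OF assms(1)] assms(2) by simp
  then have "AE x in lborel. ennreal ((rho x powr m * norm (f x))\<^sup>2) = 0"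
    unfolding wsqn_eq by (subst (asm) nn_integral_0_iff_AE) auto
  then show ?thesis by eventually_elim auto
qed

lemma wsqn_component: "wsqn m (\<lambda>x. f x $ i) \<le> wsqn m (f :: real^3 \<Rightarrow> real^3)"
  by (rule wsq_mono) (simp add: component_le_norm_cart ennreal_leI)

lemma wsqn_components:
  fixes f :: "real^3 \<Rightarrow> real^3"
  assumes [measurable]: "f \<in> borel_measurable borel"
  shows "wsqn m f = (\<Sum>i\<in>UNIV. wsqn m (\<lambda>x. f x $ i))"
proof -
  have "(rho x powr m * norm (f x))\<^sup>2 = (\<Sum>i\<in>UNIV. (rho x powr m * norm (f x $ i))\<^sup>2)" for x
    by (simp add: power_mult_distrib norm_sq_cart sum_distrib_left)
  then show ?thesis unfolding wsqn_eq by (simp add: nn_integral_sum flip: sum_ennreal)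
qed

lemma L2_finite:
  assumes "0 \<le> m" "f \<in> L2w m"
  shows "(\<integral>\<^sup>+x. (ennreal (norm (f x)))\<^sup>2 \<partial>lborel) \<le> ennreal ((wnorm m f)\<^sup>2)"
  using L2_le_wsq[OF assms(1), of "\<lambda>x. ennreal (norm (f x))"] wsqn_wnorm[OF assms(2)] by simp

lemma integrable_L2_mult:
  fixes f g :: "real^3 \<Rightarrow> real"
  assumes [measurable]: "f \<in> borel_measurable borel" "g \<in> borel_measurable borel"
    and f: "(\<integral>\<^sup>+x. (ennreal \<bar>f x\<bar>)\<^sup>2 \<partial>lborel) < \<infinity>" and g: "(\<integral>\<^sup>+x. (ennreal \<bar>g x\<bar>)\<^sup>2 \<partial>lborel) < \<infinity>"
  shows "integrable lborel (\<lambda>x. f x * g x)"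
proof (rule integrableI_bounded)
  have "(\<integral>\<^sup>+x. ennreal (norm (f x * g x)) \<partial>lborel)\<^sup>2 = (\<integral>\<^sup>+x. ennreal \<bar>f x\<bar> * ennreal \<bar>g x\<bar> \<partial>lborel)\<^sup>2"
    by (simp add: abs_mult ennreal_mult)
  also have "\<dots> \<le> (\<integral>\<^sup>+x. (ennreal \<bar>f x\<bar>)\<^sup>2 \<partial>lborel) * (\<integral>\<^sup>+x. (ennreal \<bar>g x\<bar>)\<^sup>2 \<partial>lborel)"
    by (rule Cauchy_Schwarz_nn_integral) auto
  also have "\<dots> < \<infinity>" using f g by (simp add: ennreal_mult_less_top)
  finally show "(\<integral>\<^sup>+x. ennreal (norm (f x * g x)) \<partial>lborel) < \<infinity>"
    by (simp add: power_less_top_ennreal)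
qed simp

section \<open>The linear semigroup\<close>

text \<open>
  The substitution \<open>z = e y\<close> with \<open>e = shrink t\<close> in the definition. The volume element
  contributes \<open>e\<^sup>3\<close> and \<open>exp t = e powr (- 2)\<close>, which leaves one factor \<open>e\<close>.
\<close>

lemma expL_eq:
  assumes t: "0 < t" and [measurable]: "f \<in> borel_measurable borel"
  shows "expL t f x = (LBINT y. shrink t * heat (htime t) (x - shrink t *\<^sub>R y) * f y)"
proof -
  let ?g = "\<lambda>z. exp (- ((norm (x - z))\<^sup>2 / (4 * (1 - exp (- t))))) * f (exp (t / 2) *\<^sub>R z)"
  let ?P = "(4 * pi * (1 - exp (- t))) powr (3 / 2)"
  have "(LBINT z. ?g z) = \<bar>shrink t\<bar> ^ 3 * (LBINT y. ?g (0 + shrink t *\<^sub>R y))"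
    using integral_affine[of ?g "shrink t" 0] by simp
  also have "(\<lambda>y. ?g (0 + shrink t *\<^sub>R y)) = (\<lambda>y. ?P * (heat (htime t) (x - shrink t *\<^sub>R y) * f y))"
    using htime_pos[OF t] by (auto simp: heat_def htime_def shrink_def exp_add[symmetric] fun_eq_iff)
  finally have "expL t f x = exp t * shrink t ^ 3 * (LBINT y. heat (htime t) (x - shrink t *\<^sub>R y) * f y)"
    using t htime_pos[OF t] by (simp add: expL_def htime_def)
  also have "exp t * shrink t ^ 3 = shrink t"
    by (simp add: shrink_def power3_eq_cube exp_add[symmetric])
  finally show ?thesis by (simp add: mult.assoc)
qed

lemma expL_measurable [measurable]:
  assumes [measurable]: "f \<in> borel_measurable borel" and "0 \<le> t"
  shows "expL t f \<in> borel_measurable borel"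
proof (cases "t = 0")
  case True
  then have "expL t f = f" by (simp add: expL_def fun_eq_iff)
  then show ?thesis by simp
next
  case False
  then have "expL t f = (\<lambda>x. LBINT y. shrink t * heat (htime t) (x - shrink t *\<^sub>R y) * f y)"
    using assms by (simp add: fun_eq_iff expL_eq)
  then show ?thesis by simp
qed

lemma ennreal_abs_integral_le:
  fixes f :: "'a \<Rightarrow> real"
  shows "ennreal \<bar>integral\<^sup>L M f\<bar> \<le> (\<integral>\<^sup>+x. ennreal \<bar>f x\<bar> \<partial>M)"
proof (cases "integrable M f")
  case True
  have "ennreal \<bar>integral\<^sup>L M f\<bar> \<le> ennreal (\<integral>x. \<bar>f x\<bar> \<partial>M)" by (intro ennreal_leI integral_abs_bound)
  also have "\<dots> = (\<integral>\<^sup>+x. ennreal \<bar>f x\<bar> \<partial>M)" using True by (subst nn_integral_eq_integral) auto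
  finally show ?thesis .
qed (simp add: not_integrable_integral_eq)

text \<open>
  For fields without any constraint: only \<open>wratio \<le> 1\<close> is used, and the Gaussian
  integrates to a multiple of \<open>e powr (- 3)\<close>, which the factor \<open>e\<^sup>2\<close> does not outweigh.
\<close>

lemma expL_bound:
  assumes m: "0 \<le> m"
  shows "\<exists>C<\<infinity>. \<forall>t\<ge>0. \<forall>f\<in>borel_measurable borel. wsqn m (expL t f) \<le> C * ennreal (exp (t / 2)) * wsqn m f"
proof -
  define A where "A = exp (4 * m\<^sup>2)"
  define D where "D = ennreal (A\<^sup>2 * (sqrt (16 * pi) ^ 3)\<^sup>2)"
  show ?thesis
  proof (intro exI[of _ "D + 1"] conjI allI ballI impI)
    show "D + 1 < \<infinity>" by (simp add: D_def)
    fix t :: real and f :: "real^3 \<Rightarrow> real" assume "0 \<le> t" and [measurable]: "f \<in> borel_measurable borel"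
    show "wsqn m (expL t f) \<le> (D + 1) * ennreal (exp (t / 2)) * wsqn m f"
    proof (cases "t = 0")
      case True
      then have "expL t f = f" by (simp add: expL_def fun_eq_iff)
      then show ?thesis using True by (simp add: distrib_right)
    next
      case False
      then have t: "0 < t" using \<open>0 \<le> t\<close> by simp
      let ?e = "shrink t" and ?a = "htime t"
      have a: "0 < ?a" using t by simp
      have e1: "?e \<le> 1" using t by (simp add: shrink_le1)
      have "wsqn m (expL t f) \<le> wsq m (\<lambda>x. \<integral>\<^sup>+y. ennreal \<bar>?e * heat ?a (x - ?e *\<^sub>R y)\<bar> * (ennreal \<bar>f y\<bar> * 1) \<partial>lborel)"
      proof (rule wsq_mono)
        fix x
        have "ennreal \<bar>expL t f x\<bar> \<le> (\<integral>\<^sup>+y. ennreal \<bar>?e * heat ?a (x - ?e *\<^sub>R y) * f y\<bar> \<partial>lborel)"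
          using t by (simp only: expL_eq \<open>f \<in> borel_measurable borel\<close>) (rule ennreal_abs_integral_le)
        then show "ennreal (norm (expL t f x)) \<le> (\<integral>\<^sup>+y. ennreal \<bar>?e * heat ?a (x - ?e *\<^sub>R y)\<bar> * (ennreal \<bar>f y\<bar> * 1) \<partial>lborel)"
          by (simp add: abs_mult ennreal_mult)
      qed
      also have "\<dots> \<le> ennreal ((A * (?e * ?a powr (-(3/2))))\<^sup>2 * sqrt (16 * pi * ?a) ^ 3) * ennreal ((sqrt (16 * pi * ?a) / ?e) ^ 3) * wsq m (\<lambda>y. ennreal \<bar>f y\<bar>)"
      proof (rule kernel_estimate[where l="wratio m ?e" and \<epsilon>="?e"])
        fix x
        have "(\<integral>\<^sup>+ y. ennreal (wide ?a (x - ?e *\<^sub>R y)) * (ennreal ((wratio m ?e y)\<^sup>2) * 1\<^sup>2) \<partial>lborel) \<le> (\<integral>\<^sup>+ y. ennreal (wide ?a (x - ?e *\<^sub>R y)) * 1 \<partial>lborel)"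
          using wratio_le1[of m ?e] e1 m by (intro nn_integral_mono mult_left_mono) (auto simp: power_le_one)
        also have "\<dots> = ennreal ((sqrt (16 * pi * ?a) / ?e) ^ 3)" using a by (simp add: nn_integral_wide)
        finally show "(\<integral>\<^sup>+ y. ennreal (wide ?a (x - ?e *\<^sub>R y)) * (ennreal ((wratio m ?e y)\<^sup>2) * 1\<^sup>2) \<partial>lborel) \<le> ennreal ((sqrt (16 * pi * ?a) / ?e) ^ 3)" .
      next
        fix x y
        have "rho x powr m * \<bar>?e * heat ?a (x - ?e *\<^sub>R y)\<bar> \<le> (rho (x - ?e *\<^sub>R y) powr m * (wratio m ?e y * rho y powr m)) * \<bar>?e * heat ?a (x - ?e *\<^sub>R y)\<bar>"
          by (intro mult_right_mono rho_powr_le_wratio m) auto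
        also have "\<dots> = ?e * (wratio m ?e y * rho y powr m) * (rho (x - ?e *\<^sub>R y) powr m * heat ?a (x - ?e *\<^sub>R y))"
          by (simp add: abs_mult mult_ac)
        also have "\<dots> \<le> ?e * (wratio m ?e y * rho y powr m) * (A * ?a powr (-(3/2)) * wide ?a (x - ?e *\<^sub>R y))"
          unfolding A_def using a m by (intro mult_left_mono rho_heat_le) auto
        finally show "rho x powr m * \<bar>?e * heat ?a (x - ?e *\<^sub>R y)\<bar> \<le> A * (?e * ?a powr (-(3/2))) * wide ?a (x - ?e *\<^sub>R y) * (wratio m ?e y * rho y powr m)"
          by (simp add: mult_ac)
      qed (use a in \<open>auto simp: A_def\<close>)
      also have "ennreal ((A * (?e * ?a powr (-(3/2))))\<^sup>2 * sqrt (16 * pi * ?a) ^ 3) * ennreal ((sqrt (16 * pi * ?a) / ?e) ^ 3) = D * ennreal (exp (t / 2))"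
      proof -
        have 1: "sqrt (16 * pi * ?a) ^ 3 = sqrt (16 * pi) ^ 3 * ?a powr (3/2)"
          using a by (simp add: real_sqrt_mult power_mult_distrib sqrt_cube less_imp_le)
        have 2: "(A * (?e * ?a powr (-(3/2))))\<^sup>2 = A\<^sup>2 * ?e\<^sup>2 * ?a powr (-3)"
          using a by (simp add: power_mult_distrib powr_power)
        have "(A * (?e * ?a powr (-(3/2))))\<^sup>2 * sqrt (16 * pi * ?a) ^ 3 * (sqrt (16 * pi * ?a) / ?e) ^ 3
          = A\<^sup>2 * (sqrt (16 * pi) ^ 3)\<^sup>2 * (?e\<^sup>2 / ?e ^ 3) * (?a powr (-3) * ?a powr (3/2) * ?a powr (3/2))"
          unfolding power_divide 1 2 by (simp add: power2_eq_square mult_ac)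
        also have "?a powr (-3) * ?a powr (3/2) * ?a powr (3/2) = 1" using a by (simp add: powr_add[symmetric])
        also have "?e\<^sup>2 / ?e ^ 3 = exp (t / 2)"
          by (simp add: shrink_def power2_eq_square power3_eq_cube exp_add[symmetric] exp_diff[symmetric])
        finally show ?thesis using a by (simp add: D_def ennreal_mult[symmetric])
      qed
      also have "D * ennreal (exp (t / 2)) * wsq m (\<lambda>y. ennreal \<bar>f y\<bar>) \<le> (D + 1) * ennreal (exp (t / 2)) * wsq m (\<lambda>y. ennreal \<bar>f y\<bar>)"
        by (intro mult_right_mono) auto
      finally show ?thesis by simp
    qed
  qed
qed

section \<open>Cancellation for divergence-free fields\<close>

lemma powr_neg_3_2_le_4:
  assumes "1/2 \<le> (a::real)"
  shows "a powr (-(3/2)) \<le> 4"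
proof -
  have "a powr (-(3/2)) \<le> (1/2) powr (-(3/2))" using assms by (intro powr_mono2') auto
  also have "\<dots> \<le> (1/2) powr (-2)" by (intro powr_mono') auto
  finally show ?thesis by (simp add: powr_minus powr_numeral power2_eq_square)
qed

text \<open>
  A shift by at most \<open>1\<close> is absorbed by the wider Gaussian. The lower bound on \<open>a\<close> keeps the
  constant uniform.
\<close>

lemma gauss_shift_bound:
  assumes m: "0 \<le> m"
  shows "\<exists>C\<ge>0. \<forall>a x z. 1/2 \<le> a \<longrightarrow> a \<le> 1 \<longrightarrow> norm z \<le> 1 \<longrightarrow> rho x powr m * (heat a x + heat a (x - z)) \<le> C * wide a (x - z)"
proof -
  define C1 where "C1 = exp (2 * m\<^sup>2) * 4 * exp (1/4)"
  define C2 where "C2 = 2 powr m * (exp (4 * m\<^sup>2) * 4)"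
  note a4 = powr_neg_3_2_le_4
  show ?thesis
  proof (intro exI[of _ "C1 + C2"] conjI allI impI)
    show "0 \<le> C1 + C2" by (simp add: C1_def C2_def)
    fix a :: real and x z :: "real^3" assume a: "1/2 \<le> a" "a \<le> 1" and z: "norm z \<le> 1"
    have "rho x powr m * heat a x \<le> C1 * wide a (x - z)"
    proof -
      have "(norm (x - z))\<^sup>2 \<le> (norm x + 1)\<^sup>2"
        using z norm_triangle_ineq4[of x z] by (intro power_mono) auto
      also have "\<dots> \<le> 2 * (norm x)\<^sup>2 + 2"
        using zero_le_power2[of "norm x - 1"] by (simp add: power2_eq_square algebra_simps)
      finally have n: "(norm (x - z))\<^sup>2 \<le> 2 * (norm x)\<^sup>2 + 2" .
      have "(norm x)\<^sup>2 / 8 - (norm x)\<^sup>2 / (4 * a) \<le> 1/4 - (norm (x - z))\<^sup>2 / (16 * a)"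
      proof -
        have "(norm x)\<^sup>2 * (2 * a) \<le> (norm x)\<^sup>2 * 2" using a by (intro mult_left_mono) auto
        then show ?thesis using a n by (simp add: divide_simps)
      qed
      then have ex: "exp ((norm x)\<^sup>2 / 8 - (norm x)\<^sup>2 / (4 * a)) \<le> exp (1/4) * wide a (x - z)"
        unfolding wide_def exp_add[symmetric] by simp
      have "rho x powr m \<le> exp (2 * m\<^sup>2) * exp ((norm x)\<^sup>2 / 8)"
        using rho_powr_le_exp[OF m, of "1/8" x] by (simp add: mult.commute)
      moreover have "heat a x \<le> 4 * exp (- (norm x)\<^sup>2 / (4 * a))"
      proof -
        have "a powr (3/2) \<le> (4 * pi * a) powr (3 / 2)"
          using a pi_gt3 by (intro powr_mono2) auto
        then have "heat a x \<le> a powr (-(3/2)) * exp (- (norm x)\<^sup>2 / (4 * a))"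
          using a unfolding heat_def by (simp add: powr_minus divide_simps)
        also have "\<dots> \<le> 4 * exp (- (norm x)\<^sup>2 / (4 * a))" using a4[OF a(1)] by (intro mult_right_mono) auto
        finally show ?thesis .
      qed
      ultimately have "rho x powr m * heat a x \<le> (exp (2 * m\<^sup>2) * exp ((norm x)\<^sup>2 / 8)) * (4 * exp (- (norm x)\<^sup>2 / (4 * a)))"
        by (intro mult_mono) auto
      also have "\<dots> = exp (2 * m\<^sup>2) * 4 * (exp ((norm x)\<^sup>2 / 8) * exp (- (norm x)\<^sup>2 / (4 * a)))" by simp
      also have "exp ((norm x)\<^sup>2 / 8) * exp (- (norm x)\<^sup>2 / (4 * a)) = exp ((norm x)\<^sup>2 / 8 - (norm x)\<^sup>2 / (4 * a))"
        unfolding exp_add[symmetric] by simp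
      also have "exp (2 * m\<^sup>2) * 4 * \<dots> \<le> exp (2 * m\<^sup>2) * 4 * (exp (1/4) * wide a (x - z))"
        using ex by (intro mult_left_mono) auto
      finally show ?thesis by (simp add: C1_def)
    qed
    moreover have "rho x powr m * heat a (x - z) \<le> C2 * wide a (x - z)"
    proof -
      have "rho z powr m \<le> 2 powr m" using z m by (intro powr_mono2) (auto simp: rho_def)
      then have "rho x powr m \<le> rho (x - z) powr m * 2 powr m"
        using rho_powr_le_diff[OF m, of x z] by (meson mult_left_mono order_trans powr_ge_zero)
      then have "rho x powr m * heat a (x - z) \<le> (rho (x - z) powr m * 2 powr m) * heat a (x - z)"
        by (intro mult_right_mono) auto
      also have "\<dots> = 2 powr m * (rho (x - z) powr m * heat a (x - z))" by simp
      also have "\<dots> \<le> 2 powr m * (exp (4 * m\<^sup>2) * a powr (-(3/2)) * wide a (x - z))"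
        using a m by (intro mult_left_mono rho_heat_le) auto
      also have "\<dots> \<le> 2 powr m * (exp (4 * m\<^sup>2) * 4 * wide a (x - z))"
        using a4[OF a(1)] by (intro mult_left_mono mult_right_mono) auto
      finally show ?thesis by (simp add: C2_def)
    qed
    ultimately show "rho x powr m * (heat a x + heat a (x - z)) \<le> (C1 + C2) * wide a (x - z)"
      by (simp add: distrib_left distrib_right)
  qed
qed

lemma abs_exp_diff_le: "\<bar>exp (- x) - exp (- y)\<bar> \<le> \<bar>x - y\<bar> * (exp (- x) + exp (- (y::real)))"
proof -
  have *: "exp (- x) - exp (- y) \<le> (y - x) * exp (- x)" if "x \<le> y" for x y :: real
  proof -
    have "1 - (y - x) \<le> exp (- (y - x))" using exp_ge_add_one_self[of "x - y"] by (simp add: algebra_simps)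
    then have "exp (- x) * (1 - (y - x)) \<le> exp (- x) * exp (- (y - x))" by (intro mult_left_mono) auto
    also have "\<dots> = exp (- y)" by (simp add: exp_add[symmetric])
    finally show ?thesis by (simp add: algebra_simps)
  qed
  have **: "\<bar>exp (- x) - exp (- y)\<bar> \<le> \<bar>x - y\<bar> * (exp (- x) + exp (- y))" if "x \<le> y" for x y :: real
  proof -
    have "\<bar>exp (- x) - exp (- y)\<bar> = exp (- x) - exp (- y)" using that by simp
    also have "\<dots> \<le> (y - x) * exp (- x)" using *[OF that] .
    also have "\<dots> \<le> (y - x) * (exp (- x) + exp (- y))" using that by (intro mult_left_mono) auto
    finally show ?thesis using that by simp
  qed
  show ?thesis using **[of x y] **[of y x] by (cases "x \<le> y") (simp_all add: abs_minus_commute add.commute)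
qed

text \<open>
  The exponents differ by at most a multiple of \<open>norm z * rho \<xi>\<close>, and \<open>exp\<close> is Lipschitz with a
  constant given by its values at the two end points.
\<close>

lemma gauss_diff_bound:
  assumes "1/2 \<le> a" "norm z \<le> 1"
  shows "\<bar>heat a (\<xi> - z) - heat a \<xi>\<bar> \<le> norm z * rho \<xi> * (heat a \<xi> + heat a (\<xi> - z))"
proof -
  let ?x = "(norm (\<xi> - z))\<^sup>2 / (4 * a)" and ?y = "(norm \<xi>)\<^sup>2 / (4 * a)" and ?P = "(4 * pi * a) powr (3/2)"
  have "(norm (\<xi> - z))\<^sup>2 - (norm \<xi>)\<^sup>2 = (norm (\<xi> - z) - norm \<xi>) * (norm (\<xi> - z) + norm \<xi>)"
    by (simp add: power2_eq_square algebra_simps)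
  then have "\<bar>(norm (\<xi> - z))\<^sup>2 - (norm \<xi>)\<^sup>2\<bar> = \<bar>norm (\<xi> - z) - norm \<xi>\<bar> * (norm (\<xi> - z) + norm \<xi>)"
    by (simp only: abs_mult) simp
  also have "\<dots> \<le> norm z * (2 * rho \<xi>)"
  proof (rule mult_mono)
    show "\<bar>norm (\<xi> - z) - norm \<xi>\<bar> \<le> norm z" using norm_triangle_ineq3[of "\<xi> - z" \<xi>] by simp
    show "norm (\<xi> - z) + norm \<xi> \<le> 2 * rho \<xi>" using norm_triangle_ineq4[of \<xi> z] assms by (simp add: rho_def)
  qed auto
  finally have *: "\<bar>(norm (\<xi> - z))\<^sup>2 - (norm \<xi>)\<^sup>2\<bar> \<le> norm z * (2 * rho \<xi>)" .
  have "\<bar>?x - ?y\<bar> \<le> norm z * (2 * rho \<xi>) / (4 * a)"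
  proof -
    have "\<bar>?x - ?y\<bar> = \<bar>(norm (\<xi> - z))\<^sup>2 - (norm \<xi>)\<^sup>2\<bar> / (4 * a)"
      using assms by (simp add: diff_divide_distrib[symmetric] abs_divide)
    with * show ?thesis using assms by (simp only:) (rule divide_right_mono, auto)
  qed
  also have "\<dots> \<le> norm z * rho \<xi>"
  proof -
    have "norm z * 1 \<le> norm z * (2 * a)" using assms by (intro mult_left_mono) auto
    then show ?thesis using assms by (simp add: divide_simps)
  qed
  finally have "\<bar>?x - ?y\<bar> * (exp (- ?x) + exp (- ?y)) \<le> norm z * rho \<xi> * (exp (- ?x) + exp (- ?y))"
    by (intro mult_right_mono) auto
  then have "\<bar>exp (- ?x) - exp (- ?y)\<bar> / ?P \<le> norm z * rho \<xi> * (exp (- ?x) + exp (- ?y)) / ?P"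
    using abs_exp_diff_le[of ?x ?y] by (intro divide_right_mono) auto
  moreover have "\<bar>heat a (\<xi> - z) - heat a \<xi>\<bar> = \<bar>exp (- ?x) - exp (- ?y)\<bar> / ?P"
    unfolding heat_def by (simp add: diff_divide_distrib[symmetric])
  moreover have "heat a \<xi> + heat a (\<xi> - z) = (exp (- ?x) + exp (- ?y)) / ?P"
    unfolding heat_def by (simp add: add_divide_distrib)
  ultimately show ?thesis by simp
qed

lemma rho_nonneg [simp]: "0 \<le> rho x"
  by (simp add: less_imp_le)

lemma L2_bounded_support:
  fixes f :: "real^3 \<Rightarrow> real"
  assumes "\<And>y. \<bar>f y\<bar> \<le> C" "\<And>y. R < norm y \<Longrightarrow> f y = 0"
  shows "(\<integral>\<^sup>+y. (ennreal \<bar>f y\<bar>)\<^sup>2 \<partial>lborel) < \<infinity>"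
proof -
  have "(\<integral>\<^sup>+y. (ennreal \<bar>f y\<bar>)\<^sup>2 \<partial>lborel) \<le> (\<integral>\<^sup>+y. ennreal (C\<^sup>2) * indicator (cball (0::real^3) R) y \<partial>lborel)"
  proof (rule nn_integral_mono)
    fix y
    have "\<bar>f y\<bar>\<^sup>2 \<le> C\<^sup>2" using assms(1) by (intro power_mono) auto
    then show "(ennreal \<bar>f y\<bar>)\<^sup>2 \<le> ennreal (C\<^sup>2) * indicator (cball 0 R) y"
      using assms(2)[of y] by (cases "R < norm y") (auto simp: ennreal_power ennreal_leI)
  qed
  also have "\<dots> = ennreal (C\<^sup>2) * emeasure lborel (cball (0::real^3) R)"
    by (rule nn_integral_cmult_indicator) simp
  also have "\<dots> < \<infinity>"
    using emeasure_bounded_finite[OF bounded_cball, of "0::real^3" R] by (simp add: ennreal_mult_less_top)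
  finally show ?thesis .
qed

lemma gauss_L2:
  fixes F :: "real^3 \<Rightarrow> real"
  assumes [measurable]: "F \<in> borel_measurable borel" and "0 < a" "e \<noteq> 0" and F: "\<And>x. \<bar>F x\<bar> \<le> K * wide a x"
  shows "(\<integral>\<^sup>+y. (ennreal \<bar>F (\<xi> - e *\<^sub>R y)\<bar>)\<^sup>2 \<partial>lborel) < \<infinity>"
proof -
  have "(\<integral>\<^sup>+y. (ennreal \<bar>F (\<xi> - e *\<^sub>R y)\<bar>)\<^sup>2 \<partial>lborel) \<le> (\<integral>\<^sup>+y. ennreal (K\<^sup>2) * ennreal (wide a (\<xi> - e *\<^sub>R y)) \<partial>lborel)"
  proof (rule nn_integral_mono)
    fix y
    let ?x = "\<xi> - e *\<^sub>R y"
    have "\<bar>F ?x\<bar>\<^sup>2 \<le> (K * wide a ?x)\<^sup>2" using F by (intro power_mono) auto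
    also have "\<dots> = K\<^sup>2 * (wide a ?x)\<^sup>2" by (simp add: power_mult_distrib)
    also have "\<dots> \<le> K\<^sup>2 * wide a ?x"
      using wide_le1[OF assms(2), of ?x] by (intro mult_left_mono) (auto simp: power2_eq_square intro!: mult_left_le_one_le)
    finally show "(ennreal \<bar>F ?x\<bar>)\<^sup>2 \<le> ennreal (K\<^sup>2) * ennreal (wide a ?x)"
      by (simp add: ennreal_power ennreal_mult[symmetric] ennreal_leI)
  qed
  also have "\<dots> = ennreal (K\<^sup>2) * ennreal ((sqrt (16 * pi * a) / \<bar>e\<bar>) ^ 3)"
    using assms by (simp add: nn_integral_cmult nn_integral_wide)
  also have "\<dots> < \<infinity>" by (simp add: ennreal_mult_less_top)
  finally show ?thesis .
qed

lemma heat_le_wide: "0 < a \<Longrightarrow> a \<le> 1 \<Longrightarrow> \<bar>heat a x\<bar> \<le> a powr (-(3/2)) * wide a x"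
  using rho_heat_le[of 0 a x] by simp

lemma heatD_le_wide: "0 < a \<Longrightarrow> a \<le> 1 \<Longrightarrow> \<bar>heatD a j x\<bar> \<le> exp 4 * a powr (-2) * wide a x"
  using rho_heatD_le[of 0 a x j] by simp

lemma component_L2:
  assumes "0 \<le> m" "w \<in> L2w m"
  shows "(\<integral>\<^sup>+x. (ennreal \<bar>w x $ j\<bar>)\<^sup>2 \<partial>lborel) < \<infinity>"
proof -
  have "(\<integral>\<^sup>+x. (ennreal \<bar>w x $ j\<bar>)\<^sup>2 \<partial>lborel) \<le> (\<integral>\<^sup>+x. (ennreal (norm (w x)))\<^sup>2 \<partial>lborel)"
    by (intro nn_integral_mono power_mono_ennreal ennreal_leI component_le_norm_cart)
  also have "\<dots> \<le> ennreal ((wnorm m w)\<^sup>2)" by (rule L2_finite[OF assms])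
  also have "\<dots> < \<infinity>" by simp
  finally show ?thesis .
qed

lemma integrable_component_mult:
  assumes "0 \<le> m" "w \<in> L2w m" "f \<in> borel_measurable borel" "(\<integral>\<^sup>+x. (ennreal \<bar>f x\<bar>)\<^sup>2 \<partial>lborel) < \<infinity>"
  shows "integrable lborel (\<lambda>x. w x $ j * f x)"
proof -
  have [measurable]: "w \<in> borel_measurable borel" using assms by (simp add: L2w_measurable)
  show ?thesis by (rule integrable_L2_mult[OF _ assms(3) component_L2[OF assms(1,2)] assms(4)]) simp
qed

text \<open>
  The \<open>j\<close>-th derivative of the cut-off coordinate \<open>y $ i * bump (e *\<^sub>R y)\<close>.
\<close>

definition moment_test :: "3 \<Rightarrow> real \<Rightarrow> 3 \<Rightarrow> real^3 \<Rightarrow> real" where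
  "moment_test i e j y = y $ i * (e * dbump j (e *\<^sub>R y)) + axis j 1 $ i * bump (e *\<^sub>R y)"

text \<open>
  As the gradient of the coordinate function \<open>y\<^sub>i\<close> is the \<open>i\<close>-th unit vector, this says that
  \<open>w\<^sub>i\<close> has integral \<open>0\<close>, up to the cut-off. The cut-off is essential: for small \<open>m\<close> a field
  in \<open>L\<^sup>2(m)\<close> need not be integrable.
\<close>

lemma div_free_moment:
  assumes "div_free w" "0 < e"
  shows "(LBINT y. \<Sum>j\<in>UNIV. w y $ j * moment_test i e j y) = 0"
proof -
  have tf: "test_function (\<lambda>y. y $ i * bump (e *\<^sub>R y))"
    by (rule test_function_cutoff[OF Ck_nth assms(2)])
  have pj: "partial j (\<lambda>y. y $ i * bump (e *\<^sub>R y)) y = moment_test i e j y" for j y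
  proof -
    have "partial j (\<lambda>y. y $ i) y = axis j 1 $ i"
      by (rule partial_eq) (intro bounded_linear_imp_has_derivative bounded_linear_vec_nth)
    then show ?thesis using partial_cutoff[OF Ck_nth] by (simp add: moment_test_def)
  qed
  show ?thesis using assms(1)[unfolded div_free_def, rule_format, OF tf] by (simp only: pj)
qed

lemma moment_test_L2:
  assumes "0 < e"
  shows "(\<integral>\<^sup>+y. (ennreal \<bar>moment_test i e j y\<bar>)\<^sup>2 \<partial>lborel) < \<infinity>"
proof -
  obtain L where L: "0 < L" "\<And>j y. \<bar>dbump j y\<bar> \<le> L * norm y" by (rule bump_Lipschitz) blast
  have out: "moment_test i e j y = 0" if "1 \<le> norm (e *\<^sub>R y)" for y
    using that by (simp only: moment_test_def bump_eq_0 dbump_eq_0)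
  show ?thesis
  proof (rule L2_bounded_support)
    fix y
    show "\<bar>moment_test i e j y\<bar> \<le> L + 1"
    proof (cases "1 \<le> norm (e *\<^sub>R y)")
      case True then show ?thesis using L out by simp
    next
      case False
      have "\<bar>moment_test i e j y\<bar> \<le> \<bar>(e *\<^sub>R y) $ i\<bar> * \<bar>dbump j (e *\<^sub>R y)\<bar> + \<bar>axis j (1::real) $ i\<bar> * \<bar>bump (e *\<^sub>R y)\<bar>"
        unfolding moment_test_def using abs_triangle_ineq by (simp add: abs_mult[symmetric] mult_ac)
      also have "\<dots> \<le> 1 * L + 1 * 1"
      proof (intro add_mono mult_mono)
        show "\<bar>(e *\<^sub>R y) $ i\<bar> \<le> 1" using component_le_norm_cart[of "e *\<^sub>R y" i] False by linarith
        have "L * norm (e *\<^sub>R y) \<le> L * 1" using L False by (intro mult_left_mono) auto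
        then show "\<bar>dbump j (e *\<^sub>R y)\<bar> \<le> L" using L(2)[of j "e *\<^sub>R y"] by linarith
        show "\<bar>bump (e *\<^sub>R y)\<bar> \<le> 1" using bump_bounds[of "e *\<^sub>R y"] by simp
        show "\<bar>axis j (1::real) $ i\<bar> \<le> 1" by (simp add: axis_def)
      qed auto
      finally show ?thesis by simp
    qed
  next
    fix y :: "real^3" assume "1 / e < norm y"
    then have "1 \<le> norm (e *\<^sub>R y)" using assms by (simp add: field_simps)
    then show "moment_test i e j y = 0" by (rule out)
  qed
qed

lemma moment_test_measurable [measurable]: "moment_test i e j \<in> borel_measurable borel"
  unfolding moment_test_def by measurable

text \<open>
  The Gaussian is not compactly supported. It is cut off at radius \<open>n\<close>, and the limit is taken by
  dominated convergence.
\<close>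

lemma div_free_gauss:
  assumes m: "0 \<le> m" and w: "w \<in> L2w m" and df: "div_free w" and a: "0 < a" "a \<le> 1" and c: "0 < c"
  shows "(LBINT y. \<Sum>j\<in>UNIV. w y $ j * heatD a j (x - c *\<^sub>R y)) = 0"
proof -
  have [measurable]: "w \<in> borel_measurable borel" using w by (simp add: L2w_measurable)
  obtain L where L: "0 < L" "\<And>j y. \<bar>dbump j y\<bar> \<le> L * norm y" by (rule bump_Lipschitz) blast
  have dL: "\<bar>dbump j y\<bar> \<le> L" for j y
  proof (cases "1 \<le> norm y")
    case False
    have "L * norm y \<le> L * 1" using L False by (intro mult_left_mono) auto
    then show ?thesis using L(2)[of j y] by linarith
  qed (use L in \<open>simp add: dbump_eq_0\<close>)
  define d where "d n = inverse (real (Suc n))" for n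
  have d: "0 < d n" "d n \<le> 1" for n by (auto simp: d_def inverse_le_1_iff)
  have d0: "d \<longlonglongrightarrow> 0" unfolding d_def by (rule LIMSEQ_inverse_real_of_nat)
  define s where "s n y = (\<Sum>j\<in>UNIV. w y $ j * (heat a (x - c *\<^sub>R y) * (d n * dbump j (d n *\<^sub>R y)) + (- c * heatD a j (x - c *\<^sub>R y)) * bump (d n *\<^sub>R y)))" for n y
  define b where "b y = (\<Sum>j\<in>UNIV. \<bar>w y $ j * (L * heat a (x - c *\<^sub>R y))\<bar> + \<bar>w y $ j * (c * heatD a j (x - c *\<^sub>R y))\<bar>)" for y
  have s0: "(LBINT y. s n y) = 0" for n
  proof -
    have tf: "test_function (\<lambda>y. heat a (x - c *\<^sub>R y) * bump (d n *\<^sub>R y))"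
      by (rule test_function_cutoff[OF heat_Ck d(1)])
    show ?thesis using df[unfolded div_free_def, rule_format, OF tf] unfolding s_def
      by (simp only: partial_cutoff[OF heat_Ck] heat_partial)
  qed
  have GL: "(\<integral>\<^sup>+y. (ennreal \<bar>heat a (x - c *\<^sub>R y)\<bar>)\<^sup>2 \<partial>lborel) < \<infinity>"
    using a c by (intro gauss_L2[OF _ _ _ heat_le_wide]) auto
  have DL: "(\<integral>\<^sup>+y. (ennreal \<bar>heatD a j (x - c *\<^sub>R y)\<bar>)\<^sup>2 \<partial>lborel) < \<infinity>" for j
    using a c by (intro gauss_L2[OF _ _ _ heatD_le_wide]) auto
  have b: "integrable lborel b"
  proof -
    have "integrable lborel (\<lambda>y. L * (w y $ j * heat a (x - c *\<^sub>R y)))" for j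
      by (intro integrable_mult_right integrable_component_mult[OF m w _ GL]) auto
    moreover have "integrable lborel (\<lambda>y. c * (w y $ j * heatD a j (x - c *\<^sub>R y)))" for j
      by (intro integrable_mult_right integrable_component_mult[OF m w _ DL]) auto
    ultimately show ?thesis unfolding b_def
      by (intro Bochner_Integration.integrable_sum Bochner_Integration.integrable_add integrable_abs) (simp_all add: mult_ac)
  qed
  have "(\<lambda>n. LBINT y. s n y) \<longlonglongrightarrow> (LBINT y. \<Sum>j\<in>UNIV. w y $ j * (- c * heatD a j (x - c *\<^sub>R y)))"
  proof (rule integral_dominated_convergence[where w=b])
    show "(\<lambda>y. \<Sum>j\<in>UNIV. w y $ j * (- c * heatD a j (x - c *\<^sub>R y))) \<in> borel_measurable lborel" by measurable
    show "s n \<in> borel_measurable lborel" for n unfolding s_def by measurable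
    show "AE y in lborel. (\<lambda>n. s n y) \<longlonglongrightarrow> (\<Sum>j\<in>UNIV. w y $ j * (- c * heatD a j (x - c *\<^sub>R y)))"
    proof (rule AE_I2)
      fix y :: "real^3"
      have "isCont (\<lambda>y. bump (1 *\<^sub>R y)) 0"
        using bump_derivative[of 1 0] has_derivative_continuous by blast
      then have "isCont bump 0" by simp
      moreover have "(\<lambda>n. d n *\<^sub>R y) \<longlonglongrightarrow> 0" using tendsto_scaleR[OF d0 tendsto_const, of y] by simp
      ultimately have bl: "(\<lambda>n. bump (d n *\<^sub>R y)) \<longlonglongrightarrow> 1" using isCont_tendsto_compose[of 0 bump] by fastforce
      have "(\<lambda>n. d n * dbump j (d n *\<^sub>R y)) \<longlonglongrightarrow> 0" for j
      proof (rule Lim_null_comparison)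
        show "\<forall>\<^sub>F n in sequentially. norm (d n * dbump j (d n *\<^sub>R y)) \<le> d n * L"
          using dL by (intro always_eventually allI) (simp add: abs_mult abs_of_pos[OF d(1)] d(1))
        show "(\<lambda>n. d n * L) \<longlonglongrightarrow> 0" using tendsto_mult[OF d0 tendsto_const[of L]] by simp
      qed
      then have "(\<lambda>n. s n y) \<longlonglongrightarrow> (\<Sum>j\<in>UNIV. w y $ j * (heat a (x - c *\<^sub>R y) * 0 + (- c * heatD a j (x - c *\<^sub>R y)) * 1))"
        unfolding s_def by (intro tendsto_intros bl)
      then show "(\<lambda>n. s n y) \<longlonglongrightarrow> (\<Sum>j\<in>UNIV. w y $ j * (- c * heatD a j (x - c *\<^sub>R y)))" by simp
    qed
    show "AE y in lborel. norm (s n y) \<le> b y" for n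
    proof (rule AE_I2)
      fix y
      show "norm (s n y) \<le> b y" unfolding s_def b_def real_norm_def
      proof (rule order_trans[OF sum_abs sum_mono])
        fix j
        have 1: "\<bar>d n * dbump j (d n *\<^sub>R y)\<bar> \<le> 1 * L" unfolding abs_mult using d[of n] dL by (intro mult_mono) auto
        have 2: "\<bar>bump (d n *\<^sub>R y)\<bar> \<le> 1" using bump_bounds[of "d n *\<^sub>R y"] by simp
        have "\<bar>w y $ j * (heat a (x - c *\<^sub>R y) * (d n * dbump j (d n *\<^sub>R y)) + (- c * heatD a j (x - c *\<^sub>R y)) * bump (d n *\<^sub>R y))\<bar>
          \<le> \<bar>w y $ j * heat a (x - c *\<^sub>R y)\<bar> * \<bar>d n * dbump j (d n *\<^sub>R y)\<bar> + \<bar>w y $ j * (c * heatD a j (x - c *\<^sub>R y))\<bar> * \<bar>bump (d n *\<^sub>R y)\<bar>"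
          unfolding abs_mult[symmetric] distrib_left using abs_triangle_ineq4[of "w y $ j * (heat a (x - c *\<^sub>R y) * (d n * dbump j (d n *\<^sub>R y)))" "w y $ j * (c * heatD a j (x - c *\<^sub>R y)) * bump (d n *\<^sub>R y)"]
          by (simp add: mult_ac)
        also have "\<dots> \<le> \<bar>w y $ j * heat a (x - c *\<^sub>R y)\<bar> * (1 * L) + \<bar>w y $ j * (c * heatD a j (x - c *\<^sub>R y))\<bar> * 1"
          by (intro add_mono mult_left_mono 1 2) auto
        also have "\<dots> = \<bar>w y $ j * (L * heat a (x - c *\<^sub>R y))\<bar> + \<bar>w y $ j * (c * heatD a j (x - c *\<^sub>R y))\<bar>"
          using L(1) by (simp add: abs_mult mult_ac)
        finally show "\<bar>w y $ j * (heat a (x - c *\<^sub>R y) * (d n * dbump j (d n *\<^sub>R y)) + (- c * heatD a j (x - c *\<^sub>R y)) * bump (d n *\<^sub>R y))\<bar>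
          \<le> \<bar>w y $ j * (L * heat a (x - c *\<^sub>R y))\<bar> + \<bar>w y $ j * (c * heatD a j (x - c *\<^sub>R y))\<bar>" .
      qed
    qed
  qed (rule b)
  then have "(LBINT y. \<Sum>j\<in>UNIV. w y $ j * (- c * heatD a j (x - c *\<^sub>R y))) = 0"
    unfolding s0 by (simp add: LIMSEQ_const_iff)
  moreover have "(\<Sum>j\<in>UNIV. w y $ j * (- c * heatD a j (x - c *\<^sub>R y))) = - c * (\<Sum>j\<in>UNIV. w y $ j * heatD a j (x - c *\<^sub>R y))" for y
    by (simp add: sum_distrib_left mult_ac sum_negf)
  ultimately show ?thesis using c by simp
qed

text \<open>
  The kernel that is left after the vanishing moment, multiplied by \<open>heat a x\<close>, has been
  subtracted, with absolute values taken in each term.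
\<close>

definition resid :: "real \<Rightarrow> real \<Rightarrow> real^3 \<Rightarrow> real^3 \<Rightarrow> real" where
  "resid a e x y = \<bar>heat a (x - e *\<^sub>R y) - heat a x * bump (e *\<^sub>R y)\<bar> + heat a x * (\<Sum>j\<in>UNIV. norm (e *\<^sub>R y) * \<bar>dbump j (e *\<^sub>R y)\<bar>)"

lemma resid_measurable [measurable]: "case_prod (resid a e) \<in> borel_measurable (borel \<Otimes>\<^sub>M borel)"
  unfolding resid_def by measurable

lemma resid_nonneg [simp]: "0 \<le> resid a e x y"
  unfolding resid_def by (intro add_nonneg_nonneg mult_nonneg_nonneg sum_nonneg) auto

lemma expL_div_free_le:
  assumes m: "0 \<le> m" and w: "w \<in> L2w m" and df: "div_free w" and t: "0 < t"
  shows "ennreal \<bar>expL t (\<lambda>y. w y $ i) x\<bar> \<le> (\<integral>\<^sup>+y. ennreal \<bar>shrink t * resid (htime t) (shrink t) x y\<bar> * (ennreal (norm (w y)) * 1) \<partial>lborel)"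
proof -
  have [measurable]: "w \<in> borel_measurable borel" using w by (simp add: L2w_measurable)
  let ?e = "shrink t" and ?a = "htime t"
  have a: "0 < ?a" "?a \<le> 1" using t by auto
  have I1: "integrable lborel (\<lambda>y. w y $ i * heat ?a (x - ?e *\<^sub>R y))"
    using a by (intro integrable_component_mult[OF m w] gauss_L2[OF _ _ _ heat_le_wide]) auto
  have I2: "integrable lborel (\<lambda>y. \<Sum>j\<in>UNIV. w y $ j * moment_test i ?e j y)"
    by (intro Bochner_Integration.integrable_sum integrable_component_mult[OF m w] moment_test_L2) auto
  have "expL t (\<lambda>y. w y $ i) x = (LBINT y. ?e * (w y $ i * heat ?a (x - ?e *\<^sub>R y)))"
    using t by (subst expL_eq) (auto simp: mult_ac)
  also have "\<dots> = ?e * (LBINT y. w y $ i * heat ?a (x - ?e *\<^sub>R y))" by simp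
  also have "\<dots> = ?e * ((LBINT y. w y $ i * heat ?a (x - ?e *\<^sub>R y)) - heat ?a x * (LBINT y. \<Sum>j\<in>UNIV. w y $ j * moment_test i ?e j y))"
    by (simp add: div_free_moment[OF df])
  also have "\<dots> = (LBINT y. ?e * (w y $ i * heat ?a (x - ?e *\<^sub>R y) - heat ?a x * (\<Sum>j\<in>UNIV. w y $ j * moment_test i ?e j y)))"
    using I1 I2 by (simp add: Bochner_Integration.integral_diff)
  finally have "ennreal \<bar>expL t (\<lambda>y. w y $ i) x\<bar> \<le> (\<integral>\<^sup>+y. ennreal \<bar>?e * (w y $ i * heat ?a (x - ?e *\<^sub>R y) - heat ?a x * (\<Sum>j\<in>UNIV. w y $ j * moment_test i ?e j y))\<bar> \<partial>lborel)"
    by (simp only: ennreal_abs_integral_le)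
  also have "\<dots> \<le> (\<integral>\<^sup>+y. ennreal \<bar>?e * resid ?a ?e x y\<bar> * (ennreal (norm (w y)) * 1) \<partial>lborel)"
  proof (rule nn_integral_mono)
    fix y
    let ?d = "\<lambda>j. (?e *\<^sub>R y) $ i * dbump j (?e *\<^sub>R y)"
    have "(\<Sum>j\<in>UNIV. w y $ j * moment_test i ?e j y) = (\<Sum>j\<in>UNIV. w y $ j * ?d j) + w y $ i * bump (?e *\<^sub>R y)"
    proof -
      have "w y $ j * (axis j 1 $ i * bump (?e *\<^sub>R y)) = (if i = j then w y $ j * bump (?e *\<^sub>R y) else 0)" for j
        by (simp add: axis_def)
      then show ?thesis unfolding moment_test_def by (simp add: distrib_left sum.distrib mult_ac)
    qed
    then have "w y $ i * heat ?a (x - ?e *\<^sub>R y) - heat ?a x * (\<Sum>j\<in>UNIV. w y $ j * moment_test i ?e j y)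
      = w y $ i * (heat ?a (x - ?e *\<^sub>R y) - heat ?a x * bump (?e *\<^sub>R y)) - heat ?a x * (\<Sum>j\<in>UNIV. w y $ j * ?d j)"
      by (simp add: algebra_simps)
    also have "\<bar>\<dots>\<bar> \<le> \<bar>w y $ i\<bar> * \<bar>heat ?a (x - ?e *\<^sub>R y) - heat ?a x * bump (?e *\<^sub>R y)\<bar> + heat ?a x * (\<Sum>j\<in>UNIV. \<bar>w y $ j\<bar> * \<bar>?d j\<bar>)"
    proof -
      have "\<bar>heat ?a x * (\<Sum>j\<in>UNIV. w y $ j * ?d j)\<bar> = heat ?a x * \<bar>\<Sum>j\<in>UNIV. w y $ j * ?d j\<bar>" by (simp add: abs_mult)
      also have "\<dots> \<le> heat ?a x * (\<Sum>j\<in>UNIV. \<bar>w y $ j * ?d j\<bar>)" by (intro mult_left_mono sum_abs) auto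
      finally have "\<bar>heat ?a x * (\<Sum>j\<in>UNIV. w y $ j * ?d j)\<bar> \<le> heat ?a x * (\<Sum>j\<in>UNIV. \<bar>w y $ j\<bar> * \<bar>?d j\<bar>)" by (simp only: abs_mult)
      then show ?thesis using abs_triangle_ineq4[of "w y $ i * (heat ?a (x - ?e *\<^sub>R y) - heat ?a x * bump (?e *\<^sub>R y))" "heat ?a x * (\<Sum>j\<in>UNIV. w y $ j * ?d j)"]
        by (simp only: abs_mult[of "w y $ i"])
    qed
    also have "\<dots> \<le> norm (w y) * \<bar>heat ?a (x - ?e *\<^sub>R y) - heat ?a x * bump (?e *\<^sub>R y)\<bar> + heat ?a x * (\<Sum>j\<in>UNIV. norm (w y) * (norm (?e *\<^sub>R y) * \<bar>dbump j (?e *\<^sub>R y)\<bar>))"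
      unfolding abs_mult[of "(?e *\<^sub>R y) $ i"]
      by (intro add_mono mult_left_mono mult_right_mono sum_mono mult_mono component_le_norm_cart) auto
    also have "\<dots> = norm (w y) * resid ?a ?e x y"
      unfolding resid_def by (simp add: distrib_left sum_distrib_left[symmetric] mult_ac)
    finally have "\<bar>?e * (w y $ i * heat ?a (x - ?e *\<^sub>R y) - heat ?a x * (\<Sum>j\<in>UNIV. w y $ j * moment_test i ?e j y))\<bar> \<le> ?e * (norm (w y) * resid ?a ?e x y)"
      unfolding abs_mult by (simp add: mult_left_mono)
    then show "ennreal \<bar>?e * (w y $ i * heat ?a (x - ?e *\<^sub>R y) - heat ?a x * (\<Sum>j\<in>UNIV. w y $ j * moment_test i ?e j y))\<bar>
        \<le> ennreal \<bar>?e * resid ?a ?e x y\<bar> * (ennreal (norm (w y)) * 1)"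
      by (simp add: abs_mult ennreal_mult[symmetric] mult_ac ennreal_leI)
  qed
  finally show ?thesis .
qed

text \<open>
  For \<open>e * norm y \<ge> 1\<close> the cut-off vanishes and the heat kernel itself remains. Otherwise
  the difference of the two heat kernels and the error of the cut-off are both of the order
  \<open>e * norm y\<close>. The bound has the form that \<open>kernel_estimate\<close> asks for, with a factor
  \<open>min 1 (e * norm y)\<close> in front of the weight ratio.
\<close>

lemma resid_bound:
  assumes m: "0 \<le> m"
  shows "\<exists>A\<ge>0. \<forall>a e x y. 1/2 \<le> a \<longrightarrow> a \<le> 1 \<longrightarrow> 0 < e \<longrightarrow>
    rho x powr m * resid a e x y \<le> A * wide a (x - e *\<^sub>R y) * ((min 1 (e * norm y) * wratio m e y) * rho y powr m)"
proof -
  obtain L where L: "0 < L" "\<And>y. \<bar>1 - bump y\<bar> \<le> L * (norm y)\<^sup>2" "\<And>j y. \<bar>dbump j y\<bar> \<le> L * norm y"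
    by (rule bump_Lipschitz) blast
  obtain C1 where C1: "0 \<le> C1" "\<And>a x z. 1/2 \<le> a \<Longrightarrow> a \<le> 1 \<Longrightarrow> norm z \<le> 1 \<Longrightarrow> rho x powr m * (heat a x + heat a (x - z)) \<le> C1 * wide a (x - z)"
    using gauss_shift_bound[OF m] by blast
  obtain C2 where C2: "0 \<le> C2" "\<And>a x z. 1/2 \<le> a \<Longrightarrow> a \<le> 1 \<Longrightarrow> norm z \<le> 1 \<Longrightarrow> rho x powr (m + 1) * (heat a x + heat a (x - z)) \<le> C2 * wide a (x - z)"
    using gauss_shift_bound[of "m + 1"] m by auto
  define C3 where "C3 = exp (4 * m\<^sup>2) * 4"
  note a4 = powr_neg_3_2_le_4
  show ?thesis
  proof (intro exI[of _ "C2 + 4 * L * C1 + C3"] conjI allI impI)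
    show "0 \<le> C2 + 4 * L * C1 + C3" using C1 C2 L by (simp add: C3_def)
    fix a e :: real and x y :: "real^3" assume a: "1/2 \<le> a" "a \<le> 1" and e: "0 < e"
    let ?z = "e *\<^sub>R y"
    have kr: "(min 1 (e * norm y) * wratio m e y) * rho y powr m = min 1 (norm ?z) * rho ?z powr m"
      using e by (simp add: wratio_rho mult.assoc)
    have "rho x powr m * resid a e x y \<le> (C2 + 4 * L * C1 + C3) * wide a (x - ?z) * (min 1 (norm ?z) * rho ?z powr m)"
    proof (cases "1 \<le> norm ?z")
      case True
      have b: "bump ?z = 0" and db: "dbump j ?z = 0" for j using True by (simp_all only: bump_eq_0 dbump_eq_0)
      have "resid a e x y = heat a (x - ?z)" unfolding resid_def b db by simp
      then have "rho x powr m * resid a e x y \<le> (rho (x - ?z) powr m * rho ?z powr m) * heat a (x - ?z)"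
        using rho_powr_le_diff[OF m, of x ?z] by (simp add: mult_right_mono)
      also have "\<dots> = (rho (x - ?z) powr m * heat a (x - ?z)) * rho ?z powr m" by simp
      also have "\<dots> \<le> (exp (4 * m\<^sup>2) * a powr (-(3/2)) * wide a (x - ?z)) * rho ?z powr m"
        using a m by (intro mult_right_mono rho_heat_le) auto
      also have "\<dots> \<le> (exp (4 * m\<^sup>2) * 4 * wide a (x - ?z)) * rho ?z powr m"
        using a4[OF a(1)] by (intro mult_right_mono mult_left_mono) auto
      also have "\<dots> \<le> ((C2 + 4 * L * C1 + C3) * wide a (x - ?z)) * rho ?z powr m"
        using C1 C2 L by (intro mult_right_mono) (auto simp: C3_def)
      finally show ?thesis using True by simp
    next
      case False
      then have z: "norm ?z \<le> 1" by simp
      let ?S = "heat a x + heat a (x - ?z)"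
      have z2: "(norm ?z)\<^sup>2 \<le> norm ?z" using z by (simp only: power2_eq_square) (rule mult_left_le_one_le, auto)
      have 1: "\<bar>heat a (x - ?z) - heat a x * bump ?z\<bar> \<le> norm ?z * rho x * ?S + L * norm ?z * heat a x"
      proof -
        have "\<bar>heat a (x - ?z) - heat a x * bump ?z\<bar> = \<bar>(heat a (x - ?z) - heat a x) + heat a x * (1 - bump ?z)\<bar>"
          by (simp add: algebra_simps)
        also have "\<dots> \<le> \<bar>heat a (x - ?z) - heat a x\<bar> + heat a x * \<bar>1 - bump ?z\<bar>"
          by (rule order_trans[OF abs_triangle_ineq]) (simp add: abs_mult)
        also have "\<dots> \<le> norm ?z * rho x * ?S + heat a x * (L * norm ?z)"
        proof (intro add_mono mult_left_mono gauss_diff_bound a z)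
          have "L * (norm ?z)\<^sup>2 \<le> L * norm ?z" using L z2 by (intro mult_left_mono) auto
          then show "\<bar>1 - bump ?z\<bar> \<le> L * norm ?z" using L(2)[of ?z] by linarith
        qed auto
        finally show ?thesis by (simp add: mult_ac)
      qed
      have 2: "(\<Sum>j\<in>(UNIV::3 set). norm ?z * \<bar>dbump j ?z\<bar>) \<le> 3 * L * norm ?z"
      proof -
        have "(\<Sum>j\<in>(UNIV::3 set). norm ?z * \<bar>dbump j ?z\<bar>) \<le> (\<Sum>j\<in>(UNIV::3 set). norm ?z * L)"
        proof (intro sum_mono mult_left_mono)
          fix j :: 3
          have "L * norm ?z \<le> L * 1" using L z by (intro mult_left_mono) auto
          then show "\<bar>dbump j ?z\<bar> \<le> L" using L(3)[of j ?z] by linarith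
        qed auto
        then show ?thesis by (simp add: mult_ac)
      qed
      have "resid a e x y \<le> (norm ?z * rho x * ?S + L * norm ?z * heat a x) + heat a x * (3 * L * norm ?z)"
        unfolding resid_def by (intro add_mono 1 mult_left_mono 2) auto
      also have "\<dots> = norm ?z * (rho x * ?S + 4 * L * heat a x)" by (simp add: algebra_simps)
      also have "\<dots> \<le> norm ?z * (rho x * ?S + 4 * L * ?S)"
        using L by (intro mult_left_mono add_left_mono) auto
      finally have "rho x powr m * resid a e x y \<le> rho x powr m * (norm ?z * (rho x * ?S + 4 * L * ?S))"
        by (intro mult_left_mono) auto
      also have "\<dots> = norm ?z * (rho x powr (m + 1) * ?S + 4 * L * (rho x powr m * ?S))"
        by (simp add: powr_add less_imp_le algebra_simps)
      also have "\<dots> \<le> norm ?z * (C2 * wide a (x - ?z) + 4 * L * (C1 * wide a (x - ?z)))"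
        using L by (intro mult_left_mono add_mono C1 C2 a z) auto
      also have "\<dots> = (C2 + 4 * L * C1) * wide a (x - ?z) * norm ?z" by (simp add: algebra_simps)
      also have "\<dots> \<le> (C2 + 4 * L * C1 + C3) * wide a (x - ?z) * norm ?z"
        by (intro mult_right_mono) (auto simp: C3_def)
      also have "\<dots> \<le> (C2 + 4 * L * C1 + C3) * wide a (x - ?z) * (min 1 (norm ?z) * rho ?z powr m)"
      proof (rule mult_left_mono)
        have "norm ?z * 1 \<le> norm ?z * rho ?z powr m" using rho_powr_ge1[OF m] by (intro mult_left_mono) auto
        then show "norm ?z \<le> min 1 (norm ?z) * rho ?z powr m" using z by (simp add: min_absorb2)
        show "0 \<le> (C2 + 4 * L * C1 + C3) * wide a (x - ?z)" using C1 C2 L by (simp add: C3_def)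
      qed
      finally show ?thesis .
    qed
    then show "rho x powr m * resid a e x y \<le> (C2 + 4 * L * C1 + C3) * wide a (x - e *\<^sub>R y) * ((min 1 (e * norm y) * wratio m e y) * rho y powr m)"
      unfolding kr .
  qed
qed

text \<open>
  Without the cancellation the exponent \<open>r\<close> in \<open>weighted_gauss_integral\<close> could not be
  positive; the gain \<open>min 1 (e * norm y)\<close> allows \<open>r = 4 * \<mu> - 2\<close>, and with the factor
  \<open>e\<^sup>2\<close> of the kernel the square decays like \<open>e powr (4 * \<mu>) = (exp (- \<mu> * s))\<^sup>2\<close>. The
  requirement \<open>3 < 2 * m - (4 * \<mu> - 2)\<close> is the hypothesis on \<open>m\<close>, and \<open>\<mu> \<le> 1\<close> says
  that one factor \<open>e * norm y\<close> is enough.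
\<close>

theorem expL_decay_late:
  assumes \<mu>: "0 < \<mu>" "\<mu> \<le> 1" "2 * \<mu> + 1/2 < m"
  shows "\<exists>C<\<infinity>. \<forall>s w i. 1/2 \<le> htime s \<longrightarrow> w \<in> LL2w m \<longrightarrow> wsqn m (expL s (\<lambda>y. w y $ i)) \<le> C * ennreal ((exp (- \<mu> * s))\<^sup>2) * wsqn m w"
proof -
  have m: "0 \<le> m" using \<mu> by simp
  obtain A where A: "0 \<le> A" "\<And>a e x y. 1/2 \<le> a \<Longrightarrow> a \<le> 1 \<Longrightarrow> 0 < e \<Longrightarrow>
    rho x powr m * resid a e x y \<le> A * wide a (x - e *\<^sub>R y) * ((min 1 (e * norm y) * wratio m e y) * rho y powr m)"
    using resid_bound[OF m] by blast
  obtain C where C: "C < \<infinity>" "\<And>e a x l. l\<in>borel_measurable borel \<Longrightarrow>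
     0 < e \<Longrightarrow> e \<le> 1 \<Longrightarrow> 0 < a \<Longrightarrow> a \<le> 1 \<Longrightarrow> (\<forall>y. 0 \<le> l y \<and> l y \<le> wratio m e y) \<Longrightarrow>
     (\<forall>y. e * norm y < 1 \<longrightarrow> (l y)\<^sup>2 \<le> 4 * (e * rho y / 2) powr (4 * \<mu> - 2) * (wratio m e y)\<^sup>2) \<Longrightarrow>
     (\<integral>\<^sup>+y. ennreal (wide a (x - e *\<^sub>R y)) * ennreal ((l y)\<^sup>2) \<partial>lborel) \<le> C * ennreal (e powr (4 * \<mu> - 2))"
    using weighted_gauss_integral[of m "4 * \<mu> - 2"] \<mu> by auto
  define D where "D = ennreal (A\<^sup>2 * sqrt (16 * pi) ^ 3)"
  show ?thesis
  proof (intro exI[of _ "D * C"] conjI allI impI)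
    show "D * C < \<infinity>" using C(1) by (simp add: D_def ennreal_mult_less_top)
    fix s w i assume a2: "1/2 \<le> htime s" and "w \<in> LL2w m"
    then have w: "w \<in> L2w m" "div_free w" by (auto simp: LL2w_def)
    have [measurable]: "w \<in> borel_measurable borel" using w by (simp add: L2w_measurable)
    have s: "0 < s"
    proof (rule ccontr)
      assume "\<not> 0 < s"
      then have "1 \<le> exp (- s)" by simp
      then show False using a2 unfolding htime_def by linarith
    qed
    let ?e = "shrink s" and ?a = "htime s"
    have a: "0 < ?a" "?a \<le> 1" using s by auto
    have e1: "?e \<le> 1" using s by (simp add: shrink_le1)
    define l where "l y = min 1 (?e * norm y) * wratio m ?e y" for y
    have [measurable]: "l \<in> borel_measurable borel" unfolding l_def by measurable
    have l: "0 \<le> l y" "l y \<le> wratio m ?e y" for y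
      unfolding l_def by (auto intro!: mult_left_le_one_le)
    have "wsqn m (expL s (\<lambda>y. w y $ i)) \<le> wsq m (\<lambda>x. \<integral>\<^sup>+y. ennreal \<bar>?e * resid ?a ?e x y\<bar> * (ennreal (norm (w y)) * 1) \<partial>lborel)"
      using expL_div_free_le[OF m w s] by (intro wsq_mono) simp
    also have "\<dots> \<le> ennreal ((A * ?e)\<^sup>2 * sqrt (16 * pi * ?a) ^ 3) * (C * ennreal (?e powr (4 * \<mu> - 2))) * wsqn m w"
    proof (rule kernel_estimate[where l=l and \<epsilon>="?e"])
      show "(\<integral>\<^sup>+y. ennreal (wide ?a (x - ?e *\<^sub>R y)) * (ennreal ((l y)\<^sup>2) * 1\<^sup>2) \<partial>lborel) \<le> C * ennreal (?e powr (4 * \<mu> - 2))" for x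
      proof -
        have "(\<integral>\<^sup>+y. ennreal (wide ?a (x - ?e *\<^sub>R y)) * ennreal ((l y)\<^sup>2) \<partial>lborel) \<le> C * ennreal (?e powr (4 * \<mu> - 2))"
        proof (rule C(2))
          show "\<forall>y. ?e * norm y < 1 \<longrightarrow> (l y)\<^sup>2 \<le> 4 * (?e * rho y / 2) powr (4 * \<mu> - 2) * (wratio m ?e y)\<^sup>2"
          proof (intro allI impI)
            fix y :: "real^3" assume y: "?e * norm y < 1"
            let ?t = "?e * rho y / 2"
            have t: "0 < ?t" "?t \<le> 1" using shrink_rho_le[OF _ e1 y] by auto
            have "(l y)\<^sup>2 = (?e * norm y)\<^sup>2 * (wratio m ?e y)\<^sup>2" using y unfolding l_def by (simp add: power_mult_distrib)
            also have "\<dots> \<le> (2 * ?t)\<^sup>2 * (wratio m ?e y)\<^sup>2"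
              by (intro mult_right_mono power_mono) (auto simp: rho_def)
            also have "(2 * ?t)\<^sup>2 = 4 * ?t powr 2" using t by (simp only: powr_numeral[OF less_imp_le[OF t(1)]] power_mult_distrib) simp
            also have "4 * ?t powr 2 * (wratio m ?e y)\<^sup>2 \<le> 4 * ?t powr (4 * \<mu> - 2) * (wratio m ?e y)\<^sup>2"
              using t \<mu> by (intro mult_right_mono mult_left_mono powr_mono') auto
            finally show "(l y)\<^sup>2 \<le> 4 * (?e * rho y / 2) powr (4 * \<mu> - 2) * (wratio m ?e y)\<^sup>2" .
          qed
        qed (use a e1 l in auto)
        then show ?thesis by simp
      qed
      show "rho x powr m * \<bar>?e * resid ?a ?e x y\<bar> \<le> (A * ?e) * wide ?a (x - ?e *\<^sub>R y) * (l y * rho y powr m)" for x y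
        using mult_left_mono[OF A(2)[OF a2 a(2) shrink_pos, of x s y], of ?e] unfolding l_def by (simp add: abs_mult mult_ac)
    qed (use a A l in auto)
    also have "\<dots> \<le> D * C * ennreal ((exp (- \<mu> * s))\<^sup>2) * wsqn m w"
    proof (rule mult_right_mono)
      have e: "?e\<^sup>2 * ?e powr (4 * \<mu> - 2) = (exp (- \<mu> * s))\<^sup>2"
      proof -
        have "?e\<^sup>2 * ?e powr (4 * \<mu> - 2) = ?e powr 2 * ?e powr (4 * \<mu> - 2)" by (simp add: powr_numeral)
        also have "\<dots> = (exp (- \<mu> * s))\<^sup>2"
          by (simp add: powr_add[symmetric] shrink_powr power2_eq_square exp_add[symmetric] field_simps)
        finally show ?thesis .
      qed
      have "(A * ?e)\<^sup>2 * sqrt (16 * pi * ?a) ^ 3 * ?e powr (4 * \<mu> - 2) \<le> (A * ?e)\<^sup>2 * sqrt (16 * pi) ^ 3 * ?e powr (4 * \<mu> - 2)"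
        using a by (intro mult_right_mono mult_left_mono power_mono) auto
      also have "\<dots> = A\<^sup>2 * sqrt (16 * pi) ^ 3 * (exp (- \<mu> * s))\<^sup>2"
        unfolding e[symmetric] by (simp add: power_mult_distrib mult_ac)
      finally have "ennreal ((A * ?e)\<^sup>2 * sqrt (16 * pi * ?a) ^ 3) * ennreal (?e powr (4 * \<mu> - 2)) \<le> D * ennreal ((exp (- \<mu> * s))\<^sup>2)"
        unfolding D_def using a by (simp add: ennreal_mult[symmetric] ennreal_leI)
      from mult_left_mono[OF this, of C]
      show "ennreal ((A * ?e)\<^sup>2 * sqrt (16 * pi * ?a) ^ 3) * (C * ennreal (?e powr (4 * \<mu> - 2))) \<le> D * C * ennreal ((exp (- \<mu> * s))\<^sup>2)"
        by (simp add: mult_ac)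
    qed simp
    finally show "wsqn m (expL s (\<lambda>y. w y $ i)) \<le> D * C * ennreal ((exp (- \<mu> * s))\<^sup>2) * wsqn m w" .
  qed
qed

definition expLv :: "real \<Rightarrow> (real^3 \<Rightarrow> real^3) \<Rightarrow> real^3 \<Rightarrow> real^3" where
  "expLv t w x = (\<chi> i. expL t (\<lambda>z. w z $ i) x)"

lemma borel_measurable_vec_lambda [measurable (raw)]:
  fixes f :: "'n::finite \<Rightarrow> 'a \<Rightarrow> real"
  assumes "\<And>i. f i \<in> borel_measurable M"
  shows "(\<lambda>x. \<chi> i. f i x) \<in> borel_measurable M"
proof (rule borel_measurable_euclidean_space[THEN iffD2], rule ballI)
  fix b :: "real^'n" assume "b \<in> Basis"
  then obtain i where "b = axis i 1" by (auto simp: Basis_vec_def)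
  then show "(\<lambda>x. (\<chi> i. f i x) \<bullet> b) \<in> borel_measurable M"
    using assms[of i] by (simp add: inner_axis)
qed

lemma expLv_measurable [measurable]:
  assumes [measurable]: "w \<in> borel_measurable borel" and "0 \<le> t"
  shows "expLv t w \<in> borel_measurable borel"
  unfolding expLv_def using assms(2) by measurable

text \<open>
  As long as \<open>htime t < 1/2\<close> there is nothing to gain, but the time is bounded and
  \<open>expL_bound\<close> suffices.
\<close>

theorem expLv_decay:
  assumes \<mu>: "0 < \<mu>" "\<mu> \<le> 1" "2 * \<mu> + 1/2 < m"
  shows "\<exists>C\<ge>0. \<forall>t\<ge>0. \<forall>w\<in>LL2w m. expLv t w \<in> L2w m \<and> wnorm m (expLv t w) \<le> C * exp (- \<mu> * t) * wnorm m w"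
proof -
  have m: "0 \<le> m" using \<mu> by simp
  obtain C1 where C1: "C1 < \<infinity>" "\<And>t f. 0 \<le> t \<Longrightarrow> f\<in>borel_measurable borel \<Longrightarrow> wsqn m (expL t f) \<le> C1 * ennreal (exp (t / 2)) * wsqn m f"
    using expL_bound[OF m] by blast
  obtain C2 where C2: "C2 < \<infinity>" "\<And>t w i. 1/2 \<le> htime t \<Longrightarrow> w \<in> LL2w m \<Longrightarrow> wsqn m (expL t (\<lambda>y. w y $ i)) \<le> C2 * ennreal ((exp (- \<mu> * t))\<^sup>2) * wsqn m w"
    using expL_decay_late[OF assms] by blast
  \<comment> \<open>\<open>3\<close> components; \<open>32 = 2 * 16\<close> from \<open>exp (\<sigma> / 2) \<le> 2\<close> and \<open>(exp (- \<mu> * \<sigma>))\<^sup>2 \<ge> 1/16\<close> while \<open>htime \<sigma> < 1/2\<close>\<close>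
  have "3 * (32 * C1 + C2) < \<infinity>" using C1(1) C2(1) by (simp add: ennreal_mult_less_top)
  then obtain K where K: "0 \<le> K" "3 * (32 * C1 + C2) = ennreal K" by (cases "3 * (32 * C1 + C2)") auto
  show ?thesis
  proof (intro exI[of _ "sqrt K"] conjI allI ballI impI)
    show "0 \<le> sqrt K" using K by simp
    fix t :: real and w assume t: "0 \<le> t" and w: "w \<in> LL2w m"
    have [measurable]: "w \<in> borel_measurable borel" using w by (auto simp: LL2w_def intro: L2w_measurable)
    let ?d = "ennreal ((exp (- \<mu> * t))\<^sup>2)"
    have 1: "wsqn m (expL t (\<lambda>y. w y $ i)) \<le> (32 * C1 + C2) * ?d * wsqn m w" for i
    proof (cases "1/2 \<le> htime t")
      case True
      have "wsqn m (expL t (\<lambda>y. w y $ i)) \<le> C2 * ?d * wsqn m w" by (rule C2(2)[OF True w])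
      also have "\<dots> \<le> (32 * C1 + C2) * ?d * wsqn m w" by (intro mult_right_mono) auto
      finally show ?thesis .
    next
      case False
      then have e: "1/2 \<le> shrink t" by (intro shrink_ge_half) simp
      have "exp (t / 2) * shrink t = 1" by (simp add: shrink_def exp_add[symmetric])
      then have e2: "exp (t / 2) = 1 / shrink t" by (simp add: field_simps)
      have "exp (t / 2) \<le> 2" unfolding e2 using e by (simp add: divide_simps)
      moreover have "1/16 \<le> (exp (- \<mu> * t))\<^sup>2"
      proof -
        have "1/16 = (1/2::real) powr 4" by (simp add: powr_numeral power_divide)
        also have "\<dots> \<le> (1/2::real) powr (4 * \<mu>)" using \<mu> by (intro powr_mono') auto
        also have "\<dots> \<le> shrink t powr (4 * \<mu>)" using e \<mu> by (intro powr_mono2) auto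
        also have "\<dots> = (exp (- \<mu> * t))\<^sup>2" by (simp add: shrink_powr power2_eq_square exp_add[symmetric])
        finally show ?thesis .
      qed
      ultimately have "exp (t / 2) \<le> 32 * (exp (- \<mu> * t))\<^sup>2" by linarith
      then have "ennreal (exp (t / 2)) \<le> ennreal (32 * (exp (- \<mu> * t))\<^sup>2)" by (rule ennreal_leI)
      also have "\<dots> = 32 * ?d" by (simp add: ennreal_mult')
      finally have "ennreal (exp (t / 2)) \<le> 32 * ?d" .
      have "wsqn m (expL t (\<lambda>y. w y $ i)) \<le> C1 * ennreal (exp (t / 2)) * wsqn m (\<lambda>y. w y $ i)"
        by (rule C1(2)[OF t]) simp
      also have "\<dots> \<le> C1 * (32 * ?d) * wsqn m w"
        by (intro mult_mono wsqn_component mult_left_mono \<open>ennreal (exp (t / 2)) \<le> 32 * ?d\<close>) auto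
      also have "\<dots> = (32 * C1) * ?d * wsqn m w" by (simp add: mult_ac)
      also have "\<dots> \<le> (32 * C1 + C2) * ?d * wsqn m w" by (intro mult_right_mono) auto
      finally show ?thesis .
    qed
    have "wsqn m (expLv t w) = (\<Sum>i\<in>UNIV. wsqn m (expL t (\<lambda>y. w y $ i)))"
      using t by (subst wsqn_components) (auto simp: expLv_def)
    also have "\<dots> \<le> (\<Sum>i\<in>(UNIV::3 set). (32 * C1 + C2) * ?d * wsqn m w)" by (intro sum_mono 1)
    also have "\<dots> = 3 * (32 * C1 + C2) * ?d * wsqn m w" by (simp add: mult.assoc del: distrib_left_numeral)
    also have "\<dots> = ennreal K * ?d * ennreal ((wnorm m w)\<^sup>2)"
      using w by (simp add: K(2)[symmetric] wsqn_wnorm LL2w_def)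
    also have "\<dots> = ennreal ((sqrt K * exp (- \<mu> * t) * wnorm m w)\<^sup>2)"
      using K(1) by (simp add: ennreal_mult[symmetric] power_mult_distrib)
    finally have "wsqn m (expLv t w) \<le> ennreal ((sqrt K * exp (- \<mu> * t) * wnorm m w)\<^sup>2)" .
    then show "expLv t w \<in> L2w m" "wnorm m (expLv t w) \<le> sqrt K * exp (- \<mu> * t) * wnorm m w"
      using t K by (auto intro!: wnorm_leI)
  qed
qed

section \<open>The Biot-Savart field\<close>

lemma cross3_measurable [measurable (raw)]:
  assumes [measurable]: "f \<in> borel_measurable M" "g \<in> borel_measurable M"
  shows "(\<lambda>x. cross3 (f x) (g x)) \<in> borel_measurable M"
proof -
  have "(\<lambda>p. cross3 (fst p) (snd p)) \<in> borel_measurable borel"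
    by (intro borel_measurable_continuous_onI continuous_on_cross continuous_on_fst continuous_on_snd continuous_on_id)
  from measurable_compose[OF borel_measurable_Pair[OF assms] this] show ?thesis by simp
qed

lemma norm_cross3_le: "norm (cross3 x y) \<le> norm x * norm y"
proof (rule power2_le_imp_le)
  show "(norm (cross3 x y))\<^sup>2 \<le> (norm x * norm y)\<^sup>2"
    using norm_cross[of x y] by (simp add: power_mult_distrib)
qed simp

lemma biot_savart_measurable [measurable]:
  assumes [measurable]: "w \<in> borel_measurable borel"
  shows "biot_savart w \<in> borel_measurable borel"
  unfolding biot_savart_def by measurable

lemma biot_savart_kernel_le:
  "ennreal (norm ((1 / norm (y - z) ^ 3) *\<^sub>R cross3 (y - z) v)) \<le> ennreal (1 / (norm (y - z))\<^sup>2) * ennreal (norm v)"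
proof -
  have "norm ((1 / norm (y - z) ^ 3) *\<^sub>R cross3 (y - z) v) \<le> 1 / norm (y - z) ^ 3 * (norm (y - z) * norm v)"
    by (simp add: norm_cross3_le divide_right_mono)
  also have "\<dots> = 1 / (norm (y - z))\<^sup>2 * norm v"
    by (cases "y = z") (auto simp: power2_eq_square power3_eq_cube)
  finally show ?thesis by (simp add: ennreal_mult[symmetric] ennreal_leI)
qed

text \<open>
  The Biot-Savart kernel is at most \<open>norm (\<xi> - z) powr (- 2)\<close> in absolute value, since
  \<open>cross3\<close> is bounded by the product of the norms.
\<close>

lemma biot_savart_le_riesz:
  assumes [measurable]: "w \<in> borel_measurable borel"
  shows "ennreal (norm (biot_savart w y)) \<le> riesz (\<lambda>z. ennreal (norm (w z))) y"
proof (cases "integrable lborel (\<lambda>z. (1 / norm (y - z) ^ 3) *\<^sub>R cross3 (y - z) (w z))")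
  case True
  have "norm (biot_savart w y) \<le> 1 * norm (LBINT z. (1 / norm (y - z) ^ 3) *\<^sub>R cross3 (y - z) (w z))"
    unfolding biot_savart_def norm_scaleR
    using pi_gt3 by (intro mult_right_mono) auto
  then have "ennreal (norm (biot_savart w y)) \<le> ennreal (norm (LBINT z. (1 / norm (y - z) ^ 3) *\<^sub>R cross3 (y - z) (w z)))"
    by (simp add: ennreal_leI)
  also have "\<dots> \<le> (\<integral>\<^sup>+z. ennreal (norm ((1 / norm (y - z) ^ 3) *\<^sub>R cross3 (y - z) (w z))) \<partial>lborel)"
    by (rule integral_norm_bound_ennreal[OF True])
  also have "\<dots> \<le> riesz (\<lambda>z. ennreal (norm (w z))) y"
    unfolding riesz_def by (intro nn_integral_mono biot_savart_kernel_le)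
  finally show ?thesis .
qed (simp add: biot_savart_def not_integrable_integral_eq)

lemma biot_savart_integrable:
  assumes [measurable]: "w \<in> borel_measurable borel" and "riesz (\<lambda>z. ennreal (norm (w z))) y < \<infinity>"
  shows "integrable lborel (\<lambda>z. (1 / norm (y - z) ^ 3) *\<^sub>R cross3 (y - z) (w z))"
proof (rule integrableI_bounded)
  have "(\<integral>\<^sup>+z. ennreal (norm ((1 / norm (y - z) ^ 3) *\<^sub>R cross3 (y - z) (w z))) \<partial>lborel) \<le> riesz (\<lambda>z. ennreal (norm (w z))) y"
    unfolding riesz_def by (intro nn_integral_mono biot_savart_kernel_le)
  then show "(\<integral>\<^sup>+z. ennreal (norm ((1 / norm (y - z) ^ 3) *\<^sub>R cross3 (y - z) (w z))) \<partial>lborel) < \<infinity>"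
    using assms(2) by (rule le_less_trans)
qed simp

text \<open>
  Only almost everywhere: at a point where one of the potentials is infinite the integrals are \<open>0\<close>
  by convention and linearity may fail.
\<close>

lemma biot_savart_diff_AE:
  assumes m: "0 \<le> m" and u: "u \<in> L2w m" "u' \<in> L2w m"
  shows "AE y in lborel. biot_savart (\<lambda>x. u x - u' x) y = biot_savart u y - biot_savart u' y"
proof -
  have [measurable]: "u \<in> borel_measurable borel" "u' \<in> borel_measurable borel" using u by (auto intro: L2w_measurable)
  have fin: "AE y in lborel. riesz (\<lambda>z. ennreal (norm (f z))) y < \<infinity>" if f: "f \<in> L2w m" for f :: "real^3 \<Rightarrow> real^3"
  proof (rule riesz_finite_AE)
    show "(\<lambda>z. ennreal (norm (f z))) \<in> borel_measurable borel" using L2w_measurable[OF f] by measurable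
    show "(\<integral>\<^sup>+ z. (ennreal (norm (f z)))\<^sup>2 \<partial>lborel) < \<infinity>"
      using L2_finite[OF m f] by (rule le_less_trans) simp
  qed
  from fin[OF u(1)] fin[OF u(2)] show ?thesis
  proof eventually_elim
    case (elim y)
    show ?case unfolding biot_savart_def
      using biot_savart_integrable[OF _ elim(1)] biot_savart_integrable[OF _ elim(2)]
      by (simp add: Cross3.right_diff_distrib scaleR_diff_right Bochner_Integration.integral_diff)
  qed
qed

section \<open>The integrand of the Duhamel term\<close>

text \<open>
  The tensor \<open>w\<^sub>j v\<^sub>i - v\<^sub>j w\<^sub>i\<close> whose divergence is the nonlinearity.
\<close>

definition flux :: "3 \<Rightarrow> 3 \<Rightarrow> (real^3 \<Rightarrow> real^3) \<Rightarrow> real^3 \<Rightarrow> real" where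
  "flux i j u z = u z $ j * biot_savart u z $ i - biot_savart u z $ j * u z $ i"

definition dflux :: "3 \<Rightarrow> 3 \<Rightarrow> real \<Rightarrow> (real^3 \<Rightarrow> real^3) \<Rightarrow> real^3 \<Rightarrow> real" where
  "dflux i j t u x = partial j (expL_half t (flux i j u)) x"

lemma duhamel_dflux: "duhamel w i j \<tau> x s = dflux i j (\<tau> - s) (w s) x"
  unfolding duhamel_def dflux_def flux_def ..

lemma flux_measurable [measurable]:
  assumes [measurable]: "u \<in> borel_measurable borel"
  shows "flux i j u \<in> borel_measurable borel"
  unfolding flux_def by measurable

text \<open>
  The kernel decays faster than any power of \<open>rho y\<close>, uniformly for \<open>x\<close> in a unit ball. This is
  the domination needed to differentiate under the integral.
\<close>

lemma heatD_weighted_bound: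
  assumes a: "0 < a" "a \<le> 1" and e: "0 < e" "e \<le> 1"
  shows "\<exists>K\<ge>0. \<forall>x y. norm (x - \<xi>) \<le> 1 \<longrightarrow> \<bar>heatD a j (x - e *\<^sub>R y)\<bar> \<le> K * rho y powr (-2) \<and> heat a (x - e *\<^sub>R y) \<le> K * rho y powr (-2)"
proof -
  define B where "B = max (exp (4 * 2\<^sup>2 + 4) * a powr (-2)) (exp (4 * 2\<^sup>2) * a powr (-(3/2)))"
  define K where "K = B * (2 * rho \<xi> / e) powr 2"
  have B: "0 \<le> B" by (simp add: B_def le_max_iff_disj)
  show ?thesis
  proof (intro exI[of _ K] allI impI conjI)
    show "0 \<le> K" using B by (simp add: K_def)
    fix x y :: "real^3" assume x: "norm (x - \<xi>) \<le> 1"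
    let ?z = "x - e *\<^sub>R y"
    have r: "rho y powr 2 \<le> (2 * rho \<xi> / e) powr 2 * rho ?z powr 2"
    proof -
      have "e * rho y \<le> rho (e *\<^sub>R y)" using e by (simp add: rho_def algebra_simps)
      also have "\<dots> \<le> rho x * rho (- ?z)" using rho_add_le[of x "- ?z"] by simp
      also have "rho (- ?z) = rho ?z" by (simp add: rho_def norm_minus_commute)
      also have "rho x \<le> 2 * rho \<xi>"
      proof -
        have "norm x \<le> norm \<xi> + 1" using x norm_triangle_ineq2[of x \<xi>] by simp
        moreover have "0 \<le> norm \<xi>" by simp
        ultimately show ?thesis unfolding rho_def distrib_left by linarith
      qed
      finally have "rho y \<le> (2 * rho \<xi> / e) * rho ?z" using e by (simp add: field_simps mult_right_mono less_imp_le)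
      then have "rho y powr 2 \<le> ((2 * rho \<xi> / e) * rho ?z) powr 2" by (intro powr_mono2) (auto simp: less_imp_le)
      also have "\<dots> = (2 * rho \<xi> / e) powr 2 * rho ?z powr 2" by (rule powr_mult)
      finally show ?thesis .
    qed
    have *: "f \<le> K * rho y powr (-2)" if "rho ?z powr 2 * f \<le> B" "0 \<le> f" for f
    proof -
      have "rho y powr 2 * f \<le> ((2 * rho \<xi> / e) powr 2 * rho ?z powr 2) * f" using r that by (intro mult_right_mono) auto
      also have "\<dots> = (2 * rho \<xi> / e) powr 2 * (rho ?z powr 2 * f)" by simp
      also have "\<dots> \<le> (2 * rho \<xi> / e) powr 2 * B" using that by (intro mult_left_mono) auto
      finally have "rho y powr 2 * f \<le> K" by (simp add: K_def mult.commute)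
      then show ?thesis by (simp add: powr_minus field_simps)
    qed
    have "rho ?z powr 2 * \<bar>heatD a j ?z\<bar> \<le> exp (4 * 2\<^sup>2 + 4) * a powr (-2) * wide a ?z" using a by (intro rho_heatD_le) auto
    also have "\<dots> \<le> exp (4 * 2\<^sup>2 + 4) * a powr (-2) * 1" using wide_le1[OF a(1)] by (intro mult_left_mono) auto
    also have "\<dots> \<le> B" by (simp add: B_def)
    finally show "\<bar>heatD a j ?z\<bar> \<le> K * rho y powr (-2)" by (intro *) auto
    have "rho ?z powr 2 * heat a ?z \<le> exp (4 * 2\<^sup>2) * a powr (-(3/2)) * wide a ?z" using a by (intro rho_heat_le) auto
    also have "\<dots> \<le> exp (4 * 2\<^sup>2) * a powr (-(3/2)) * 1" using wide_le1[OF a(1)] by (intro mult_left_mono) auto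
    also have "\<dots> \<le> B" by (simp add: B_def)
    finally show "heat a ?z \<le> K * rho y powr (-2)" by (intro *) auto
  qed
qed

lemma weighted_integrable_mult:
  fixes f g :: "real^3 \<Rightarrow> real"
  assumes [measurable]: "f \<in> borel_measurable borel" "g \<in> borel_measurable borel"
    and f: "integrable lborel (\<lambda>y. rho y powr (-2) * f y)" and g: "\<And>y. \<bar>g y\<bar> \<le> K * rho y powr (-2)"
  shows "integrable lborel (\<lambda>y. g y * f y)"
proof (rule Bochner_Integration.integrable_bound)
  show "integrable lborel (\<lambda>y. K * (rho y powr (-2) * f y))" using f by simp
  show "AE y in lborel. norm (g y * f y) \<le> norm (K * (rho y powr (-2) * f y))"
  proof (rule AE_I2)
    fix y
    have "\<bar>g y\<bar> * \<bar>f y\<bar> \<le> \<bar>K * rho y powr (-2)\<bar> * \<bar>f y\<bar>" using g[of y] by (intro mult_right_mono) auto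
    then show "norm (g y * f y) \<le> norm (K * (rho y powr (-2) * f y))" by (simp add: abs_mult)
  qed
qed simp

text \<open>
  Differentiation under the integral sign. The hypothesis on \<open>f\<close> is what \<open>riesz_mult_weighted\<close>
  provides for the flux, which need not be integrable itself.
\<close>

lemma partial_expL_half:
  assumes [measurable]: "f \<in> borel_measurable borel" and f: "integrable lborel (\<lambda>y. rho y powr (-2) * f y)" and s: "0 < s"
  shows "partial j (expL_half s f) \<xi> = (LBINT y. (shrink s)\<^sup>2 * heatD (htime s) j (\<xi> - shrink s *\<^sub>R y) * f y)"
    and "integrable lborel (\<lambda>y. (shrink s)\<^sup>2 * heatD (htime s) j (\<xi> - shrink s *\<^sub>R y) * f y)"
proof -
  let ?e = "shrink s" and ?a = "htime s" and ?b = "axis j 1 :: real^3"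
  have a: "0 < ?a" "?a \<le> 1" and e: "0 < ?e" "?e \<le> 1" using s by (auto simp: shrink_le1)
  obtain K where K: "0 \<le> K" "\<And>x y. norm (x - \<xi>) \<le> 1 \<Longrightarrow> \<bar>heatD ?a j (x - ?e *\<^sub>R y)\<bar> \<le> K * rho y powr (-2)"
     "\<And>x y. norm (x - \<xi>) \<le> 1 \<Longrightarrow> heat ?a (x - ?e *\<^sub>R y) \<le> K * rho y powr (-2)"
    using heatD_weighted_bound[OF a e, of \<xi> j] by blast
  have ID: "integrable lborel (\<lambda>y. heatD ?a j (\<xi> - ?e *\<^sub>R y) * f y)"
    using K by (intro weighted_integrable_mult[OF _ _ f, where K=K]) auto
  then have ID': "integrable lborel (\<lambda>y. ?e\<^sup>2 * (heatD ?a j (\<xi> - ?e *\<^sub>R y) * f y))" by simp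
  then show "integrable lborel (\<lambda>y. ?e\<^sup>2 * heatD ?a j (\<xi> - ?e *\<^sub>R y) * f y)" by (simp only: mult.assoc)
  have IG: "integrable lborel (\<lambda>y. heat ?a (x - ?e *\<^sub>R y) * f y)" if "norm (x - \<xi>) \<le> 1" for x
    using K that by (intro weighted_integrable_mult[OF _ _ f, where K=K]) auto
  define F where "F t = (LBINT y. heat ?a (\<xi> + t *\<^sub>R ?b - ?e *\<^sub>R y) * f y)" for t
  have eqF: "expL_half s f (\<xi> + t *\<^sub>R ?b) = ?e\<^sup>2 * F t" for t
  proof -
    have "expL_half s f (\<xi> + t *\<^sub>R ?b) = ?e * (LBINT y. ?e * (heat ?a (\<xi> + t *\<^sub>R ?b - ?e *\<^sub>R y) * f y))"
      unfolding expL_half_def using s by (simp only: expL_eq assms(1) shrink_def mult.assoc)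
    then show ?thesis by (simp add: F_def power2_eq_square)
  qed
  have D: "(F has_real_derivative (LBINT y. heatD ?a j (\<xi> - ?e *\<^sub>R y) * f y)) (at 0)"
    unfolding has_field_derivative_iff tendsto_at_iff_sequentially
  proof (intro allI impI)
    fix X :: "nat \<Rightarrow> real" assume X: "\<forall>i. X i \<in> UNIV - {0}" "X \<longlonglongrightarrow> 0"
    have "\<forall>\<^sub>F n in sequentially. \<bar>X n\<bar> < 1" using order_tendstoD(2)[OF tendsto_rabs[OF X(2)], of 1] by simp
    then obtain N where N: "\<And>n. N \<le> n \<Longrightarrow> \<bar>X n\<bar> < 1" by (auto simp: eventually_sequentially)
    define Y where "Y n = X (n + N)" for n
    have Y: "Y n \<noteq> 0" "\<bar>Y n\<bar> < 1" for n using X(1) N[of "n + N"] by (auto simp: Y_def)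
    have Y0: "Y \<longlonglongrightarrow> 0" unfolding Y_def using LIMSEQ_ignore_initial_segment[OF X(2)] .
    define q where "q n y = (heat ?a (\<xi> + Y n *\<^sub>R ?b - ?e *\<^sub>R y) - heat ?a (\<xi> - ?e *\<^sub>R y)) / Y n" for n y
    have der: "((\<lambda>t. heat ?a (\<xi> + t *\<^sub>R ?b - ?e *\<^sub>R y)) has_real_derivative heatD ?a j (\<xi> + t *\<^sub>R ?b - ?e *\<^sub>R y)) (at t)" for t y
    proof -
      have "((\<lambda>t. \<xi> + t *\<^sub>R ?b - ?e *\<^sub>R y) has_derivative (\<lambda>t. t *\<^sub>R ?b)) (at t)"
        by (auto intro!: derivative_eq_intros)
      from has_derivative_compose[OF this heat_derivative]
      have *: "((\<lambda>t. heat ?a (\<xi> + t *\<^sub>R ?b - ?e *\<^sub>R y)) has_derivative (\<lambda>h. \<Sum>k\<in>UNIV. heatD ?a k (\<xi> + t *\<^sub>R ?b - ?e *\<^sub>R y) * (h *\<^sub>R ?b) $ k)) (at t)" .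
      have "(\<Sum>k\<in>UNIV. heatD ?a k x * (h *\<^sub>R ?b) $ k) = heatD ?a j x * h" for x h
      proof -
        have "heatD ?a k x * (h *\<^sub>R ?b) $ k = (if j = k then heatD ?a k x * h else 0)" for k by (simp add: axis_def)
        then show ?thesis by simp
      qed
      with * show ?thesis by (simp add: has_field_derivative_def)
    qed
    have qb: "\<bar>q n y\<bar> \<le> K * rho y powr (-2)" for n y
    proof -
      obtain t where t: "\<bar>t\<bar> < 1" "heat ?a (\<xi> + Y n *\<^sub>R ?b - ?e *\<^sub>R y) - heat ?a (\<xi> - ?e *\<^sub>R y) = Y n * heatD ?a j (\<xi> + t *\<^sub>R ?b - ?e *\<^sub>R y)"
      proof (cases "0 < Y n")
        case True
        from MVT2[OF True der, of y] obtain z where "0 < z" "z < Y n"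
          "heat ?a (\<xi> + Y n *\<^sub>R ?b - ?e *\<^sub>R y) - heat ?a (\<xi> + 0 *\<^sub>R ?b - ?e *\<^sub>R y) = (Y n - 0) * heatD ?a j (\<xi> + z *\<^sub>R ?b - ?e *\<^sub>R y)" by auto
        then show ?thesis using that[of z] Y(2)[of n] by auto
      next
        case False
        then have "Y n < 0" using Y(1)[of n] by linarith
        from MVT2[OF this der, of y] obtain z where "Y n < z" "z < 0"
          "heat ?a (\<xi> + 0 *\<^sub>R ?b - ?e *\<^sub>R y) - heat ?a (\<xi> + Y n *\<^sub>R ?b - ?e *\<^sub>R y) = (0 - Y n) * heatD ?a j (\<xi> + z *\<^sub>R ?b - ?e *\<^sub>R y)" by auto
        then show ?thesis using that[of z] Y(2)[of n] by (auto simp: algebra_simps)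
      qed
      have "\<bar>q n y\<bar> = \<bar>heatD ?a j (\<xi> + t *\<^sub>R ?b - ?e *\<^sub>R y)\<bar>" unfolding q_def t(2) using Y(1)[of n] by simp
      also have "\<dots> \<le> K * rho y powr (-2)" using t(1) by (intro K) (simp add: norm_axis_1)
      finally show ?thesis .
    qed
    have lim: "(\<lambda>n. LBINT y. q n y * f y) \<longlonglongrightarrow> (LBINT y. heatD ?a j (\<xi> - ?e *\<^sub>R y) * f y)"
    proof (rule integral_dominated_convergence[where w="\<lambda>y. K * \<bar>rho y powr (-2) * f y\<bar>"])
      show "(\<lambda>y. heatD ?a j (\<xi> - ?e *\<^sub>R y) * f y) \<in> borel_measurable lborel" by measurable
      show "(\<lambda>y. q n y * f y) \<in> borel_measurable lborel" for n unfolding q_def by measurable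
      show "integrable lborel (\<lambda>y. K * \<bar>rho y powr (-2) * f y\<bar>)" using f by (intro integrable_mult_right integrable_abs)
      show "AE y in lborel. (\<lambda>n. q n y * f y) \<longlonglongrightarrow> heatD ?a j (\<xi> - ?e *\<^sub>R y) * f y"
      proof (intro AE_I2 tendsto_mult tendsto_const)
        fix y
        have "((\<lambda>h. (heat ?a (\<xi> + (0 + h) *\<^sub>R ?b - ?e *\<^sub>R y) - heat ?a (\<xi> + 0 *\<^sub>R ?b - ?e *\<^sub>R y)) / h) \<longlongrightarrow> heatD ?a j (\<xi> + 0 *\<^sub>R ?b - ?e *\<^sub>R y)) (at 0)"
          using der[of y 0] unfolding DERIV_def .
        moreover have "filterlim Y (at 0) sequentially" using Y0 Y(1) by (auto simp: filterlim_at)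
        ultimately have "(\<lambda>n. (heat ?a (\<xi> + (0 + Y n) *\<^sub>R ?b - ?e *\<^sub>R y) - heat ?a (\<xi> + 0 *\<^sub>R ?b - ?e *\<^sub>R y)) / Y n) \<longlonglongrightarrow> heatD ?a j (\<xi> + 0 *\<^sub>R ?b - ?e *\<^sub>R y)"
          by (rule filterlim_compose)
        then show "(\<lambda>n. q n y) \<longlonglongrightarrow> heatD ?a j (\<xi> - ?e *\<^sub>R y)" unfolding q_def by simp
      qed
      show "AE y in lborel. norm (q n y * f y) \<le> K * \<bar>rho y powr (-2) * f y\<bar>" for n
      proof (rule AE_I2)
        fix y
        have "\<bar>q n y\<bar> * \<bar>f y\<bar> \<le> (K * rho y powr (-2)) * \<bar>f y\<bar>" by (intro mult_right_mono qb) auto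
        then show "norm (q n y * f y) \<le> K * \<bar>rho y powr (-2) * f y\<bar>" by (simp add: abs_mult)
      qed
    qed
    have "(LBINT y. q n y * f y) = (F (Y n) - F 0) / (Y n - 0)" for n
    proof -
      have 1: "norm (\<xi> + Y n *\<^sub>R ?b - \<xi>) \<le> 1" using Y(2)[of n] by (simp add: norm_axis_1)
      have "(LBINT y. q n y * f y) = (LBINT y. (heat ?a (\<xi> + Y n *\<^sub>R ?b - ?e *\<^sub>R y) * f y - heat ?a (\<xi> - ?e *\<^sub>R y) * f y) / Y n)"
        unfolding q_def by (simp add: left_diff_distrib diff_divide_distrib)
      also have "\<dots> = (F (Y n) - F 0) / Y n"
        unfolding F_def using IG[OF 1] IG[of \<xi>] by (simp add: Bochner_Integration.integral_diff)
      finally show ?thesis by simp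
    qed
    then have "(\<lambda>n. ((\<lambda>y. (F y - F 0) / (y - 0)) \<circ> X) (n + N)) \<longlonglongrightarrow> (LBINT y. heatD ?a j (\<xi> - ?e *\<^sub>R y) * f y)"
      using lim by (simp add: Y_def o_def)
    then show "((\<lambda>y. (F y - F 0) / (y - 0)) \<circ> X) \<longlonglongrightarrow> (LBINT y. heatD ?a j (\<xi> - ?e *\<^sub>R y) * f y)"
      by (rule LIMSEQ_offset)
  qed
  have "((\<lambda>t. expL_half s f (\<xi> + t *\<^sub>R ?b)) has_real_derivative ?e\<^sup>2 * (LBINT y. heatD ?a j (\<xi> - ?e *\<^sub>R y) * f y)) (at 0)"
    unfolding eqF using DERIV_cmult[OF D] by simp
  then show "partial j (expL_half s f) \<xi> = (LBINT y. ?e\<^sup>2 * heatD ?a j (\<xi> - ?e *\<^sub>R y) * f y)"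
    unfolding partial_def by (simp add: DERIV_imp_deriv mult.assoc)
qed

text \<open>
  The flux is bilinear; a difference is written as \<open>(u - u') v + u' (v - v')\<close>.
\<close>

lemma flux_diff_AE:
  assumes m: "0 \<le> m" and u: "u \<in> L2w m" "u' \<in> L2w m"
  shows "AE y in lborel. ennreal \<bar>flux i j u y - flux i j u' y\<bar> \<le>
    2 * (ennreal (norm (u y - u' y)) * riesz (\<lambda>\<eta>. ennreal (norm (u \<eta>))) y + ennreal (norm (u' y)) * riesz (\<lambda>\<eta>. ennreal (norm (u \<eta> - u' \<eta>))) y)"
  using biot_savart_diff_AE[OF assms]
proof eventually_elim
  case (elim y)
  have [measurable]: "u \<in> borel_measurable borel" "u' \<in> borel_measurable borel" using u by (auto intro: L2w_measurable)
  let ?d = "u y - u' y" and ?b = "biot_savart u y" and ?c = "biot_savart (\<lambda>x. u x - u' x) y"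
  have 1: "flux i j u y - flux i j u' y = ?d $ j * ?b $ i + u' y $ j * ?c $ i - (?b $ j * ?d $ i + ?c $ j * u' y $ i)"
    unfolding flux_def elim by (simp add: algebra_simps)
  have prod: "\<bar>x $ k * z $ l\<bar> \<le> norm x * norm z" for x z :: "real^3" and k l
    unfolding abs_mult by (intro mult_mono component_le_norm_cart) auto
  have "\<bar>flux i j u y - flux i j u' y\<bar> \<le> 2 * (norm ?d * norm ?b + norm (u' y) * norm ?c)"
    unfolding 1 using prod[of ?d j ?b i] prod[of "u' y" j ?c i] prod[of ?b j ?d i] prod[of ?c j "u' y" i]
    by (simp add: mult.commute[of "norm ?b"] mult.commute[of "norm ?c"] abs_le_iff)
  then have "ennreal \<bar>flux i j u y - flux i j u' y\<bar> \<le> 2 * (ennreal (norm ?d) * ennreal (norm ?b) + ennreal (norm (u' y)) * ennreal (norm ?c))"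
    using ennreal_leI by (fastforce simp: ennreal_mult ennreal_plus)
  also have "\<dots> \<le> 2 * (ennreal (norm ?d) * riesz (\<lambda>\<eta>. ennreal (norm (u \<eta>))) y + ennreal (norm (u' y)) * riesz (\<lambda>\<eta>. ennreal (norm (u \<eta> - u' \<eta>))) y)"
    by (intro mult_left_mono add_mono biot_savart_le_riesz) auto
  finally show ?case .
qed

lemma ennreal_le_from_sq:
  assumes "x\<^sup>2 \<le> ennreal c * (ennreal r)\<^sup>2 * (ennreal s)\<^sup>2" "0 \<le> c" "0 \<le> r" "0 \<le> s"
  shows "x \<le> ennreal (sqrt c * r * s)"
proof (rule ennreal_sq_le_imp_le)
  have "(ennreal (sqrt c * r * s))\<^sup>2 = ennreal c * (ennreal r)\<^sup>2 * (ennreal s)\<^sup>2"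
    using assms(2-) by (simp add: ennreal_power ennreal_mult[symmetric] power_mult_distrib)
  then show "x\<^sup>2 \<le> (ennreal (sqrt c * r * s))\<^sup>2" using assms(1) by simp
qed

lemma flux_weighted_diff:
  assumes m: "0 \<le> m"
  shows "\<exists>C\<ge>0. \<forall>i j. \<forall>u\<in>L2w m. \<forall>u'\<in>L2w m. (\<integral>\<^sup>+y. ennreal (rho y powr (-2)) * ennreal \<bar>flux i j u y - flux i j u' y\<bar> \<partial>lborel)
     \<le> ennreal (C * ((wnorm m u + wnorm m u') * wnorm m (\<lambda>x. u x - u' x)))"
proof -
  obtain C0 where C0: "C0 < \<infinity>" "\<And>p q. p \<in> borel_measurable borel \<Longrightarrow> q \<in> borel_measurable borel \<Longrightarrow>
       (\<integral>\<^sup>+y. ennreal (rho y powr (-2)) * (p y * riesz q y) \<partial>lborel)\<^sup>2 \<le> C0 * (\<integral>\<^sup>+z. (p z)\<^sup>2 \<partial>lborel) * (\<integral>\<^sup>+z. (q z)\<^sup>2 \<partial>lborel)"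
    using riesz_mult_weighted by blast
  obtain c where c: "0 \<le> c" "C0 = ennreal c" using C0(1) by (cases C0) auto
  have I: "(\<integral>\<^sup>+y. ennreal (rho y powr (-2)) * (ennreal (norm (f y)) * riesz (\<lambda>z. ennreal (norm (g z))) y) \<partial>lborel) \<le> ennreal (sqrt c * wnorm m f * wnorm m g)"
    if f: "f \<in> L2w m" and g: "g \<in> L2w m" for f g :: "real^3 \<Rightarrow> real^3"
  proof (rule ennreal_le_from_sq)
    have [measurable]: "f \<in> borel_measurable borel" "g \<in> borel_measurable borel" using f g by (auto intro: L2w_measurable)
    have "(\<integral>\<^sup>+y. ennreal (rho y powr (-2)) * (ennreal (norm (f y)) * riesz (\<lambda>z. ennreal (norm (g z))) y) \<partial>lborel)\<^sup>2
       \<le> C0 * (\<integral>\<^sup>+z. (ennreal (norm (f z)))\<^sup>2 \<partial>lborel) * (\<integral>\<^sup>+z. (ennreal (norm (g z)))\<^sup>2 \<partial>lborel)"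
      by (rule C0) auto
    also have "\<dots> \<le> C0 * ennreal ((wnorm m f)\<^sup>2) * ennreal ((wnorm m g)\<^sup>2)"
      by (intro mult_mono L2_finite m f g) auto
    finally show "(\<integral>\<^sup>+y. ennreal (rho y powr (-2)) * (ennreal (norm (f y)) * riesz (\<lambda>z. ennreal (norm (g z))) y) \<partial>lborel)\<^sup>2
      \<le> ennreal c * (ennreal (wnorm m f))\<^sup>2 * (ennreal (wnorm m g))\<^sup>2" by (simp add: c ennreal_power)
  qed (use c in auto)
  show ?thesis
  proof (intro exI[of _ "2 * sqrt c"] conjI allI ballI)
    show "0 \<le> 2 * sqrt c" using c by simp
    fix i j and u u' :: "real^3 \<Rightarrow> real^3" assume u: "u \<in> L2w m" "u' \<in> L2w m"
    have [measurable]: "u \<in> borel_measurable borel" "u' \<in> borel_measurable borel" using u by (auto intro: L2w_measurable)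
    let ?P = "\<lambda>y. ennreal (norm (u y - u' y)) * riesz (\<lambda>z. ennreal (norm (u z))) y"
    let ?R = "\<lambda>y. ennreal (norm (u' y)) * riesz (\<lambda>z. ennreal (norm (u z - u' z))) y"
    let ?r = "\<lambda>y. ennreal (rho y powr (-2))"
    have "(\<integral>\<^sup>+y. ?r y * ennreal \<bar>flux i j u y - flux i j u' y\<bar> \<partial>lborel) \<le> (\<integral>\<^sup>+y. 2 * (?r y * ?P y + ?r y * ?R y) \<partial>lborel)"
      using flux_diff_AE[OF m u, of i j]
    proof (intro nn_integral_mono_AE, eventually_elim)
      case (elim y)
      from mult_left_mono[OF elim(2), of "?r y"] show ?case by (simp add: distrib_left mult_ac)
    qed
    also have "\<dots> = 2 * ((\<integral>\<^sup>+y. ?r y * ?P y \<partial>lborel) + (\<integral>\<^sup>+y. ?r y * ?R y \<partial>lborel))"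
      by (subst nn_integral_cmult, measurable) (subst nn_integral_add; simp)
    also have "\<dots> \<le> 2 * (ennreal (sqrt c * wnorm m (\<lambda>x. u x - u' x) * wnorm m u) + ennreal (sqrt c * wnorm m u' * wnorm m (\<lambda>x. u x - u' x)))"
      by (intro mult_left_mono add_mono I L2w_diff u) auto
    also have "\<dots> = ennreal (2 * (sqrt c * wnorm m (\<lambda>x. u x - u' x) * wnorm m u + sqrt c * wnorm m u' * wnorm m (\<lambda>x. u x - u' x)))"
      using c by (simp add: ennreal_mult ennreal_plus)
    also have "2 * (sqrt c * wnorm m (\<lambda>x. u x - u' x) * wnorm m u + sqrt c * wnorm m u' * wnorm m (\<lambda>x. u x - u' x))
      = 2 * sqrt c * ((wnorm m u + wnorm m u') * wnorm m (\<lambda>x. u x - u' x))" by (simp add: algebra_simps)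
    finally show "(\<integral>\<^sup>+y. ?r y * ennreal \<bar>flux i j u y - flux i j u' y\<bar> \<partial>lborel) \<le> ennreal (2 * sqrt c * ((wnorm m u + wnorm m u') * wnorm m (\<lambda>x. u x - u' x)))" .
  qed
qed

lemma flux_zero [simp]: "flux i j (\<lambda>_. 0) y = 0"
  by (simp add: flux_def)

lemma flux_integrable:
  assumes m: "0 \<le> m" and u: "u \<in> L2w m"
  shows "integrable lborel (\<lambda>y. rho y powr (-2) * flux i j u y)"
proof (rule integrableI_bounded)
  have [measurable]: "u \<in> borel_measurable borel" using u by (auto intro: L2w_measurable)
  show "(\<lambda>y. rho y powr (-2) * flux i j u y) \<in> borel_measurable lborel" by measurable
  obtain C where C: "\<And>i j u u'. u\<in>L2w m \<Longrightarrow> u'\<in>L2w m \<Longrightarrow> (\<integral>\<^sup>+y. ennreal (rho y powr (-2)) * ennreal \<bar>flux i j u y - flux i j u' y\<bar> \<partial>lborel)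
     \<le> ennreal (C * ((wnorm m u + wnorm m u') * wnorm m (\<lambda>x. u x - u' x)))"
    using flux_weighted_diff[OF m] by blast
  have "(\<integral>\<^sup>+y. ennreal (norm (rho y powr (-2) * flux i j u y)) \<partial>lborel) = (\<integral>\<^sup>+y. ennreal (rho y powr (-2)) * ennreal \<bar>flux i j u y - flux i j (\<lambda>_. 0) y\<bar> \<partial>lborel)"
    by (simp add: abs_mult ennreal_mult)
  also have "\<dots> \<le> ennreal (C * ((wnorm m u + wnorm m (\<lambda>_. 0::real^3)) * wnorm m (\<lambda>x. u x - 0)))"
    using C[OF u, of "\<lambda>_. 0"] by simp
  also have "\<dots> < \<infinity>" by simp
  finally show "(\<integral>\<^sup>+y. ennreal (norm (rho y powr (-2) * flux i j u y)) \<partial>lborel) < \<infinity>" .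
qed

lemma dflux_eq:
  assumes m: "0 \<le> m" and u: "u \<in> L2w m" and t: "0 < t"
  shows "dflux i j t u x = (LBINT y. (shrink t)\<^sup>2 * heatD (htime t) j (x - shrink t *\<^sub>R y) * flux i j u y)"
    and "integrable lborel (\<lambda>y. (shrink t)\<^sup>2 * heatD (htime t) j (x - shrink t *\<^sub>R y) * flux i j u y)"
  using partial_expL_half[OF flux_measurable[OF L2w_measurable[OF u]] flux_integrable[OF m u] t]
  unfolding dflux_def by auto

lemma dflux_zero: "0 < t \<Longrightarrow> dflux i j t (\<lambda>_. 0) x = 0"
  using dflux_eq(1)[of 0 "\<lambda>_. 0"] by simp

lemma dflux_diff_le_heatD_op:
  assumes m: "0 \<le> m" and u: "u \<in> L2w m" "u' \<in> L2w m" and t: "0 < t"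
  shows "ennreal \<bar>dflux i j t u x - dflux i j t u' x\<bar> \<le> heatD_op j t (\<lambda>y. ennreal \<bar>flux i j u y - flux i j u' y\<bar>) x"
proof -
  have "dflux i j t u x - dflux i j t u' x = (LBINT y. (shrink t)\<^sup>2 * heatD (htime t) j (x - shrink t *\<^sub>R y) * (flux i j u y - flux i j u' y))"
    unfolding right_diff_distrib dflux_eq(1)[OF m u(1) t] dflux_eq(1)[OF m u(2) t]
    by (rule Bochner_Integration.integral_diff[OF dflux_eq(2)[OF m u(1) t] dflux_eq(2)[OF m u(2) t], symmetric])
  then have "ennreal \<bar>dflux i j t u x - dflux i j t u' x\<bar> \<le> (\<integral>\<^sup>+y. ennreal \<bar>(shrink t)\<^sup>2 * heatD (htime t) j (x - shrink t *\<^sub>R y) * (flux i j u y - flux i j u' y)\<bar> \<partial>lborel)"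
    by (simp only: ennreal_abs_integral_le)
  also have "\<dots> = heatD_op j t (\<lambda>y. ennreal \<bar>flux i j u y - flux i j u' y\<bar>) x"
    unfolding heatD_op_def abs_mult[of "_ * _" "_ - _"] by (simp add: ennreal_mult)
  finally show ?thesis .
qed

text \<open>
  Continuity of the integrand at a fixed point and time, with a constant that may depend on both. It
  serves only for measurability in time.
\<close>

lemma dflux_pointwise_diff:
  assumes m: "0 \<le> m" and t: "0 < t"
  shows "\<exists>C\<ge>0. \<forall>u\<in>L2w m. \<forall>u'\<in>L2w m. \<bar>dflux i j t u \<xi> - dflux i j t u' \<xi>\<bar> \<le> C * ((wnorm m u + wnorm m u') * wnorm m (\<lambda>x. u x - u' x))"
proof -
  obtain C where C: "0 \<le> C" "\<And>i j u u'. u\<in>L2w m \<Longrightarrow> u'\<in>L2w m \<Longrightarrow> (\<integral>\<^sup>+y. ennreal (rho y powr (-2)) * ennreal \<bar>flux i j u y - flux i j u' y\<bar> \<partial>lborel)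
     \<le> ennreal (C * ((wnorm m u + wnorm m u') * wnorm m (\<lambda>x. u x - u' x)))"
    using flux_weighted_diff[OF m] by blast
  obtain K where K: "0 \<le> K" "\<And>y. \<bar>heatD (htime t) j (\<xi> - shrink t *\<^sub>R y)\<bar> \<le> K * rho y powr (-2)"
    using heatD_weighted_bound[of "htime t" "shrink t" \<xi> j] t shrink_le1[of t] by fastforce
  let ?K = "(shrink t)\<^sup>2 * K"
  show ?thesis
  proof (intro exI[of _ "?K * C"] conjI ballI)
    show "0 \<le> ?K * C" using K C by simp
    fix u u' :: "real^3 \<Rightarrow> real^3" assume u: "u \<in> L2w m" "u' \<in> L2w m"
    have [measurable]: "u \<in> borel_measurable borel" "u' \<in> borel_measurable borel" using u by (auto intro: L2w_measurable)
    have "ennreal \<bar>dflux i j t u \<xi> - dflux i j t u' \<xi>\<bar> \<le> heatD_op j t (\<lambda>y. ennreal \<bar>flux i j u y - flux i j u' y\<bar>) \<xi>"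
      by (rule dflux_diff_le_heatD_op[OF m u t])
    also have "\<dots> \<le> (\<integral>\<^sup>+y. ennreal ?K * (ennreal (rho y powr (-2)) * ennreal \<bar>flux i j u y - flux i j u' y\<bar>) \<partial>lborel)"
      unfolding heatD_op_def
    proof (rule nn_integral_mono)
      fix y
      have "\<bar>(shrink t)\<^sup>2 * heatD (htime t) j (\<xi> - shrink t *\<^sub>R y)\<bar> \<le> ?K * rho y powr (-2)"
        using mult_left_mono[OF K(2)[of y], of "(shrink t)\<^sup>2"] by (simp add: abs_mult mult.assoc)
      then have "ennreal \<bar>(shrink t)\<^sup>2 * heatD (htime t) j (\<xi> - shrink t *\<^sub>R y)\<bar> \<le> ennreal ?K * ennreal (rho y powr (-2))"
        using K(1) by (simp add: ennreal_mult[symmetric] ennreal_leI)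
      then show "ennreal \<bar>(shrink t)\<^sup>2 * heatD (htime t) j (\<xi> - shrink t *\<^sub>R y)\<bar> * ennreal \<bar>flux i j u y - flux i j u' y\<bar>
        \<le> ennreal ?K * (ennreal (rho y powr (-2)) * ennreal \<bar>flux i j u y - flux i j u' y\<bar>)"
        unfolding mult.assoc[symmetric] by (rule mult_right_mono) simp
    qed
    also have "\<dots> = ennreal ?K * (\<integral>\<^sup>+y. ennreal (rho y powr (-2)) * ennreal \<bar>flux i j u y - flux i j u' y\<bar> \<partial>lborel)"
      by (rule nn_integral_cmult) measurable
    also have "\<dots> \<le> ennreal ?K * ennreal (C * ((wnorm m u + wnorm m u') * wnorm m (\<lambda>x. u x - u' x)))"
      by (intro mult_left_mono C u) auto
    also have "\<dots> = ennreal (?K * C * ((wnorm m u + wnorm m u') * wnorm m (\<lambda>x. u x - u' x)))"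
      using K C by (simp add: ennreal_mult[symmetric] mult.assoc)
    finally show "\<bar>dflux i j t u \<xi> - dflux i j t u' \<xi>\<bar> \<le> ?K * C * ((wnorm m u + wnorm m u') * wnorm m (\<lambda>x. u x - u' x))"
      using K C by (simp add: ennreal_le_iff)
  qed
qed

text \<open>
  The decay and the singularity in time of the integrand of the Duhamel term.
\<close>

definition tker :: "real \<Rightarrow> real \<Rightarrow> real" where
  "tker \<mu> t = exp (- \<mu> * t) * htime t powr (-(7/8))"

lemma tker_nonneg [simp]: "0 \<le> tker \<mu> t" by (simp add: tker_def)

lemma htime_measurable [measurable]: "htime \<in> borel_measurable borel" and shrink_measurable [measurable]: "shrink \<in> borel_measurable borel"
  unfolding htime_def shrink_def by measurable

lemma tker_measurable [measurable]: "tker \<mu> \<in> borel_measurable borel"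
  unfolding tker_def by measurable

text \<open>
  The difference of two fluxes is a sum of two products of a field and a Riesz potential, and
  \<open>bilinear_kernel_estimate\<close> applies to each of them.
\<close>

theorem dflux_norm_diff:
  assumes \<mu>: "0 < \<mu>" "\<mu> \<le> 1" "2 * \<mu> + 1/2 < m"
  shows "\<exists>K\<ge>0. \<forall>i j t. \<forall>u\<in>L2w m. \<forall>u'\<in>L2w m. 0 < t \<longrightarrow>
    wsqn m (\<lambda>\<xi>. dflux i j t u \<xi> - dflux i j t u' \<xi>) \<le> ennreal ((K * (tker \<mu> t * ((wnorm m u + wnorm m u') * wnorm m (\<lambda>x. u x - u' x))))\<^sup>2)"
proof -
  have m: "0 \<le> m" using \<mu> by simp
  obtain C where C: "C < \<infinity>" "\<And>j t p q. p\<in>borel_measurable borel \<Longrightarrow> q\<in>borel_measurable borel \<Longrightarrow> 0 < t \<Longrightarrow>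
     wsq m (heatD_op j t (\<lambda>y. p y * riesz q y)) \<le> C * ennreal ((exp (- \<mu> * t) * htime t powr (-(7/8)))\<^sup>2) * wsq m p * (\<integral>\<^sup>+y. (q y)\<^sup>2 \<partial>lborel)"
    using bilinear_kernel_estimate[OF assms] by blast
  obtain c where c: "0 \<le> c" "C = ennreal c" using C(1) by (cases C) auto
  show ?thesis
  proof (intro exI[of _ "sqrt (8 * c)"] conjI allI ballI impI)
    show "0 \<le> sqrt (8 * c)" using c by simp
    fix i j and t :: real and u u' :: "real^3 \<Rightarrow> real^3" assume u: "u \<in> L2w m" "u' \<in> L2w m" and t: "0 < t"
    have [measurable]: "u \<in> borel_measurable borel" "u' \<in> borel_measurable borel" using u by (auto intro: L2w_measurable)
    have d: "(\<lambda>x. u x - u' x) \<in> L2w m" by (intro L2w_diff u)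
    let ?P = "\<lambda>y. ennreal (norm (u y - u' y)) * riesz (\<lambda>z. ennreal (norm (u z))) y"
    let ?R = "\<lambda>y. ennreal (norm (u' y)) * riesz (\<lambda>z. ennreal (norm (u z - u' z))) y"
    let ?D = "wnorm m (\<lambda>x. u x - u' x)"
    have "ennreal \<bar>dflux i j t u \<xi> - dflux i j t u' \<xi>\<bar> \<le> 2 * heatD_op j t ?P \<xi> + 2 * heatD_op j t ?R \<xi>" for \<xi>
    proof -
      let ?k = "\<lambda>y. ennreal \<bar>(shrink t)\<^sup>2 * heatD (htime t) j (\<xi> - shrink t *\<^sub>R y)\<bar>"
      have "ennreal \<bar>dflux i j t u \<xi> - dflux i j t u' \<xi>\<bar> \<le> heatD_op j t (\<lambda>y. ennreal \<bar>flux i j u y - flux i j u' y\<bar>) \<xi>"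
        by (rule dflux_diff_le_heatD_op[OF m u t])
      also have "\<dots> \<le> (\<integral>\<^sup>+y. 2 * (?k y * ?P y) + 2 * (?k y * ?R y) \<partial>lborel)"
        unfolding heatD_op_def using flux_diff_AE[OF m u, of i j]
      proof (intro nn_integral_mono_AE, eventually_elim)
        case (elim y)
        from mult_left_mono[OF elim(2), of "?k y"] show ?case by (simp add: distrib_left mult_ac)
      qed
      also have "\<dots> = 2 * heatD_op j t ?P \<xi> + 2 * heatD_op j t ?R \<xi>"
        unfolding heatD_op_def by (subst nn_integral_add; simp add: nn_integral_cmult)
      finally show ?thesis .
    qed
    then have "wsqn m (\<lambda>\<xi>. dflux i j t u \<xi> - dflux i j t u' \<xi>) \<le> wsq m (\<lambda>\<xi>. 2 * heatD_op j t ?P \<xi> + 2 * heatD_op j t ?R \<xi>)"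
      by (intro wsq_mono) simp
    also have "\<dots> \<le> 2 * wsq m (\<lambda>\<xi>. 2 * heatD_op j t ?P \<xi>) + 2 * wsq m (\<lambda>\<xi>. 2 * heatD_op j t ?R \<xi>)"
      by (rule wsq_add) auto
    also have "\<dots> = 8 * wsq m (heatD_op j t ?P) + 8 * wsq m (heatD_op j t ?R)"
      by (simp add: wsq_cmult mult.assoc[symmetric])
    also have "\<dots> \<le> 8 * (C * ennreal ((tker \<mu> t)\<^sup>2) * wsqn m (\<lambda>x. u x - u' x) * (\<integral>\<^sup>+y. (ennreal (norm (u y)))\<^sup>2 \<partial>lborel))
      + 8 * (C * ennreal ((tker \<mu> t)\<^sup>2) * wsqn m u' * (\<integral>\<^sup>+y. (ennreal (norm (u y - u' y)))\<^sup>2 \<partial>lborel))"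
      unfolding tker_def using t by (intro add_mono mult_left_mono C(2)) auto
    also have "\<dots> \<le> 8 * (C * ennreal ((tker \<mu> t)\<^sup>2) * ennreal (?D\<^sup>2) * ennreal ((wnorm m u)\<^sup>2))
      + 8 * (C * ennreal ((tker \<mu> t)\<^sup>2) * ennreal ((wnorm m u')\<^sup>2) * ennreal (?D\<^sup>2))"
      unfolding wsqn_wnorm[OF d] wsqn_wnorm[OF u(2)]
      by (intro add_mono mult_left_mono L2_finite m u d) auto
    also have "\<dots> = ennreal (8 * (c * (tker \<mu> t)\<^sup>2 * ?D\<^sup>2 * (wnorm m u)\<^sup>2) + 8 * (c * (tker \<mu> t)\<^sup>2 * (wnorm m u')\<^sup>2 * ?D\<^sup>2))"
      using c by (simp add: ennreal_mult ennreal_plus)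
    also have "\<dots> \<le> ennreal ((sqrt (8 * c) * (tker \<mu> t * ((wnorm m u + wnorm m u') * ?D)))\<^sup>2)"
    proof (rule ennreal_leI)
      have "(wnorm m u)\<^sup>2 + (wnorm m u')\<^sup>2 \<le> (wnorm m u + wnorm m u')\<^sup>2" by (simp add: power2_sum)
      then have "8 * c * (tker \<mu> t)\<^sup>2 * ?D\<^sup>2 * ((wnorm m u)\<^sup>2 + (wnorm m u')\<^sup>2) \<le> 8 * c * (tker \<mu> t)\<^sup>2 * ?D\<^sup>2 * (wnorm m u + wnorm m u')\<^sup>2"
        using c by (intro mult_left_mono) auto
      also have "\<dots> = (sqrt (8 * c) * (tker \<mu> t * ((wnorm m u + wnorm m u') * ?D)))\<^sup>2"
        using c by (simp add: power_mult_distrib mult_ac)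
      finally show "8 * (c * (tker \<mu> t)\<^sup>2 * ?D\<^sup>2 * (wnorm m u)\<^sup>2) + 8 * (c * (tker \<mu> t)\<^sup>2 * (wnorm m u')\<^sup>2 * ?D\<^sup>2) \<le> (sqrt (8 * c) * (tker \<mu> t * ((wnorm m u + wnorm m u') * ?D)))\<^sup>2"
        by (simp add: distrib_left mult_ac)
    qed
    finally show "wsqn m (\<lambda>\<xi>. dflux i j t u \<xi> - dflux i j t u' \<xi>) \<le> ennreal ((sqrt (8 * c) * (tker \<mu> t * ((wnorm m u + wnorm m u') * ?D)))\<^sup>2)" .
  qed
qed

section \<open>Minkowski's inequality for time integrals\<close>

lemma nn_integral_exp_half_line: "(\<integral>\<^sup>+t. ennreal (exp (- t)) * indicator {0<..} t \<partial>lborel) = (1::ennreal)"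
proof -
  have "(\<integral>\<^sup>+t. ennreal (exp (- t)) * indicator {0..} t \<partial>lborel) = ennreal (0 - (- exp (- 0)))"
  proof (rule nn_integral_FTC_atLeast)
    show "((\<lambda>x::real. - exp (- x)) \<longlongrightarrow> 0) at_top" by real_asymp
  qed (auto intro!: derivative_eq_intros)
  moreover have "AE t in lborel. ennreal (exp (- t)) * indicator {0..} t = ennreal (exp (- t)) * indicator {0<..} (t::real)"
    using AE_lborel_singleton[of 0] by eventually_elim (auto split: split_indicator)
  ultimately show ?thesis by (simp add: nn_integral_cong_AE)
qed

text \<open>
  Cauchy-Schwarz in \<open>t\<close> with the weights \<open>sqrt (b t)\<close> and \<open>1 / sqrt (b t)\<close>, followed by
  Tonelli's theorem; \<open>b\<close> has to be positive to divide by it.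
\<close>

lemma Minkowski_time_pos:
  fixes f :: "real \<Rightarrow> real^3 \<Rightarrow> real"
  assumes [measurable]: "case_prod f \<in> borel_measurable (borel \<Otimes>\<^sub>M borel)" "b \<in> borel_measurable borel"
    and b: "\<And>t. 0 < t \<Longrightarrow> 0 < b t" and f: "\<And>t. 0 < t \<Longrightarrow> wsqn m (f t) \<le> ennreal ((b t)\<^sup>2)"
  shows "wsq m (\<lambda>x. \<integral>\<^sup>+t. ennreal \<bar>f t x\<bar> * indicator {0<..} t \<partial>lborel) \<le> (\<integral>\<^sup>+t. ennreal (b t) * indicator {0<..} t \<partial>lborel)\<^sup>2"
proof -
  let ?I = "\<lambda>t. indicator {0<..} t :: ennreal"
  let ?B = "\<integral>\<^sup>+t. ennreal (b t) * ?I t \<partial>lborel"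
  define X where "X t = ennreal (sqrt (b t)) * ?I t" for t
  define Y where "Y x t = ennreal (rho x powr m * \<bar>f t x\<bar> / sqrt (b t)) * ?I t" for x t
  have [measurable]: "X \<in> borel_measurable borel" unfolding X_def by measurable
  have [measurable]: "Y x \<in> borel_measurable borel" for x unfolding Y_def by measurable
  have pt: "(ennreal (rho x powr m) * (\<integral>\<^sup>+t. ennreal \<bar>f t x\<bar> * ?I t \<partial>lborel))\<^sup>2
    \<le> ?B * (\<integral>\<^sup>+t. ennreal ((rho x powr m * \<bar>f t x\<bar>)\<^sup>2 / b t) * ?I t \<partial>lborel)" for x
  proof -
    have "ennreal (rho x powr m) * (\<integral>\<^sup>+t. ennreal \<bar>f t x\<bar> * ?I t \<partial>lborel) = (\<integral>\<^sup>+t. X t * Y x t \<partial>lborel)"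
    proof (subst nn_integral_cmult[symmetric], measurable, rule nn_integral_cong)
      fix t show "ennreal (rho x powr m) * (ennreal \<bar>f t x\<bar> * ?I t) = X t * Y x t"
        using b[of t] by (auto simp: X_def Y_def ennreal_mult[symmetric] split: split_indicator)
    qed
    then have "(ennreal (rho x powr m) * (\<integral>\<^sup>+t. ennreal \<bar>f t x\<bar> * ?I t \<partial>lborel))\<^sup>2 \<le> (\<integral>\<^sup>+t. (X t)\<^sup>2 \<partial>lborel) * (\<integral>\<^sup>+t. (Y x t)\<^sup>2 \<partial>lborel)"
      by (simp add: Cauchy_Schwarz_nn_integral)
    also have "(\<integral>\<^sup>+t. (X t)\<^sup>2 \<partial>lborel) = ?B"
    proof (rule nn_integral_cong)
      fix t show "(X t)\<^sup>2 = ennreal (b t) * ?I t"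
        using b[of t] by (auto simp: X_def ennreal_power less_imp_le split: split_indicator)
    qed
    also have "(\<integral>\<^sup>+t. (Y x t)\<^sup>2 \<partial>lborel) = (\<integral>\<^sup>+t. ennreal ((rho x powr m * \<bar>f t x\<bar>)\<^sup>2 / b t) * ?I t \<partial>lborel)"
    proof (rule nn_integral_cong)
      fix t show "(Y x t)\<^sup>2 = ennreal ((rho x powr m * \<bar>f t x\<bar>)\<^sup>2 / b t) * ?I t"
        using b[of t] by (auto simp: Y_def ennreal_power power_divide less_imp_le split: split_indicator)
    qed
    finally show ?thesis .
  qed
  have "wsq m (\<lambda>x. \<integral>\<^sup>+t. ennreal \<bar>f t x\<bar> * ?I t \<partial>lborel) \<le> (\<integral>\<^sup>+x. ?B * (\<integral>\<^sup>+t. ennreal ((rho x powr m * \<bar>f t x\<bar>)\<^sup>2 / b t) * ?I t \<partial>lborel) \<partial>lborel)"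
    unfolding wsq_def by (intro nn_integral_mono pt)
  also have "\<dots> = ?B * (\<integral>\<^sup>+x. \<integral>\<^sup>+t. ennreal ((rho x powr m * \<bar>f t x\<bar>)\<^sup>2 / b t) * ?I t \<partial>lborel \<partial>lborel)"
    by (rule nn_integral_cmult) measurable
  also have "(\<integral>\<^sup>+x. \<integral>\<^sup>+t. ennreal ((rho x powr m * \<bar>f t x\<bar>)\<^sup>2 / b t) * ?I t \<partial>lborel \<partial>lborel)
      = (\<integral>\<^sup>+t. \<integral>\<^sup>+x. ennreal ((rho x powr m * \<bar>f t x\<bar>)\<^sup>2 / b t) * ?I t \<partial>lborel \<partial>lborel)"
    by (rule lborel_pair.Fubini') measurable
  also have "\<dots> \<le> (\<integral>\<^sup>+t. ennreal (b t) * ?I t \<partial>lborel)"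
  proof (rule nn_integral_mono)
    fix t :: real
    show "(\<integral>\<^sup>+x. ennreal ((rho x powr m * \<bar>f t x\<bar>)\<^sup>2 / b t) * ?I t \<partial>lborel) \<le> ennreal (b t) * ?I t"
    proof (cases "0 < t")
      case True
      have "(\<integral>\<^sup>+x. ennreal ((rho x powr m * \<bar>f t x\<bar>)\<^sup>2 / b t) * ?I t \<partial>lborel) = (\<integral>\<^sup>+x. ennreal (1 / b t) * ennreal ((rho x powr m * norm (f t x))\<^sup>2) \<partial>lborel)"
        using True b[OF True] by (intro nn_integral_cong) (simp add: ennreal_mult[symmetric])
      also have "\<dots> = ennreal (1 / b t) * wsqn m (f t)"
        unfolding wsqn_eq by (rule nn_integral_cmult) measurable
      also have "\<dots> \<le> ennreal (1 / b t) * ennreal ((b t)\<^sup>2)" by (intro mult_left_mono f True) simp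
      also have "\<dots> = ennreal (b t)" using b[OF True] by (simp add: ennreal_mult[symmetric] power2_eq_square)
      finally show ?thesis using True by simp
    qed simp
  qed
  finally show ?thesis by (simp add: power2_eq_square mult_left_mono)
qed

text \<open>
  The general case, by adding \<open>d * exp (- t)\<close> to \<open>b\<close> and letting \<open>d\<close> tend to \<open>0\<close>.
\<close>

lemma Minkowski_time:
  fixes f :: "real \<Rightarrow> real^3 \<Rightarrow> real"
  assumes [measurable]: "case_prod f \<in> borel_measurable (borel \<Otimes>\<^sub>M borel)" "b \<in> borel_measurable borel"
    and b: "\<And>t. 0 < t \<Longrightarrow> 0 \<le> b t" and f: "\<And>t. 0 < t \<Longrightarrow> wsqn m (f t) \<le> ennreal ((b t)\<^sup>2)"
    and B: "(\<integral>\<^sup>+t. ennreal (b t) * indicator {0<..} t \<partial>lborel) \<le> ennreal B" "0 \<le> B"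
  shows "wsq m (\<lambda>x. \<integral>\<^sup>+t. ennreal \<bar>f t x\<bar> * indicator {0<..} t \<partial>lborel) \<le> ennreal (B\<^sup>2)"
    (is "?L \<le> _")
proof -
  have *: "?L \<le> ennreal ((B + d)\<^sup>2)" if d: "0 < d" for d
  proof -
    have "?L \<le> (\<integral>\<^sup>+t. ennreal (b t + d * exp (- t)) * indicator {0<..} t \<partial>lborel)\<^sup>2"
    proof (rule Minkowski_time_pos)
      fix t :: real assume t: "0 < t"
      have "(b t)\<^sup>2 \<le> (b t + d * exp (- t))\<^sup>2" using b[OF t] d by (intro power_mono) auto
      then show "wsqn m (f t) \<le> ennreal ((b t + d * exp (- t))\<^sup>2)" using f[OF t] ennreal_leI order_trans by blast
      show "0 < b t + d * exp (- t)" using b[OF t] d by (simp add: add_nonneg_pos)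
    qed measurable
    also have "(\<integral>\<^sup>+t. ennreal (b t + d * exp (- t)) * indicator {0<..} t \<partial>lborel)
      = (\<integral>\<^sup>+t. ennreal (b t) * indicator {0<..} t + ennreal d * (ennreal (exp (- t)) * indicator {0<..} t) \<partial>lborel)"
      using b d by (intro nn_integral_cong) (auto simp: ennreal_plus ennreal_mult split: split_indicator)
    also have "\<dots> = (\<integral>\<^sup>+t. ennreal (b t) * indicator {0<..} t \<partial>lborel) + ennreal d * 1"
      by (subst nn_integral_add, measurable) (subst nn_integral_cmult; simp add: nn_integral_exp_half_line)
    also have "\<dots> \<le> ennreal B + ennreal d" using B by (simp add: add_right_mono)
    also have "\<dots> = ennreal (B + d)" using B d by simp
    finally show ?thesis using B d by (simp add: ennreal_power power_mono_ennreal del: ennreal_plus)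
  qed
  have "?L < \<infinity>" using *[of 1] by (simp add: le_less_trans)
  then obtain l where l: "?L = ennreal l" "0 \<le> l" by (cases ?L) auto
  have "l \<le> (B + d)\<^sup>2" if "0 < d" for d using *[OF that] l by (simp add: ennreal_le_iff)
  then have "eventually (\<lambda>d. l \<le> (B + d)\<^sup>2) (at_right 0)" by (simp add: eventually_at_filter)
  moreover have "((\<lambda>d. (B + d)\<^sup>2) \<longlongrightarrow> (B + 0)\<^sup>2) (at_right 0)" by (intro tendsto_intros)
  ultimately have "l \<le> (B + 0)\<^sup>2" by (intro tendsto_lowerbound) auto
  then show ?thesis using l by (simp add: ennreal_leI)
qed

section \<open>The Duhamel operator\<close>

text \<open>
  The largest multiple of \<open>1 / (n + 1)\<close> that does not exceed \<open>t\<close>. Functions of time are frozen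
  at these points to obtain joint measurability in time and space.
\<close>

definition grid_floor :: "nat \<Rightarrow> real \<Rightarrow> real" where
  "grid_floor n t = of_int \<lfloor>real (Suc n) * t\<rfloor> / real (Suc n)"

lemma grid_floor_bounds: "grid_floor n t \<le> t" "t - inverse (real (Suc n)) \<le> grid_floor n t"
proof -
  have "of_int \<lfloor>real (Suc n) * t\<rfloor> \<le> real (Suc n) * t" by (rule of_int_floor_le)
  then have "grid_floor n t \<le> (real (Suc n) * t) / real (Suc n)" unfolding grid_floor_def by (rule divide_right_mono) simp
  then show "grid_floor n t \<le> t" by simp
  have "real (Suc n) * t - 1 \<le> of_int \<lfloor>real (Suc n) * t\<rfloor>" by linarith
  then have "(real (Suc n) * t - 1) / real (Suc n) \<le> grid_floor n t" unfolding grid_floor_def by (rule divide_right_mono) simp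
  then show "t - inverse (real (Suc n)) \<le> grid_floor n t" by (simp add: diff_divide_distrib inverse_eq_divide)
qed

lemma grid_floor_tendsto: "(\<lambda>n. grid_floor n t) \<longlonglongrightarrow> t"
proof (rule tendsto_sandwich)
  show "(\<lambda>n. t - inverse (real (Suc n))) \<longlonglongrightarrow> t"
    using tendsto_diff[OF tendsto_const LIMSEQ_inverse_real_of_nat, of t] by simp
  show "\<forall>\<^sub>F n in sequentially. t - inverse (real (Suc n)) \<le> grid_floor n t"
    by (intro always_eventually allI grid_floor_bounds)
qed (auto intro!: always_eventually grid_floor_bounds tendsto_const)

text \<open>
  Continuity from the left along the grid points is all that measurability needs. Full continuity
  would be too much to ask: the curves of the Duhamel term, a solution read backwards in time and
  extended by \<open>0\<close>, jump at one point.
\<close>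

definition grid_cont :: "real \<Rightarrow> (real \<Rightarrow> real^3 \<Rightarrow> real^3) \<Rightarrow> bool" where
  "grid_cont m u \<longleftrightarrow> (\<forall>t. u t \<in> L2w m) \<and> (\<forall>t. (\<lambda>n. wnorm m (\<lambda>x. u (grid_floor n t) x - u t x)) \<longlonglongrightarrow> 0)"

lemma grid_contD: "grid_cont m u \<Longrightarrow> u t \<in> L2w m"
  by (simp add: grid_cont_def)

lemma grid_cont_zero [simp]: "grid_cont m (\<lambda>_ _. 0)"
  by (simp add: grid_cont_def)

lemma measurable_floor_compose:
  fixes g :: "int \<Rightarrow> 'a \<Rightarrow> real" and h :: "'a \<Rightarrow> real"
  assumes [measurable]: "\<And>k. g k \<in> borel_measurable M" "h \<in> borel_measurable M"
  shows "(\<lambda>x. g \<lfloor>h x\<rfloor> x) \<in> borel_measurable M"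
proof (rule measurable_compose_countable[of g M borel "\<lambda>x. \<lfloor>h x\<rfloor>"])
  show "(\<lambda>x. \<lfloor>h x\<rfloor>) \<in> M \<rightarrow>\<^sub>M count_space UNIV"
    by (rule measurable_compose[OF assms(2) measurable_real_floor])
qed simp

lemma grid_cont_norm_measurable:
  assumes "grid_cont m u" "grid_cont m u'"
  shows "(\<lambda>t. wnorm m (\<lambda>x. u t x - u' t x)) \<in> borel_measurable borel"
proof (rule borel_measurable_LIMSEQ_real)
  fix n
  have "(\<lambda>t. (\<lambda>k (_::real). wnorm m (\<lambda>x. u (of_int k / real (Suc n)) x - u' (of_int k / real (Suc n)) x)) \<lfloor>real (Suc n) * t\<rfloor> t) \<in> borel_measurable borel"
    by (rule measurable_floor_compose) auto
  then show "(\<lambda>t. wnorm m (\<lambda>x. u (grid_floor n t) x - u' (grid_floor n t) x)) \<in> borel_measurable borel"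
    by (simp add: grid_floor_def)
next
  fix t :: real
  have L: "u s \<in> L2w m" "u' s \<in> L2w m" for s using assms by (auto intro: grid_contD)
  have 0: "(\<lambda>n. wnorm m (\<lambda>x. u (grid_floor n t) x - u t x) + wnorm m (\<lambda>x. u' (grid_floor n t) x - u' t x)) \<longlonglongrightarrow> 0"
    using assms tendsto_add[of "\<lambda>n. wnorm m (\<lambda>x. u (grid_floor n t) x - u t x)" 0 sequentially "\<lambda>n. wnorm m (\<lambda>x. u' (grid_floor n t) x - u' t x)" 0]
    by (auto simp: grid_cont_def)
  have "(\<lambda>n. wnorm m (\<lambda>x. u (grid_floor n t) x - u' (grid_floor n t) x) - wnorm m (\<lambda>x. u t x - u' t x)) \<longlonglongrightarrow> 0"
  proof (rule Lim_null_comparison[OF _ 0], intro always_eventually allI)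
    fix n
    let ?s = "grid_floor n t"
    have "\<bar>wnorm m (\<lambda>x. u ?s x - u' ?s x) - wnorm m (\<lambda>x. u t x - u' t x)\<bar> \<le> wnorm m (\<lambda>x. (u ?s x - u' ?s x) - (u t x - u' t x))"
      by (intro wnorm_abs_diff_le L2w_diff L)
    also have "\<dots> = wnorm m (\<lambda>x. (u ?s x - u t x) - (u' ?s x - u' t x))" by (simp add: algebra_simps)
    also have "\<dots> \<le> wnorm m (\<lambda>x. u ?s x - u t x) + wnorm m (\<lambda>x. u' ?s x - u' t x)"
      by (intro L2w_diff L)
    finally show "norm (wnorm m (\<lambda>x. u ?s x - u' ?s x) - wnorm m (\<lambda>x. u t x - u' t x)) \<le> wnorm m (\<lambda>x. u ?s x - u t x) + wnorm m (\<lambda>x. u' ?s x - u' t x)" by simp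
  qed
  then show "(\<lambda>n. wnorm m (\<lambda>x. u (grid_floor n t) x - u' (grid_floor n t) x)) \<longlonglongrightarrow> wnorm m (\<lambda>x. u t x - u' t x)"
    by (rule LIM_zero_cancel)
qed

text \<open>
  The integrand of the Duhamel term, as a function of the elapsed time \<open>t = \<tau> - s\<close>.
\<close>

definition past_dflux :: "(real \<Rightarrow> real^3 \<Rightarrow> real^3) \<Rightarrow> 3 \<Rightarrow> 3 \<Rightarrow> real \<Rightarrow> real^3 \<Rightarrow> real" where
  "past_dflux u i j t x = indicator {0<..} t * dflux i j t (u t) x"

lemma heatD_measurable2 [measurable (raw)]:
  assumes [measurable]: "f \<in> borel_measurable M" "g \<in> borel_measurable M"
  shows "(\<lambda>x. heatD (f x) j (g x)) \<in> borel_measurable M"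
  using measurable_compose[OF measurable_Pair[OF assms] heatD_measurable] by simp

text \<open>
  A continuous curve in \<open>L\<^sup>2(m)\<close> is a family of functions, each of which is determined up to null
  sets only, so joint measurability is not automatic. The smoothing by the heat kernel makes
  the integrand continuous along the curve at every point, hence it is a limit of integrands
  for step functions in time.
\<close>

lemma past_dflux_measurable:
  assumes m: "0 \<le> m" and u: "grid_cont m u"
  shows "case_prod (past_dflux u i j) \<in> borel_measurable (borel \<Otimes>\<^sub>M borel)"
proof (rule borel_measurable_LIMSEQ_real)
  define g where "g n k p = indicator {0<..} (fst p) * (LBINT y. (shrink (fst p))\<^sup>2 * heatD (htime (fst p)) j (snd p - shrink (fst p) *\<^sub>R y) * flux i j (u (of_int k / real (Suc n))) y)" for n k and p :: "real \<times> (real^3)"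
  define F where "F n p = indicator {0<..} (fst p) * dflux i j (fst p) (u (grid_floor n (fst p))) (snd p)" for n and p :: "real \<times> (real^3)"
  have g: "g n k \<in> borel_measurable (borel \<Otimes>\<^sub>M borel)" for n k
  proof -
    have [measurable]: "u (of_int k / real (Suc n)) \<in> borel_measurable borel" using grid_contD[OF u] by (rule L2w_measurable)
    show ?thesis unfolding g_def by measurable
  qed
  show "F n \<in> borel_measurable (borel \<Otimes>\<^sub>M borel)" for n
  proof -
    have "(\<lambda>p. g n \<lfloor>real (Suc n) * fst p\<rfloor> p) \<in> borel_measurable (borel \<Otimes>\<^sub>M borel)"
      by (rule measurable_floor_compose[OF g]) measurable
    moreover have "g n \<lfloor>real (Suc n) * fst p\<rfloor> p = F n p" for p
      using dflux_eq(1)[OF m grid_contD[OF u], of "fst p"] by (cases "0 < fst p") (simp_all add: g_def F_def grid_floor_def)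
    ultimately show ?thesis by simp
  qed
  fix p :: "real \<times> (real^3)"
  obtain t \<xi> where p: "p = (t, \<xi>)" by (cases p) auto
  show "(\<lambda>n. F n p) \<longlonglongrightarrow> case_prod (past_dflux u i j) p"
  proof (cases "0 < t")
    case True
    obtain C where C: "0 \<le> C" "\<And>u u'. u\<in>L2w m \<Longrightarrow> u'\<in>L2w m \<Longrightarrow> \<bar>dflux i j t u \<xi> - dflux i j t u' \<xi>\<bar> \<le> C * ((wnorm m u + wnorm m u') * wnorm m (\<lambda>x. u x - u' x))"
      using dflux_pointwise_diff[OF m True] by blast
    define d where "d n = wnorm m (\<lambda>x. u (grid_floor n t) x - u t x)" for n
    have d: "d \<longlonglongrightarrow> 0" using u unfolding d_def grid_cont_def by auto
    have "(\<lambda>n. F n p - past_dflux u i j t \<xi>) \<longlonglongrightarrow> 0"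
    proof (rule Lim_null_comparison)
      show "\<forall>\<^sub>F n in sequentially. norm (F n p - past_dflux u i j t \<xi>) \<le> C * ((d n + 2 * wnorm m (u t)) * d n)"
      proof (intro always_eventually allI)
        fix n
        have "norm (F n p - past_dflux u i j t \<xi>) = \<bar>dflux i j t (u (grid_floor n t)) \<xi> - dflux i j t (u t) \<xi>\<bar>"
          using True by (simp add: F_def past_dflux_def p)
        also have "\<dots> \<le> C * ((wnorm m (u (grid_floor n t)) + wnorm m (u t)) * d n)"
          unfolding d_def by (intro C grid_contD[OF u])
        also have "\<dots> \<le> C * ((d n + 2 * wnorm m (u t)) * d n)"
        proof (intro mult_left_mono mult_right_mono C)
          show "wnorm m (u (grid_floor n t)) + wnorm m (u t) \<le> d n + 2 * wnorm m (u t)"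
            using wnorm_abs_diff_le[OF grid_contD[OF u, of "grid_floor n t"] grid_contD[OF u, of t]] unfolding d_def by linarith
        qed (simp add: d_def)
        finally show "norm (F n p - past_dflux u i j t \<xi>) \<le> C * ((d n + 2 * wnorm m (u t)) * d n)" .
      qed
      have "(\<lambda>n. C * ((d n + 2 * wnorm m (u t)) * d n)) \<longlonglongrightarrow> C * ((0 + 2 * wnorm m (u t)) * 0)"
        by (intro tendsto_intros d)
      then show "(\<lambda>n. C * ((d n + 2 * wnorm m (u t)) * d n)) \<longlonglongrightarrow> 0" by simp
    qed
    then show ?thesis unfolding p by (simp add: LIM_zero_iff)
  qed (simp add: p F_def past_dflux_def)
qed

lemma past_dflux_measurable1:
  assumes "0 \<le> m" "grid_cont m u"
  shows "(\<lambda>t. past_dflux u i j t x) \<in> borel_measurable borel"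
  using measurable_compose[OF _ past_dflux_measurable[OF assms], of "\<lambda>t. (t, x)" borel i j] by simp

definition duhamel_op :: "(real \<Rightarrow> real^3 \<Rightarrow> real^3) \<Rightarrow> real^3 \<Rightarrow> real^3" where
  "duhamel_op u x = (\<chi> i. \<Sum>j\<in>UNIV. LBINT t. past_dflux u i j t x)"

lemma duhamel_op_measurable:
  assumes "0 \<le> m" "grid_cont m u"
  shows "duhamel_op u \<in> borel_measurable borel"
proof -
  have [measurable]: "(\<lambda>(x, t). past_dflux u i j t x) \<in> borel_measurable (borel \<Otimes>\<^sub>M borel)" for i j
    using measurable_compose[OF measurable_pair_swap' past_dflux_measurable[OF assms, of i j]] by (simp add: case_prod_beta')
  show ?thesis unfolding duhamel_op_def by measurable
qed

definition duhamel_integrable :: "(real \<Rightarrow> real^3 \<Rightarrow> real^3) \<Rightarrow> bool" where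
  "duhamel_integrable u \<longleftrightarrow> (AE x in lborel. \<forall>i j. integrable lborel (\<lambda>t. past_dflux u i j t x))"

text \<open>
  The Lipschitz estimate of the Duhamel operator with constant \<open>K\<close>, for a majorant \<open>b\<close> of the time
  integrand. The first conclusion does not presuppose that the time integrals converge; applied with
  \<open>u' = 0\<close> it yields their convergence, which the second conclusion needs.
\<close>

definition duhamel_bound :: "real \<Rightarrow> real \<Rightarrow> real \<Rightarrow> bool" where
  "duhamel_bound \<mu> m K \<longleftrightarrow> 0 \<le> m \<and> 0 < \<mu> \<and> 0 \<le> K \<and> (\<forall>u u' b B. grid_cont m u \<longrightarrow> grid_cont m u' \<longrightarrow> b \<in> borel_measurable borel \<longrightarrow>
     (\<forall>t>0. tker \<mu> t * ((wnorm m (u t) + wnorm m (u' t)) * wnorm m (\<lambda>x. u t x - u' t x)) \<le> b t) \<longrightarrow>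
     0 \<le> B \<longrightarrow> (\<integral>\<^sup>+t. ennreal (b t) * indicator {0<..} t \<partial>lborel) \<le> ennreal B \<longrightarrow>
     (\<forall>i j. wsq m (\<lambda>\<xi>. \<integral>\<^sup>+t. ennreal \<bar>past_dflux u i j t \<xi> - past_dflux u' i j t \<xi>\<bar> \<partial>lborel) \<le> ennreal ((K * B)\<^sup>2)) \<and>
     (duhamel_integrable u \<longrightarrow> duhamel_integrable u' \<longrightarrow> (\<lambda>\<xi>. duhamel_op u \<xi> - duhamel_op u' \<xi>) \<in> L2w m \<and> wnorm m (\<lambda>\<xi>. duhamel_op u \<xi> - duhamel_op u' \<xi>) \<le> K * B))"

theorem duhamel_op_estimate:
  assumes \<mu>: "0 < \<mu>" "\<mu> \<le> 1" "2 * \<mu> + 1/2 < m"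
  shows "\<exists>K. duhamel_bound \<mu> m K"
proof -
  have m: "0 \<le> m" using \<mu> by simp
  obtain K where K: "0 \<le> K" "\<And>i j t u u'. u\<in>L2w m \<Longrightarrow> u'\<in>L2w m \<Longrightarrow> 0 < t \<Longrightarrow>
    wsqn m (\<lambda>\<xi>. dflux i j t u \<xi> - dflux i j t u' \<xi>) \<le> ennreal ((K * (tker \<mu> t * ((wnorm m u + wnorm m u') * wnorm m (\<lambda>x. u x - u' x))))\<^sup>2)"
    using dflux_norm_diff[OF assms] by blast
  show ?thesis unfolding duhamel_bound_def
  \<comment> \<open>three terms in each of three components: \<open>3 * 9 \<le> 9\<^sup>2\<close> for the squares\<close>
  proof (intro exI[of _ "9 * K"] conjI impI allI)
    show "0 \<le> m" "0 < \<mu>" by fact+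
    show "0 \<le> 9 * K" using K by simp
    fix u u' b B
    assume u: "grid_cont m u" "grid_cont m u'" and [measurable]: "b \<in> borel_measurable borel"
      and b: "\<forall>t>0. tker \<mu> t * ((wnorm m (u t) + wnorm m (u' t)) * wnorm m (\<lambda>x. u t x - u' t x)) \<le> b t"
      and B: "0 \<le> B" "(\<integral>\<^sup>+t. ennreal (b t) * indicator {0<..} t \<partial>lborel) \<le> ennreal B"
    have J[measurable]: "case_prod (past_dflux u i j) \<in> borel_measurable (borel \<Otimes>\<^sub>M borel)" "case_prod (past_dflux u' i j) \<in> borel_measurable (borel \<Otimes>\<^sub>M borel)" for i j
      using past_dflux_measurable[OF m u(1)] past_dflux_measurable[OF m u(2)] by auto
    define X where "X i j \<xi> = (\<integral>\<^sup>+t. ennreal \<bar>past_dflux u i j t \<xi> - past_dflux u' i j t \<xi>\<bar> \<partial>lborel)" for i j \<xi>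
    have X0: "wsq m (X i j) \<le> ennreal ((K * B)\<^sup>2)" for i j
    proof -
      have "wsq m (\<lambda>\<xi>. \<integral>\<^sup>+t. ennreal \<bar>past_dflux u i j t \<xi> - past_dflux u' i j t \<xi>\<bar> * indicator {0<..} t \<partial>lborel) \<le> ennreal ((K * B)\<^sup>2)"
      proof (rule Minkowski_time[where f="\<lambda>t \<xi>. past_dflux u i j t \<xi> - past_dflux u' i j t \<xi>" and b="\<lambda>t. K * b t"])
        show "(\<lambda>(t, \<xi>). past_dflux u i j t \<xi> - past_dflux u' i j t \<xi>) \<in> borel_measurable (borel \<Otimes>\<^sub>M borel)"
          by measurable
        fix t :: real assume t: "0 < t"
        have b0: "0 \<le> b t" by (rule order_trans[OF _ b[rule_format, OF t]]) simp
        then show "0 \<le> K * b t" using K by simp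
        have "wsqn m (\<lambda>\<xi>. past_dflux u i j t \<xi> - past_dflux u' i j t \<xi>) = wsqn m (\<lambda>\<xi>. dflux i j t (u t) \<xi> - dflux i j t (u' t) \<xi>)"
          using t by (simp add: past_dflux_def)
        also have "\<dots> \<le> ennreal ((K * (tker \<mu> t * ((wnorm m (u t) + wnorm m (u' t)) * wnorm m (\<lambda>x. u t x - u' t x))))\<^sup>2)"
          by (intro K grid_contD u t)
        also have "\<dots> \<le> ennreal ((K * b t)\<^sup>2)"
          using b t K by (intro ennreal_leI power_mono mult_left_mono) auto
        finally show "wsqn m (\<lambda>\<xi>. past_dflux u i j t \<xi> - past_dflux u' i j t \<xi>) \<le> ennreal ((K * b t)\<^sup>2)" .
      next
        have "(\<integral>\<^sup>+t. ennreal (K * b t) * indicator {0<..} t \<partial>lborel) = ennreal K * (\<integral>\<^sup>+t. ennreal (b t) * indicator {0<..} t \<partial>lborel)"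
          using K by (subst nn_integral_cmult[symmetric]) (auto simp: ennreal_mult' mult.assoc)
        also have "\<dots> \<le> ennreal K * ennreal B" by (intro mult_left_mono B) simp
        finally show "(\<integral>\<^sup>+t. ennreal (K * b t) * indicator {0<..} t \<partial>lborel) \<le> ennreal (K * B)"
          using K B by (simp add: ennreal_mult)
      qed (use K B in auto)
      moreover have "ennreal \<bar>past_dflux u i j t \<xi> - past_dflux u' i j t \<xi>\<bar> * indicator {0<..} t = ennreal \<bar>past_dflux u i j t \<xi> - past_dflux u' i j t \<xi>\<bar>" for t \<xi>
        by (auto simp: past_dflux_def split: split_indicator)
      ultimately show ?thesis unfolding X_def by simp
    qed
    show "wsq m (\<lambda>\<xi>. \<integral>\<^sup>+t. ennreal \<bar>past_dflux u i j t \<xi> - past_dflux u' i j t \<xi>\<bar> \<partial>lborel) \<le> ennreal ((9 * K * B)\<^sup>2)" for i j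
    proof (rule order_trans[OF X0[unfolded X_def] ennreal_leI], rule power_mono)
      have "1 * (K * B) \<le> 9 * (K * B)" using K B by (intro mult_right_mono) auto
      then show "K * B \<le> 9 * K * B" by simp
    qed (use K B in simp)
    assume di: "duhamel_integrable u" "duhamel_integrable u'"
    let ?f = "\<lambda>\<xi>. duhamel_op u \<xi> - duhamel_op u' \<xi>"
    have [measurable]: "duhamel_op u \<in> borel_measurable borel" "duhamel_op u' \<in> borel_measurable borel" using duhamel_op_measurable[OF m u(1)] duhamel_op_measurable[OF m u(2)] by auto
    have Xm[measurable]: "X i j \<in> borel_measurable borel" for i j
    proof -
      have [measurable]: "(\<lambda>(\<xi>, t). past_dflux u i j t \<xi>) \<in> borel_measurable (borel \<Otimes>\<^sub>M borel)" "(\<lambda>(\<xi>, t). past_dflux u' i j t \<xi>) \<in> borel_measurable (borel \<Otimes>\<^sub>M borel)"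
        using measurable_compose[OF measurable_pair_swap' J(1)[of i j]] measurable_compose[OF measurable_pair_swap' J(2)[of i j]] by (simp_all add: case_prod_beta')
      show ?thesis unfolding X_def by measurable
    qed
    have comp: "wsqn m (\<lambda>\<xi>. ?f \<xi> $ i) \<le> ennreal (9 * (K * B)\<^sup>2)" for i
    proof -
      have "wsqn m (\<lambda>\<xi>. ?f \<xi> $ i) \<le> wsq m (\<lambda>\<xi>. \<Sum>j\<in>UNIV. X i j \<xi>)"
      proof (rule wsq_mono_AE)
        from di show "AE \<xi> in lborel. ennreal (norm (?f \<xi> $ i)) \<le> (\<Sum>j\<in>UNIV. X i j \<xi>)"
          unfolding duhamel_integrable_def
        proof eventually_elim
          case (elim \<xi>)
          have "?f \<xi> $ i = (\<Sum>j\<in>UNIV. LBINT t. past_dflux u i j t \<xi> - past_dflux u' i j t \<xi>)"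
            unfolding duhamel_op_def using elim by (simp add: sum_subtractf Bochner_Integration.integral_diff)
          then have "ennreal \<bar>?f \<xi> $ i\<bar> \<le> ennreal (\<Sum>j\<in>UNIV. \<bar>LBINT t. past_dflux u i j t \<xi> - past_dflux u' i j t \<xi>\<bar>)"
            by (simp only: sum_abs ennreal_leI)
          also have "\<dots> = (\<Sum>j\<in>UNIV. ennreal \<bar>LBINT t. past_dflux u i j t \<xi> - past_dflux u' i j t \<xi>\<bar>)" by simp
          also have "\<dots> \<le> (\<Sum>j\<in>UNIV. X i j \<xi>)" unfolding X_def by (intro sum_mono ennreal_abs_integral_le)
          finally show ?case by simp
        qed
      qed
      also have "\<dots> \<le> (\<Sum>j\<in>(UNIV::3 set). 3 * wsq m (X i j))"
      proof -
        have "(\<Sum>j\<in>UNIV. x j)\<^sup>2 \<le> (\<Sum>j\<in>UNIV. 3 * (x j)\<^sup>2)" for x :: "3 \<Rightarrow> ennreal"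
        proof (cases "\<exists>j. x j = \<top>")
          case True
          then obtain k where "x k = \<top>" by blast
          then have "3 * (x k)\<^sup>2 = \<top>" by (simp add: top_power_ennreal ennreal_mult_top)
          moreover have "3 * (x k)\<^sup>2 \<le> (\<Sum>j\<in>UNIV. 3 * (x j)\<^sup>2)" by (rule member_le_sum) auto
          ultimately have "(\<Sum>j\<in>UNIV. 3 * (x j)\<^sup>2) = \<top>" by (simp only: top_unique)
          then show ?thesis by (simp only: top_greatest)
        next
          case False
          then have "\<forall>j. \<exists>r. 0 \<le> r \<and> x j = ennreal r" by (metis ennreal_cases)
          then obtain r where r: "\<And>j. 0 \<le> r j" "\<And>j. x j = ennreal (r j)" by metis
          have "(\<Sum>j\<in>UNIV. r j)\<^sup>2 \<le> (\<Sum>j\<in>UNIV. 3 * (r j)\<^sup>2)"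
          proof -
            have "0 \<le> (r 1 - r 2)\<^sup>2 + (r 2 - r 3)\<^sup>2 + (r 1 - r 3)\<^sup>2" by simp
            then show ?thesis unfolding sum_3 by (simp add: power2_eq_square algebra_simps)
          qed
          then have "ennreal ((\<Sum>j\<in>UNIV. r j)\<^sup>2) \<le> ennreal (\<Sum>j\<in>UNIV. 3 * (r j)\<^sup>2)" by (rule ennreal_leI)
          also have "\<dots> = (\<Sum>j\<in>UNIV. ennreal (3 * (r j)\<^sup>2))" by (rule sum_ennreal[symmetric]) simp
          also have "\<dots> = (\<Sum>j\<in>UNIV. 3 * (x j)\<^sup>2)" using r by (simp add: ennreal_mult ennreal_power)
          finally show ?thesis using r by (simp add: ennreal_power sum_nonneg)
        qed
        then have pt: "(ennreal (rho \<xi> powr m) * (\<Sum>j\<in>UNIV. X i j \<xi>))\<^sup>2 \<le> (\<Sum>j\<in>UNIV. 3 * (ennreal (rho \<xi> powr m) * X i j \<xi>)\<^sup>2)" for \<xi>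
          unfolding sum_distrib_left by blast
        have "wsq m (\<lambda>\<xi>. \<Sum>j\<in>UNIV. X i j \<xi>) \<le> (\<integral>\<^sup>+\<xi>. (\<Sum>j\<in>UNIV. 3 * (ennreal (rho \<xi> powr m) * X i j \<xi>)\<^sup>2) \<partial>lborel)"
          unfolding wsq_def by (intro nn_integral_mono pt)
        also have "\<dots> = (\<Sum>j\<in>UNIV. 3 * wsq m (X i j))"
          unfolding wsq_def by (subst nn_integral_sum) (auto simp: nn_integral_cmult)
        finally show ?thesis .
      qed
      also have "\<dots> \<le> (\<Sum>j\<in>(UNIV::3 set). 3 * ennreal ((K * B)\<^sup>2))" by (intro sum_mono mult_left_mono X0) auto
      also have "\<dots> = ennreal (9 * (K * B)\<^sup>2)" by (simp add: ennreal_mult' mult.assoc[symmetric])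
      finally show ?thesis .
    qed
    have "wsqn m ?f = (\<Sum>i\<in>UNIV. wsqn m (\<lambda>\<xi>. ?f \<xi> $ i))" by (rule wsqn_components) measurable
    also have "\<dots> \<le> (\<Sum>i\<in>(UNIV::3 set). ennreal (9 * (K * B)\<^sup>2))" by (intro sum_mono comp)
    also have "\<dots> = ennreal (27 * (K * B)\<^sup>2)" by (simp add: ennreal_mult' mult.assoc[symmetric])
    also have "\<dots> \<le> ennreal ((9 * K * B)\<^sup>2)" by (intro ennreal_leI) (simp add: power_mult_distrib mult_right_mono)
    finally have "wsqn m ?f \<le> ennreal ((9 * K * B)\<^sup>2)" .
    then show "?f \<in> L2w m" "wnorm m ?f \<le> 9 * K * B"
      using K B by (auto intro!: wnorm_leI)
  qed
qed

section \<open>Convolution with the singular time kernel\<close>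

text \<open>
  On \<open>[0, 1]\<close> one has \<open>htime t \<ge> t / 2\<close>, and beyond \<open>1\<close> the function \<open>htime\<close> is at least
  \<open>1/2\<close>.
\<close>

lemma htime_powr_le:
  assumes "0 < t"
  shows "htime t powr (-(7/8)) \<le> 2 * (\<bar>t\<bar> powr (-(7/8)) * indicator {0..1} \<bar>t\<bar> + 1)"
proof -
  have p: "0 < htime t" using assms by simp
  have h: "(x / 2) powr (-(7/8)) \<le> 2 * x powr (-(7/8))" if "0 < x" for x :: real
  proof -
    have "(x / 2) powr (-(7/8)) = x powr (-(7/8)) * (1/2) powr (-(7/8))" by (simp add: powr_mult[symmetric])
    also have "\<dots> \<le> x powr (-(7/8)) * (1/2) powr (-1)" by (intro mult_left_mono powr_mono') auto
    finally show ?thesis by (simp add: powr_minus mult.commute)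
  qed
  show ?thesis
  proof (cases "t \<le> 1")
    case True
    have "exp (- t) * (1 + t) \<le> exp (- t) * exp t" by (intro mult_left_mono) auto
    also have "\<dots> = 1" by (simp add: exp_add[symmetric])
    finally have "exp (- t) \<le> 1 / (1 + t)" using assms by (simp add: field_simps)
    then have "t / (1 + t) \<le> htime t" using assms unfolding htime_def by (simp add: field_simps)
    moreover have "t / 2 \<le> t / (1 + t)" using assms True by (intro divide_left_mono) auto
    ultimately have "t / 2 \<le> htime t" by linarith
    then have "htime t powr (-(7/8)) \<le> (t / 2) powr (-(7/8))" using assms by (intro powr_mono2') auto
    also have "\<dots> \<le> 2 * t powr (-(7/8))" by (rule h[OF assms])
    finally show ?thesis using True assms by simp
  next
    case False
    have "2 \<le> exp t" using exp_ge_add_one_self[of t] False by linarith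
    then have "1/2 \<le> htime t" unfolding htime_def by (simp add: exp_minus field_simps)
    then have "htime t powr (-(7/8)) \<le> (1 / 2) powr (-(7/8))" by (intro powr_mono2') auto
    also have "\<dots> \<le> 2" using h[of 1] by simp
    finally show ?thesis using False assms by simp
  qed
qed

text \<open>
  The singular part is integrable on its own, and for the bounded part the exponential has integral
  at most \<open>1 / \<mu>\<close>, whatever \<open>\<tau>\<close> is.
\<close>

lemma time_kernel_convolution:
  assumes "0 < \<mu>"
  shows "\<exists>M\<ge>0. \<forall>\<tau>. (\<integral>\<^sup>+\<sigma>. ennreal (htime \<sigma> powr (-(7/8)) * (exp (- \<mu> * (\<tau> - \<sigma>)) * indicator {..\<tau>} \<sigma>)) * indicator {0<..} \<sigma> \<partial>lborel) \<le> ennreal M"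
proof -
  define A where "A = (\<integral>\<^sup>+t. ennreal (\<bar>t\<bar> powr (-(7/8))) * indicator {0..1} \<bar>t\<bar> \<partial>lborel)"
  have A: "A < \<infinity>" unfolding A_def by (rule nn_integral_powr_0) auto
  have exp_int: "(\<integral>\<^sup>+\<sigma>. ennreal (exp (- \<mu> * (\<tau> - \<sigma>))) * indicator {..\<tau>} \<sigma> \<partial>lborel) = ennreal (1 / \<mu>)" for \<tau>
  proof -
    have "(\<integral>\<^sup>+s. ennreal (exp (- \<mu> * s)) * indicator {0..} s \<partial>lborel) = ennreal (0 - (- exp (- \<mu> * 0) / \<mu>))"
    proof (rule nn_integral_FTC_atLeast)
      show "((\<lambda>s. - exp (- \<mu> * s) / \<mu>) \<longlongrightarrow> 0) at_top" using assms by real_asymp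
    qed (use assms in \<open>auto intro!: derivative_eq_intros\<close>)
    moreover have "(\<integral>\<^sup>+s. ennreal (exp (- \<mu> * s)) * indicator {0..} s \<partial>lborel) = (\<integral>\<^sup>+\<sigma>. ennreal (exp (- \<mu> * (\<tau> - \<sigma>))) * indicator {0..} (\<tau> - \<sigma>) \<partial>lborel)"
      using nn_integral_translate_reflect(1)[of "\<lambda>s. ennreal (exp (- \<mu> * s)) * indicator {0..} s" \<tau>] by simp
    moreover have "indicator {0..} (\<tau> - \<sigma>) = (indicator {..\<tau>} \<sigma> :: ennreal)" for \<sigma> by (simp split: split_indicator)
    ultimately show ?thesis by simp
  qed
  have "2 * (A + ennreal (1 / \<mu>)) < \<infinity>" using A by (simp add: ennreal_mult_less_top)
  then obtain M where M: "0 \<le> M" "2 * (A + ennreal (1 / \<mu>)) = ennreal M" by (cases "2 * (A + ennreal (1 / \<mu>))") auto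
  show ?thesis
  proof (intro exI[of _ M] conjI allI M)
    fix \<tau>
    have "(\<integral>\<^sup>+\<sigma>. ennreal (htime \<sigma> powr (-(7/8)) * (exp (- \<mu> * (\<tau> - \<sigma>)) * indicator {..\<tau>} \<sigma>)) * indicator {0<..} \<sigma> \<partial>lborel)
      \<le> (\<integral>\<^sup>+\<sigma>. 2 * (ennreal (\<bar>\<sigma>\<bar> powr (-(7/8))) * indicator {0..1} \<bar>\<sigma>\<bar> + ennreal (exp (- \<mu> * (\<tau> - \<sigma>))) * indicator {..\<tau>} \<sigma>) \<partial>lborel)"
    proof (rule nn_integral_mono)
      fix \<sigma> :: real
      let ?e = "exp (- \<mu> * (\<tau> - \<sigma>)) * indicator {..\<tau>} \<sigma> :: real"
      show "ennreal (htime \<sigma> powr (-(7/8)) * ?e) * indicator {0<..} \<sigma>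
        \<le> 2 * (ennreal (\<bar>\<sigma>\<bar> powr (-(7/8))) * indicator {0..1} \<bar>\<sigma>\<bar> + ennreal (exp (- \<mu> * (\<tau> - \<sigma>))) * indicator {..\<tau>} \<sigma>)"
      proof (cases "0 < \<sigma>")
        case True
        have e: "0 \<le> ?e" "?e \<le> 1" using assms by (auto split: split_indicator)
        have "htime \<sigma> powr (-(7/8)) * ?e \<le> 2 * (\<bar>\<sigma>\<bar> powr (-(7/8)) * indicator {0..1} \<bar>\<sigma>\<bar> + 1) * ?e"
          using htime_powr_le[OF True] e by (intro mult_right_mono) auto
        also have "\<dots> = 2 * (\<bar>\<sigma>\<bar> powr (-(7/8)) * indicator {0..1} \<bar>\<sigma>\<bar> * ?e + ?e)" by (simp add: algebra_simps)
        also have "\<dots> \<le> 2 * (\<bar>\<sigma>\<bar> powr (-(7/8)) * indicator {0..1} \<bar>\<sigma>\<bar> * 1 + ?e)"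
          using e by (intro mult_left_mono add_right_mono) auto
        finally have "ennreal (htime \<sigma> powr (-(7/8)) * ?e) \<le> ennreal (2 * (\<bar>\<sigma>\<bar> powr (-(7/8)) * indicator {0..1} \<bar>\<sigma>\<bar> + ?e))" by (intro ennreal_leI) simp
        also have "\<dots> = 2 * (ennreal (\<bar>\<sigma>\<bar> powr (-(7/8))) * indicator {0..1} \<bar>\<sigma>\<bar> + ennreal (exp (- \<mu> * (\<tau> - \<sigma>))) * indicator {..\<tau>} \<sigma>)"
          using e by (simp add: ennreal_mult' ennreal_plus del: ennreal_plus[symmetric] split: split_indicator)
        finally show ?thesis using True by simp
      qed simp
    qed
    also have "\<dots> = 2 * (A + ennreal (1 / \<mu>))"
      unfolding A_def exp_int[symmetric, of \<tau>] by (subst nn_integral_cmult, measurable) (subst nn_integral_add; simp)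
    finally show "(\<integral>\<^sup>+\<sigma>. ennreal (htime \<sigma> powr (-(7/8)) * (exp (- \<mu> * (\<tau> - \<sigma>)) * indicator {..\<tau>} \<sigma>)) * indicator {0<..} \<sigma> \<partial>lborel) \<le> ennreal M"
      unfolding M(2) .
  qed
qed

lemma tker_integrable:
  assumes "0 < \<mu>"
  shows "(\<integral>\<^sup>+\<sigma>. ennreal (tker \<mu> \<sigma>) * indicator {0<..} \<sigma> \<partial>lborel) < \<infinity>"
proof -
  define A where "A = (\<integral>\<^sup>+t. ennreal (\<bar>t\<bar> powr (-(7/8))) * indicator {0..1} \<bar>t\<bar> \<partial>lborel)"
  have A: "A < \<infinity>" unfolding A_def by (rule nn_integral_powr_0) auto
  have E: "(\<integral>\<^sup>+s. ennreal (exp (- \<mu> * s)) * indicator {0..} s \<partial>lborel) = ennreal (0 - (- exp (- \<mu> * 0) / \<mu>))"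
  proof (rule nn_integral_FTC_atLeast)
    show "((\<lambda>s. - exp (- \<mu> * s) / \<mu>) \<longlongrightarrow> 0) at_top" using assms by real_asymp
  qed (use assms in \<open>auto intro!: derivative_eq_intros\<close>)
  have "(\<integral>\<^sup>+\<sigma>. ennreal (tker \<mu> \<sigma>) * indicator {0<..} \<sigma> \<partial>lborel)
    \<le> (\<integral>\<^sup>+\<sigma>. 2 * (ennreal (\<bar>\<sigma>\<bar> powr (-(7/8))) * indicator {0..1} \<bar>\<sigma>\<bar> + ennreal (exp (- \<mu> * \<sigma>)) * indicator {0..} \<sigma>) \<partial>lborel)"
  proof (rule nn_integral_mono)
    fix \<sigma> :: real
    show "ennreal (tker \<mu> \<sigma>) * indicator {0<..} \<sigma> \<le> 2 * (ennreal (\<bar>\<sigma>\<bar> powr (-(7/8))) * indicator {0..1} \<bar>\<sigma>\<bar> + ennreal (exp (- \<mu> * \<sigma>)) * indicator {0..} \<sigma>)"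
    proof (cases "0 < \<sigma>")
      case True
      let ?e = "exp (- \<mu> * \<sigma>)"
      have e: "0 \<le> ?e" "?e \<le> 1" using assms True by auto
      have "tker \<mu> \<sigma> \<le> ?e * (2 * (\<bar>\<sigma>\<bar> powr (-(7/8)) * indicator {0..1} \<bar>\<sigma>\<bar> + 1))"
        unfolding tker_def using htime_powr_le[OF True] e by (intro mult_left_mono) auto
      also have "\<dots> = 2 * (\<bar>\<sigma>\<bar> powr (-(7/8)) * indicator {0..1} \<bar>\<sigma>\<bar> * ?e + ?e)" by (simp add: algebra_simps)
      also have "\<dots> \<le> 2 * (\<bar>\<sigma>\<bar> powr (-(7/8)) * indicator {0..1} \<bar>\<sigma>\<bar> * 1 + ?e)"
        using e by (intro mult_left_mono add_right_mono) auto
      finally have "ennreal (tker \<mu> \<sigma>) \<le> ennreal (2 * (\<bar>\<sigma>\<bar> powr (-(7/8)) * indicator {0..1} \<bar>\<sigma>\<bar> + ?e))" by (intro ennreal_leI) simp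
      also have "\<dots> = 2 * (ennreal (\<bar>\<sigma>\<bar> powr (-(7/8))) * indicator {0..1} \<bar>\<sigma>\<bar> + ennreal ?e)"
        using e by (simp add: ennreal_mult' ennreal_plus del: ennreal_plus[symmetric] split: split_indicator)
      finally show ?thesis using True by simp
    qed simp
  qed
  also have "\<dots> = 2 * (A + ennreal (0 - (- exp (- \<mu> * 0) / \<mu>)))"
    unfolding A_def E[symmetric] by (subst nn_integral_cmult, measurable) (subst nn_integral_add; simp)
  also have "\<dots> < \<infinity>" using A by (simp add: ennreal_mult_less_top)
  finally show ?thesis .
qed

section \<open>Strong continuity of the semigroup\<close>

lemma wnorm_tendsto_0:
  fixes f :: "nat \<Rightarrow> real^3 \<Rightarrow> 'b::euclidean_space"
  assumes [measurable]: "\<And>n. f n \<in> borel_measurable borel"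
    and lim: "AE x in lborel. (\<lambda>n. f n x) \<longlonglongrightarrow> 0"
    and dom: "\<And>n. AE x in lborel. norm (f n x) \<le> g x"
    and g: "integrable lborel (\<lambda>x. (rho x powr m * g x)\<^sup>2)"
  shows "(\<lambda>n. wnorm m (f n)) \<longlonglongrightarrow> 0"
proof -
  have "(\<lambda>n. LBINT x. (rho x powr m * norm (f n x))\<^sup>2) \<longlonglongrightarrow> (LBINT (x::real^3). 0)"
  proof (rule integral_dominated_convergence[where w="\<lambda>x. (rho x powr m * g x)\<^sup>2"])
    show "AE x in lborel. (\<lambda>n. (rho x powr m * norm (f n x))\<^sup>2) \<longlonglongrightarrow> 0"
      using lim
    proof eventually_elim
      case (elim x)
      have "(\<lambda>n. (rho x powr m * norm (f n x))\<^sup>2) \<longlonglongrightarrow> (rho x powr m * norm (0::'b))\<^sup>2"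
        by (intro tendsto_intros elim)
      then show ?case by simp
    qed
    show "AE x in lborel. norm ((rho x powr m * norm (f n x))\<^sup>2) \<le> (rho x powr m * g x)\<^sup>2" for n
      using dom[of n]
    proof eventually_elim
      case (elim x)
      then have "(rho x powr m * norm (f n x))\<^sup>2 \<le> (rho x powr m * g x)\<^sup>2" by (intro power_mono mult_left_mono) auto
      then show ?case by simp
    qed
  qed (use g in auto)
  then have "(\<lambda>n. sqrt (LBINT x. (rho x powr m * norm (f n x))\<^sup>2)) \<longlonglongrightarrow> sqrt 0"
    by (intro tendsto_real_sqrt) simp
  then show ?thesis unfolding wnorm_def by simp
qed

definition clampr :: "real \<Rightarrow> real \<Rightarrow> real" where "clampr k t = max (- k) (min k t)"
definition ramp :: "real \<Rightarrow> real^3 \<Rightarrow> real" where "ramp k x = max 0 (min 1 (k + 1 - norm x))"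

lemma ramp_bounds: "0 \<le> ramp k x" "ramp k x \<le> 1" by (auto simp: ramp_def)

lemma clampr_abs: "0 \<le> k \<Longrightarrow> \<bar>clampr k t\<bar> \<le> k" by (auto simp: clampr_def)

lemma truncation_error: "0 \<le> k \<Longrightarrow> \<bar>clampr k t * ramp k' x - t\<bar> \<le> \<bar>t\<bar>"
proof -
  assume k: "0 \<le> k"
  consider "0 \<le> t" | "t < 0" by linarith
  then show ?thesis
  proof cases
    case 1
    then have c: "0 \<le> clampr k t" "clampr k t \<le> t" using k by (auto simp: clampr_def)
    have "0 \<le> clampr k t * ramp k' x" using c ramp_bounds by simp
    moreover have "clampr k t * ramp k' x \<le> t * 1" using c ramp_bounds[of k' x] 1 by (intro mult_mono) auto
    ultimately show ?thesis using 1 by simp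
  next
    case 2
    then have c: "0 \<le> - clampr k t" "- clampr k t \<le> - t" using k by (auto simp: clampr_def)
    have "0 \<le> - clampr k t * ramp k' x" using c ramp_bounds by (intro mult_nonneg_nonneg) auto
    moreover have "- clampr k t * ramp k' x \<le> - t * 1" using c ramp_bounds[of k' x] 2 by (intro mult_mono) auto
    ultimately show ?thesis using 2 by simp
  qed
qed

lemma finite_weight_on_ball:
  assumes m: "0 \<le> m"
  shows "integrable lborel (\<lambda>x::real^3. (rho x powr m * (c * indicator (cball 0 R) x))\<^sup>2)"
proof (rule integrableI_bounded)
  have "(\<integral>\<^sup>+x. ennreal (norm ((rho x powr m * (c * indicator (cball 0 R) x))\<^sup>2)) \<partial>lborel)
      \<le> (\<integral>\<^sup>+x. ennreal (((1 + R) powr m * c)\<^sup>2) * indicator (cball (0::real^3) R) x \<partial>lborel)"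
  proof (rule nn_integral_mono)
    fix x :: "real^3"
    show "ennreal (norm ((rho x powr m * (c * indicator (cball 0 R) x))\<^sup>2)) \<le> ennreal (((1 + R) powr m * c)\<^sup>2) * indicator (cball (0::real^3) R) x"
    proof (cases "x \<in> cball 0 R")
      case True
      then have "rho x powr m \<le> (1 + R) powr m" using m by (intro powr_mono2) (auto simp: rho_def)
      then have "\<bar>rho x powr m * c\<bar>\<^sup>2 \<le> \<bar>(1 + R) powr m * c\<bar>\<^sup>2" unfolding abs_mult by (intro power_mono mult_right_mono) auto
      then show ?thesis using True by (simp add: ennreal_leI)
    qed simp
  qed
  also have "\<dots> = ennreal (((1 + R) powr m * c)\<^sup>2) * emeasure lborel (cball (0::real^3) R)"
    by (rule nn_integral_cmult_indicator) simp
  also have "\<dots> < \<infinity>"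
    using emeasure_bounded_finite[OF bounded_cball, of "0::real^3" R] by (simp add: ennreal_mult_less_top)
  finally show "(\<integral>\<^sup>+x. ennreal (norm ((rho x powr m * (c * indicator (cball (0::real^3) R) x))\<^sup>2)) \<partial>lborel) < \<infinity>" .
qed measurable

text \<open>
  A measurable function is the limit almost everywhere of continuous functions. Truncating it in
  value and in space, and the approximations in the same way, makes the convergence dominated.
\<close>

lemma compactly_supported_dense:
  fixes f :: "real^3 \<Rightarrow> real"
  assumes m: "0 \<le> m" and f: "f \<in> L2w m" and e: "0 < e"
  shows "\<exists>g R. continuous_on UNIV g \<and> (\<forall>x. R < norm x \<longrightarrow> g x = 0) \<and> g \<in> L2w m \<and> wnorm m (\<lambda>x. f x - g x) < e"
proof -
  have [measurable]: "f \<in> borel_measurable borel" using f by (rule L2w_measurable)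
  have rampc: "continuous_on UNIV (ramp k)" for k unfolding ramp_def by (intro continuous_intros)
  then have [measurable]: "ramp k \<in> borel_measurable borel" for k by (rule borel_measurable_continuous_onI)
  define F where "F k x = clampr (real k) (f x) * ramp (real k) x" for k :: nat and x
  have [measurable]: "F k \<in> borel_measurable borel" for k unfolding F_def clampr_def by measurable
  have "(\<lambda>k. wnorm m (\<lambda>x. F k x - f x)) \<longlonglongrightarrow> 0"
  proof (rule wnorm_tendsto_0[where g="\<lambda>x. \<bar>f x\<bar>"])
    show "AE x in lborel. (\<lambda>k. F k x - f x) \<longlonglongrightarrow> 0"
    proof (intro AE_I2 tendsto_eventually)
      fix x :: "real^3"
      obtain N :: nat where N: "\<bar>f x\<bar> + norm x < real N" using reals_Archimedean2 by blast
      show "\<forall>\<^sub>F k in sequentially. F k x - f x = 0"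
      proof (rule eventually_sequentiallyI[of N])
        fix k assume "N \<le> k"
        then have "\<bar>f x\<bar> + norm x < real k" using N by linarith
        then have "\<bar>f x\<bar> < real k" "norm x < real k" using norm_ge_zero[of x] by linarith+
        then have "clampr (real k) (f x) = f x" "ramp (real k) x = 1" by (auto simp: clampr_def ramp_def)
        then show "F k x - f x = 0" by (simp add: F_def)
      qed
    qed
    show "AE x in lborel. norm (F k x - f x) \<le> \<bar>f x\<bar>" for k
      unfolding F_def by (intro AE_I2) (simp add: truncation_error)
    show "integrable lborel (\<lambda>x. (rho x powr m * \<bar>f x\<bar>)\<^sup>2)" using f by (simp add: L2w_def)
  qed measurable
  then have "\<forall>\<^sub>F k in sequentially. wnorm m (\<lambda>x. F k x - f x) < e / 2"
    by (rule order_tendstoD(2)) (use e in simp)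
  then obtain k where k: "wnorm m (\<lambda>x. F k x - f x) < e / 2" using eventually_happens'[OF sequentially_bot] by blast
  have FL: "F k \<in> L2w m"
  proof -
    have "(\<lambda>x. F k x - f x) \<in> L2w m"
    proof (rule L2wI)
      have "wsqn m (\<lambda>x. F k x - f x) \<le> wsqn m f"
        unfolding F_def by (intro wsq_mono ennreal_leI) (simp add: truncation_error)
      also have "\<dots> < \<infinity>" using wsqn_wnorm[OF f] by simp
      finally show "wsqn m (\<lambda>x. F k x - f x) < \<infinity>" .
    qed measurable
    from L2w_add(1)[OF this f] show ?thesis by simp
  qed
  have "f \<in> borel_measurable lebesgue" by (rule measurable_completion) simp
  then have "f measurable_on UNIV" by (rule lebesgue_measurable_imp_measurable_on) simp
  then obtain N g where N: "negligible N" and g: "\<And>n. continuous_on UNIV (g n)" "\<And>x. x \<notin> N \<Longrightarrow> (\<lambda>n. g n x) \<longlonglongrightarrow> f x"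
    unfolding measurable_on_def by auto
  have AEN: "AE x in lborel. x \<notin> N"
  proof -
    have "AE x in lebesgue. x \<notin> N" using N unfolding negligible_iff_null_sets by (rule AE_not_in)
    then show ?thesis by (simp only: AE_completion_iff)
  qed
  define h where "h n x = clampr (real k) (g n x) * ramp (real k) x" for n x
  have hc: "continuous_on UNIV (h n)" for n
    unfolding h_def clampr_def by (intro continuous_intros g(1) rampc)
  then have [measurable]: "h n \<in> borel_measurable borel" for n by (rule borel_measurable_continuous_onI)
  have h0: "h n x = 0" if "real k + 1 < norm x" for n x using that by (simp add: h_def ramp_def)
  have hbd: "\<bar>h n x\<bar> \<le> real k * indicator (cball 0 (real k + 1)) x" for n x
  proof (cases "norm x \<le> real k + 1")
    case True
    have "\<bar>h n x\<bar> \<le> real k * 1" unfolding h_def abs_mult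
      using clampr_abs[of "real k" "g n x"] ramp_bounds[of "real k" x] by (intro mult_mono) auto
    then show ?thesis using True by simp
  qed (simp add: h0)
  have "(\<lambda>n. wnorm m (\<lambda>x. h n x - F k x)) \<longlonglongrightarrow> 0"
  proof (rule wnorm_tendsto_0[where g="\<lambda>x. 2 * real k * indicator (cball 0 (real k + 1)) x"])
    show "AE x in lborel. (\<lambda>n. h n x - F k x) \<longlonglongrightarrow> 0"
      using AEN
    proof eventually_elim
      case (elim x)
      have "(\<lambda>n. h n x) \<longlonglongrightarrow> F k x" unfolding h_def F_def clampr_def
        by (intro tendsto_intros g(2) elim)
      then show ?case by (simp add: LIM_zero)
    qed
    have Fb: "\<bar>F k x\<bar> \<le> real k * indicator (cball 0 (real k + 1)) x" for x
    proof (cases "norm x \<le> real k + 1")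
      case True
      have "\<bar>F k x\<bar> \<le> real k * 1" unfolding F_def abs_mult
        using clampr_abs[of "real k" "f x"] ramp_bounds[of "real k" x] by (intro mult_mono) auto
      then show ?thesis using True by simp
    qed (simp add: F_def ramp_def)
    show "AE x in lborel. norm (h n x - F k x) \<le> 2 * real k * indicator (cball 0 (real k + 1)) x" for n
    proof (rule AE_I2)
      fix x
      show "norm (h n x - F k x) \<le> 2 * real k * indicator (cball 0 (real k + 1)) x"
        using hbd[of n x] Fb[of x] by simp
    qed
    show "integrable lborel (\<lambda>x. (rho x powr m * (2 * real k * indicator (cball 0 (real k + 1)) x))\<^sup>2)"
      by (rule finite_weight_on_ball[OF m])
  qed measurable
  then have "\<forall>\<^sub>F n in sequentially. wnorm m (\<lambda>x. h n x - F k x) < e / 2"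
    by (rule order_tendstoD(2)) (use e in simp)
  then obtain n where n: "wnorm m (\<lambda>x. h n x - F k x) < e / 2" using eventually_happens'[OF sequentially_bot] by blast
  have hL: "h n \<in> L2w m"
  proof (rule L2wI)
    have "wsqn m (h n) \<le> wsqn m (\<lambda>x. real k * indicator (cball 0 (real k + 1)) x :: real)"
      using hbd by (intro wsq_mono ennreal_leI) simp
    also have "\<dots> < \<infinity>" unfolding wsqn_eq
      using finite_weight_on_ball[OF m, of "real k" "real k + 1"] by (simp add: integrable_iff_bounded)
    finally show "wsqn m (h n) < \<infinity>" .
  qed measurable
  have "wnorm m (\<lambda>x. f x - h n x) \<le> wnorm m (\<lambda>x. f x - F k x) + wnorm m (\<lambda>x. F k x - h n x)"
    by (rule wnorm_triangle_diff[OF f FL hL])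
  also have "\<dots> < e" using n k unfolding wnorm_minus_commute[of m f "F k"] wnorm_minus_commute[of m "F k" "h n"] by simp
  finally show ?thesis using hc h0 hL by blast
qed

text \<open>
  The substitution \<open>z = \<xi> - sqrt (htime t) *\<^sub>R x\<close> moves all of the time dependence into the
  argument of \<open>g\<close>. The formula also covers \<open>t = 0\<close>.
\<close>

lemma expL_rescaled:
  assumes t: "0 \<le> t" and [measurable]: "g \<in> borel_measurable borel"
  shows "expL t g \<xi> = exp t * (LBINT x. heat 1 x * g (exp (t / 2) *\<^sub>R (\<xi> - sqrt (htime t) *\<^sub>R x)))"
proof (cases "t = 0")
  case True
  have "has_bochner_integral lborel (heat 1) 1"
    using nn_integral_heat[of 1] by (intro has_bochner_integral_nn_integral) auto
  then have "(LBINT x. heat 1 x) = 1" by (rule has_bochner_integral_integral_eq)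
  then show ?thesis using True by (simp add: expL_def htime_def)
next
  case False
  then have a: "0 < htime t" using t by simp
  let ?h = "\<lambda>z. exp (- ((norm (\<xi> - z))\<^sup>2 / (4 * (1 - exp (- t))))) * g (exp (t / 2) *\<^sub>R z)"
  have "(LBINT z. ?h z) = \<bar>- sqrt (htime t)\<bar> ^ 3 * (LBINT x. ?h (\<xi> + (- sqrt (htime t)) *\<^sub>R x))"
    using integral_affine[of ?h "- sqrt (htime t)" \<xi>] a by simp
  also have "(\<lambda>x. ?h (\<xi> + (- sqrt (htime t)) *\<^sub>R x)) = (\<lambda>x. (4 * pi) powr (3/2) * (heat 1 x * g (exp (t / 2) *\<^sub>R (\<xi> - sqrt (htime t) *\<^sub>R x))))"
  proof
    fix x
    have "(norm (\<xi> - (\<xi> + (- sqrt (htime t)) *\<^sub>R x)))\<^sup>2 = htime t * (norm x)\<^sup>2"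
      using a by (simp add: power_mult_distrib)
    then have "(norm (\<xi> - (\<xi> + (- sqrt (htime t)) *\<^sub>R x)))\<^sup>2 / (4 * htime t) = (norm x)\<^sup>2 / 4"
      using a by simp
    then have "(norm (\<xi> - (\<xi> + (- sqrt (htime t)) *\<^sub>R x)))\<^sup>2 / (4 * (1 - exp (- t))) = (norm x)\<^sup>2 / 4"
      by (simp only: htime_def)
    then show "?h (\<xi> + (- sqrt (htime t)) *\<^sub>R x) = (4 * pi) powr (3/2) * (heat 1 x * g (exp (t / 2) *\<^sub>R (\<xi> - sqrt (htime t) *\<^sub>R x)))"
      by (simp add: heat_def)
  qed
  finally have I: "(LBINT z. ?h z) = sqrt (htime t) ^ 3 * (4 * pi) powr (3/2) * (LBINT x. heat 1 x * g (exp (t / 2) *\<^sub>R (\<xi> - sqrt (htime t) *\<^sub>R x)))"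
    using a by simp
  have "(4 * pi * (1 - exp (- t))) powr (3 / 2) = sqrt (htime t) ^ 3 * (4 * pi) powr (3/2)"
    using a by (simp add: htime_def[symmetric] powr_mult sqrt_cube less_imp_le mult.commute)
  then show ?thesis using False a unfolding expL_def I by simp
qed

text \<open>
  For continuous \<open>g\<close> the integrand of \<open>expL_rescaled\<close> converges pointwise. The convergence is
  dominated by means of \<open>\<bar>g x\<bar> \<le> M * rho x powr (- (m + 2))\<close>, a bound that survives the
  convolution and is square integrable with weight \<open>rho powr m\<close>.
\<close>

lemma expL_continuous_compact:
  fixes g :: "real^3 \<Rightarrow> real"
  assumes m: "0 \<le> m" and g: "continuous_on UNIV g" "\<And>x. R < norm x \<Longrightarrow> g x = 0"
    and t: "\<And>n. 0 \<le> T n" "T \<longlonglongrightarrow> t" "0 \<le> t"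
  shows "(\<lambda>n. wnorm m (\<lambda>\<xi>. expL (T n) g \<xi> - expL t g \<xi>)) \<longlonglongrightarrow> 0"
proof -
  have [measurable]: "g \<in> borel_measurable borel" using g(1) by (rule borel_measurable_continuous_onI)
  define N where "N = m + 2"
  have N: "0 \<le> N" using m by (simp add: N_def)
  have "bounded (g ` cball 0 (max R 0))"
    by (intro compact_imp_bounded compact_continuous_image continuous_on_subset[OF g(1)]) auto
  then obtain M0 where M0: "0 < M0" "\<And>x. norm x \<le> max R 0 \<Longrightarrow> \<bar>g x\<bar> \<le> M0" unfolding bounded_pos by auto
  have gM: "\<bar>g x\<bar> \<le> M0" for x using M0 g(2)[of x] by (cases "norm x \<le> max R 0") auto
  define M where "M = M0 * (1 + max R 0) powr N"
  have gN: "\<bar>g x\<bar> \<le> M * rho x powr (- N)" for x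
  proof (cases "norm x \<le> max R 0")
    case True
    then have "rho x powr N \<le> (1 + max R 0) powr N" using N by (intro powr_mono2) (auto simp: rho_def)
    then have "1 \<le> (1 + max R 0) powr N * rho x powr (- N)" by (simp add: powr_minus divide_simps)
    then have "M0 * 1 \<le> M0 * ((1 + max R 0) powr N * rho x powr (- N))" using M0 by (intro mult_left_mono) auto
    then show ?thesis using gM[of x] by (simp add: M_def mult.assoc)
  next
    case False
    then show ?thesis using g(2)[of x] M0 by (simp add: M_def)
  qed
  have Mpos: "0 \<le> M" using M0 by (simp add: M_def)
  have GI: "integrable lborel (heat 1)"
    using nn_integral_heat[of 1] by (intro integrableI_nonneg) auto
  have GNI: "integrable lborel (\<lambda>x. heat 1 x * rho x powr N)"
  proof (rule integrableI_nonneg)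
    have "(\<integral>\<^sup>+x. ennreal (heat 1 x * rho x powr N) \<partial>lborel) \<le> (\<integral>\<^sup>+x. ennreal (exp (4 * N\<^sup>2)) * ennreal (wide 1 x) \<partial>lborel)"
      using rho_heat_le[OF N, of 1] by (intro nn_integral_mono) (simp add: ennreal_mult[symmetric] ennreal_leI mult.commute)
    also have "\<dots> = ennreal (exp (4 * N\<^sup>2)) * ennreal (sqrt (16 * pi * 1) ^ 3)"
      using nn_integral_wide'[of 1 0] by (simp add: nn_integral_cmult)
    also have "\<dots> < \<infinity>" by (simp add: ennreal_mult_less_top)
    finally show "(\<integral>\<^sup>+x. ennreal (heat 1 x * rho x powr N) \<partial>lborel) < \<infinity>" .
  qed auto
  define C where "C = (LBINT x. heat 1 x * rho x powr N)"
  have bound: "\<bar>expL s g \<xi>\<bar> \<le> exp s * M * C * rho \<xi> powr (- N)" if s: "0 \<le> s" for s \<xi>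
  proof -
    let ?z = "\<lambda>x. exp (s / 2) *\<^sub>R (\<xi> - sqrt (htime s) *\<^sub>R x)"
    have pt: "\<bar>heat 1 x * g (?z x)\<bar> \<le> M * rho \<xi> powr (- N) * (heat 1 x * rho x powr N)" for x
    proof -
      have a: "0 \<le> htime s" "sqrt (htime s) \<le> 1" using s by (auto simp: htime_def)
      have "rho \<xi> \<le> rho (\<xi> - sqrt (htime s) *\<^sub>R x) * rho (sqrt (htime s) *\<^sub>R x)" by (rule rho_le_diff)
      also have "\<dots> \<le> rho (?z x) * rho x"
      proof (intro mult_mono)
        show "rho (\<xi> - sqrt (htime s) *\<^sub>R x) \<le> rho (?z x)"
          unfolding rho_def using s by (simp add: mult_left_le_one_le mult_le_cancel_right1)
        show "rho (sqrt (htime s) *\<^sub>R x) \<le> rho x" using a by (intro rho_scale_le) auto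
      qed auto
      finally have "rho \<xi> powr N \<le> (rho (?z x) * rho x) powr N" using N by (intro powr_mono2) auto
      also have "\<dots> = rho (?z x) powr N * rho x powr N" by (rule powr_mult)
      finally have "rho (?z x) powr (- N) \<le> rho \<xi> powr (- N) * rho x powr N" by (simp add: powr_minus field_simps)
      then have "\<bar>g (?z x)\<bar> \<le> M * (rho \<xi> powr (- N) * rho x powr N)"
        using gN[of "?z x"] Mpos by (meson mult_left_mono order_trans)
      then have "heat 1 x * \<bar>g (?z x)\<bar> \<le> heat 1 x * (M * (rho \<xi> powr (- N) * rho x powr N))" by (intro mult_left_mono) auto
      then show ?thesis by (simp add: abs_mult mult_ac)
    qed
    have "\<bar>LBINT x. heat 1 x * g (?z x)\<bar> \<le> (LBINT x. M * rho \<xi> powr (- N) * (heat 1 x * rho x powr N))"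
    proof (rule order_trans[OF integral_abs_bound integral_mono])
      show I: "integrable lborel (\<lambda>x. M * rho \<xi> powr (- N) * (heat 1 x * rho x powr N))" using GNI by simp
      have "integrable lborel (\<lambda>x. heat 1 x * g (?z x))"
      proof (rule Bochner_Integration.integrable_bound[OF I])
        show "AE x in lborel. norm (heat 1 x * g (?z x)) \<le> norm (M * rho \<xi> powr (- N) * (heat 1 x * rho x powr N))"
          unfolding real_norm_def by (rule AE_I2) (rule order_trans[OF pt abs_ge_self])
      qed measurable
      then show "integrable lborel (\<lambda>x. \<bar>heat 1 x * g (?z x)\<bar>)" by (rule integrable_abs)
    qed (rule pt)
    also have "\<dots> = M * rho \<xi> powr (- N) * C" by (simp add: C_def)
    finally have "exp s * \<bar>LBINT x. heat 1 x * g (?z x)\<bar> \<le> exp s * (M * rho \<xi> powr (- N) * C)" by (intro mult_left_mono) auto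
    then show ?thesis unfolding expL_rescaled[OF s \<open>g \<in> borel_measurable borel\<close>] by (simp add: abs_mult mult_ac)
  qed
  obtain S where S: "\<And>n. T n \<le> S" "t \<le> S"
  proof -
    have "Bseq T" using t(2) by (rule convergent_imp_Bseq[OF convergentI])
    then obtain K where "\<And>n. \<bar>T n\<bar> \<le> K" by (auto simp: Bseq_def)
    then show ?thesis using that[of "max K t"] by (meson abs_le_D1 le_max_iff_disj order_refl)
  qed
  have C0: "0 \<le> C" unfolding C_def by (intro Bochner_Integration.integral_nonneg) simp
  let ?B = "\<lambda>\<xi>. 2 * exp S * M * C * rho \<xi> powr (- N)"
  show ?thesis
  proof (rule wnorm_tendsto_0[where g="?B"])
    show "(\<lambda>\<xi>. expL (T n) g \<xi> - expL t g \<xi>) \<in> borel_measurable borel" for n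
      using t(1)[of n] t(3) by measurable
    have bS: "\<bar>expL s g \<xi>\<bar> \<le> exp S * M * C * rho \<xi> powr (- N)" if "0 \<le> s" "s \<le> S" for s \<xi>
      by (rule order_trans[OF bound[OF that(1)]]) (use that Mpos C0 in \<open>auto intro!: mult_right_mono\<close>)
    show "AE \<xi> in lborel. norm (expL (T n) g \<xi> - expL t g \<xi>) \<le> ?B \<xi>" for n
    proof (rule AE_I2)
      fix \<xi>
      show "norm (expL (T n) g \<xi> - expL t g \<xi>) \<le> ?B \<xi>"
        using bS[OF t(1) S(1), of n \<xi>] bS[OF t(3) S(2), of \<xi>] by simp
    qed
    have "(rho \<xi> powr m * ?B \<xi>)\<^sup>2 = (2 * exp S * M * C)\<^sup>2 * rho \<xi> powr (-4)" for \<xi>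
    proof -
      have "rho \<xi> powr m * ?B \<xi> = 2 * exp S * M * C * (rho \<xi> powr m * rho \<xi> powr (- N))" by simp
      also have "rho \<xi> powr m * rho \<xi> powr (- N) = rho \<xi> powr (-2)" by (simp add: powr_add[symmetric] N_def)
      finally have "(rho \<xi> powr m * ?B \<xi>)\<^sup>2 = (2 * exp S * M * C * rho \<xi> powr (-2))\<^sup>2" by (simp only:)
      also have "\<dots> = (2 * exp S * M * C)\<^sup>2 * (rho \<xi> powr (-2))\<^sup>2" by (rule power_mult_distrib)
      also have "(rho \<xi> powr (-2))\<^sup>2 = rho \<xi> powr (-4)" by (simp add: powr_power)
      finally show ?thesis .
    qed
    moreover have "integrable lborel (\<lambda>\<xi>. rho \<xi> powr (-4))"
      using finite_rho_integral[of 4] by (intro integrableI_nonneg) auto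
    ultimately show "integrable lborel (\<lambda>\<xi>. (rho \<xi> powr m * ?B \<xi>)\<^sup>2)" by simp
    show "AE \<xi> in lborel. (\<lambda>n. expL (T n) g \<xi> - expL t g \<xi>) \<longlonglongrightarrow> 0"
    proof (rule AE_I2)
      fix \<xi> :: "real^3"
      let ?z = "\<lambda>s x. exp (s / 2) *\<^sub>R (\<xi> - sqrt (htime s) *\<^sub>R x)"
      have "(\<lambda>n. LBINT x. heat 1 x * g (?z (T n) x)) \<longlonglongrightarrow> (LBINT x. heat 1 x * g (?z t x))"
      proof (rule integral_dominated_convergence[where w="\<lambda>x. M0 * heat 1 x"])
        show "AE x in lborel. norm (heat 1 x * g (?z (T n) x)) \<le> M0 * heat 1 x" for n
          using gM by (intro AE_I2) (simp add: abs_mult mult.commute[of M0] mult_left_mono)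
        show "AE x in lborel. (\<lambda>n. heat 1 x * g (?z (T n) x)) \<longlonglongrightarrow> heat 1 x * g (?z t x)"
        proof (intro AE_I2 tendsto_mult tendsto_const)
          fix x
          have "(\<lambda>n. ?z (T n) x) \<longlonglongrightarrow> ?z t x" unfolding htime_def by (intro tendsto_intros t(2)) auto
          moreover have "isCont g (?z t x)" using g(1) by (simp add: continuous_on_eq_continuous_at)
          ultimately show "(\<lambda>n. g (?z (T n) x)) \<longlonglongrightarrow> g (?z t x)" using isCont_tendsto_compose by blast
        qed
      qed (use GI in auto)
      then have "(\<lambda>n. exp (T n) * (LBINT x. heat 1 x * g (?z (T n) x))) \<longlonglongrightarrow> exp t * (LBINT x. heat 1 x * g (?z t x))"
        by (intro tendsto_mult tendsto_exp t(2))
      then have "(\<lambda>n. expL (T n) g \<xi>) \<longlonglongrightarrow> expL t g \<xi>"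
        using t(1,3) by (simp only: expL_rescaled \<open>g \<in> borel_measurable borel\<close>)
      then show "(\<lambda>n. expL (T n) g \<xi> - expL t g \<xi>) \<longlonglongrightarrow> 0" by (simp add: LIM_zero)
    qed
  qed
qed

lemma expL_diff:
  assumes m: "0 \<le> m" and f: "f \<in> L2w m" "g \<in> L2w m" and t: "0 \<le> t"
  shows "expL t (\<lambda>x. f x - g x) \<xi> = expL t f \<xi> - expL t g \<xi>"
proof (cases "t = 0")
  case False
  then have t: "0 < t" using t by simp
  have I: "integrable lborel (\<lambda>y. shrink t * heat (htime t) (\<xi> - shrink t *\<^sub>R y) * h y)" if h: "h \<in> L2w m" for h
  proof -
    have [measurable]: "h \<in> borel_measurable borel" using h by (rule L2w_measurable)
    have 1: "(\<integral>\<^sup>+ x. (ennreal \<bar>h x\<bar>)\<^sup>2 \<partial>lborel) < \<infinity>"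
      using L2_finite[OF m h] by (simp add: le_less_trans)
    have 2: "(\<integral>\<^sup>+ y. (ennreal \<bar>heat (htime t) (\<xi> - shrink t *\<^sub>R y)\<bar>)\<^sup>2 \<partial>lborel) < \<infinity>"
      using t by (intro gauss_L2[OF _ _ _ heat_le_wide]) auto
    have "integrable lborel (\<lambda>y. heat (htime t) (\<xi> - shrink t *\<^sub>R y) * h y)"
      by (rule integrable_L2_mult[OF _ _ 2 1]) auto
    then have "integrable lborel (\<lambda>y. shrink t * (heat (htime t) (\<xi> - shrink t *\<^sub>R y) * h y))" by simp
    then show ?thesis by (simp only: mult.assoc)
  qed
  have [measurable]: "f \<in> borel_measurable borel" "g \<in> borel_measurable borel" using f by (auto intro: L2w_measurable)
  have "expL t (\<lambda>x. f x - g x) \<xi> = (LBINT y. shrink t * heat (htime t) (\<xi> - shrink t *\<^sub>R y) * f y - shrink t * heat (htime t) (\<xi> - shrink t *\<^sub>R y) * g y)"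
    by (subst expL_eq[OF t]) (auto simp: right_diff_distrib)
  also have "\<dots> = expL t f \<xi> - expL t g \<xi>"
    by (subst Bochner_Integration.integral_diff[OF I[OF f(1)] I[OF f(2)]]) (simp add: expL_eq[OF t])
  finally show ?thesis .
qed (simp add: expL_def)

lemma expL_L2w:
  assumes m: "0 \<le> m"
  shows "\<exists>C\<ge>0. \<forall>t\<ge>0. \<forall>f\<in>L2w m. expL t f \<in> L2w m \<and> wnorm m (expL t f) \<le> C * exp t * wnorm m f"
proof -
  obtain C where C: "C < \<infinity>" "\<And>t f. 0 \<le> t \<Longrightarrow> f\<in>borel_measurable borel \<Longrightarrow> wsqn m (expL t f) \<le> C * ennreal (exp (t / 2)) * wsqn m f"
    using expL_bound[OF m] by blast
  obtain c where c: "0 \<le> c" "C = ennreal c" using C(1) by (cases C) auto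
  show ?thesis
  proof (intro exI[of _ "sqrt c"] conjI allI ballI impI)
    show "0 \<le> sqrt c" using c by simp
    fix t :: real and f :: "real^3 \<Rightarrow> real" assume t: "0 \<le> t" and f: "f \<in> L2w m"
    have [measurable]: "f \<in> borel_measurable borel" using f by (rule L2w_measurable)
    have "wsqn m (expL t f) \<le> C * ennreal (exp (t / 2)) * wsqn m f" by (rule C(2)[OF t]) simp
    also have "\<dots> = ennreal (c * exp (t / 2) * (wnorm m f)\<^sup>2)"
      unfolding wsqn_wnorm[OF f] c(2) using c(1) by (simp add: ennreal_mult[symmetric])
    also have "\<dots> \<le> ennreal ((sqrt c * exp t * wnorm m f)\<^sup>2)"
    proof (rule ennreal_leI)
      have "exp (t / 2) \<le> (exp t)\<^sup>2" using t by (simp add: power2_eq_square exp_add[symmetric])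
      then have "c * exp (t / 2) * (wnorm m f)\<^sup>2 \<le> c * (exp t)\<^sup>2 * (wnorm m f)\<^sup>2" using c by (intro mult_right_mono mult_left_mono) auto
      then show "c * exp (t / 2) * (wnorm m f)\<^sup>2 \<le> (sqrt c * exp t * wnorm m f)\<^sup>2" using c by (simp add: power_mult_distrib)
    qed
    finally have *: "wsqn m (expL t f) \<le> ennreal ((sqrt c * exp t * wnorm m f)\<^sup>2)" .
    show "expL t f \<in> L2w m" "wnorm m (expL t f) \<le> sqrt c * exp t * wnorm m f"
      using t c by (auto intro!: wnorm_leI[OF _ *])
  qed
qed

text \<open>
  From compactly supported continuous functions to all of \<open>L\<^sup>2(m)\<close> by density, since the
  semigroup is bounded uniformly on bounded time intervals.
\<close>

lemma expL_strongly_continuous: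
  fixes f :: "real^3 \<Rightarrow> real"
  assumes m: "0 \<le> m" and f: "f \<in> L2w m" and t: "\<And>n. 0 \<le> T n" "T \<longlonglongrightarrow> t" "0 \<le> t"
  shows "(\<lambda>n. wnorm m (\<lambda>\<xi>. expL (T n) f \<xi> - expL t f \<xi>)) \<longlonglongrightarrow> 0"
proof (rule LIMSEQ_I)
  fix r :: real assume r: "0 < r"
  obtain C where C: "0 \<le> C" "\<And>\<sigma> f. 0 \<le> \<sigma> \<Longrightarrow> f\<in>L2w m \<Longrightarrow> expL \<sigma> f \<in> L2w m" "\<And>\<sigma> f. 0 \<le> \<sigma> \<Longrightarrow> f\<in>L2w m \<Longrightarrow> wnorm m (expL \<sigma> f) \<le> C * exp \<sigma> * wnorm m f"
    using expL_L2w[OF m] by blast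
  obtain S where S: "\<And>n. T n \<le> S" "t \<le> S"
  proof -
    have "Bseq T" using t(2) by (rule convergent_imp_Bseq[OF convergentI])
    then obtain K where "\<And>n. \<bar>T n\<bar> \<le> K" by (auto simp: Bseq_def)
    then show ?thesis using that[of "max K t"] by (meson abs_le_D1 le_max_iff_disj order_refl)
  qed
  define e where "e = r / (4 * (C * exp S + 1))"
  have CS: "0 \<le> C * exp S" using C by simp
  have e: "0 < e" unfolding e_def using r CS by (intro divide_pos_pos) auto
  have Ce: "C * exp S * e < r / 4"
  proof -
    have "C * exp S * e < (C * exp S + 1) * e" using e by simp
    also have "\<dots> = r / 4" unfolding e_def using CS by (simp add: field_simps)
    finally show ?thesis .
  qed
  obtain g R where g: "continuous_on UNIV g" "\<And>x. R < norm x \<Longrightarrow> g x = 0" "g \<in> L2w m" "wnorm m (\<lambda>x. f x - g x) < e"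
    using compactly_supported_dense[OF m f e] by blast
  have near: "wnorm m (\<lambda>\<xi>. expL s f \<xi> - expL s g \<xi>) < r / 4" if s: "0 \<le> s" "s \<le> S" for s
  proof -
    have "(\<lambda>\<xi>. expL s f \<xi> - expL s g \<xi>) = expL s (\<lambda>x. f x - g x)"
      by (simp add: fun_eq_iff expL_diff[OF m f g(3) s(1)])
    then have "wnorm m (\<lambda>\<xi>. expL s f \<xi> - expL s g \<xi>) = wnorm m (expL s (\<lambda>x. f x - g x))" by simp
    also have "\<dots> \<le> C * exp s * wnorm m (\<lambda>x. f x - g x)" by (intro C s L2w_diff f g)
    also have "\<dots> \<le> C * exp S * e" using C s g(4) by (intro mult_mono) auto
    finally show ?thesis using Ce by linarith
  qed
  have "(\<lambda>n. wnorm m (\<lambda>\<xi>. expL (T n) g \<xi> - expL t g \<xi>)) \<longlonglongrightarrow> 0"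
    by (rule expL_continuous_compact[OF m g(1,2) t])
  then have "\<forall>\<^sub>F n in sequentially. wnorm m (\<lambda>\<xi>. expL (T n) g \<xi> - expL t g \<xi>) < r / 4"
    using r by (intro order_tendstoD(2)) auto
  then obtain n0 where n0: "\<And>n. n0 \<le> n \<Longrightarrow> wnorm m (\<lambda>\<xi>. expL (T n) g \<xi> - expL t g \<xi>) < r / 4" by (auto simp: eventually_sequentially)
  show "\<exists>no. \<forall>n\<ge>no. norm (wnorm m (\<lambda>\<xi>. expL (T n) f \<xi> - expL t f \<xi>) - 0) < r"
  proof (intro exI allI impI)
    fix n assume n: "n0 \<le> n"
    have "wnorm m (\<lambda>\<xi>. expL (T n) f \<xi> - expL t f \<xi>) \<le> wnorm m (\<lambda>\<xi>. expL (T n) f \<xi> - expL (T n) g \<xi>) + wnorm m (\<lambda>\<xi>. expL (T n) g \<xi> - expL t f \<xi>)"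
      by (intro wnorm_triangle_diff C f g t)
    also have "wnorm m (\<lambda>\<xi>. expL (T n) g \<xi> - expL t f \<xi>) \<le> wnorm m (\<lambda>\<xi>. expL (T n) g \<xi> - expL t g \<xi>) + wnorm m (\<lambda>\<xi>. expL t g \<xi> - expL t f \<xi>)"
      by (intro wnorm_triangle_diff C f g t)
    finally show "norm (wnorm m (\<lambda>\<xi>. expL (T n) f \<xi> - expL t f \<xi>) - 0) < r"
      using n0[OF n] near[OF t(1) S(1), of n] near[OF t(3) S(2)] wnorm_minus_commute[of m "expL t g" "expL t f"] r by simp
  qed
qed

lemma wnorm_le_components:
  fixes f :: "real^3 \<Rightarrow> real^3"
  assumes [measurable]: "f \<in> borel_measurable borel" and f: "\<And>i. (\<lambda>x. f x $ i) \<in> L2w m"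
  shows "f \<in> L2w m" "wnorm m f \<le> (\<Sum>i\<in>UNIV. wnorm m (\<lambda>x. f x $ i))"
proof -
  have "wsqn m f = (\<Sum>i\<in>UNIV. ennreal ((wnorm m (\<lambda>x. f x $ i))\<^sup>2))"
    by (simp only: wsqn_components[OF assms(1)] wsqn_wnorm[OF f])
  also have "\<dots> = ennreal (\<Sum>i\<in>UNIV. (wnorm m (\<lambda>x. f x $ i))\<^sup>2)" by (simp add: sum_ennreal)
  also have "\<dots> \<le> ennreal ((\<Sum>i\<in>UNIV. wnorm m (\<lambda>x. f x $ i))\<^sup>2)"
    by (intro ennreal_leI) (simp add: sum_3 power2_eq_square algebra_simps)
  finally show "f \<in> L2w m" "wnorm m f \<le> (\<Sum>i\<in>UNIV. wnorm m (\<lambda>x. f x $ i))"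
    by (auto intro!: wnorm_leI sum_nonneg)
qed

lemma component_L2w:
  fixes f :: "real^3 \<Rightarrow> real^3"
  assumes f: "f \<in> L2w m"
  shows "(\<lambda>x. f x $ i) \<in> L2w m"
proof (rule L2wI)
  show "(\<lambda>x. f x $ i) \<in> borel_measurable borel" using L2w_measurable[OF f] by measurable
  show "wsqn m (\<lambda>x. f x $ i) < \<infinity>" using wsqn_component[of m f i] wsqn_wnorm[OF f] by (simp add: le_less_trans)
qed

text \<open>
  Continuous curves with values in \<open>L\<^sup>2(m)\<close>, described by sequences.
\<close>

definition cpath :: "real \<Rightarrow> (real \<Rightarrow> real^3 \<Rightarrow> real^3) \<Rightarrow> bool" where
  "cpath m w \<longleftrightarrow> (\<forall>\<tau>\<ge>0. w \<tau> \<in> L2w m) \<and> (\<forall>T t. (\<forall>n. 0 \<le> T n) \<longrightarrow> 0 \<le> t \<longrightarrow> T \<longlonglongrightarrow> t \<longrightarrow> (\<lambda>n::nat. wnorm m (\<lambda>x. w (T n) x - w t x)) \<longlonglongrightarrow> 0)"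

lemma cpath_expLv:
  assumes m: "0 \<le> m" and w: "w \<in> L2w m"
  shows "cpath m (\<lambda>\<tau>. expLv \<tau> w)"
  unfolding cpath_def
proof (intro conjI allI impI)
  have [measurable]: "w \<in> borel_measurable borel" using w by (rule L2w_measurable)
  have ex: "expL s (\<lambda>y. w y $ i) \<in> L2w m" if "0 \<le> s" for s i
    using expL_L2w[OF m] that component_L2w[OF w, of i] by blast
  show "expLv s w \<in> L2w m" if s: "0 \<le> s" for s
    using wnorm_le_components(1)[OF expLv_measurable[OF _ s]] ex[OF s] by (simp add: expLv_def)
  fix T :: "nat \<Rightarrow> real" and t :: real assume T: "\<forall>n. 0 \<le> T n" "0 \<le> t" "T \<longlonglongrightarrow> t"
  have "(\<lambda>n. \<Sum>i\<in>UNIV. wnorm m (\<lambda>\<xi>. expL (T n) (\<lambda>y. w y $ i) \<xi> - expL t (\<lambda>y. w y $ i) \<xi>)) \<longlonglongrightarrow> (\<Sum>i\<in>(UNIV::3 set). 0)"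
    using T by (intro tendsto_sum expL_strongly_continuous[OF m component_L2w[OF w]]) auto
  then have lim: "(\<lambda>n. \<Sum>i\<in>UNIV. wnorm m (\<lambda>\<xi>. expL (T n) (\<lambda>y. w y $ i) \<xi> - expL t (\<lambda>y. w y $ i) \<xi>)) \<longlonglongrightarrow> 0" by simp
  show "(\<lambda>n. wnorm m (\<lambda>\<xi>. expLv (T n) w \<xi> - expLv t w \<xi>)) \<longlonglongrightarrow> 0"
  proof (rule Lim_null_comparison[OF _ lim], intro always_eventually allI)
    fix n
    have [measurable]: "expLv (T n) w \<in> borel_measurable borel" "expLv t w \<in> borel_measurable borel"
      using T by (auto intro: expLv_measurable)
    have "wnorm m (\<lambda>\<xi>. expLv (T n) w \<xi> - expLv t w \<xi>) \<le> (\<Sum>i\<in>UNIV. wnorm m (\<lambda>\<xi>. (expLv (T n) w \<xi> - expLv t w \<xi>) $ i))"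
    proof (rule wnorm_le_components(2))
      show "(\<lambda>x. (expLv (T n) w x - expLv t w x) $ i) \<in> L2w m" for i
        using L2w_diff(1)[OF ex ex, of "T n" t i i] T by (simp add: expLv_def)
    qed measurable
    then show "norm (wnorm m (\<lambda>\<xi>. expLv (T n) w \<xi> - expLv t w \<xi>)) \<le> (\<Sum>i\<in>UNIV. wnorm m (\<lambda>\<xi>. expL (T n) (\<lambda>y. w y $ i) \<xi> - expL t (\<lambda>y. w y $ i) \<xi>))"
      by (simp add: expLv_def)
  qed
qed

section \<open>The divergence constraint\<close>

lemma partial_zero_outside:
  assumes "\<And>x. R < norm x \<Longrightarrow> P x = 0" "R < norm x"
  shows "partial j P x = 0"
proof -
  have "open {y::real^3. R < norm y}" by (intro open_Collect_less continuous_intros)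
  then obtain e where e: "0 < e" "ball x e \<subseteq> {y. R < norm y}" using assms(2) by (auto simp: open_contains_ball)
  have "\<forall>\<^sub>F t in nhds 0. P (x + t *\<^sub>R axis j 1) = 0"
  proof -
    have "\<forall>\<^sub>F t in nhds 0. t \<in> ball (0::real) e" by (intro eventually_nhds_in_open) (use e in auto)
    then show ?thesis
    proof eventually_elim
      case (elim t)
      then have "x + t *\<^sub>R axis j 1 \<in> ball x e" by (simp add: dist_norm norm_axis_1)
      then show ?case using e assms(1) by auto
    qed
  qed
  then have "deriv (\<lambda>t. P (x + t *\<^sub>R axis j 1)) 0 = deriv (\<lambda>t. 0) 0" by (rule deriv_cong_ev) simp
  then show ?thesis unfolding partial_def by simp
qed

lemma continuous_support_bounded:
  fixes h :: "real^3 \<Rightarrow> real"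
  assumes "continuous_on UNIV h" "\<And>x. R < norm x \<Longrightarrow> h x = 0"
  shows "\<exists>B\<ge>0. \<forall>x. \<bar>h x\<bar> \<le> B"
proof -
  have "bounded (h ` cball 0 R)"
    by (intro compact_imp_bounded compact_continuous_image continuous_on_subset[OF assms(1)]) auto
  then obtain B where B: "0 < B" "\<And>x. norm x \<le> R \<Longrightarrow> \<bar>h x\<bar> \<le> B" unfolding bounded_pos by auto
  then have "\<bar>h x\<bar> \<le> B" for x using assms(2)[of x] by (cases "norm x \<le> R") auto
  then show ?thesis using B by (intro exI[of _ B]) auto
qed

lemma integrable_bounded_support:
  fixes h :: "real^3 \<Rightarrow> real"
  assumes "h \<in> borel_measurable borel" "\<And>x. \<bar>h x\<bar> \<le> B" "\<And>x. R < norm x \<Longrightarrow> h x = 0"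
  shows "integrable lborel h"
proof (rule Bochner_Integration.integrable_bound)
  show "integrable lborel (\<lambda>x::real^3. B * indicator (cball 0 R) x)"
    using emeasure_bounded_finite[OF bounded_cball, of "0::real^3" R]
    by (intro integrable_mult_right integrable_real_indicator) auto
  show "AE x in lborel. norm (h x) \<le> norm (B * indicator (cball 0 R) x)"
  proof (rule AE_I2)
    fix x
    have "0 \<le> B" using assms(2)[of x] by linarith
    then show "norm (h x) \<le> norm (B * indicator (cball 0 R) x)" using assms(2)[of x] assms(3)[of x]
      by (cases "norm x \<le> R") auto
  qed
qed (use assms in auto)

lemma continuous_support_integrable:
  fixes h :: "real^3 \<Rightarrow> real"
  assumes "continuous_on UNIV h" "\<And>x. R < norm x \<Longrightarrow> h x = 0"
  shows "integrable lborel h"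
  using continuous_support_bounded[OF assms] integrable_bounded_support[OF borel_measurable_continuous_onI[OF assms(1)] _ assms(2)]
  by blast

lemma Ck1_partial_continuous: "Ck (Suc 0) P \<Longrightarrow> continuous_on UNIV (partial j P)"
  by simp

text \<open>
  The derivative is the limit of difference quotients, whose integrals vanish by translation
  invariance; the limit may be exchanged with the integral because the quotients are bounded and
  supported in a fixed ball.
\<close>

lemma integral_partial_zero:
  fixes P :: "real^3 \<Rightarrow> real"
  assumes P: "Ck (Suc 0) P" and supp: "\<And>x. R < norm x \<Longrightarrow> P x = 0"
  shows "(LBINT x. partial j P x) = 0"
proof -
  let ?b = "axis j 1 :: real^3"
  have Pc: "continuous_on UNIV P" using Ck_SucD[OF P] by simp
  have [measurable]: "P \<in> borel_measurable borel" by (rule borel_measurable_continuous_onI[OF Pc])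
  have [measurable]: "partial j P \<in> borel_measurable borel" by (rule borel_measurable_continuous_onI[OF Ck1_partial_continuous[OF P]])
  have dz: "partial j P x = 0" if "R < norm x" for x by (rule partial_zero_outside[OF supp that])
  obtain B where B: "0 \<le> B" "\<And>x. \<bar>partial j P x\<bar> \<le> B"
    using continuous_support_bounded[OF Ck1_partial_continuous[OF P] dz] by blast
  have der: "((\<lambda>t. P (x + t *\<^sub>R ?b)) has_real_derivative partial j P (x + t *\<^sub>R ?b)) (at t)" for x t
  proof -
    obtain P' where P': "(P has_derivative P') (at (x + t *\<^sub>R ?b))"
      using Ck_differentiable[OF P] by (auto simp: differentiable_def)
    interpret bounded_linear P' using P' by (rule has_derivative_bounded_linear)
    have "((\<lambda>t. x + t *\<^sub>R ?b) has_derivative (\<lambda>t. t *\<^sub>R ?b)) (at t)" by (auto intro!: derivative_eq_intros)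
    from has_derivative_compose[OF this P'] show ?thesis
      unfolding has_field_derivative_def partial_eq[OF P'] by (simp add: scaleR mult.commute[of _ "P' _"])
  qed
  define d where "d n = inverse (real (Suc n))" for n
  have d: "0 < d n" "d n \<le> 1" for n by (auto simp: d_def inverse_le_1_iff)
  have d0: "d \<longlonglongrightarrow> 0" unfolding d_def by (rule LIMSEQ_inverse_real_of_nat)
  define q where "q n x = (P (x + d n *\<^sub>R ?b) - P x) / d n" for n x
  have PI: "integrable lborel P" by (rule continuous_support_integrable[OF Pc supp])
  have trans: "integrable lborel (\<lambda>x. P (x + v))" "(LBINT x. P (x + v)) = (LBINT x. P x)" for v
  proof -
    have c: "continuous_on UNIV (\<lambda>x. P (x + v))" by (intro continuous_on_compose2[OF Pc] continuous_intros) auto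
    show "integrable lborel (\<lambda>x. P (x + v))"
    proof (rule continuous_support_integrable[OF c, of "R + norm v"])
      fix x :: "real^3" assume "R + norm v < norm x"
      then have "R < norm (x + v)" using norm_triangle_ineq2[of x "- v"] by simp
      then show "P (x + v) = 0" by (rule supp)
    qed
    show "(LBINT x. P (x + v)) = (LBINT x. P x)"
      using integral_affine[of P 1 v] by (simp add: add.commute)
  qed
  have q0: "(LBINT x. q n x) = 0" for n
    unfolding q_def using trans[of "d n *\<^sub>R ?b"] PI by (simp add: Bochner_Integration.integral_diff)
  have "(\<lambda>n. LBINT x. q n x) \<longlonglongrightarrow> (LBINT x. partial j P x)"
  proof (rule integral_dominated_convergence[where w="\<lambda>x. B * indicator (cball 0 (R + 1)) x"])
    show "q n \<in> borel_measurable lborel" for n unfolding q_def by measurable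
    show "integrable lborel (\<lambda>x::real^3. B * indicator (cball 0 (R + 1)) x)"
      using emeasure_bounded_finite[OF bounded_cball, of "0::real^3" "R + 1"]
      by (intro integrable_mult_right integrable_real_indicator) auto
    show "AE x in lborel. (\<lambda>n. q n x) \<longlonglongrightarrow> partial j P x"
    proof (rule AE_I2)
      fix x :: "real^3"
      have "((\<lambda>h. (P (x + (0 + h) *\<^sub>R ?b) - P (x + 0 *\<^sub>R ?b)) / h) \<longlongrightarrow> partial j P (x + 0 *\<^sub>R ?b)) (at 0)"
        using der[of x 0] unfolding DERIV_def .
      moreover have "filterlim d (at 0) sequentially" using d0 d(1) by (auto simp: filterlim_at less_imp_neq[symmetric])
      ultimately have "(\<lambda>n. (P (x + (0 + d n) *\<^sub>R ?b) - P (x + 0 *\<^sub>R ?b)) / d n) \<longlonglongrightarrow> partial j P (x + 0 *\<^sub>R ?b)"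
        by (rule filterlim_compose)
      then show "(\<lambda>n. q n x) \<longlonglongrightarrow> partial j P x" unfolding q_def by simp
    qed
    show "AE x in lborel. norm (q n x) \<le> B * indicator (cball 0 (R + 1)) x" for n
    proof (rule AE_I2)
      fix x :: "real^3"
      show "norm (q n x) \<le> B * indicator (cball 0 (R + 1)) x"
      proof (cases "norm x \<le> R + 1")
        case True
        from MVT2[OF d(1)[of n] der[of x]] obtain z where "P (x + d n *\<^sub>R ?b) - P (x + 0 *\<^sub>R ?b) = (d n - 0) * partial j P (x + z *\<^sub>R ?b)" by auto
        then have "q n x = partial j P (x + z *\<^sub>R ?b)" unfolding q_def using d(1)[of n] by simp
        then show ?thesis using B True by simp
      next
        case False
        have "norm (d n *\<^sub>R ?b) \<le> 1" using d[of n] by (simp add: norm_axis_1)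
        then have "R < norm (x + d n *\<^sub>R ?b)" using False norm_triangle_ineq2[of x "- (d n *\<^sub>R ?b)"] by simp
        moreover have "R < norm x" using False by simp
        ultimately have "q n x = 0" unfolding q_def by (simp add: supp)
        then show ?thesis using B by simp
      qed
    qed
  qed measurable
  then show ?thesis unfolding q0 by (simp add: LIMSEQ_const_iff)
qed

lemma test_functionD:
  assumes "test_function \<phi>"
  shows "Ck k \<phi>" "\<exists>R. \<forall>x. R < norm x \<longrightarrow> \<phi> x = 0"
proof -
  show "Ck k \<phi>" using assms by (simp add: test_function_def)
  have "bounded (closure {\<xi>. \<phi> \<xi> \<noteq> 0})" using assms by (auto simp: test_function_def intro: compact_imp_bounded)
  then obtain R where "\<And>x. x \<in> closure {\<xi>. \<phi> \<xi> \<noteq> 0} \<Longrightarrow> norm x \<le> R" unfolding bounded_iff by blast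
  then show "\<exists>R. \<forall>x. R < norm x \<longrightarrow> \<phi> x = 0" using closure_subset by (meson in_mono mem_Collect_eq not_le)
qed

lemma integration_by_parts:
  assumes \<phi>: "Ck (Suc 0) \<phi>" "\<And>x. R < norm x \<Longrightarrow> \<phi> x = 0" and H: "Ck (Suc 0) H"
  shows "(LBINT x. partial i \<phi> x * H x) = - (LBINT x. \<phi> x * partial i H x)"
proof -
  have c: "continuous_on UNIV \<phi>" "continuous_on UNIV H" using Ck_SucD[OF \<phi>(1)] Ck_SucD[OF H] by simp_all
  have I1: "integrable lborel (\<lambda>x. partial i \<phi> x * H x)"
    by (rule continuous_support_integrable[of _ R])
       (auto intro!: continuous_on_mult c Ck1_partial_continuous \<phi> simp: partial_zero_outside[OF \<phi>(2)])
  have I2: "integrable lborel (\<lambda>x. \<phi> x * partial i H x)"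
    by (rule continuous_support_integrable[of _ R])
       (auto intro!: continuous_on_mult c Ck1_partial_continuous H simp: \<phi>(2))
  have "(LBINT x. partial i (\<lambda>x. \<phi> x * H x) x) = 0"
    by (rule integral_partial_zero[of _ R]) (auto intro!: Ck_mult[OF \<phi>(1) H] simp del: Ck.simps simp: \<phi>(2))
  moreover have "partial i (\<lambda>x. \<phi> x * H x) x = \<phi> x * partial i H x + partial i \<phi> x * H x" for x
    by (rule partial_rule(2)[OF Ck_differentiable[OF \<phi>(1)] Ck_differentiable[OF H]])
  ultimately show ?thesis using I1 I2 by simp
qed

lemma heat_minus: "heat a (- x) = heat a x" and heatD_minus: "heatD a j (- x) = - heatD a j x"
  by (simp_all add: heat_def heatD_def)

lemma heat_translate: "Ck k (\<lambda>x. heat a (x - z))" "partial j (\<lambda>x. heat a (x - z)) x = heatD a j (x - z)"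
proof -
  have e: "(\<lambda>x. heat a (x - z)) = (\<lambda>x. heat a (z - 1 *\<^sub>R x))"
    using heat_minus[of a "z - _"] by (simp add: fun_eq_iff)
  show "Ck k (\<lambda>x. heat a (x - z))" unfolding e by (rule heat_Ck)
  show "partial j (\<lambda>x. heat a (x - z)) x = heatD a j (x - z)"
    unfolding e heat_partial using heatD_minus[of a j "z - x"] by simp
qed

definition heatDD :: "real \<Rightarrow> 3 \<Rightarrow> 3 \<Rightarrow> real^3 \<Rightarrow> real" where
  "heatDD a i j x = (x $ i * x $ j / (4 * a\<^sup>2) - (if i = j then 1 else 0) / (2 * a)) * heat a x"

lemma heatDD_sym: "heatDD a i j = heatDD a j i"
  by (auto simp: heatDD_def fun_eq_iff)

lemma heatD_translate: "Ck k (\<lambda>x. heatD a j (x - z))" "partial i (\<lambda>x. heatD a j (x - z)) x = heatDD a i j (x - z)"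
proof -
  let ?l = "\<lambda>x::real^3. (- 1 / (2 * a)) * (x $ j + (- (z $ j)))"
  have e: "(\<lambda>x. heatD a j (x - z)) = (\<lambda>x. ?l x * heat a (x - z))"
    by (simp add: heatD_def fun_eq_iff) (simp add: left_diff_distrib diff_divide_distrib)
  have l: "Ck k ?l" for k by (rule Ck_mult[OF Ck_const Ck_add[OF Ck_nth Ck_const]])
  show "Ck k (\<lambda>x. heatD a j (x - z))" unfolding e by (rule Ck_mult[OF l heat_translate(1)])
  have dl: "partial i ?l x = (- 1 / (2 * a)) * axis i 1 $ j"
  proof (rule partial_eq)
    show "(?l has_derivative (\<lambda>h. (- 1 / (2 * a)) * h $ j)) (at x)"
      by (intro has_derivative_mult_right has_derivative_add_const bounded_linear_imp_has_derivative bounded_linear_vec_nth)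
  qed
  have "partial i (\<lambda>x. ?l x * heat a (x - z)) x = ?l x * heatD a i (x - z) + partial i ?l x * heat a (x - z)"
    using partial_rule(2)[OF Ck_differentiable[OF l] Ck_differentiable[OF heat_translate(1)]] by (simp add: heat_translate(2))
  also have "\<dots> = heatDD a i j (x - z)"
  proof -
    have alg: "(- 1 / (2 * a)) * q * (- p / (2 * a) * G) + (- 1 / (2 * a)) * d * G = (p * q / (4 * a\<^sup>2) - d / (2 * a)) * G" for p q d G :: real
      by (cases "a = 0") (auto simp: field_simps power2_eq_square)
    have ax: "axis i (1::real) $ j = (if i = j then 1 else 0)" by (simp add: axis_def)
    show ?thesis unfolding dl heatDD_def heatD_def ax
      using alg[of "x $ j - z $ j" "x $ i - z $ i" "heat a (x - z)" "if i = j then 1 else 0"] by simp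
  qed
  finally show "partial i (\<lambda>x. heatD a j (x - z)) x = heatDD a i j (x - z)" unfolding e .
qed

text \<open>
  The absolute convergence rests on \<open>rho y \<le> rho (\<xi> - e y) * rho \<xi> / e\<close>: two powers of \<open>rho\<close> from
  \<open>F\<close> compensate the missing integrability of \<open>f\<close>, and \<open>\<phi>\<close> has bounded support.
\<close>

lemma convolution_Fubini:
  fixes F f \<phi> :: "real^3 \<Rightarrow> real"
  assumes [measurable]: "F \<in> borel_measurable borel" "f \<in> borel_measurable borel" "\<phi> \<in> borel_measurable borel"
    and F: "\<And>x. rho x powr 2 * \<bar>F x\<bar> \<le> B" and e: "0 < e" "e \<le> 1"
    and f: "integrable lborel (\<lambda>y. rho y powr (-2) * f y)"
    and \<phi>: "\<And>x. \<bar>\<phi> x\<bar> \<le> B'" "\<And>x. R < norm x \<Longrightarrow> \<phi> x = 0"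
  shows "integrable lborel (\<lambda>\<xi>. \<phi> \<xi> * (LBINT y. F (\<xi> - e *\<^sub>R y) * f y))"
    and "(LBINT \<xi>. \<phi> \<xi> * (LBINT y. F (\<xi> - e *\<^sub>R y) * f y)) = (LBINT y. f y * (LBINT \<xi>. \<phi> \<xi> * F (\<xi> - e *\<^sub>R y)))"
proof -
  have B: "0 \<le> B" using F[of 0] by (meson abs_ge_zero mult_nonneg_nonneg order_trans powr_ge_zero)
  have B': "0 \<le> B'" using \<phi>(1)[of 0] by linarith
  let ?k = "\<lambda>\<xi> y. \<phi> \<xi> * (F (\<xi> - e *\<^sub>R y) * f y)"
  define K where "K \<xi> = \<bar>\<phi> \<xi>\<bar> * (B * (rho \<xi> / e) powr 2)" for \<xi>
  have [measurable]: "K \<in> borel_measurable borel" unfolding K_def by measurable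
  have pt: "\<bar>?k \<xi> y\<bar> \<le> K \<xi> * \<bar>rho y powr (-2) * f y\<bar>" for \<xi> y
  proof -
    let ?z = "\<xi> - e *\<^sub>R y"
    have "e * rho y \<le> rho (e *\<^sub>R y)" using e by (simp add: rho_def algebra_simps)
    also have "\<dots> \<le> rho \<xi> * rho (- ?z)" using rho_add_le[of \<xi> "- ?z"] by simp
    also have "rho (- ?z) = rho ?z" by (simp add: rho_def norm_minus_commute)
    finally have "rho y \<le> (rho \<xi> / e) * rho ?z" using e by (simp add: field_simps)
    then have "rho y powr 2 \<le> ((rho \<xi> / e) * rho ?z) powr 2" by (intro powr_mono2) auto
    also have "\<dots> = (rho \<xi> / e) powr 2 * rho ?z powr 2" by (rule powr_mult)
    finally have "rho y powr 2 * \<bar>F ?z\<bar> \<le> (rho \<xi> / e) powr 2 * (rho ?z powr 2 * \<bar>F ?z\<bar>)"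
      by (simp only: mult.assoc[symmetric]) (rule mult_right_mono, auto)
    also have "\<dots> \<le> (rho \<xi> / e) powr 2 * B" by (intro mult_left_mono F) auto
    finally have "\<bar>F ?z\<bar> \<le> (B * (rho \<xi> / e) powr 2) * rho y powr (-2)" by (simp add: powr_minus field_simps)
    then have "\<bar>\<phi> \<xi>\<bar> * (\<bar>F ?z\<bar> * \<bar>f y\<bar>) \<le> \<bar>\<phi> \<xi>\<bar> * (((B * (rho \<xi> / e) powr 2) * rho y powr (-2)) * \<bar>f y\<bar>)"
      by (intro mult_left_mono mult_right_mono) auto
    then show ?thesis by (simp add: K_def abs_mult mult_ac)
  qed
  have KI: "integrable lborel K"
  proof (rule integrable_bounded_support)
    show "K \<xi> = 0" if "R < norm \<xi>" for \<xi> using \<phi>(2)[OF that] by (simp add: K_def)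
    show "\<bar>K \<xi>\<bar> \<le> B' * (B * ((1 + max R 0) / e) powr 2)" for \<xi>
    proof (cases "R < norm \<xi>")
      case True then show ?thesis using \<phi>(2)[OF True] B B' by (simp add: K_def)
    next
      case False
      then have "rho \<xi> \<le> 1 + max R 0" by (simp add: rho_def)
      then have "(rho \<xi> / e) powr 2 \<le> ((1 + max R 0) / e) powr 2" using e by (intro powr_mono2 divide_right_mono) auto
      then have "\<bar>\<phi> \<xi>\<bar> * (B * (rho \<xi> / e) powr 2) \<le> B' * (B * ((1 + max R 0) / e) powr 2)"
        using \<phi>(1)[of \<xi>] B B' by (intro mult_mono mult_left_mono) auto
      then show ?thesis using B by (simp add: K_def abs_mult)
    qed
  qed simp
  have I: "integrable (lborel \<Otimes>\<^sub>M lborel) (\<lambda>(\<xi>, y). ?k \<xi> y)"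
  proof (rule integrableI_bounded)
    show "(\<lambda>(\<xi>, y). ?k \<xi> y) \<in> borel_measurable (lborel \<Otimes>\<^sub>M lborel)" by measurable
    have "(\<integral>\<^sup>+p. ennreal (norm (case p of (\<xi>, y) \<Rightarrow> ?k \<xi> y)) \<partial>(lborel \<Otimes>\<^sub>M lborel)) = (\<integral>\<^sup>+\<xi>. \<integral>\<^sup>+y. ennreal \<bar>?k \<xi> y\<bar> \<partial>lborel \<partial>lborel)"
      by (subst lborel.nn_integral_fst[symmetric]) (simp_all add: case_prod_beta')
    also have "\<dots> \<le> (\<integral>\<^sup>+\<xi>. \<integral>\<^sup>+y. ennreal (K \<xi>) * ennreal \<bar>rho y powr (-2) * f y\<bar> \<partial>lborel \<partial>lborel)"
      using pt B by (intro nn_integral_mono) (simp add: ennreal_mult[symmetric] K_def ennreal_leI)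
    also have "\<dots> = (\<integral>\<^sup>+\<xi>. ennreal (K \<xi>) \<partial>lborel) * (\<integral>\<^sup>+y. ennreal \<bar>rho y powr (-2) * f y\<bar> \<partial>lborel)"
      by (simp add: nn_integral_cmult nn_integral_multc)
    also have "\<dots> < \<infinity>"
    proof -
      have "(\<integral>\<^sup>+\<xi>. ennreal (K \<xi>) \<partial>lborel) < \<infinity>"
        using KI B unfolding integrable_iff_bounded by (simp add: K_def)
      then show ?thesis using f unfolding integrable_iff_bounded by (simp add: ennreal_mult_less_top)
    qed
    finally show "(\<integral>\<^sup>+p. ennreal (norm (case p of (\<xi>, y) \<Rightarrow> ?k \<xi> y)) \<partial>(lborel \<Otimes>\<^sub>M lborel)) < \<infinity>" .
  qed
  have "integrable lborel (\<lambda>\<xi>. LBINT y. ?k \<xi> y)" by (rule lborel_pair.integrable_fst[OF I])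
  then show "integrable lborel (\<lambda>\<xi>. \<phi> \<xi> * (LBINT y. F (\<xi> - e *\<^sub>R y) * f y))" by simp
  have "(LBINT y. LBINT \<xi>. ?k \<xi> y) = (LBINT \<xi>. LBINT y. ?k \<xi> y)" by (rule lborel_pair.Fubini_integral[OF I])
  moreover have "(LBINT \<xi>. ?k \<xi> y) = f y * (LBINT \<xi>. \<phi> \<xi> * F (\<xi> - e *\<^sub>R y))" for y
    by (simp add: mult_ac flip: integral_mult_right_zero)
  ultimately show "(LBINT \<xi>. \<phi> \<xi> * (LBINT y. F (\<xi> - e *\<^sub>R y) * f y)) = (LBINT y. f y * (LBINT \<xi>. \<phi> \<xi> * F (\<xi> - e *\<^sub>R y)))"
    by simp
qed

lemma gauss_rho_bounds:
  assumes "0 < a" "a \<le> 1"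
  shows "rho x powr 2 * \<bar>heat a x\<bar> \<le> exp (4 * 2\<^sup>2) * a powr (-(3/2))" "rho x powr 2 * \<bar>heatD a j x\<bar> \<le> exp (4 * 2\<^sup>2 + 4) * a powr (-2)"
proof -
  have "rho x powr 2 * heat a x \<le> exp (4 * 2\<^sup>2) * a powr (-(3/2)) * wide a x" using assms by (intro rho_heat_le) auto
  also have "\<dots> \<le> exp (4 * 2\<^sup>2) * a powr (-(3/2)) * 1" using wide_le1[OF assms(1)] by (intro mult_left_mono) auto
  finally show "rho x powr 2 * \<bar>heat a x\<bar> \<le> exp (4 * 2\<^sup>2) * a powr (-(3/2))" by simp
  have "rho x powr 2 * \<bar>heatD a j x\<bar> \<le> exp (4 * 2\<^sup>2 + 4) * a powr (-2) * wide a x" using assms by (intro rho_heatD_le) auto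
  also have "\<dots> \<le> exp (4 * 2\<^sup>2 + 4) * a powr (-2) * 1" using wide_le1[OF assms(1)] by (intro mult_left_mono) auto
  finally show "rho x powr 2 * \<bar>heatD a j x\<bar> \<le> exp (4 * 2\<^sup>2 + 4) * a powr (-2)" by simp
qed

lemma component_weighted_integrable:
  assumes m: "0 \<le> m" and w: "w \<in> L2w m"
  shows "integrable lborel (\<lambda>y. rho y powr (-2) * w y $ i)"
proof -
  have "(\<integral>\<^sup>+x. (ennreal \<bar>rho x powr (-2)\<bar>)\<^sup>2 \<partial>lborel) < \<infinity>"
    using finite_rho_integral[of 4] by (simp add: ennreal_power powr_power)
  from integrable_component_mult[OF m w _ this, of i] show ?thesis by (simp add: mult.commute)
qed

text \<open>
  Fubini and an integration by parts move the derivative of the test function onto the heat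
  kernel, where the divergence of \<open>w\<close> vanishes by \<open>div_free_gauss\<close>.
\<close>

lemma div_free_expLv:
  assumes m: "0 \<le> m" and w: "w \<in> L2w m" and df: "div_free w" and \<tau>: "0 \<le> \<tau>"
  shows "div_free (expLv \<tau> w)"
proof (cases "\<tau> = 0")
  case True
  then show ?thesis using df unfolding div_free_def by (simp add: expLv_def expL_def)
next
  case False
  then have \<tau>: "0 < \<tau>" using \<tau> by simp
  let ?e = "shrink \<tau>" and ?a = "htime \<tau>"
  have a: "0 < ?a" "?a \<le> 1" and e: "0 < ?e" "?e \<le> 1" using \<tau> by (auto simp: shrink_le1)
  have [measurable]: "w \<in> borel_measurable borel" using w by (rule L2w_measurable)
  show ?thesis unfolding div_free_def
  proof (intro allI impI)
    fix \<phi> assume "test_function \<phi>"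
    then have C: "\<And>k. Ck k \<phi>" and "\<exists>R. \<forall>x. R < norm x \<longrightarrow> \<phi> x = 0" by (auto intro: test_functionD)
    then obtain R where R: "\<And>x. R < norm x \<Longrightarrow> \<phi> x = 0" by blast
    have dc: "continuous_on UNIV (partial i \<phi>)" for i by (rule Ck1_partial_continuous[OF C])
    have pc: "continuous_on UNIV \<phi>" using C[of 0] by simp
    have [measurable]: "\<phi> \<in> borel_measurable borel" "partial i \<phi> \<in> borel_measurable borel" for i
      using pc dc by (auto intro: borel_measurable_continuous_onI)
    have dR: "partial i \<phi> x = 0" if "R < norm x" for i x by (rule partial_zero_outside[OF R that])
    obtain B where B: "\<And>x. \<bar>\<phi> x\<bar> \<le> B" using continuous_support_bounded[OF pc R] by blast
    have main: "integrable lborel (\<lambda>\<xi>. partial i \<phi> \<xi> * (LBINT y. heat ?a (\<xi> - ?e *\<^sub>R y) * w y $ i))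
      \<and> (LBINT \<xi>. partial i \<phi> \<xi> * (LBINT y. heat ?a (\<xi> - ?e *\<^sub>R y) * w y $ i)) = - (LBINT \<xi>. \<phi> \<xi> * (LBINT y. heatD ?a i (\<xi> - ?e *\<^sub>R y) * w y $ i))
      \<and> integrable lborel (\<lambda>\<xi>. \<phi> \<xi> * (LBINT y. heatD ?a i (\<xi> - ?e *\<^sub>R y) * w y $ i))" for i
    proof -
      obtain B' where B': "\<And>x. \<bar>partial i \<phi> x\<bar> \<le> B'" using continuous_support_bounded[OF dc dR] by blast
      note F1 = convolution_Fubini[where F="heat ?a" and f="\<lambda>y. w y $ i" and \<phi>="partial i \<phi>" and e="?e",
          OF _ _ _ gauss_rho_bounds(1)[OF a] e component_weighted_integrable[OF m w] B' dR]
      note F2 = convolution_Fubini[where F="heatD ?a i" and f="\<lambda>y. w y $ i" and \<phi>="\<phi>" and e="?e",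
          OF _ _ _ gauss_rho_bounds(2)[OF a] e component_weighted_integrable[OF m w] B R]
      have "(LBINT \<xi>. partial i \<phi> \<xi> * heat ?a (\<xi> - ?e *\<^sub>R y)) = - (LBINT \<xi>. \<phi> \<xi> * heatD ?a i (\<xi> - ?e *\<^sub>R y))" for y
        using integration_by_parts[where i=i and H="\<lambda>\<xi>. heat ?a (\<xi> - ?e *\<^sub>R y)", OF C R heat_translate(1)] unfolding heat_translate(2) .
      then show ?thesis using F1 F2 by simp
    qed
    have ex: "expL \<tau> (\<lambda>y. w y $ i) \<xi> = ?e * (LBINT y. heat ?a (\<xi> - ?e *\<^sub>R y) * w y $ i)" for i \<xi>
      using \<tau> by (subst expL_eq) (auto simp: mult.assoc)
    have "(LBINT \<xi>. \<Sum>i\<in>UNIV. expLv \<tau> w \<xi> $ i * partial i \<phi> \<xi>) = (LBINT \<xi>. \<Sum>i\<in>UNIV. ?e * (partial i \<phi> \<xi> * (LBINT y. heat ?a (\<xi> - ?e *\<^sub>R y) * w y $ i)))"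
      by (simp add: expLv_def ex mult_ac)
    also have "\<dots> = (\<Sum>i\<in>UNIV. ?e * (LBINT \<xi>. partial i \<phi> \<xi> * (LBINT y. heat ?a (\<xi> - ?e *\<^sub>R y) * w y $ i)))"
      using main by (subst Bochner_Integration.integral_sum) auto
    also have "\<dots> = - ?e * (\<Sum>i\<in>UNIV. LBINT \<xi>. \<phi> \<xi> * (LBINT y. heatD ?a i (\<xi> - ?e *\<^sub>R y) * w y $ i))"
      using main by (simp add: sum_distrib_left sum_negf)
    also have "(\<Sum>i\<in>UNIV. LBINT \<xi>. \<phi> \<xi> * (LBINT y. heatD ?a i (\<xi> - ?e *\<^sub>R y) * w y $ i)) = (LBINT \<xi>. \<Sum>i\<in>UNIV. \<phi> \<xi> * (LBINT y. heatD ?a i (\<xi> - ?e *\<^sub>R y) * w y $ i))"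
      using main by (subst Bochner_Integration.integral_sum) auto
    also have "\<dots> = (LBINT \<xi>. \<phi> \<xi> * (LBINT y. \<Sum>i\<in>UNIV. w y $ i * heatD ?a i (\<xi> - ?e *\<^sub>R y)))"
    proof -
      have "integrable lborel (\<lambda>y. w y $ i * heatD ?a i (\<xi> - ?e *\<^sub>R y))" for i \<xi>
        using a by (intro integrable_component_mult[OF m w] gauss_L2[OF _ _ _ heatD_le_wide]) auto
      then show ?thesis by (simp add: Bochner_Integration.integral_sum sum_distrib_left mult.commute)
    qed
    also have "\<dots> = 0" by (simp add: div_free_gauss[OF m w df a e(1)])
    finally show "(LBINT \<xi>. \<Sum>i\<in>UNIV. expLv \<tau> w \<xi> $ i * partial i \<phi> \<xi>) = 0" by simp
  qed
qed

lemma flux_antisym: "flux i j u y = - flux j i u y"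
  by (simp add: flux_def)

text \<open>
  Tested against \<open>\<phi>\<close>, the divergence of the Duhamel term is a double sum over \<open>i\<close> and \<open>j\<close> of
  the flux paired with a second derivative of the heat kernel. The former is antisymmetric, the latter
  symmetric, so the sum equals its own negative.
\<close>

lemma div_free_duhamel_op:
  assumes m: "0 \<le> m" and u: "grid_cont m u"
    and fin: "\<And>i j. wsq m (\<lambda>\<xi>. \<integral>\<^sup>+t. ennreal \<bar>past_dflux u i j t \<xi>\<bar> \<partial>lborel) < \<infinity>"
  shows "div_free (duhamel_op u)"
  unfolding div_free_def
proof (intro allI impI)
  fix \<phi> assume "test_function \<phi>"
  then have C: "\<And>k. Ck k \<phi>" and "\<exists>R. \<forall>x. R < norm x \<longrightarrow> \<phi> x = 0" by (auto intro: test_functionD)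
  then obtain R where R: "\<And>x. R < norm x \<Longrightarrow> \<phi> x = 0" by blast
  have dc: "continuous_on UNIV (partial i \<phi>)" for i by (rule Ck1_partial_continuous[OF C])
  have [measurable]: "partial i \<phi> \<in> borel_measurable borel" for i
    using dc by (auto intro: borel_measurable_continuous_onI)
  have dR: "partial i \<phi> x = 0" if "R < norm x" for i x by (rule partial_zero_outside[OF R that])
  have Jm[measurable]: "(\<lambda>(\<xi>, t). past_dflux u i j t \<xi>) \<in> borel_measurable (borel \<Otimes>\<^sub>M borel)" for i j
    using measurable_compose[OF measurable_pair_swap' past_dflux_measurable[OF m u, of i j]] by (simp add: case_prod_beta')
  define I where "I i j t = (LBINT \<xi>. partial i \<phi> \<xi> * past_dflux u i j t \<xi>)" for i j t
  have F: "integrable lborel (\<lambda>\<xi>. partial i \<phi> \<xi> * (LBINT t. past_dflux u i j t \<xi>)) \<and> (LBINT \<xi>. partial i \<phi> \<xi> * (LBINT t. past_dflux u i j t \<xi>)) = (LBINT t. I i j t)" for i j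
  proof -
    obtain B where B: "0 \<le> B" "\<And>x. \<bar>partial i \<phi> x\<bar> \<le> B" using continuous_support_bounded[OF dc dR] by blast
    let ?X = "\<lambda>\<xi>. \<integral>\<^sup>+t. ennreal \<bar>past_dflux u i j t \<xi>\<bar> \<partial>lborel"
    have P: "integrable (lborel \<Otimes>\<^sub>M lborel) (\<lambda>(\<xi>, t). partial i \<phi> \<xi> * past_dflux u i j t \<xi>)"
    proof (rule integrableI_bounded)
      show "(\<lambda>(\<xi>, t). partial i \<phi> \<xi> * past_dflux u i j t \<xi>) \<in> borel_measurable (lborel \<Otimes>\<^sub>M lborel)" by measurable
      have "(\<integral>\<^sup>+p. ennreal (norm (case p of (\<xi>, t) \<Rightarrow> partial i \<phi> \<xi> * past_dflux u i j t \<xi>)) \<partial>(lborel \<Otimes>\<^sub>M lborel)) = (\<integral>\<^sup>+\<xi>. \<integral>\<^sup>+t. ennreal \<bar>partial i \<phi> \<xi> * past_dflux u i j t \<xi>\<bar> \<partial>lborel \<partial>lborel)"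
        by (subst lborel.nn_integral_fst[symmetric]) (simp_all add: case_prod_beta')
      also have "\<dots> = (\<integral>\<^sup>+\<xi>. ennreal \<bar>partial i \<phi> \<xi>\<bar> * ?X \<xi> \<partial>lborel)"
        by (simp add: abs_mult ennreal_mult nn_integral_cmult)
      finally have eq: "(\<integral>\<^sup>+p. ennreal (norm (case p of (\<xi>, t) \<Rightarrow> partial i \<phi> \<xi> * past_dflux u i j t \<xi>)) \<partial>(lborel \<Otimes>\<^sub>M lborel)) = (\<integral>\<^sup>+\<xi>. ennreal \<bar>partial i \<phi> \<xi>\<bar> * ?X \<xi> \<partial>lborel)" .
      have "(\<integral>\<^sup>+\<xi>. ennreal \<bar>partial i \<phi> \<xi>\<bar> * ?X \<xi> \<partial>lborel)\<^sup>2 \<le> (\<integral>\<^sup>+\<xi>. (ennreal \<bar>partial i \<phi> \<xi>\<bar>)\<^sup>2 \<partial>lborel) * (\<integral>\<^sup>+\<xi>. (?X \<xi>)\<^sup>2 \<partial>lborel)"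
        by (rule Cauchy_Schwarz_nn_integral) measurable
      also have "\<dots> < \<infinity>"
        using L2_bounded_support[OF B(2) dR] fin[of i j] L2_le_wsq[OF m, of ?X] by (simp add: ennreal_mult_less_top le_less_trans)
      finally show "(\<integral>\<^sup>+p. ennreal (norm (case p of (\<xi>, t) \<Rightarrow> partial i \<phi> \<xi> * past_dflux u i j t \<xi>)) \<partial>(lborel \<Otimes>\<^sub>M lborel)) < \<infinity>"
        unfolding eq by (simp add: power_less_top_ennreal)
    qed
    show ?thesis using lborel_pair.integrable_fst[OF P] lborel_pair.Fubini_integral[OF P] unfolding I_def by simp
  qed
  have anti: "I i j t = - I j i t" for i j t
  proof (cases "0 < t")
    case True
    let ?e = "shrink t" and ?a = "htime t"
    have a: "0 < ?a" "?a \<le> 1" and e: "0 < ?e" "?e \<le> 1" using True by (auto simp: shrink_le1)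
    have [measurable]: "u t \<in> borel_measurable borel" by (rule L2w_measurable[OF grid_contD[OF u]])
    define c where "c i j y = (LBINT \<xi>. partial i \<phi> \<xi> * heatD ?a j (\<xi> - ?e *\<^sub>R y))" for i j y
    have c: "c i j y = - (LBINT \<xi>. \<phi> \<xi> * heatDD ?a i j (\<xi> - ?e *\<^sub>R y))" for i j y
      unfolding c_def using integration_by_parts[where i=i and H="\<lambda>\<xi>. heatD ?a j (\<xi> - ?e *\<^sub>R y)", OF C R heatD_translate(1)] unfolding heatD_translate(2) .
    have csym: "c i j = c j i" for i j unfolding c heatDD_sym[of _ i j] by (simp add: fun_eq_iff c heatDD_sym[of _ i j])
    have I: "I i j t = ?e\<^sup>2 * (LBINT y. flux i j (u t) y * c i j y)" for i j
    proof -
      obtain B where B: "0 \<le> B" "\<And>x. \<bar>partial i \<phi> x\<bar> \<le> B" using continuous_support_bounded[OF dc dR] by blast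
      have JJe: "past_dflux u i j t \<xi> = ?e\<^sup>2 * (LBINT y. heatD ?a j (\<xi> - ?e *\<^sub>R y) * flux i j (u t) y)" for \<xi>
        using True dflux_eq(1)[OF m grid_contD[OF u] True] by (simp add: past_dflux_def mult.assoc)
      then have "I i j t = ?e\<^sup>2 * (LBINT \<xi>. partial i \<phi> \<xi> * (LBINT y. heatD ?a j (\<xi> - ?e *\<^sub>R y) * flux i j (u t) y))"
      proof -
        have pe: "partial i \<phi> \<xi> * past_dflux u i j t \<xi> = ?e\<^sup>2 * (partial i \<phi> \<xi> * (LBINT y. heatD ?a j (\<xi> - ?e *\<^sub>R y) * flux i j (u t) y))" for \<xi>
          unfolding JJe by (rule mult.left_commute)
        show ?thesis unfolding I_def pe by (rule integral_mult_right_zero)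
      qed
      also have "(LBINT \<xi>. partial i \<phi> \<xi> * (LBINT y. heatD ?a j (\<xi> - ?e *\<^sub>R y) * flux i j (u t) y)) = (LBINT y. flux i j (u t) y * c i j y)"
        unfolding c_def
        by (rule convolution_Fubini(2)[OF _ _ _ gauss_rho_bounds(2)[OF a] e flux_integrable[OF m grid_contD[OF u]] B(2) dR]) auto
      finally show ?thesis .
    qed
    have "I i j t = ?e\<^sup>2 * (LBINT y. - (flux j i (u t) y * c j i y))"
      unfolding I[of i j] csym[of i j] flux_antisym[of i j] by simp
    then show ?thesis unfolding I[of j i] by simp
  qed (simp add: I_def past_dflux_def)
  have "(LBINT \<xi>. \<Sum>i\<in>UNIV. duhamel_op u \<xi> $ i * partial i \<phi> \<xi>) = (LBINT \<xi>. \<Sum>i\<in>UNIV. \<Sum>j\<in>UNIV. partial i \<phi> \<xi> * (LBINT t. past_dflux u i j t \<xi>))"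
    by (simp add: duhamel_op_def sum_distrib_left mult.commute[of "sum _ _"])
  also have "\<dots> = (\<Sum>i\<in>UNIV. \<Sum>j\<in>UNIV. LBINT \<xi>. partial i \<phi> \<xi> * (LBINT t. past_dflux u i j t \<xi>))"
    using F by (simp add: Bochner_Integration.integral_sum)
  also have "\<dots> = (\<Sum>i\<in>UNIV. \<Sum>j\<in>UNIV. LBINT t. I i j t)" using F by simp
  finally have S: "(LBINT \<xi>. \<Sum>i\<in>UNIV. duhamel_op u \<xi> $ i * partial i \<phi> \<xi>) = (\<Sum>i\<in>UNIV. \<Sum>j\<in>UNIV. LBINT t. I i j t)" .
  have "(\<Sum>i\<in>UNIV. \<Sum>j\<in>UNIV. LBINT t. I i j t) = (\<Sum>i\<in>UNIV. \<Sum>j\<in>UNIV. - (LBINT t. I j i t))"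
    by (subst anti) simp
  also have "\<dots> = - (\<Sum>i\<in>UNIV. \<Sum>j\<in>UNIV. LBINT t. I j i t)" by (simp add: sum_negf)
  also have "(\<Sum>i\<in>UNIV. \<Sum>j\<in>UNIV. LBINT t. I j i t) = (\<Sum>i\<in>UNIV. \<Sum>j\<in>UNIV. LBINT t. I i j t)" by (rule sum.swap)
  finally show "(LBINT \<xi>. \<Sum>i\<in>UNIV. duhamel_op u \<xi> $ i * partial i \<phi> \<xi>) = 0" unfolding S by simp
qed

section \<open>The integral equation\<close>

text \<open>
  The curve \<open>w\<close> read backwards from time \<open>\<tau>\<close>. Extended by \<open>0\<close> beyond time \<open>\<tau>\<close>, it turns the
  Duhamel integral over \<open>[0, \<tau>]\<close> into an integral over the half line, with a kernel
  independent of \<open>\<tau>\<close>.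
\<close>

definition past :: "(real \<Rightarrow> real^3 \<Rightarrow> real^3) \<Rightarrow> real \<Rightarrow> real \<Rightarrow> real^3 \<Rightarrow> real^3" where
  "past w \<tau> t = (if t \<le> \<tau> then w (\<tau> - t) else (\<lambda>_. 0))"

lemma cpath_L2w: "cpath m w \<Longrightarrow> 0 \<le> \<tau> \<Longrightarrow> w \<tau> \<in> L2w m"
  by (simp add: cpath_def)

lemma cpath_limit: "cpath m w \<Longrightarrow> (\<And>n. 0 \<le> T n) \<Longrightarrow> 0 \<le> t \<Longrightarrow> T \<longlonglongrightarrow> t \<Longrightarrow> (\<lambda>n::nat. wnorm m (\<lambda>x. w (T n) x - w t x)) \<longlonglongrightarrow> 0"
  by (simp add: cpath_def)

lemma cpath_zero: "cpath m (\<lambda>_ _. 0)"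
  by (simp add: cpath_def)

lemma past_L2w: "cpath m w \<Longrightarrow> past w \<tau> t \<in> L2w m"
  by (simp add: past_def cpath_L2w)

text \<open>
  The hypothesis on \<open>t0\<close> excludes only the jump at \<open>0\<close> approached from the negative side.
\<close>

lemma past_limit:
  assumes w: "cpath m w" and s: "(\<lambda>n::nat. t n) \<longlonglongrightarrow> t0" "t0 \<noteq> 0 \<or> (\<forall>n. 0 \<le> t n)"
  shows "(\<lambda>n. wnorm m (\<lambda>x. (if 0 \<le> t n then w (t n) else (\<lambda>_. 0)) x - (if 0 \<le> t0 then w t0 else (\<lambda>_. 0)) x)) \<longlonglongrightarrow> 0"
proof (cases "0 \<le> t0")
  case True
  have ev: "\<forall>\<^sub>F n in sequentially. 0 \<le> t n"
  proof (cases "t0 = 0")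
    case True then show ?thesis using s(2) by simp
  next
    case False
    then have "0 < t0" using True by simp
    from order_tendstoD(1)[OF s(1) this] show ?thesis by eventually_elim simp
  qed
  have mx: "(\<lambda>n. max 0 (t n)) \<longlonglongrightarrow> t0" using tendsto_max[OF tendsto_const s(1), of 0] True by (simp add: max_absorb2)
  have "(\<lambda>n. wnorm m (\<lambda>\<xi>. w (max 0 (t n)) \<xi> - w t0 \<xi>)) \<longlonglongrightarrow> 0"
    by (rule cpath_limit[OF w _ True mx]) simp
  moreover have "\<forall>\<^sub>F n in sequentially. wnorm m (\<lambda>\<xi>. w (max 0 (t n)) \<xi> - w t0 \<xi>) = wnorm m (\<lambda>x. (if 0 \<le> t n then w (t n) else (\<lambda>_. 0)) x - (if 0 \<le> t0 then w t0 else (\<lambda>_. 0)) x)"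
    using ev by eventually_elim (simp add: True max_absorb2)
  ultimately show ?thesis by (rule Lim_transform_eventually)
next
  case False
  then have "t0 < 0" by simp
  from order_tendstoD(2)[OF s(1) this]
  have "\<forall>\<^sub>F n in sequentially. wnorm m (\<lambda>x. (if 0 \<le> t n then w (t n) else (\<lambda>_. 0)) x - (if 0 \<le> t0 then w t0 else (\<lambda>_. 0)) x) = 0"
    by eventually_elim (use False in simp)
  then show ?thesis by (rule tendsto_eventually)
qed

lemma past_alt: "past w \<tau> t = (if 0 \<le> \<tau> - t then w (\<tau> - t) else (\<lambda>_. 0))"
  by (simp add: past_def)

lemma past_grid_cont:
  assumes "cpath m w"
  shows "grid_cont m (past w \<tau>)"
  unfolding grid_cont_def
proof (intro conjI allI)
  show "past w \<tau> t \<in> L2w m" for t by (rule past_L2w[OF assms])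
  fix t
  have l: "(\<lambda>n. \<tau> - grid_floor n t) \<longlonglongrightarrow> \<tau> - t" by (intro tendsto_diff tendsto_const grid_floor_tendsto)
  have "\<tau> - t \<noteq> 0 \<or> (\<forall>n. 0 \<le> \<tau> - grid_floor n t)"
  proof (cases "\<tau> = t")
    case True then show ?thesis using grid_floor_bounds(1)[of _ t] by simp
  qed simp
  from past_limit[OF assms l this] show "(\<lambda>n. wnorm m (\<lambda>x. past w \<tau> (grid_floor n t) x - past w \<tau> t x)) \<longlonglongrightarrow> 0"
    unfolding past_alt .
qed

lemma cpath_bounded:
  assumes w: "cpath m w"
  shows "\<exists>M\<ge>0. \<forall>s. 0 \<le> s \<longrightarrow> s \<le> T \<longrightarrow> wnorm m (w s) \<le> M"
proof -
  have "continuous_on {0..T} (\<lambda>s. wnorm m (w s))"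
    unfolding continuous_on_sequentially
  proof (intro allI ballI impI)
    fix x :: "nat \<Rightarrow> real" and a assume a: "a \<in> {0..T}" and x: "(\<forall>n. x n \<in> {0..T}) \<and> x \<longlonglongrightarrow> a"
    have l: "(\<lambda>n. wnorm m (\<lambda>\<xi>. w (x n) \<xi> - w a \<xi>)) \<longlonglongrightarrow> 0"
      using a x by (intro cpath_limit[OF w]) auto
    have "(\<lambda>n. wnorm m (w (x n)) - wnorm m (w a)) \<longlonglongrightarrow> 0"
    proof (rule Lim_null_comparison[OF _ l], intro always_eventually allI)
      fix n show "norm (wnorm m (w (x n)) - wnorm m (w a)) \<le> wnorm m (\<lambda>\<xi>. w (x n) \<xi> - w a \<xi>)"
        using wnorm_abs_diff_le[OF cpath_L2w[OF w] cpath_L2w[OF w], of "x n" a] a x by simp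
    qed
    then show "((\<lambda>s. wnorm m (w s)) \<circ> x) \<longlonglongrightarrow> wnorm m (w a)" unfolding o_def by (rule LIM_zero_cancel)
  qed
  then have "bounded ((\<lambda>s. wnorm m (w s)) ` {0..T})" by (intro compact_imp_bounded compact_continuous_image) auto
  then obtain M where "0 < M" "\<And>s. s \<in> {0..T} \<Longrightarrow> \<bar>wnorm m (w s)\<bar> \<le> M" unfolding bounded_pos by auto
  then show ?thesis by (intro exI[of _ M]) auto
qed

lemma past_dflux_zero [simp]: "past_dflux (\<lambda>_ _. 0) i j t x = 0"
  using dflux_zero[of t i j x] by (cases "0 < t") (auto simp: past_dflux_def)

lemma duhamel_op_zero [simp]: "duhamel_op (\<lambda>_ _. 0) x = 0"
  by (simp add: duhamel_op_def vec_eq_iff)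

lemma duhamel_integrable_bounded:
  assumes K: "duhamel_bound \<mu> m K" and u: "grid_cont m u" and M: "\<And>t. 0 < t \<Longrightarrow> wnorm m (u t) \<le> M"
  shows "wsq m (\<lambda>\<xi>. \<integral>\<^sup>+t. ennreal \<bar>past_dflux u i j t \<xi>\<bar> \<partial>lborel) < \<infinity>" "duhamel_integrable u"
proof -
  have m: "0 \<le> m" and \<mu>: "0 < \<mu>" using K by (auto simp: duhamel_bound_def)
  have M0: "0 \<le> M" using M[of 1] wnorm_nonneg order_trans by (meson zero_less_one)
  obtain B where B: "0 \<le> B" "(\<integral>\<^sup>+t. ennreal (tker \<mu> t) * indicator {0<..} t \<partial>lborel) = ennreal B"
    using tker_integrable[OF \<mu>] by (cases "\<integral>\<^sup>+t. ennreal (tker \<mu> t) * indicator {0<..} t \<partial>lborel") auto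
  have "(\<integral>\<^sup>+t. ennreal (M\<^sup>2 * tker \<mu> t) * indicator {0<..} t \<partial>lborel) = ennreal (M\<^sup>2) * (\<integral>\<^sup>+t. ennreal (tker \<mu> t) * indicator {0<..} t \<partial>lborel)"
    by (subst nn_integral_cmult[symmetric]) (auto simp: ennreal_mult mult.assoc)
  also have "\<dots> = ennreal (M\<^sup>2 * B)" using B by (simp add: ennreal_mult)
  finally have I: "(\<integral>\<^sup>+t. ennreal (M\<^sup>2 * tker \<mu> t) * indicator {0<..} t \<partial>lborel) \<le> ennreal (M\<^sup>2 * B)" by simp
  have b: "\<forall>t>0. tker \<mu> t * ((wnorm m (u t) + wnorm m (\<lambda>_::real^3. 0::real^3)) * wnorm m (\<lambda>x. u t x - 0)) \<le> M\<^sup>2 * tker \<mu> t"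
  proof (intro allI impI)
    fix t :: real assume t: "0 < t"
    have "tker \<mu> t * (wnorm m (u t) * wnorm m (u t)) \<le> tker \<mu> t * (M * M)"
      using M[OF t] M0 by (intro mult_left_mono mult_mono) auto
    then show "tker \<mu> t * ((wnorm m (u t) + wnorm m (\<lambda>_::real^3. 0::real^3)) * wnorm m (\<lambda>x. u t x - 0)) \<le> M\<^sup>2 * tker \<mu> t"
      by (simp add: power2_eq_square mult_ac)
  qed
  have fin: "wsq m (\<lambda>\<xi>. \<integral>\<^sup>+t. ennreal \<bar>past_dflux u i j t \<xi>\<bar> \<partial>lborel) < \<infinity>" for i j
  proof -
    have bm: "(\<lambda>t. M\<^sup>2 * tker \<mu> t) \<in> borel_measurable borel" by measurable
    have B0: "0 \<le> M\<^sup>2 * B" using B by simp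
    have "wsq m (\<lambda>\<xi>. \<integral>\<^sup>+t. ennreal \<bar>past_dflux u i j t \<xi> - past_dflux (\<lambda>_ _. 0) i j t \<xi>\<bar> \<partial>lborel) \<le> ennreal ((K * (M\<^sup>2 * B))\<^sup>2)"
      using K[unfolded duhamel_bound_def, THEN conjunct2, THEN conjunct2, THEN conjunct2, rule_format, OF u grid_cont_zero bm b[rule_format] B0 I] by blast
    then show ?thesis by (simp add: le_less_trans)
  qed
  then show "wsq m (\<lambda>\<xi>. \<integral>\<^sup>+t. ennreal \<bar>past_dflux u i j t \<xi>\<bar> \<partial>lborel) < \<infinity>" .
  have Jm[measurable]: "(\<lambda>(\<xi>, t). past_dflux u i j t \<xi>) \<in> borel_measurable (borel \<Otimes>\<^sub>M borel)" for i j
    using measurable_compose[OF measurable_pair_swap' past_dflux_measurable[OF m u, of i j]] by (simp add: case_prod_beta')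
  have "AE \<xi> in lborel. integrable lborel (\<lambda>t. past_dflux u i j t \<xi>)" for i j
  proof -
    have "AE \<xi> in lborel. (ennreal (rho \<xi> powr m) * (\<integral>\<^sup>+t. ennreal \<bar>past_dflux u i j t \<xi>\<bar> \<partial>lborel))\<^sup>2 \<noteq> \<infinity>"
      using fin[of i j] unfolding wsq_def by (intro nn_integral_PInf_AE) auto
    then show ?thesis
    proof eventually_elim
      case (elim \<xi>)
      have "(\<integral>\<^sup>+t. ennreal \<bar>past_dflux u i j t \<xi>\<bar> \<partial>lborel) \<noteq> \<infinity>"
      proof
        assume "(\<integral>\<^sup>+t. ennreal \<bar>past_dflux u i j t \<xi>\<bar> \<partial>lborel) = \<infinity>"
        then have "(ennreal (rho \<xi> powr m) * (\<integral>\<^sup>+t. ennreal \<bar>past_dflux u i j t \<xi>\<bar> \<partial>lborel))\<^sup>2 = \<infinity>"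
          by (simp add: ennreal_mult_top top_power_ennreal)
        with elim show False by simp
      qed
      then show ?case using past_dflux_measurable1[OF m u, of i j \<xi>] by (intro integrableI_bounded) (auto simp: top.not_eq_extremum)
    qed
  qed
  then show "duhamel_integrable u" unfolding duhamel_integrable_def by (simp add: AE_all_countable)
qed

lemma past_bounded:
  assumes w: "cpath m w"
  shows "\<exists>M\<ge>0. \<forall>\<tau>\<le>T. \<forall>t>0. wnorm m (past w \<tau> t) \<le> M"
proof -
  obtain M where M: "0 \<le> M" "\<And>s. 0 \<le> s \<Longrightarrow> s \<le> T \<Longrightarrow> wnorm m (w s) \<le> M" using cpath_bounded[OF w] by blast
  then show ?thesis by (intro exI[of _ M]) (auto simp: past_def)
qed

lemma duhamel_integrable_past:
  assumes "duhamel_bound \<mu> m K" "cpath m w"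
  shows "wsq m (\<lambda>x. \<integral>\<^sup>+t. ennreal \<bar>past_dflux (past w \<tau>) i j t x\<bar> \<partial>lborel) < \<infinity>" "duhamel_integrable (past w \<tau>)"
proof -
  obtain M where M: "\<And>t. 0 < t \<Longrightarrow> wnorm m (past w \<tau> t) \<le> M" using past_bounded[OF assms(2), of \<tau>] by blast
  show "wsq m (\<lambda>x. \<integral>\<^sup>+t. ennreal \<bar>past_dflux (past w \<tau>) i j t x\<bar> \<partial>lborel) < \<infinity>" "duhamel_integrable (past w \<tau>)"
    using duhamel_integrable_bounded[OF assms(1) past_grid_cont[OF assms(2)] M] by auto
qed

lemma duhamel_op_past_diff:
  assumes K: "duhamel_bound \<mu> m K" and w: "cpath m w" "cpath m w'" and b: "b \<in> borel_measurable borel"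
     "\<And>t. 0 < t \<Longrightarrow> tker \<mu> t * ((wnorm m (past w \<tau> t) + wnorm m (past w' \<tau>' t)) * wnorm m (\<lambda>x. past w \<tau> t x - past w' \<tau>' t x)) \<le> b t"
     "0 \<le> B" "(\<integral>\<^sup>+t. ennreal (b t) * indicator {0<..} t \<partial>lborel) \<le> ennreal B"
  shows "(\<lambda>\<xi>. duhamel_op (past w \<tau>) \<xi> - duhamel_op (past w' \<tau>') \<xi>) \<in> L2w m" "wnorm m (\<lambda>\<xi>. duhamel_op (past w \<tau>) \<xi> - duhamel_op (past w' \<tau>') \<xi>) \<le> K * B"
  using K[unfolded duhamel_bound_def, THEN conjunct2, THEN conjunct2, THEN conjunct2, rule_format, OF past_grid_cont[OF w(1)] past_grid_cont[OF w(2)] b(1) b(2) b(3,4)]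
    duhamel_integrable_past(2)[OF K w(1)] duhamel_integrable_past(2)[OF K w(2)] by auto

lemma past_zero [simp]: "past (\<lambda>_ _. 0) \<tau> = (\<lambda>_ _. 0)"
  by (simp add: past_def fun_eq_iff)

lemma duhamel_op_past_L2w:
  assumes K: "duhamel_bound \<mu> m K" and w: "cpath m w"
  shows "duhamel_op (past w \<tau>) \<in> L2w m"
proof -
  have \<mu>: "0 < \<mu>" using K by (simp add: duhamel_bound_def)
  obtain M where M: "0 \<le> M" "\<And>t. 0 < t \<Longrightarrow> wnorm m (past w \<tau> t) \<le> M" using past_bounded[OF w, of \<tau>] by blast
  obtain B where B: "0 \<le> B" "(\<integral>\<^sup>+t. ennreal (tker \<mu> t) * indicator {0<..} t \<partial>lborel) = ennreal B"
    using tker_integrable[OF \<mu>] by (cases "\<integral>\<^sup>+t. ennreal (tker \<mu> t) * indicator {0<..} t \<partial>lborel") auto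
  have "(\<lambda>\<xi>. duhamel_op (past w \<tau>) \<xi> - duhamel_op (past (\<lambda>_ _. 0) \<tau>) \<xi>) \<in> L2w m"
  proof (rule duhamel_op_past_diff(1)[OF K w cpath_zero])
    show "(\<lambda>t. M\<^sup>2 * tker \<mu> t) \<in> borel_measurable borel" by measurable
    show "0 \<le> M\<^sup>2 * B" using B by simp
    have "(\<integral>\<^sup>+t. ennreal (M\<^sup>2 * tker \<mu> t) * indicator {0<..} t \<partial>lborel) = ennreal (M\<^sup>2) * (\<integral>\<^sup>+t. ennreal (tker \<mu> t) * indicator {0<..} t \<partial>lborel)"
      by (subst nn_integral_cmult[symmetric]) (auto simp: ennreal_mult mult.assoc)
    then show "(\<integral>\<^sup>+t. ennreal (M\<^sup>2 * tker \<mu> t) * indicator {0<..} t \<partial>lborel) \<le> ennreal (M\<^sup>2 * B)" using B by (simp add: ennreal_mult)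
    fix t :: real assume t: "0 < t"
    have "tker \<mu> t * (wnorm m (past w \<tau> t) * wnorm m (past w \<tau> t)) \<le> tker \<mu> t * (M * M)"
      using M t by (intro mult_left_mono mult_mono) auto
    then show "tker \<mu> t * ((wnorm m (past w \<tau> t) + wnorm m (past (\<lambda>_ _. 0) \<tau> t)) * wnorm m (\<lambda>x. past w \<tau> t x - past (\<lambda>_ _. 0) \<tau> t x)) \<le> M\<^sup>2 * tker \<mu> t"
      by (simp add: power2_eq_square mult_ac)
  qed
  then show ?thesis by simp
qed

text \<open>
  The Lipschitz estimate compares the Duhamel terms at two times, and the time integral of its
  majorant tends to \<open>0\<close> by dominated convergence; the jump of \<open>past\<close> is a single point.
\<close>

lemma cpath_duhamel_op:
  assumes K: "duhamel_bound \<mu> m K" and w: "cpath m w"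
  shows "cpath m (\<lambda>\<tau>. duhamel_op (past w \<tau>))"
  unfolding cpath_def
proof (intro conjI allI impI)
  show "duhamel_op (past w \<tau>) \<in> L2w m" for \<tau> by (rule duhamel_op_past_L2w[OF K w])
  fix T :: "nat \<Rightarrow> real" and t assume T: "\<forall>n. 0 \<le> T n" "0 \<le> t" "T \<longlonglongrightarrow> t"
  have \<mu>: "0 < \<mu>" and K0: "0 \<le> K" using K by (auto simp: duhamel_bound_def)
  obtain S where S: "\<And>n. T n \<le> S" "t \<le> S"
  proof -
    have "Bseq T" using T(3) by (rule convergent_imp_Bseq[OF convergentI])
    then obtain K where "\<And>n. \<bar>T n\<bar> \<le> K" by (auto simp: Bseq_def)
    then show ?thesis using that[of "max K t"] by (meson abs_le_D1 le_max_iff_disj order_refl)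
  qed
  obtain M where M: "0 \<le> M" "\<And>\<tau> s. \<tau> \<le> S \<Longrightarrow> 0 < s \<Longrightarrow> wnorm m (past w \<tau> s) \<le> M" using past_bounded[OF w, of S] by blast
  define d where "d n s = wnorm m (\<lambda>x. past w (T n) s x - past w t s x)" for n s
  have dm[measurable]: "d n \<in> borel_measurable borel" for n
    unfolding d_def using grid_cont_norm_measurable[OF past_grid_cont[OF w] past_grid_cont[OF w], of "T n" t] by simp
  define b where "b n s = indicator {0<..} s * (tker \<mu> s * (2 * M * d n s))" for n s
  have bm[measurable]: "b n \<in> borel_measurable borel" for n unfolding b_def by measurable
  have b0: "0 \<le> b n s" for n s unfolding b_def d_def using M by simp
  have dM: "d n s \<le> 2 * M" if "0 < s" for n s
  proof -
    have "d n s \<le> wnorm m (past w (T n) s) + wnorm m (past w t s)" unfolding d_def by (intro L2w_diff past_L2w w)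
    then show ?thesis using M(2)[OF S(1) that, of n] M(2)[OF S(2) that] by linarith
  qed
  define g where "g s = indicator {0<..} s * (tker \<mu> s * (2 * M * (2 * M)))" for s
  have bg: "b n s \<le> g s" for n s
  proof (cases "0 < s")
    case True
    have "tker \<mu> s * (2 * M * d n s) \<le> tker \<mu> s * (2 * M * (2 * M))"
      using dM[OF True] M(1) by (intro mult_left_mono) auto
    then show ?thesis by (simp add: b_def g_def True)
  qed (simp add: b_def g_def)
  have gI: "integrable lborel g"
  proof (rule integrableI_nonneg)
    have "(\<integral>\<^sup>+s. ennreal (g s) \<partial>lborel) = (\<integral>\<^sup>+s. ennreal (4 * M\<^sup>2) * (ennreal (tker \<mu> s) * indicator {0<..} s) \<partial>lborel)"
      by (rule nn_integral_cong) (auto simp: g_def ennreal_mult[symmetric] power2_eq_square split: split_indicator)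
    also have "\<dots> < \<infinity>" using tker_integrable[OF \<mu>] by (simp add: nn_integral_cmult ennreal_mult_less_top)
    finally show "(\<integral>\<^sup>+s. ennreal (g s) \<partial>lborel) < \<infinity>" .
    show "g \<in> borel_measurable lborel" unfolding g_def by measurable
  qed (use M in \<open>simp_all add: g_def\<close>)
  have lim: "(\<lambda>n. LBINT s. b n s) \<longlonglongrightarrow> (LBINT (s::real). 0)"
  proof (rule integral_dominated_convergence[where w=g])
    show "AE s in lborel. (\<lambda>n. b n s) \<longlonglongrightarrow> 0"
      using AE_lborel_singleton[of t]
    proof eventually_elim
      case (elim s)
      have l: "(\<lambda>n. T n - s) \<longlonglongrightarrow> t - s" by (intro tendsto_intros T)
      have "(\<lambda>n. d n s) \<longlonglongrightarrow> 0" unfolding d_def past_alt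
        by (rule past_limit[OF w l]) (use elim in simp)
      then have "(\<lambda>n. b n s) \<longlonglongrightarrow> indicator {0<..} s * (tker \<mu> s * (2 * M * 0))" unfolding b_def by (intro tendsto_intros)
      then show ?case by simp
    qed
    show "AE s in lborel. norm (b n s) \<le> g s" for n using b0 bg by (intro AE_I2) simp
  qed (use gI in auto)
  have bI: "integrable lborel (b n)" for n
    by (rule Bochner_Integration.integrable_bound[OF gI]) (use b0 bg in \<open>auto intro: order_trans[OF bg abs_ge_self]\<close>)
  have bd: "wnorm m (\<lambda>\<xi>. duhamel_op (past w (T n)) \<xi> - duhamel_op (past w t) \<xi>) \<le> K * (LBINT s. b n s)" for n
  proof (rule duhamel_op_past_diff(2)[OF K w w bm])
    show "0 \<le> (LBINT s. b n s)" using b0 by (intro Bochner_Integration.integral_nonneg) auto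
    have "(\<integral>\<^sup>+s. ennreal (b n s) * indicator {0<..} s \<partial>lborel) \<le> (\<integral>\<^sup>+s. ennreal (b n s) \<partial>lborel)"
      by (intro nn_integral_mono) (auto split: split_indicator)
    also have "\<dots> = ennreal (LBINT s. b n s)" using b0 by (intro nn_integral_eq_integral bI) auto
    finally show "(\<integral>\<^sup>+s. ennreal (b n s) * indicator {0<..} s \<partial>lborel) \<le> ennreal (LBINT s. b n s)" .
    fix s :: real assume s: "0 < s"
    have "wnorm m (past w (T n) s) + wnorm m (past w t s) \<le> 2 * M"
      using M(2)[OF S(1) s, of n] M(2)[OF S(2) s] by linarith
    then have "tker \<mu> s * ((wnorm m (past w (T n) s) + wnorm m (past w t s)) * d n s) \<le> tker \<mu> s * (2 * M * d n s)"
      by (intro mult_left_mono mult_right_mono) (auto simp: d_def)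
    then show "tker \<mu> s * ((wnorm m (past w (T n) s) + wnorm m (past w t s)) * wnorm m (\<lambda>x. past w (T n) s x - past w t s x)) \<le> b n s"
      using s by (simp add: b_def d_def)
  qed
  have "(\<lambda>n. K * (LBINT s. b n s)) \<longlonglongrightarrow> 0" using tendsto_mult[OF tendsto_const lim, of K] by simp
  then show "(\<lambda>n. wnorm m (\<lambda>\<xi>. duhamel_op (past w (T n)) \<xi> - duhamel_op (past w t) \<xi>)) \<longlonglongrightarrow> 0"
    by (rule Lim_null_comparison[rotated]) (use bd in simp)
qed

lemma cpath_add:
  assumes f: "cpath m f" and g: "cpath m g"
  shows "cpath m (\<lambda>\<tau> x. f \<tau> x + g \<tau> x)"
  unfolding cpath_def
proof (intro conjI allI impI)
  show "(\<lambda>x. f \<tau> x + g \<tau> x) \<in> L2w m" if "0 \<le> \<tau>" for \<tau> by (intro L2w_add cpath_L2w f g that)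
  fix T :: "nat \<Rightarrow> real" and t assume T: "\<forall>n. 0 \<le> T n" "0 \<le> t" "T \<longlonglongrightarrow> t"
  have "(\<lambda>n. wnorm m (\<lambda>x. f (T n) x - f t x) + wnorm m (\<lambda>x. g (T n) x - g t x)) \<longlonglongrightarrow> 0 + 0"
    using T by (intro tendsto_add cpath_limit[OF f] cpath_limit[OF g]) auto
  then have l: "(\<lambda>n. wnorm m (\<lambda>x. f (T n) x - f t x) + wnorm m (\<lambda>x. g (T n) x - g t x)) \<longlonglongrightarrow> 0" by simp
  show "(\<lambda>n. wnorm m (\<lambda>x. (f (T n) x + g (T n) x) - (f t x + g t x))) \<longlonglongrightarrow> 0"
  proof (rule Lim_null_comparison[OF _ l], intro always_eventually allI)
    fix n
    have "wnorm m (\<lambda>x. (f (T n) x + g (T n) x) - (f t x + g t x)) = wnorm m (\<lambda>x. (f (T n) x - f t x) + (g (T n) x - g t x))"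
      by (simp add: algebra_simps)
    also have "\<dots> \<le> wnorm m (\<lambda>x. f (T n) x - f t x) + wnorm m (\<lambda>x. g (T n) x - g t x)"
      using T by (intro L2w_add L2w_diff cpath_L2w f g) auto
    finally show "norm (wnorm m (\<lambda>x. (f (T n) x + g (T n) x) - (f t x + g t x))) \<le> wnorm m (\<lambda>x. f (T n) x - f t x) + wnorm m (\<lambda>x. g (T n) x - g t x)"
      by simp
  qed
qed

text \<open>
  The substitution \<open>t = \<tau> - s\<close>.
\<close>

lemma duhamel_integral:
  assumes m: "0 \<le> m" and w: "cpath m w" and \<tau>: "0 \<le> \<tau>"
  shows "(LBINT s:{0..\<tau>}. duhamel w i j \<tau> x s) = (LBINT t. past_dflux (past w \<tau>) i j t x)"
    and "set_integrable lborel {0..\<tau>} (duhamel w i j \<tau> x) \<longleftrightarrow> integrable lborel (\<lambda>t. past_dflux (past w \<tau>) i j t x)"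
proof -
  define f where "f s = indicator {0..\<tau>} s *\<^sub>R duhamel w i j \<tau> x s" for s
  \<comment> \<open>at elapsed time \<open>0\<close> the integrand is a derivative that need not exist; its value \<open>c\<close> sits on a null set\<close>
  define c where "c = dflux i j 0 (w \<tau>) x"
  have f: "f (\<tau> + (-1) * t) = past_dflux (past w \<tau>) i j t x + indicator {0} t * c" for t
  proof -
    consider "t < 0" | "t = 0" | "0 < t" "t \<le> \<tau>" | "\<tau> < t" "0 < t" using \<tau> by linarith
    then show ?thesis
    proof cases
      case 4
      then show ?thesis using dflux_zero[of t i j x] by (simp add: f_def past_dflux_def past_def)
    qed (use \<tau> in \<open>auto simp: f_def past_dflux_def past_def duhamel_dflux c_def\<close>)
  qed
  have Jm: "(\<lambda>t. past_dflux (past w \<tau>) i j t x) \<in> borel_measurable borel" by (rule past_dflux_measurable1[OF m past_grid_cont[OF w]])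
  have c0: "integrable lborel (\<lambda>t::real. indicator {0} t * c)" "(LBINT (t::real). indicator {0} t * c) = 0"
    by (auto intro!: integrable_mult_left integrable_real_indicator)
  have iff: "integrable lborel f \<longleftrightarrow> integrable lborel (\<lambda>t. past_dflux (past w \<tau>) i j t x)"
  proof -
    have "integrable lborel f \<longleftrightarrow> integrable lborel (\<lambda>t. f (\<tau> + (-1) * t))"
      by (rule lborel_integrable_real_affine_iff[symmetric]) simp
    also have "\<dots> \<longleftrightarrow> integrable lborel (\<lambda>t. past_dflux (past w \<tau>) i j t x)"
    proof
      assume "integrable lborel (\<lambda>t. f (\<tau> + (-1) * t))"
      then have "integrable lborel (\<lambda>t. f (\<tau> + (-1) * t) - indicator {0} t * c)" using c0(1) by (rule Bochner_Integration.integrable_diff)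
      then show "integrable lborel (\<lambda>t. past_dflux (past w \<tau>) i j t x)" unfolding f by simp
    next
      assume "integrable lborel (\<lambda>t. past_dflux (past w \<tau>) i j t x)"
      then show "integrable lborel (\<lambda>t. f (\<tau> + (-1) * t))" unfolding f using c0(1) by (rule Bochner_Integration.integrable_add)
    qed
    finally show ?thesis .
  qed
  then show "set_integrable lborel {0..\<tau>} (duhamel w i j \<tau> x) \<longleftrightarrow> integrable lborel (\<lambda>t. past_dflux (past w \<tau>) i j t x)"
    unfolding set_integrable_def f_def .
  have "(LBINT s. f s) = (LBINT t. past_dflux (past w \<tau>) i j t x)"
  proof (cases "integrable lborel (\<lambda>t. past_dflux (past w \<tau>) i j t x)")
    case True
    have "(LBINT s. f s) = (LBINT t. f (\<tau> + (-1) * t))"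
      using lborel_integral_real_affine[of "-1" f \<tau>] by simp
    also have "\<dots> = (LBINT t. past_dflux (past w \<tau>) i j t x)" unfolding f using True c0 by simp
    finally show ?thesis .
  next
    case False
    then show ?thesis using iff by (simp add: not_integrable_integral_eq)
  qed
  then show "(LBINT s:{0..\<tau>}. duhamel w i j \<tau> x s) = (LBINT t. past_dflux (past w \<tau>) i j t x)"
    unfolding set_lebesgue_integral_def f_def .
qed

lemma integral_equation_iff:
  assumes K: "duhamel_bound \<mu> m K" and w: "cpath m w"
  shows "integral_equation w \<longleftrightarrow> (\<forall>\<tau>\<ge>0. AE x in lborel. w \<tau> x = expLv \<tau> (w 0) x + duhamel_op (past w \<tau>) x)"
proof -
  have m: "0 \<le> m" using K by (simp add: duhamel_bound_def)
  have key: "(\<forall>i. AE x in lborel. (\<forall>j. set_integrable lborel {0..\<tau>} (duhamel w i j \<tau> x)) \<and>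
     w \<tau> x $ i = expL \<tau> (\<lambda>z. w 0 z $ i) x + (\<Sum>j\<in>UNIV. LBINT s:{0..\<tau>}. duhamel w i j \<tau> x s))
    \<longleftrightarrow> (AE x in lborel. w \<tau> x = expLv \<tau> (w 0) x + duhamel_op (past w \<tau>) x)" (is "?L \<longleftrightarrow> ?R") if \<tau>: "0 \<le> \<tau>" for \<tau>
  proof
    assume ?L
    then have "AE x in lborel. \<forall>i. w \<tau> x $ i = expL \<tau> (\<lambda>z. w 0 z $ i) x + (\<Sum>j\<in>UNIV. LBINT s:{0..\<tau>}. duhamel w i j \<tau> x s)"
      unfolding AE_all_countable by (auto elim!: eventually_mono)
    then show ?R
      by eventually_elim (simp add: vec_eq_iff expLv_def duhamel_op_def duhamel_integral[OF m w \<tau>])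
  next
    assume R: ?R
    show ?L
    proof
      fix i
      from R duhamel_integrable_past(2)[OF K w, of \<tau>, unfolded duhamel_integrable_def]
      show "AE x in lborel. (\<forall>j. set_integrable lborel {0..\<tau>} (duhamel w i j \<tau> x)) \<and>
        w \<tau> x $ i = expL \<tau> (\<lambda>z. w 0 z $ i) x + (\<Sum>j\<in>UNIV. LBINT s:{0..\<tau>}. duhamel w i j \<tau> x s)"
        by eventually_elim (simp add: expLv_def duhamel_op_def duhamel_integral[OF m w \<tau>])
    qed
  qed
  show ?thesis unfolding integral_equation_def using key by blast
qed

lemma C0_LL2w_iff_cpath:
  "w \<in> C0_LL2w m \<longleftrightarrow> cpath m w \<and> (\<forall>\<tau>\<ge>0. div_free (w \<tau>))"
proof -
  have *: "((\<lambda>\<tau>. wnorm m (\<lambda>x. w \<tau> x - w t x)) \<longlongrightarrow> 0) (at t within {0..}) \<longleftrightarrow>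
    (\<forall>T. (\<forall>n. 0 \<le> T n) \<longrightarrow> T \<longlonglongrightarrow> t \<longrightarrow> (\<lambda>n::nat. wnorm m (\<lambda>x. w (T n) x - w t x)) \<longlonglongrightarrow> 0)" for t
  proof -
    have "((\<lambda>\<tau>. wnorm m (\<lambda>x. w \<tau> x - w t x)) \<longlongrightarrow> 0) (at t within {0..}) \<longleftrightarrow> continuous (at t within {0..}) (\<lambda>\<tau>. wnorm m (\<lambda>x. w \<tau> x - w t x))"
      by (simp add: continuous_within)
    then show ?thesis unfolding continuous_within_sequentially by (auto simp: o_def)
  qed
  show ?thesis unfolding C0_LL2w_def cpath_def LL2w_def by (auto simp: *)
qed

section \<open>Picard iteration and uniqueness\<close>

lemma div_free_cong_AE:
  assumes "div_free f" "AE x in lborel. g x = f x" and [measurable]: "f \<in> borel_measurable borel" "g \<in> borel_measurable borel"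
  shows "div_free g"
  unfolding div_free_def
proof (intro allI impI)
  fix \<phi> assume t: "test_function \<phi>"
  have [measurable]: "partial j \<phi> \<in> borel_measurable borel" for j
    using Ck1_partial_continuous[OF test_functionD(1)[OF t]] by (intro borel_measurable_continuous_onI)
  have "(LBINT x. \<Sum>j\<in>UNIV. g x $ j * partial j \<phi> x) = (LBINT x. \<Sum>j\<in>UNIV. f x $ j * partial j \<phi> x)"
    using assms(2) by (intro integral_cong_AE) (auto elim!: eventually_mono)
  then show "(LBINT x. \<Sum>j\<in>UNIV. g x $ j * partial j \<phi> x) = 0" using assms(1) t by (simp add: div_free_def)
qed

lemma div_free_add:
  assumes m: "0 \<le> m" and f: "f \<in> L2w m" "div_free f" and g: "g \<in> L2w m" "div_free g"
  shows "div_free (\<lambda>\<xi>. f \<xi> + g \<xi>)"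
  unfolding div_free_def
proof (intro allI impI)
  fix \<phi> assume t: "test_function \<phi>"
  obtain R where R: "\<And>x. R < norm x \<Longrightarrow> \<phi> x = 0" using test_functionD(2)[OF t] by blast
  have i: "integrable lborel (\<lambda>\<xi>. h \<xi> $ j * partial j \<phi> \<xi>)" if "h \<in> L2w m" for h j
  proof (rule integrable_component_mult[OF m that])
    have c: "continuous_on UNIV (partial j \<phi>)" by (rule Ck1_partial_continuous[OF test_functionD(1)[OF t]])
    then show "partial j \<phi> \<in> borel_measurable borel" by (rule borel_measurable_continuous_onI)
    have z: "partial j \<phi> x = 0" if "R < norm x" for x by (rule partial_zero_outside[OF R that])
    obtain B where "\<And>x. \<bar>partial j \<phi> x\<bar> \<le> B" using continuous_support_bounded[OF c z] by blast
    then show "(\<integral>\<^sup>+x. (ennreal \<bar>partial j \<phi> x\<bar>)\<^sup>2 \<partial>lborel) < \<infinity>" by (rule L2_bounded_support) (rule z)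
  qed
  have "(LBINT \<xi>. \<Sum>j\<in>UNIV. (f \<xi> + g \<xi>) $ j * partial j \<phi> \<xi>) = (LBINT \<xi>. (\<Sum>j\<in>UNIV. f \<xi> $ j * partial j \<phi> \<xi>) + (\<Sum>j\<in>UNIV. g \<xi> $ j * partial j \<phi> \<xi>))"
    by (simp add: distrib_right sum.distrib)
  also have "\<dots> = (LBINT \<xi>. \<Sum>j\<in>UNIV. f \<xi> $ j * partial j \<phi> \<xi>) + (LBINT \<xi>. \<Sum>j\<in>UNIV. g \<xi> $ j * partial j \<phi> \<xi>)"
    using i f g by (intro Bochner_Integration.integral_add Bochner_Integration.integrable_sum) auto
  also have "\<dots> = 0" using f(2) g(2) t by (simp add: div_free_def)
  finally show "(LBINT \<xi>. \<Sum>j\<in>UNIV. (f \<xi> + g \<xi>) $ j * partial j \<phi> \<xi>) = 0" .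
qed

lemma expLv_cong_AE:
  assumes "AE x in lborel. f x = g x" and [measurable]: "f \<in> borel_measurable borel" "g \<in> borel_measurable borel" and "0 \<le> \<tau>"
  shows "AE x in lborel. expLv \<tau> f x = expLv \<tau> g x"
proof (cases "\<tau> = 0")
  case True
  then show ?thesis using assms(1) by (simp add: expLv_def expL_def vec_eq_iff)
next
  case False
  then have \<tau>: "0 < \<tau>" using assms by simp
  have "expL \<tau> (\<lambda>z. f z $ i) x = expL \<tau> (\<lambda>z. g z $ i) x" for i x
    unfolding expL_eq[OF \<tau> borel_measurable_vec_nth'[OF assms(2)]] expL_eq[OF \<tau> borel_measurable_vec_nth'[OF assms(3)]]
    using assms(1) by (intro integral_cong_AE) (auto elim!: eventually_mono)
  then show ?thesis by (simp add: expLv_def)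
qed

lemma expLv_0 [simp]: "expLv 0 w = w"
  by (simp add: expLv_def expL_def vec_eq_iff fun_eq_iff)

lemma duhamel_op_past_0 [simp]: "duhamel_op (past w 0) x = 0"
proof -
  have "past_dflux (past w 0) i j t x = 0" for i j t
    using dflux_zero[of t i j x] by (cases "0 < t") (auto simp: past_dflux_def past_def)
  then show ?thesis by (simp add: duhamel_op_def vec_eq_iff)
qed

text \<open>
  The proof of the completeness of \<open>L\<^sup>2\<close>, with an explicit limit function: the pointwise limit is
  canonical, so that no choice has to be made for every time separately. Fatou's lemma gives the
  distance to the limit.
\<close>

lemma L2w_geometric_limit:
  fixes f :: "nat \<Rightarrow> real^3 \<Rightarrow> real^3"
  assumes m: "0 \<le> m" and f: "\<And>n. f n \<in> L2w m" and A: "0 \<le> A"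
    and d: "\<And>n. wnorm m (\<lambda>x. f (Suc n) x - f n x) \<le> A / 4 ^ n"
  shows "(\<lambda>x. lim (\<lambda>n. f n x)) \<in> L2w m" "wnorm m (\<lambda>x. lim (\<lambda>n. f n x) - f n x) \<le> 2 * A / 4 ^ n"
proof -
  have [measurable]: "f n \<in> borel_measurable borel" for n using f by (rule L2w_measurable)
  let ?g = "\<lambda>x. lim (\<lambda>n. f n x)"
  \<comment> \<open>the integral of \<open>4 ^ n * h n\<close> is at most \<open>A\<^sup>2 / 4 ^ n\<close>; so the sum over \<open>n\<close> is finite almost everywhere, and the differences are \<open>O(2 powr (- n))\<close> there\<close>
  define h where "h n x = (rho x powr m * norm (f (Suc n) x - f n x))\<^sup>2" for n x
  have [measurable]: "h n \<in> borel_measurable borel" for n unfolding h_def by measurable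
  have "(\<integral>\<^sup>+x. (\<Sum>n. ennreal (4 ^ n) * ennreal (h n x)) \<partial>lborel) = (\<Sum>n. \<integral>\<^sup>+x. ennreal (4 ^ n) * ennreal (h n x) \<partial>lborel)"
    by (rule nn_integral_suminf) measurable
  also have "\<dots> \<le> (\<Sum>n. ennreal (A\<^sup>2 * (1/4) ^ n))"
  proof (rule suminf_le)
    fix n
    have "(\<integral>\<^sup>+x. ennreal (4 ^ n) * ennreal (h n x) \<partial>lborel) = ennreal (4 ^ n) * wsqn m (\<lambda>x. f (Suc n) x - f n x)"
      unfolding wsqn_eq h_def[symmetric] by (rule nn_integral_cmult) measurable
    also have "\<dots> = ennreal (4 ^ n * (wnorm m (\<lambda>x. f (Suc n) x - f n x))\<^sup>2)"
      by (simp add: wsqn_wnorm[OF L2w_diff(1)[OF f f]] ennreal_mult)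
    also have "\<dots> \<le> ennreal (4 ^ n * (A / 4 ^ n)\<^sup>2)"
      by (intro ennreal_leI mult_left_mono power_mono d) auto
    also have "4 ^ n * (A / 4 ^ n)\<^sup>2 = A\<^sup>2 * (1/4) ^ n"
      by (simp add: power2_eq_square power_one_over field_simps)
    finally show "(\<integral>\<^sup>+x. ennreal (4 ^ n) * ennreal (h n x) \<partial>lborel) \<le> ennreal (A\<^sup>2 * (1/4) ^ n)" .
  qed auto
  also have "\<dots> < \<infinity>"
  proof -
    have "summable (\<lambda>n. A\<^sup>2 * (1/4) ^ n)" by (intro summable_mult summable_geometric) simp
    then have "(\<Sum>n. ennreal (A\<^sup>2 * (1/4) ^ n)) = ennreal (\<Sum>n. A\<^sup>2 * (1/4) ^ n)" by (intro suminf_ennreal2) auto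
    then show ?thesis by simp
  qed
  finally have "AE x in lborel. (\<Sum>n. ennreal (4 ^ n) * ennreal (h n x)) \<noteq> \<infinity>"
    by (intro nn_integral_PInf_AE) auto
  then have cv: "AE x in lborel. (\<lambda>n. f n x) \<longlonglongrightarrow> ?g x"
  proof eventually_elim
    case (elim x)
    then obtain S where S: "0 \<le> S" "(\<Sum>n. ennreal (4 ^ n) * ennreal (h n x)) = ennreal S"
      by (cases "\<Sum>n. ennreal (4 ^ n) * ennreal (h n x)") auto
    have "norm (f (Suc n) x - f n x) \<le> sqrt S * (1/2) ^ n" for n
    proof -
      have "ennreal (4 ^ n * h n x) \<le> (\<Sum>n. ennreal (4 ^ n) * ennreal (h n x))"
        using sum_le_suminf[of "\<lambda>n. ennreal (4 ^ n) * ennreal (h n x)" "{n}"] by (simp add: ennreal_mult h_def)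
      then have "4 ^ n * h n x \<le> S" using S by simp
      moreover have "(2 ^ n * norm (f (Suc n) x - f n x))\<^sup>2 \<le> 4 ^ n * h n x"
      proof -
        have "1 * norm (f (Suc n) x - f n x) \<le> rho x powr m * norm (f (Suc n) x - f n x)"
          using rho_powr_ge1[OF m] by (intro mult_right_mono) auto
        then have "(norm (f (Suc n) x - f n x))\<^sup>2 \<le> h n x" unfolding h_def by (intro power_mono) auto
        then show ?thesis by (simp add: power_mult_distrib flip: power_mult power2_eq_square)
          (simp add: power_mult mult.commute[of n])
      qed
      ultimately have "2 ^ n * norm (f (Suc n) x - f n x) \<le> sqrt S" by (intro real_le_rsqrt) simp
      then show ?thesis by (simp add: power_one_over field_simps)
    qed
    note nb = this
    have "summable (\<lambda>n. sqrt S * (1/2) ^ n)" by (intro summable_mult summable_geometric) simp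
    from summable_comparison_test'[OF this nb] have "summable (\<lambda>n. f (Suc n) x - f n x)" .
    then have "convergent (\<lambda>n. f n x - f 0 x)" unfolding summable_iff_convergent sum_lessThan_telescope[of "\<lambda>n. f n x"] .
    then have "convergent (\<lambda>n. (f n x - f 0 x) + f 0 x)" by (intro convergent_add convergent_const)
    then have "convergent (\<lambda>n. f n x)" by simp
    then show ?case by (simp add: convergent_LIMSEQ_iff)
  qed
  have tel: "wnorm m (\<lambda>x. f (n + k) x - f n x) \<le> 2 * A / 4 ^ n - 2 * A / 4 ^ (n + k)" for n k
  proof (induction k)
    case (Suc k)
    have "wnorm m (\<lambda>x. f (n + Suc k) x - f n x) \<le> wnorm m (\<lambda>x. f (Suc (n + k)) x - f (n + k) x) + wnorm m (\<lambda>x. f (n + k) x - f n x)"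
      using wnorm_triangle_diff[OF f f f, of "Suc (n + k)" n "n + k"] by simp
    also have "\<dots> \<le> A / 4 ^ (n + k) + (2 * A / 4 ^ n - 2 * A / 4 ^ (n + k))" by (intro add_mono d Suc)
    also have "\<dots> \<le> 2 * A / 4 ^ n - 2 * A / 4 ^ (n + Suc k)" using A by (simp add: field_simps)
    finally show ?case .
  qed simp
  have nb: "wnorm m (\<lambda>x. f k x - f n x) \<le> 2 * A / 4 ^ n" if "n \<le> k" for n k
  proof -
    have "0 \<le> 2 * A / 4 ^ k" using A by simp
    then show ?thesis using tel[of n "k - n"] that by simp
  qed
  have gm[measurable]: "?g \<in> borel_measurable borel" by measurable
  have "wsqn m (\<lambda>x. ?g x - f n x) \<le> ennreal ((2 * A / 4 ^ n)\<^sup>2)" for n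
  proof -
    have "wsqn m (\<lambda>x. ?g x - f n x) = (\<integral>\<^sup>+x. liminf (\<lambda>k. ennreal ((rho x powr m * norm (f k x - f n x))\<^sup>2)) \<partial>lborel)"
      unfolding wsqn_eq
    proof (rule nn_integral_cong_AE)
      show "AE x in lborel. ennreal ((rho x powr m * norm (?g x - f n x))\<^sup>2) = liminf (\<lambda>k. ennreal ((rho x powr m * norm (f k x - f n x))\<^sup>2))"
        using cv
      proof eventually_elim
        case (elim x)
        have "(\<lambda>k. ennreal ((rho x powr m * norm (f k x - f n x))\<^sup>2)) \<longlonglongrightarrow> ennreal ((rho x powr m * norm (?g x - f n x))\<^sup>2)"
          by (intro tendsto_ennrealI tendsto_intros elim)
        then show ?case by (rule lim_imp_Liminf[OF sequentially_bot, symmetric])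
      qed
    qed
    also have "\<dots> \<le> liminf (\<lambda>k. \<integral>\<^sup>+x. ennreal ((rho x powr m * norm (f k x - f n x))\<^sup>2) \<partial>lborel)"
      by (rule nn_integral_liminf) measurable
    also have "\<dots> = liminf (\<lambda>k. wsqn m (\<lambda>x. f k x - f n x))" unfolding wsqn_eq ..
    also have "\<dots> \<le> limsup (\<lambda>k. wsqn m (\<lambda>x. f k x - f n x))" by (rule Liminf_le_Limsup) simp
    also have "\<dots> \<le> ennreal ((2 * A / 4 ^ n)\<^sup>2)"
    proof (rule Limsup_bounded)
      show "\<forall>\<^sub>F k in sequentially. wsqn m (\<lambda>x. f k x - f n x) \<le> ennreal ((2 * A / 4 ^ n)\<^sup>2)"
        using eventually_ge_at_top[of n]
      proof eventually_elim
        case (elim k)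
        show ?case unfolding wsqn_wnorm[OF L2w_diff(1)[OF f f]] by (intro ennreal_leI power_mono nb elim) simp
      qed
    qed
    finally show ?thesis .
  qed
  then have b: "(\<lambda>x. ?g x - f n x) \<in> L2w m \<and> wnorm m (\<lambda>x. ?g x - f n x) \<le> 2 * A / 4 ^ n" for n
    using A wnorm_leI[of "\<lambda>x. ?g x - f n x" m "2 * A / 4 ^ n"] by simp
  show "wnorm m (\<lambda>x. ?g x - f n x) \<le> 2 * A / 4 ^ n" using b by simp
  show "?g \<in> L2w m" using L2w_add(1)[OF conjunct1[OF b[of 0]] f[of 0]] by simp
qed

lemma cpath_uniform_limit:
  assumes W: "\<And>n. cpath m (W n)" and w: "\<And>\<tau>. 0 \<le> \<tau> \<Longrightarrow> w \<tau> \<in> L2w m"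
    and d: "\<And>n \<tau>. 0 \<le> \<tau> \<Longrightarrow> wnorm m (\<lambda>x. w \<tau> x - W n \<tau> x) \<le> c n" and c: "c \<longlonglongrightarrow> 0"
  shows "cpath m w"
  unfolding cpath_def
proof (intro conjI allI impI)
  show "w \<tau> \<in> L2w m" if "0 \<le> \<tau>" for \<tau> by (rule w[OF that])
  fix T :: "nat \<Rightarrow> real" and t assume T: "\<forall>n. 0 \<le> T n" "0 \<le> t" "T \<longlonglongrightarrow> t"
  show "(\<lambda>n. wnorm m (\<lambda>\<xi>. w (T n) \<xi> - w t \<xi>)) \<longlonglongrightarrow> 0"
  proof (rule LIMSEQ_I)
    fix e :: real assume e: "0 < e"
    have "\<forall>\<^sub>F N in sequentially. c N < e / 3" using order_tendstoD(2)[OF c, of "e / 3"] e by simp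
    then obtain N where N: "c N < e / 3" using eventually_happens'[OF sequentially_bot] by blast
    have "(\<lambda>n. wnorm m (\<lambda>\<xi>. W N (T n) \<xi> - W N t \<xi>)) \<longlonglongrightarrow> 0" using T by (intro cpath_limit[OF W]) auto
    then obtain n0 where n0: "\<And>n. n0 \<le> n \<Longrightarrow> wnorm m (\<lambda>\<xi>. W N (T n) \<xi> - W N t \<xi>) < e / 3"
      using order_tendstoD(2)[of _ 0 sequentially "e / 3"] e unfolding eventually_sequentially by force
    show "\<exists>no. \<forall>n\<ge>no. norm (wnorm m (\<lambda>\<xi>. w (T n) \<xi> - w t \<xi>) - 0) < e"
    proof (intro exI allI impI)
      fix n assume n: "n0 \<le> n"
      have Tn: "0 \<le> T n" using T by simp
      note L = w[OF Tn] cpath_L2w[OF W Tn, of N] cpath_L2w[OF W T(2), of N] w[OF T(2)]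
      have "wnorm m (\<lambda>\<xi>. w (T n) \<xi> - w t \<xi>) \<le> wnorm m (\<lambda>\<xi>. w (T n) \<xi> - W N (T n) \<xi>) + (wnorm m (\<lambda>\<xi>. W N (T n) \<xi> - W N t \<xi>) + wnorm m (\<lambda>\<xi>. W N t \<xi> - w t \<xi>))"
        using wnorm_triangle_diff[OF L(1,2,4)] wnorm_triangle_diff[OF L(2,3,4)] by simp
      moreover have "wnorm m (\<lambda>\<xi>. W N t \<xi> - w t \<xi>) \<le> c N" using d[OF T(2), of N] by (subst wnorm_minus_commute)
      ultimately show "norm (wnorm m (\<lambda>\<xi>. w (T n) \<xi> - w t \<xi>) - 0) < e" using d[OF Tn, of N] n0[OF n] N by simp
    qed
  qed
qed

text \<open>
  The bound \<open>M\<close> of \<open>time_kernel_convolution\<close>.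
\<close>

definition tker_bound :: "real \<Rightarrow> real \<Rightarrow> bool" where
  "tker_bound \<mu> M \<longleftrightarrow> 0 \<le> M \<and> (\<forall>\<tau>. (\<integral>\<^sup>+t. ennreal (htime t powr (-(7/8)) * (exp (- \<mu> * (\<tau> - t)) * indicator {..\<tau>} t)) * indicator {0<..} t \<partial>lborel) \<le> ennreal M)"

text \<open>
  The product of two norms decays like \<open>exp (- 2 * \<mu> * (\<tau> - t))\<close>. Together with \<open>exp (- \<mu> * t)\<close>
  from the kernel, one factor becomes \<open>exp (- \<mu> * \<tau>)\<close>, and the other stays in the integral that
  \<open>tker_bound\<close> controls.
\<close>

lemma duhamel_op_contraction:
  assumes K: "duhamel_bound \<mu> m K" and M: "tker_bound \<mu> M" and w: "cpath m w" "cpath m w'" and R: "0 \<le> R" "0 \<le> D"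
    and b: "\<And>s. 0 \<le> s \<Longrightarrow> wnorm m (w s) \<le> R * exp (- \<mu> * s)" "\<And>s. 0 \<le> s \<Longrightarrow> wnorm m (w' s) \<le> R * exp (- \<mu> * s)"
    and d: "\<And>s. 0 \<le> s \<Longrightarrow> wnorm m (\<lambda>x. w s x - w' s x) \<le> D * exp (- \<mu> * s)"
  shows "wnorm m (\<lambda>\<xi>. duhamel_op (past w \<tau>) \<xi> - duhamel_op (past w' \<tau>) \<xi>) \<le> 2 * K * M * R * D * exp (- \<mu> * \<tau>)"
proof -
  define b where "b t = 2 * R * D * exp (- \<mu> * \<tau>) * (htime t powr (-(7/8)) * (exp (- \<mu> * (\<tau> - t)) * indicator {..\<tau>} t))" for t
  have M0: "0 \<le> M" using M by (simp add: tker_bound_def)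
  have "wnorm m (\<lambda>\<xi>. duhamel_op (past w \<tau>) \<xi> - duhamel_op (past w' \<tau>) \<xi>) \<le> K * (2 * R * D * exp (- \<mu> * \<tau>) * M)"
  proof (rule duhamel_op_past_diff(2)[OF K w, where b=b])
    show "b \<in> borel_measurable borel" unfolding b_def by measurable
    show "0 \<le> 2 * R * D * exp (- \<mu> * \<tau>) * M" using R M0 by simp
    have "(\<integral>\<^sup>+t. ennreal (b t) * indicator {0<..} t \<partial>lborel) = (\<integral>\<^sup>+t. ennreal (2 * R * D * exp (- \<mu> * \<tau>)) * (ennreal (htime t powr (-(7/8)) * (exp (- \<mu> * (\<tau> - t)) * indicator {..\<tau>} t)) * indicator {0<..} t) \<partial>lborel)"
      unfolding b_def using R by (intro nn_integral_cong) (simp add: ennreal_mult mult.assoc)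
    also have "\<dots> = ennreal (2 * R * D * exp (- \<mu> * \<tau>)) * (\<integral>\<^sup>+t. ennreal (htime t powr (-(7/8)) * (exp (- \<mu> * (\<tau> - t)) * indicator {..\<tau>} t)) * indicator {0<..} t \<partial>lborel)"
      by (rule nn_integral_cmult) measurable
    also have "\<dots> \<le> ennreal (2 * R * D * exp (- \<mu> * \<tau>)) * ennreal M"
      using M by (intro mult_left_mono) (auto simp: tker_bound_def)
    also have "\<dots> = ennreal (2 * R * D * exp (- \<mu> * \<tau>) * M)" using R M0 by (simp add: ennreal_mult)
    finally show "(\<integral>\<^sup>+t. ennreal (b t) * indicator {0<..} t \<partial>lborel) \<le> ennreal (2 * R * D * exp (- \<mu> * \<tau>) * M)" .
    fix t :: real assume t: "0 < t"
    show "tker \<mu> t * ((wnorm m (past w \<tau> t) + wnorm m (past w' \<tau> t)) * wnorm m (\<lambda>x. past w \<tau> t x - past w' \<tau> t x)) \<le> b t"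
    proof (cases "t \<le> \<tau>")
      case True
      let ?E = "exp (- \<mu> * (\<tau> - t))"
      have s: "0 \<le> \<tau> - t" using True by simp
      have "wnorm m (w (\<tau> - t)) + wnorm m (w' (\<tau> - t)) \<le> 2 * R * ?E" using assms(7)[OF s] assms(8)[OF s] by simp
      then have "tker \<mu> t * ((wnorm m (past w \<tau> t) + wnorm m (past w' \<tau> t)) * wnorm m (\<lambda>x. past w \<tau> t x - past w' \<tau> t x)) \<le> tker \<mu> t * ((2 * R * ?E) * (D * ?E))"
        using d[OF s] True R by (intro mult_left_mono mult_mono) (auto simp: past_def)
      also have "\<dots> = 2 * R * D * (exp (- \<mu> * t) * ?E) * (htime t powr (-(7/8)) * ?E)" by (simp add: tker_def)
      also have "exp (- \<mu> * t) * ?E = exp (- \<mu> * \<tau>)" by (simp add: exp_add[symmetric] algebra_simps)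
      finally show ?thesis using True by (simp add: b_def)
    qed (simp add: past_def b_def)
  qed
  then show ?thesis by (simp add: mult_ac)
qed

lemma duhamel_op_bound:
  assumes K: "duhamel_bound \<mu> m K" and M: "tker_bound \<mu> M" and w: "cpath m w" and R: "0 \<le> R"
    and b: "\<And>s. 0 \<le> s \<Longrightarrow> wnorm m (w s) \<le> R * exp (- \<mu> * s)"
  shows "wnorm m (duhamel_op (past w \<tau>)) \<le> 2 * K * M * R * R * exp (- \<mu> * \<tau>)"
  using duhamel_op_contraction[OF K M w cpath_zero R R, of \<tau>] b R by simp

primrec picard :: "(real^3 \<Rightarrow> real^3) \<Rightarrow> nat \<Rightarrow> real \<Rightarrow> real^3 \<Rightarrow> real^3" where
  "picard w0 0 = (\<lambda>\<tau>. expLv \<tau> w0)"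
| "picard w0 (Suc n) = (\<lambda>\<tau> x. expLv \<tau> w0 x + duhamel_op (past (picard w0 n) \<tau>) x)"

lemma mild_solution_exists:
  assumes K: "duhamel_bound \<mu> m K" and M: "tker_bound \<mu> M" and w0: "w0 \<in> LL2w m"
    and a: "\<And>\<tau>. 0 \<le> \<tau> \<Longrightarrow> wnorm m (expLv \<tau> w0) \<le> a * exp (- \<mu> * \<tau>)" and small: "16 * K * M * a \<le> 1"
  shows "\<exists>w. cpath m w \<and> (\<forall>\<tau>\<ge>0. div_free (w \<tau>)) \<and> (\<forall>\<tau>\<ge>0. AE \<xi> in lborel. w \<tau> \<xi> = expLv \<tau> w0 \<xi> + duhamel_op (past w \<tau>) \<xi>)
    \<and> (\<forall>\<tau>\<ge>0. wnorm m (w \<tau>) \<le> 6 * a * exp (- \<mu> * \<tau>))"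
proof -
  have m: "0 \<le> m" and \<mu>: "0 < \<mu>" and K0: "0 \<le> K" using K by (auto simp: duhamel_bound_def)
  have M0: "0 \<le> M" using M by (simp add: tker_bound_def)
  have w0L: "w0 \<in> L2w m" and w0d: "div_free w0" using w0 by (auto simp: LL2w_def)
  have a0: "0 \<le> a" using a[of 0] wnorm_nonneg[of m "expLv 0 w0"] by (simp del: wnorm_nonneg expLv_0)
  \<comment> \<open>the linear part contributes \<open>a\<close> and the Duhamel term at most \<open>R / 4\<close>, so the ball of radius \<open>R\<close> is preserved\<close>
  define R where "R = 2 * a"
  have R: "0 \<le> R" using a0 by (simp add: R_def)
  have q: "2 * K * M * R \<le> 1/4" using small by (simp add: R_def)
  let ?W = "picard w0"
  have e1: "exp (- \<mu> * \<tau>) \<le> 1" if "0 \<le> \<tau>" for \<tau> using that \<mu> by simp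
  have CCe: "cpath m (\<lambda>\<tau>. expLv \<tau> w0)" by (rule cpath_expLv[OF m w0L])
  have CCW: "cpath m (?W n)" for n
    by (induction n) (auto intro: CCe cpath_add[OF CCe cpath_duhamel_op[OF K]])
  have aR: "a * exp (- \<mu> * \<tau>) + R / 4 * exp (- \<mu> * \<tau>) \<le> R * exp (- \<mu> * \<tau>)" for \<tau>
  proof -
    have "(a + R / 4) * exp (- \<mu> * \<tau>) \<le> R * exp (- \<mu> * \<tau>)" using a0 by (intro mult_right_mono) (auto simp: R_def)
    then show ?thesis by (simp add: distrib_right)
  qed
  have WR: "wnorm m (?W n \<tau>) \<le> R * exp (- \<mu> * \<tau>)" if "0 \<le> \<tau>" for n \<tau>
    using that
  proof (induction n arbitrary: \<tau>)
    case 0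
    have "a * exp (- \<mu> * \<tau>) \<le> R * exp (- \<mu> * \<tau>)" using a0 by (intro mult_right_mono) (auto simp: R_def)
    then show ?case using a[OF 0] by (simp only: picard.simps)
  next
    case (Suc n)
    have "wnorm m (duhamel_op (past (?W n) \<tau>)) \<le> (2 * K * M * R) * (R * exp (- \<mu> * \<tau>))"
      using duhamel_op_bound[OF K M CCW R Suc.IH, of \<tau>] by (simp add: mult.assoc)
    also have "\<dots> \<le> (1/4) * (R * exp (- \<mu> * \<tau>))" using q R by (intro mult_right_mono) auto
    finally have "wnorm m (duhamel_op (past (?W n) \<tau>)) \<le> R / 4 * exp (- \<mu> * \<tau>)" by simp
    moreover have "wnorm m (?W (Suc n) \<tau>) \<le> wnorm m (expLv \<tau> w0) + wnorm m (duhamel_op (past (?W n) \<tau>))"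
      using Suc.prems by (simp add: L2w_add(2) cpath_L2w[OF CCe] duhamel_op_past_L2w[OF K CCW])
    ultimately show ?case using a[OF Suc.prems] aR[of \<tau>] by linarith
  qed
  have Wd: "wnorm m (\<lambda>x. ?W (Suc n) \<tau> x - ?W n \<tau> x) \<le> R / 4 ^ n * exp (- \<mu> * \<tau>)" if "0 \<le> \<tau>" for n \<tau>
    using that
  proof (induction n arbitrary: \<tau>)
    case 0
    have "wnorm m (duhamel_op (past (?W 0) \<tau>)) \<le> (2 * K * M * R) * (R * exp (- \<mu> * \<tau>))"
      using duhamel_op_bound[OF K M CCW R WR, of 0 \<tau>] by (simp add: mult.assoc)
    also have "\<dots> \<le> 1 * (R * exp (- \<mu> * \<tau>))" using q R by (intro mult_right_mono) auto
    finally show ?case by simp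
  next
    case (Suc n)
    have "wnorm m (\<lambda>\<xi>. duhamel_op (past (?W (Suc n)) \<tau>) \<xi> - duhamel_op (past (?W n) \<tau>) \<xi>) \<le> 2 * K * M * R * (R / 4 ^ n) * exp (- \<mu> * \<tau>)"
      by (rule duhamel_op_contraction[OF K M CCW CCW R _ WR WR Suc.IH]) (use R in auto)
    also have "\<dots> = (2 * K * M * R) * (R / 4 ^ n * exp (- \<mu> * \<tau>))" by simp
    also have "\<dots> \<le> (1/4) * (R / 4 ^ n * exp (- \<mu> * \<tau>))" using q R by (intro mult_right_mono) auto
    finally show ?case by simp
  qed
  define w where "w \<tau> \<xi> = lim (\<lambda>n. ?W n \<tau> \<xi>)" for \<tau> \<xi>
  have lim: "w \<tau> \<in> L2w m \<and> wnorm m (\<lambda>\<xi>. w \<tau> \<xi> - ?W n \<tau> \<xi>) \<le> 2 * R / 4 ^ n * exp (- \<mu> * \<tau>)" if \<tau>: "0 \<le> \<tau>" for n \<tau>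
  proof -
    have A: "0 \<le> R * exp (- \<mu> * \<tau>)" using R by simp
    have "wnorm m (\<lambda>x. ?W (Suc k) \<tau> x - ?W k \<tau> x) \<le> R * exp (- \<mu> * \<tau>) / 4 ^ k" for k using Wd[OF \<tau>, of k] by simp
    from L2w_geometric_limit[OF m cpath_L2w[OF CCW \<tau>] A this] show ?thesis unfolding w_def by (simp add: mult.assoc)
  qed
  have c0: "(\<lambda>n. c / 4 ^ n) \<longlonglongrightarrow> 0" for c :: real
    using tendsto_mult[OF tendsto_const LIMSEQ_power_zero[of "1/4::real"], of c] by (simp add: power_one_over)
  have ww: "wnorm m (\<lambda>\<xi>. w \<tau> \<xi> - ?W n \<tau> \<xi>) \<le> 2 * R / 4 ^ n" if \<tau>: "0 \<le> \<tau>" for n \<tau>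
  proof -
    have "2 * R / 4 ^ n * exp (- \<mu> * \<tau>) \<le> 2 * R / 4 ^ n * 1" using R e1[OF \<tau>] by (intro mult_left_mono) auto
    then show ?thesis using lim[OF \<tau>, of n] by simp
  qed
  have CCw: "cpath m w" by (rule cpath_uniform_limit[OF CCW _ ww c0]) (use lim in auto)
  have wR: "wnorm m (w \<tau>) \<le> 3 * R * exp (- \<mu> * \<tau>)" if \<tau>: "0 \<le> \<tau>" for \<tau>
    using lim[OF \<tau>, of 0] WR[OF \<tau>, of 0] wnorm_abs_diff_le[OF cpath_L2w[OF CCw \<tau>] cpath_L2w[OF CCW \<tau>], of 0]
    unfolding power_0 div_by_1 mult.assoc by linarith
  have eq: "AE \<xi> in lborel. w \<tau> \<xi> = expLv \<tau> w0 \<xi> + duhamel_op (past w \<tau>) \<xi>" if \<tau>: "0 \<le> \<tau>" for \<tau>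
  proof -
    let ?F = "\<lambda>\<xi>. expLv \<tau> w0 \<xi> + duhamel_op (past w \<tau>) \<xi>"
    have FL: "?F \<in> L2w m" by (intro L2w_add cpath_L2w[OF CCe] duhamel_op_past_L2w[OF K CCw] \<tau>)
    have "wnorm m (\<lambda>\<xi>. w \<tau> \<xi> - ?F \<xi>) \<le> (2 * R + 2 * K * M * (3 * R) * (2 * R)) / 4 ^ n" for n
    proof -
      have W3: "wnorm m (?W n s) \<le> 3 * R * exp (- \<mu> * s)" if "0 \<le> s" for s
        by (rule order_trans[OF WR[OF that]]) (use R in \<open>auto intro: mult_right_mono\<close>)
      have "wnorm m (\<lambda>\<xi>. ?W (Suc n) \<tau> \<xi> - ?F \<xi>) = wnorm m (\<lambda>\<xi>. duhamel_op (past (?W n) \<tau>) \<xi> - duhamel_op (past w \<tau>) \<xi>)" by simp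
      also have "\<dots> \<le> 2 * K * M * (3 * R) * (2 * R / 4 ^ n) * exp (- \<mu> * \<tau>)"
        by (rule duhamel_op_contraction[OF K M CCW CCw]) (use R W3 wR lim in \<open>simp_all add: wnorm_minus_commute[of m "?W n _"] del: picard.simps\<close>)
      also have "\<dots> \<le> 2 * K * M * (3 * R) * (2 * R / 4 ^ n) * 1" using R K0 M0 e1[OF \<tau>] by (intro mult_left_mono) auto
      finally have 1: "wnorm m (\<lambda>\<xi>. ?W (Suc n) \<tau> \<xi> - ?F \<xi>) \<le> 2 * K * M * (3 * R) * (2 * R) / 4 ^ n" by simp
      have "2 * R / 4 ^ Suc n \<le> 2 * R / 4 ^ n" using R by (intro divide_left_mono) auto
      then have 2: "wnorm m (\<lambda>\<xi>. w \<tau> \<xi> - ?W (Suc n) \<tau> \<xi>) \<le> 2 * R / 4 ^ n" using ww[OF \<tau>, of "Suc n"] by linarith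
      have "wnorm m (\<lambda>\<xi>. w \<tau> \<xi> - ?F \<xi>) \<le> wnorm m (\<lambda>\<xi>. w \<tau> \<xi> - ?W (Suc n) \<tau> \<xi>) + wnorm m (\<lambda>\<xi>. ?W (Suc n) \<tau> \<xi> - ?F \<xi>)"
        by (rule wnorm_triangle_diff[OF cpath_L2w[OF CCw \<tau>] cpath_L2w[OF CCW \<tau>] FL])
      also have "\<dots> \<le> 2 * R / 4 ^ n + 2 * K * M * (3 * R) * (2 * R) / 4 ^ n" using 1 2 by (rule add_mono[rotated])
      finally show ?thesis by (simp only: add_divide_distrib)
    qed
    then have "wnorm m (\<lambda>\<xi>. w \<tau> \<xi> - ?F \<xi>) \<le> 0" by (intro LIMSEQ_le_const[OF c0]) auto
    then have "wnorm m (\<lambda>\<xi>. w \<tau> \<xi> - ?F \<xi>) = 0" using wnorm_nonneg by (rule antisym)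
    from wnorm_eq_0_AE[OF L2w_diff(1)[OF cpath_L2w[OF CCw \<tau>] FL] this] show ?thesis by simp
  qed
  have "div_free (w \<tau>)" if \<tau>: "0 \<le> \<tau>" for \<tau>
  proof (rule div_free_cong_AE[OF div_free_add[OF m _ _ _ _] eq[OF \<tau>]])
    show "div_free (expLv \<tau> w0)" by (rule div_free_expLv[OF m w0L w0d \<tau>])
    show "div_free (duhamel_op (past w \<tau>))" by (rule div_free_duhamel_op[OF m past_grid_cont[OF CCw] duhamel_integrable_past(1)[OF K CCw]])
    show L: "expLv \<tau> w0 \<in> L2w m" "duhamel_op (past w \<tau>) \<in> L2w m" by (rule cpath_L2w[OF CCe \<tau>]) (rule duhamel_op_past_L2w[OF K CCw])
    show "(\<lambda>\<xi>. expLv \<tau> w0 \<xi> + duhamel_op (past w \<tau>) \<xi>) \<in> borel_measurable borel" by (rule L2w_measurable[OF L2w_add(1)[OF L]])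
    show "w \<tau> \<in> borel_measurable borel" by (rule L2w_measurable[OF cpath_L2w[OF CCw \<tau>]])
  qed
  then show ?thesis using CCw eq wR by (intro exI[of _ w]) (auto simp: R_def)
qed

lemma tker_integral_tendsto_0:
  assumes \<mu>: "0 < \<mu>"
  shows "(\<lambda>n. \<integral>\<^sup>+t. ennreal (tker (\<mu> + real n) t) * indicator {0<..} t \<partial>lborel) \<longlonglongrightarrow> 0"
proof -
  have "(\<lambda>n. \<integral>\<^sup>+t. ennreal (tker (\<mu> + real n) t) * indicator {0<..} t \<partial>lborel) \<longlonglongrightarrow> (\<integral>\<^sup>+(t::real). 0 \<partial>lborel)"
  proof (rule nn_integral_dominated_convergence[where w="\<lambda>t. ennreal (tker \<mu> t) * indicator {0<..} t"])
    show "(\<integral>\<^sup>+t. ennreal (tker \<mu> t) * indicator {0<..} t \<partial>lborel) < \<infinity>" by (rule tker_integrable[OF \<mu>])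
    show "AE t in lborel. ennreal (tker (\<mu> + real n) t) * indicator {0<..} t \<le> ennreal (tker \<mu> t) * indicator {0<..} t" for n
      by (intro AE_I2) (auto simp: tker_def left_diff_distrib split: split_indicator intro!: ennreal_leI mult_right_mono)
    show "AE t in lborel. (\<lambda>n. ennreal (tker (\<mu> + real n) t) * indicator {0<..} t) \<longlonglongrightarrow> 0"
    proof (intro AE_I2)
      fix t :: real
      show "(\<lambda>n. ennreal (tker (\<mu> + real n) t) * indicator {0<..} t) \<longlonglongrightarrow> 0"
      proof (cases "0 < t")
        case True
        have "(\<lambda>n. exp (- t) ^ n) \<longlonglongrightarrow> 0" using True by (intro LIMSEQ_power_zero) simp
        then have "(\<lambda>n. tker \<mu> t * exp (- t) ^ n) \<longlonglongrightarrow> tker \<mu> t * 0" by (rule tendsto_mult[OF tendsto_const])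
        moreover have "tker \<mu> t * exp (- t) ^ n = tker (\<mu> + real n) t" for n
          by (simp add: tker_def exp_of_nat_mult[symmetric] exp_add[symmetric] algebra_simps)
        ultimately have "(\<lambda>n. ennreal (tker (\<mu> + real n) t)) \<longlonglongrightarrow> ennreal 0" by (intro tendsto_ennrealI) simp
        then show ?thesis using True by simp
      qed simp
    qed
  qed measurable
  then show ?thesis by simp
qed

text \<open>
  On \<open>[0, T]\<close> both curves are bounded, by constants with sum \<open>M\<close>. The weight \<open>exp (- N * s)\<close> replaces
  \<open>tker \<mu>\<close> by \<open>tker (\<mu> + N)\<close>, whose integral becomes small for large \<open>N\<close>; so the weighted
  supremum \<open>S\<close> of the difference satisfies \<open>S \<le> S / 2\<close>.
\<close>

lemma mild_solution_unique:
  assumes K: "duhamel_bound \<mu> m K" and w: "cpath m w" "cpath m w'"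
    and eq: "\<And>\<tau>. 0 \<le> \<tau> \<Longrightarrow> AE \<xi> in lborel. w \<tau> \<xi> - w' \<tau> \<xi> = duhamel_op (past w \<tau>) \<xi> - duhamel_op (past w' \<tau>) \<xi>" and T: "0 \<le> T"
  shows "AE \<xi> in lborel. w T \<xi> = w' T \<xi>"
proof -
  have \<mu>: "0 < \<mu>" and K0: "0 \<le> K" using K by (auto simp: duhamel_bound_def)
  obtain M1 where M1: "0 \<le> M1" "\<And>s. 0 \<le> s \<Longrightarrow> s \<le> T \<Longrightarrow> wnorm m (w s) \<le> M1" using cpath_bounded[OF w(1)] by blast
  obtain M2 where M2: "0 \<le> M2" "\<And>s. 0 \<le> s \<Longrightarrow> s \<le> T \<Longrightarrow> wnorm m (w' s) \<le> M2" using cpath_bounded[OF w(2)] by blast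
  define M where "M = M1 + M2"
  have M0: "0 \<le> M" using M1 M2 by (simp add: M_def)
  define d where "d s = wnorm m (\<lambda>x. w s x - w' s x)" for s
  have d0: "0 \<le> d s" for s by (simp add: d_def)
  have wM: "wnorm m (w s) + wnorm m (w' s) \<le> M" if "0 \<le> s" "s \<le> T" for s using M1(2)[OF that] M2(2)[OF that] by (simp add: M_def)
  have dM: "d s \<le> M" if "0 \<le> s" "s \<le> T" for s
    using L2w_diff(2)[OF cpath_L2w[OF w(1) that(1)] cpath_L2w[OF w(2) that(1)]] wM[OF that] unfolding d_def by linarith
  have "\<forall>\<^sub>F n in sequentially. (\<integral>\<^sup>+t. ennreal (tker (\<mu> + real n) t) * indicator {0<..} t \<partial>lborel) < ennreal (1 / (2 * (K * M + 1)))"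
    using K0 M0 by (intro order_tendstoD(2)[OF tker_integral_tendsto_0[OF \<mu>]]) (simp add: add_nonneg_pos)
  then obtain n where n: "(\<integral>\<^sup>+t. ennreal (tker (\<mu> + real n) t) * indicator {0<..} t \<partial>lborel) < ennreal (1 / (2 * (K * M + 1)))"
    using eventually_happens'[OF sequentially_bot] by blast
  define N where "N = real n"
  define I where "I = 1 / (2 * (K * M + 1))"
  have I0: "0 \<le> I" using K0 M0 by (simp add: I_def)
  have KMI: "K * M * I \<le> 1/2"
  proof -
    have "p / (2 * (p + 1)) \<le> 1/2" if "0 \<le> p" for p :: real using that by (simp add: divide_le_eq)
    from this[of "K * M"] show ?thesis using K0 M0 by (simp add: I_def)
  qed
  define S where "S = (SUP s\<in>{0..T}. exp (- N * s) * d s)"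
  have bdd: "bdd_above ((\<lambda>s. exp (- N * s) * d s) ` {0..T})"
  proof (rule bdd_aboveI2)
    fix s assume s: "s \<in> {0..T}"
    have "exp (- N * s) * d s \<le> 1 * d s" using s d0 by (intro mult_right_mono) (auto simp: N_def)
    then show "exp (- N * s) * d s \<le> M" using dM[of s] s by simp
  qed
  have up: "exp (- N * s) * d s \<le> S" if "s \<in> {0..T}" for s unfolding S_def using that bdd by (rule cSUP_upper)
  have S0: "0 \<le> S" using up[of 0] T d0[of 0] by simp
  have dS: "d s \<le> S * exp (N * s)" if "s \<in> {0..T}" for s
    using mult_right_mono[OF up[OF that], of "exp (N * s)"] by (simp add: mult.assoc mult.left_commute exp_minus_inverse flip: exp_add)
  have "exp (- N * \<tau>) * d \<tau> \<le> S / 2" if \<tau>: "\<tau> \<in> {0..T}" for \<tau>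
  proof -
    let ?c = "M * (S * exp (N * \<tau>))"
    have c0: "0 \<le> ?c" using M0 S0 by simp
    have L: "(\<lambda>\<xi>. duhamel_op (past w \<tau>) \<xi> - duhamel_op (past w' \<tau>) \<xi>) \<in> borel_measurable borel"
      by (rule L2w_measurable[OF L2w_diff(1)[OF duhamel_op_past_L2w[OF K w(1)] duhamel_op_past_L2w[OF K w(2)]]])
    have "AE \<xi> in lborel. w \<tau> \<xi> - w' \<tau> \<xi> = duhamel_op (past w \<tau>) \<xi> - duhamel_op (past w' \<tau>) \<xi>" using eq \<tau> by simp
    from wnorm_cong_AE(2)[OF this L2w_diff(1)[OF cpath_L2w[OF w(1)] cpath_L2w[OF w(2)]] L] \<tau>
    have "d \<tau> = wnorm m (\<lambda>\<xi>. duhamel_op (past w \<tau>) \<xi> - duhamel_op (past w' \<tau>) \<xi>)" unfolding d_def by simp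
    also have "\<dots> \<le> K * (?c * I)"
    proof (rule duhamel_op_past_diff(2)[OF K w, where b="\<lambda>t. ?c * tker (\<mu> + N) t"])
      show "(\<lambda>t. ?c * tker (\<mu> + N) t) \<in> borel_measurable borel" by measurable
      show "0 \<le> ?c * I" using c0 I0 by (rule mult_nonneg_nonneg)
      have "(\<integral>\<^sup>+t. ennreal (?c * tker (\<mu> + N) t) * indicator {0<..} t \<partial>lborel) = (\<integral>\<^sup>+t. ennreal ?c * (ennreal (tker (\<mu> + N) t) * indicator {0<..} t) \<partial>lborel)"
        unfolding ennreal_mult[OF c0 tker_nonneg] by (intro nn_integral_cong) (rule mult.assoc)
      also have "\<dots> = ennreal ?c * (\<integral>\<^sup>+t. ennreal (tker (\<mu> + N) t) * indicator {0<..} t \<partial>lborel)"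
        by (rule nn_integral_cmult) measurable
      also have "\<dots> \<le> ennreal ?c * ennreal I" using n unfolding N_def I_def by (intro mult_left_mono) auto
      also have "\<dots> = ennreal (?c * I)" by (rule ennreal_mult[OF c0 I0, symmetric])
      finally show "(\<integral>\<^sup>+t. ennreal (?c * tker (\<mu> + N) t) * indicator {0<..} t \<partial>lborel) \<le> ennreal (?c * I)" .
      fix t :: real assume t: "0 < t"
      show "tker \<mu> t * ((wnorm m (past w \<tau> t) + wnorm m (past w' \<tau> t)) * wnorm m (\<lambda>x. past w \<tau> t x - past w' \<tau> t x)) \<le> ?c * tker (\<mu> + N) t"
      proof (cases "t \<le> \<tau>")
        case True
        have s: "\<tau> - t \<in> {0..T}" using True t \<tau> by auto
        have "tker \<mu> t * ((wnorm m (past w \<tau> t) + wnorm m (past w' \<tau> t)) * wnorm m (\<lambda>x. past w \<tau> t x - past w' \<tau> t x)) \<le> tker \<mu> t * (M * (S * exp (N * (\<tau> - t))))"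
          using wM[of "\<tau> - t"] dS[OF s] s True M0 by (intro mult_left_mono mult_mono) (auto simp: past_def d_def)
        also have "\<dots> = ?c * tker (\<mu> + N) t"
        proof -
          have "exp (- \<mu> * t) * exp (N * (\<tau> - t)) = exp (N * \<tau>) * exp (- (\<mu> + N) * t)"
            unfolding exp_add[symmetric] by (simp add: algebra_simps)
          then show ?thesis unfolding tker_def by (simp add: mult_ac)
        qed
        finally show ?thesis .
      next
        case False
        then show ?thesis using c0 by (simp add: past_def)
      qed
    qed
    also have "\<dots> = K * M * I * (S * exp (N * \<tau>))" by simp
    also have "\<dots> \<le> 1/2 * (S * exp (N * \<tau>))" using S0 by (intro mult_right_mono KMI) auto
    finally have "exp (- N * \<tau>) * d \<tau> \<le> exp (- N * \<tau>) * (1/2 * (S * exp (N * \<tau>)))" by (intro mult_left_mono) auto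
    also have "\<dots> = S / 2" by (simp add: exp_minus)
    finally show ?thesis .
  qed
  then have "S \<le> S / 2" unfolding S_def using T by (intro cSUP_least) auto
  then have "S \<le> 0" by simp
  then have "d T \<le> 0" using dS[of T] T mult_nonpos_nonneg[of S "exp (N * T)"] by simp
  then have "wnorm m (\<lambda>x. w T x - w' T x) = 0" using d0[of T] unfolding d_def by (rule antisym)
  from wnorm_eq_0_AE[OF L2w_diff(1)[OF cpath_L2w[OF w(1) T] cpath_L2w[OF w(2) T]] this] show ?thesis by simp
qed

text \<open>
  The initial value of a solution agrees with \<open>w0\<close> almost everywhere only; the semigroup does not
  distinguish the two.
\<close>

lemma global_solution_iff:
  assumes K: "duhamel_bound \<mu> m K" and w0: "w0 \<in> LL2w m"
  shows "global_solution m w0 w \<longleftrightarrow> cpath m w \<and> (\<forall>\<tau>\<ge>0. div_free (w \<tau>)) \<and> (\<forall>\<tau>\<ge>0. AE x in lborel. w \<tau> x = expLv \<tau> w0 x + duhamel_op (past w \<tau>) x)"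
proof -
  have w0m: "w0 \<in> borel_measurable borel" using w0 by (auto simp: LL2w_def intro: L2w_measurable)
  have cong: "(AE x in lborel. w \<tau> x = expLv \<tau> (w 0) x + duhamel_op (past w \<tau>) x) \<longleftrightarrow> (AE x in lborel. w \<tau> x = expLv \<tau> w0 x + duhamel_op (past w \<tau>) x)"
    if "cpath m w" "AE x in lborel. w 0 x = w0 x" "0 \<le> \<tau>" for \<tau>
  proof -
    have "AE x in lborel. expLv \<tau> (w 0) x = expLv \<tau> w0 x"
      by (rule expLv_cong_AE[OF that(2) L2w_measurable[OF cpath_L2w[OF that(1)]] w0m that(3)]) simp
    then show ?thesis by (intro iffI; elim AE_mp) (auto elim!: eventually_mono)
  qed
  show ?thesis
  proof
    assume g: "global_solution m w0 w"
    then have cpath: "cpath m w" and df: "\<forall>\<tau>\<ge>0. div_free (w \<tau>)" and ie: "integral_equation w" and i: "AE x in lborel. w 0 x = w0 x"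
      by (auto simp: global_solution_def C0_LL2w_iff_cpath)
    have "AE x in lborel. w \<tau> x = expLv \<tau> w0 x + duhamel_op (past w \<tau>) x" if "0 \<le> \<tau>" for \<tau>
      using cong[OF cpath i that] ie that unfolding integral_equation_iff[OF K cpath] by simp
    then show "cpath m w \<and> (\<forall>\<tau>\<ge>0. div_free (w \<tau>)) \<and> (\<forall>\<tau>\<ge>0. AE x in lborel. w \<tau> x = expLv \<tau> w0 x + duhamel_op (past w \<tau>) x)"
      using cpath df by simp
  next
    assume a: "cpath m w \<and> (\<forall>\<tau>\<ge>0. div_free (w \<tau>)) \<and> (\<forall>\<tau>\<ge>0. AE x in lborel. w \<tau> x = expLv \<tau> w0 x + duhamel_op (past w \<tau>) x)"
    then have cpath: "cpath m w" by simp
    have "AE x in lborel. w 0 x = expLv 0 w0 x + duhamel_op (past w 0) x" using conjunct2[OF conjunct2[OF a], rule_format, of 0] by simp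
    then have i: "AE x in lborel. w 0 x = w0 x" by simp
    have "integral_equation w" unfolding integral_equation_iff[OF K cpath] using a cong[OF cpath i] by blast
    then show "global_solution m w0 w" using a i by (simp add: global_solution_def C0_LL2w_iff_cpath)
  qed
qed

theorem theorem2p3:
  fixes \<mu> m :: real
  assumes "0 < \<mu>" and "\<mu> \<le> 1" and "m > 2 * \<mu> + 1 / 2"
  shows "\<exists>r0>0.
    (\<forall>w0 \<in> LL2w m. wnorm m w0 \<le> r0 \<longrightarrow>
       (\<exists>w. global_solution m w0 w \<and>
          (\<forall>w'. global_solution m w0 w' \<longrightarrow> (\<forall>\<tau>\<ge>0. AE \<xi> in lborel. w' \<tau> \<xi> = w \<tau> \<xi>)))) \<and>
    (\<exists>K0\<ge>1. \<forall>w0 \<in> LL2w m. wnorm m w0 \<le> r0 \<longrightarrow>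
       (\<forall>w. global_solution m w0 w \<longrightarrow>
          (\<forall>\<tau>\<ge>0. wnorm m (w \<tau>) \<le> K0 * exp (- \<mu> * \<tau>) * wnorm m w0)))"
proof -
  obtain K where K: "duhamel_bound \<mu> m K" using duhamel_op_estimate[OF assms] by blast
  obtain M where M: "tker_bound \<mu> M" using time_kernel_convolution[OF assms(1)] unfolding tker_bound_def by blast
  obtain C where C: "0 \<le> C" "\<And>\<tau> w. 0 \<le> \<tau> \<Longrightarrow> w \<in> LL2w m \<Longrightarrow> wnorm m (expLv \<tau> w) \<le> C * exp (- \<mu> * \<tau>) * wnorm m w"
    using expLv_decay[OF assms] by blast
  have p: "0 \<le> 16 * K * M * C" using K M C by (simp add: duhamel_bound_def tker_bound_def)
  \<comment> \<open>smallness makes the Lipschitz constant of the Duhamel term at most \<open>1/4\<close> on the ball of radius \<open>2 * C * wnorm m w0\<close>\<close>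
  define r0 where "r0 = 1 / (16 * K * M * C + 1)"
  have r0: "0 < r0" "16 * K * M * C * r0 \<le> 1" using p by (auto simp: r0_def field_simps)
  have ex: "\<exists>w. global_solution m w0 w \<and> (\<forall>\<tau>\<ge>0. wnorm m (w \<tau>) \<le> 6 * (C * wnorm m w0) * exp (- \<mu> * \<tau>))"
    if w0: "w0 \<in> LL2w m" "wnorm m w0 \<le> r0" for w0
  proof -
    have "16 * K * M * C * wnorm m w0 \<le> 16 * K * M * C * r0" using w0(2) p by (rule mult_left_mono)
    then have s: "16 * K * M * (C * wnorm m w0) \<le> 1" using r0(2) by (simp add: mult.assoc)
    have "wnorm m (expLv \<tau> w0) \<le> C * wnorm m w0 * exp (- \<mu> * \<tau>)" if "0 \<le> \<tau>" for \<tau>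
      using C(2)[OF that w0(1)] by (simp add: mult_ac)
    from mild_solution_exists[OF K M w0(1) this s] show ?thesis unfolding global_solution_iff[OF K w0(1)] by blast
  qed
  have uniq: "AE \<xi> in lborel. w' \<tau> \<xi> = w \<tau> \<xi>"
    if w0: "w0 \<in> LL2w m" and g: "global_solution m w0 w" "global_solution m w0 w'" and \<tau>: "0 \<le> \<tau>" for w0 w w' \<tau>
  proof (rule mild_solution_unique[OF K _ _ _ \<tau>])
    note gi = g[unfolded global_solution_iff[OF K w0]]
    show "cpath m w'" "cpath m w" using gi by auto
    show "AE \<xi> in lborel. w' s \<xi> - w s \<xi> = duhamel_op (past w' s) \<xi> - duhamel_op (past w s) \<xi>" if "0 \<le> s" for s
    proof -
      have "AE \<xi> in lborel. w s \<xi> = expLv s w0 \<xi> + duhamel_op (past w s) \<xi>" "AE \<xi> in lborel. w' s \<xi> = expLv s w0 \<xi> + duhamel_op (past w' s) \<xi>"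
        using gi that by auto
      then show ?thesis by eventually_elim simp
    qed
  qed
  \<comment> \<open>by uniqueness every solution obeys the bound of the constructed one; the summand \<open>1\<close> makes the constant at least \<open>1\<close>\<close>
  have decay: "wnorm m (w \<tau>) \<le> (6 * C + 1) * exp (- \<mu> * \<tau>) * wnorm m w0"
    if w0: "w0 \<in> LL2w m" "wnorm m w0 \<le> r0" and g: "global_solution m w0 w" and \<tau>: "0 \<le> \<tau>" for w0 w \<tau>
  proof -
    obtain v where v: "global_solution m w0 v" "\<forall>\<tau>\<ge>0. wnorm m (v \<tau>) \<le> 6 * (C * wnorm m w0) * exp (- \<mu> * \<tau>)" using ex[OF w0] by blast
    have cpath: "cpath m v" "cpath m w" using v(1) g global_solution_iff[OF K w0(1)] by auto
    have "wnorm m (w \<tau>) = wnorm m (v \<tau>)"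
      by (rule wnorm_cong_AE(2)[OF uniq[OF w0(1) g v(1) \<tau>] cpath_L2w[OF cpath(1) \<tau>] L2w_measurable[OF cpath_L2w[OF cpath(2) \<tau>]]])
    also have "\<dots> \<le> 6 * C * (exp (- \<mu> * \<tau>) * wnorm m w0)" using v(2)[rule_format, OF \<tau>] by (simp add: mult_ac)
    also have "\<dots> \<le> (6 * C + 1) * (exp (- \<mu> * \<tau>) * wnorm m w0)" by (intro mult_right_mono) auto
    finally show ?thesis by (simp add: mult.assoc)
  qed
  show ?thesis
  proof (rule exI[of _ r0], intro conjI ballI impI r0(1))
    fix w0 assume w0: "w0 \<in> LL2w m" "wnorm m w0 \<le> r0"
    obtain w where "global_solution m w0 w" using ex[OF w0] by blast
    then show "\<exists>w. global_solution m w0 w \<and> (\<forall>w'. global_solution m w0 w' \<longrightarrow> (\<forall>\<tau>\<ge>0. AE \<xi> in lborel. w' \<tau> \<xi> = w \<tau> \<xi>))"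
      using uniq[OF w0(1)] by blast
  next
    show "\<exists>K0\<ge>1. \<forall>w0 \<in> LL2w m. wnorm m w0 \<le> r0 \<longrightarrow>
       (\<forall>w. global_solution m w0 w \<longrightarrow> (\<forall>\<tau>\<ge>0. wnorm m (w \<tau>) \<le> K0 * exp (- \<mu> * \<tau>) * wnorm m w0))"
      using decay C(1) by (intro exI[of _ "6 * C + 1"]) auto
  qed
qed

end
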